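(* Let $M$ be a translation surface of constant Gaussian curvature in $\mathbb{S}^3$. For any generic point $p\in M$, there exists a neighbourhood $U\subset M$ of $p$ such that $U$ can be written as the product $\{\alpha(s)\cdot\beta(t)\}$ of two asymptotic curves $\alpha$ and $\beta$, whose torsions are $1$ and $-1$ respectively. Moreover, if the translation surface $M$ is further simply-connected and complete, then such an expression is global, i.e. $M$ as a whole can be written as such a product.
   Context: $\mathbb{S}^3$ is the unit 3-sphere with its standard round metric of sectional curvature $1$, regarded as the Lie group of unit quaternions; this metric is bi-invariant. $\mathbb{S}^3$ is oriented so that the basis $(i,j,k)$ of the tangent space at the unit element $1$ (extended by left translation) is positively oriented; this fixes the sign of torsion. A (smooth, regular, i.e. immersed) surface $M$ in a Lie group $G$ is called a translation surface if it can be locally written as the product of two curves: $f(s,t)=a(s)\cdot b(t)$, where $\cdot$ is the multiplication of $G$. The Gaussian curvature of $M$ is the intrinsic curvature of the metric induced from $\mathbb{S}^3$. An asymptotic curve of $M\subset\mathbb{S}^3$ is a curve in $M$ whose tangent vector $T$ satisfies $\mathrm{II}(T,T)=0$ at every point, where $\mathrm{II}$ is the second fundamental form of $M$ in $\mathbb{S}^3$. (For a flat surface in $\mathbb{S}^3$ the product of the principal curvatures is $-1$ by the Gauss equation, so exactly two local asymptotic curves pass through each point.) A point $p\in M$ is called generic if the curvatures, as curves in $\mathbb{S}^3$, of the two asymptotic curves of $M$ through $p$ are both nonzero at $p$. Curvature $\kappa$ and torsion $\tau$ of an arc-length parametrized curve in $\mathbb{S}^3$ are those of its Frenet frame $(T,N,B)$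 (positively oriented) for the Levi-Civita connection $\nabla$ of $\mathbb{S}^3$: $\nabla_T T=\kappa N$, $\nabla_T N=-\kappa T+\tau B$, $\nabla_T B=-\tau N$. *)

theory Defs
  imports "HOL-Analysis.Analysis"
begin

section \<open>Unit quaternions\<close>

text \<open>A quaternion is a pair (real part, imaginary part). The product type carries the
  Euclidean inner product of $\mathbb{R}^4$; the imaginary units $i,j,k$ are
  \<open>(0, axis 1 1)\<close>, \<open>(0, axis 2 1)\<close>, \<open>(0, axis 3 1)\<close>.\<close>

type_synonym quat = "real \<times> (real^3)"

definition qmult :: "quat \<Rightarrow> quat \<Rightarrow> quat" (infixl "\<odot>" 70) where
  "p \<odot> q = (fst p * fst q - snd p \<bullet> snd q,
            fst p *\<^sub>R snd q + fst q *\<^sub>R snd p + cross3 (snd p) (snd q))"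

definition qconj :: "quat \<Rightarrow> quat" where
  "qconj p = (fst p, - snd p)"

abbreviation S3 :: "quat set" where
  "S3 \<equiv> sphere 0 1"

text \<open>The oriented cross product on the tangent space of the 3-sphere at \<open>p\<close>: translate to the
  unit element by $p^{-1} = \bar p$, take the cross product there with $(i,j,k)$ as positively
  oriented orthonormal basis, and translate back.\<close>

definition s3_cross :: "quat \<Rightarrow> quat \<Rightarrow> quat \<Rightarrow> quat" where
  "s3_cross p v w = p \<odot> (0, cross3 (snd (qconj p \<odot> v)) (snd (qconj p \<odot> w)))"


section \<open>Smoothness\<close>

text \<open>Only meant for open sets \<open>S\<close>.\<close>

primrec Ck_on :: "nat \<Rightarrow> 'a::real_normed_vector set \<Rightarrow> ('a \<Rightarrow> 'b::real_normed_vector) \<Rightarrow> bool" where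
  "Ck_on 0 S h \<longleftrightarrow> continuous_on S h"
| "Ck_on (Suc n) S h \<longleftrightarrow> (\<forall>x\<in>S. h differentiable at x) \<and>
     (\<forall>v. Ck_on n S (\<lambda>x. frechet_derivative h (at x) v))"

definition smooth_on :: "'a::real_normed_vector set \<Rightarrow> ('a \<Rightarrow> 'b::real_normed_vector) \<Rightarrow> bool" where
  "smooth_on S h \<longleftrightarrow> (\<forall>n. Ck_on n S h)"

definition open_interval :: "real set \<Rightarrow> bool" where
  "open_interval I \<longleftrightarrow> open I \<and> is_interval I \<and> I \<noteq> {}"


section \<open>Curves in the 3-sphere\<close>

text \<open>The Levi-Civita derivative of a tangent field \<open>V\<close> along a curve: the component of the
  Euclidean derivative tangent to the sphere.\<close>

definition cov_deriv :: "(real \<Rightarrow> quat) \<Rightarrow> (real \<Rightarrow> quat) \<Rightarrow> real \<Rightarrow> quat" where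
  "cov_deriv \<gamma> V t =
     vector_derivative V (at t) - (vector_derivative V (at t) \<bullet> \<gamma> t) *\<^sub>R \<gamma> t"

definition velocity :: "(real \<Rightarrow> quat) \<Rightarrow> real \<Rightarrow> quat" where
  "velocity \<gamma> t = vector_derivative \<gamma> (at t)"

definition unit_speed_curve :: "real set \<Rightarrow> (real \<Rightarrow> quat) \<Rightarrow> bool" where
  "unit_speed_curve I \<gamma> \<longleftrightarrow>
     smooth_on I \<gamma> \<and> \<gamma> ` I \<subseteq> S3 \<and> (\<forall>t\<in>I. norm (velocity \<gamma> t) = 1)"

definition curvature :: "(real \<Rightarrow> quat) \<Rightarrow> real \<Rightarrow> real" where
  "curvature \<gamma> t = norm (cov_deriv \<gamma> (velocity \<gamma>) t)"

text \<open>A positively oriented Frenet frame $(T,N,B)$ with $T = \gamma'$. The function \<open>\<kappa>\<close> is not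
  required to be positive, so that the notion also makes sense for curves whose curvature has
  zeros. Where the curvature does not vanish, \<open>N\<close> and \<open>B\<close> are determined up to a common sign,
  \<open>\<bar>\<kappa>\<bar>\<close> is the curvature, and \<open>\<tau>\<close> is uniquely determined: it is the usual torsion.\<close>

definition frenet_frame ::
  "real set \<Rightarrow> (real \<Rightarrow> quat) \<Rightarrow> (real \<Rightarrow> quat) \<Rightarrow> (real \<Rightarrow> quat) \<Rightarrow> (real \<Rightarrow> quat)
    \<Rightarrow> (real \<Rightarrow> real) \<Rightarrow> (real \<Rightarrow> real) \<Rightarrow> bool" where
  "frenet_frame I \<gamma> T N B \<kappa> \<tau> \<longleftrightarrow>
     unit_speed_curve I \<gamma> \<and> smooth_on I N \<and> smooth_on I B \<and> T = velocity \<gamma> \<and>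
     (\<forall>t\<in>I. norm (N t) = 1 \<and> N t \<bullet> \<gamma> t = 0 \<and> N t \<bullet> T t = 0 \<and>
        B t = s3_cross (\<gamma> t) (T t) (N t) \<and>
        cov_deriv \<gamma> T t = \<kappa> t *\<^sub>R N t \<and>
        cov_deriv \<gamma> N t = - \<kappa> t *\<^sub>R T t + \<tau> t *\<^sub>R B t \<and>
        cov_deriv \<gamma> B t = - \<tau> t *\<^sub>R N t)"

definition has_torsion :: "real set \<Rightarrow> (real \<Rightarrow> quat) \<Rightarrow> (real \<Rightarrow> real) \<Rightarrow> bool" where
  "has_torsion I \<gamma> \<tau> \<longleftrightarrow> (\<exists>T N B \<kappa>. frenet_frame I \<gamma> T N B \<kappa> \<tau>)"


section \<open>Local geometry of a parametrized surface in the 3-sphere\<close>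

definition pd :: "2 \<Rightarrow> (real^2 \<Rightarrow> 'b::real_normed_vector) \<Rightarrow> real^2 \<Rightarrow> 'b" where
  "pd i h z = frechet_derivative h (at z) (axis i 1)"

definition first_ff :: "(real^2 \<Rightarrow> quat) \<Rightarrow> real^2 \<Rightarrow> real^2^2" where
  "first_ff X z = (\<chi> i j. pd i X z \<bullet> pd j X z)"

text \<open>\<open>christoffel X k i j\<close> is $\Gamma^k_{ij}$, and \<open>riemann X l i j k\<close> is the coefficient of
  $\partial_l$ in $R(\partial_i,\partial_j)\partial_k$, where
  $R(V,W) = \nabla_V\nabla_W - \nabla_W\nabla_V - \nabla_{[V,W]}$.\<close>

definition christoffel :: "(real^2 \<Rightarrow> quat) \<Rightarrow> 2 \<Rightarrow> 2 \<Rightarrow> 2 \<Rightarrow> real^2 \<Rightarrow> real" where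
  "christoffel X k i j z =
     (\<Sum>l\<in>UNIV. matrix_inv (first_ff X z) $ k $ l *
        (pd i (\<lambda>w. first_ff X w $ j $ l) z + pd j (\<lambda>w. first_ff X w $ i $ l) z
          - pd l (\<lambda>w. first_ff X w $ i $ j) z)) / 2"

definition riemann :: "(real^2 \<Rightarrow> quat) \<Rightarrow> 2 \<Rightarrow> 2 \<Rightarrow> 2 \<Rightarrow> 2 \<Rightarrow> real^2 \<Rightarrow> real" where
  "riemann X l i j k z =
     pd i (christoffel X l j k) z - pd j (christoffel X l i k) z
     + (\<Sum>m\<in>UNIV. christoffel X m j k z * christoffel X l i m z
                   - christoffel X m i k z * christoffel X l j m z)"

text \<open>$K = \langle R(\partial_1,\partial_2)\partial_2,\partial_1\rangle / \det g$.\<close>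

definition gauss_curvature :: "(real^2 \<Rightarrow> quat) \<Rightarrow> real^2 \<Rightarrow> real" where
  "gauss_curvature X z =
     (\<Sum>l\<in>UNIV. riemann X l 1 2 2 z * first_ff X z $ l $ 1) / det (first_ff X z)"

definition unit_normal :: "(real^2 \<Rightarrow> quat) \<Rightarrow> real^2 \<Rightarrow> quat" where
  "unit_normal X z = sgn (s3_cross (X z) (pd 1 X z) (pd 2 X z))"

text \<open>Second fundamental form in the 3-sphere. The normal is orthogonal to the position vector,
  so the Euclidean second derivatives may be used in place of the Levi-Civita ones.\<close>

definition second_ff :: "(real^2 \<Rightarrow> quat) \<Rightarrow> real^2 \<Rightarrow> real^2 \<Rightarrow> real^2 \<Rightarrow> real" where
  "second_ff X z v w =
     (\<Sum>i\<in>UNIV. \<Sum>j\<in>UNIV. v $ i * w $ j * (pd i (pd j X) z \<bullet> unit_normal X z))"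


section \<open>Immersed surfaces\<close>

text \<open>A surface is an abstract topological space \<open>M\<close> with an atlas \<open>A\<close> of local parametrizations
  \<open>(D, x)\<close> (inverses of charts), \<open>x\<close> mapping the open set \<open>D\<close> of the plane homeomorphically onto
  an open subset of \<open>M\<close>.\<close>

type_synonym 'm parametrization = "(real^2) set \<times> (real^2 \<Rightarrow> 'm)"

definition topological_param :: "'m topology \<Rightarrow> 'm parametrization \<Rightarrow> bool" where
  "topological_param M = (\<lambda>(D, x). open D \<and> openin M (x ` D) \<and>
     homeomorphic_map (top_of_set D) (subtopology M (x ` D)) x)"

definition smooth_transition :: "'m parametrization \<Rightarrow> 'm parametrization \<Rightarrow> bool" where
  "smooth_transition = (\<lambda>(D, x) (E, y). smooth_on {z\<in>D. x z \<in> y ` E} (inv_into E y \<circ> x))"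

definition immersed_surface ::
  "'m topology \<Rightarrow> 'm parametrization set \<Rightarrow> ('m \<Rightarrow> quat) \<Rightarrow> bool" where
  "immersed_surface M A f \<longleftrightarrow>
     Hausdorff_space M \<and> second_countable M \<and>
     (\<forall>c\<in>A. topological_param M c) \<and>
     (\<Union>(D, x)\<in>A. x ` D) = topspace M \<and>
     (\<forall>c\<in>A. \<forall>c'\<in>A. smooth_transition c c') \<and>
     f ` topspace M \<subseteq> S3 \<and>
     (\<forall>(D, x)\<in>A. smooth_on D (f \<circ> x) \<and> (\<forall>z\<in>D. inj (frechet_derivative (f \<circ> x) (at z))))"

text \<open>Membership in the maximal atlas.\<close>

definition local_param ::
  "'m topology \<Rightarrow> 'm parametrization set \<Rightarrow> (real^2) set \<Rightarrow> (real^2 \<Rightarrow> 'm) \<Rightarrow> bool" where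
  "local_param M A D x \<longleftrightarrow> topological_param M (D, x) \<and>
     (\<forall>c\<in>A. smooth_transition (D, x) c \<and> smooth_transition c (D, x))"

definition constant_gauss_curvature :: "'m parametrization set \<Rightarrow> ('m \<Rightarrow> quat) \<Rightarrow> bool" where
  "constant_gauss_curvature A f \<longleftrightarrow>
     (\<exists>K. \<forall>(D, x)\<in>A. \<forall>z\<in>D. gauss_curvature (f \<circ> x) z = K)"

definition rect :: "real set \<Rightarrow> real set \<Rightarrow> (real^2) set" where
  "rect I J = {z. z $ 1 \<in> I \<and> z $ 2 \<in> J}"

definition product_param ::
  "'m topology \<Rightarrow> 'm parametrization set \<Rightarrow> ('m \<Rightarrow> quat) \<Rightarrow> real set \<Rightarrow> real set
    \<Rightarrow> (real \<Rightarrow> quat) \<Rightarrow> (real \<Rightarrow> quat) \<Rightarrow> (real^2 \<Rightarrow> 'm) \<Rightarrow> bool" where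
  "product_param M A f I J a b x \<longleftrightarrow>
     open_interval I \<and> open_interval J \<and>
     smooth_on I a \<and> smooth_on J b \<and> a ` I \<subseteq> S3 \<and> b ` J \<subseteq> S3 \<and>
     local_param M A (rect I J) x \<and>
     (\<forall>s\<in>I. \<forall>t\<in>J. f (x (vector [s, t])) = a s \<odot> b t)"

definition translation_surface ::
  "'m topology \<Rightarrow> 'm parametrization set \<Rightarrow> ('m \<Rightarrow> quat) \<Rightarrow> bool" where
  "translation_surface M A f \<longleftrightarrow> immersed_surface M A f \<and>
     (\<forall>p\<in>topspace M. \<exists>I J a b x. product_param M A f I J a b x \<and> p \<in> x ` rect I J)"


section \<open>Asymptotic curves and generic points\<close>

definition smooth_curve ::
  "'m topology \<Rightarrow> 'm parametrization set \<Rightarrow> real set \<Rightarrow> (real \<Rightarrow> 'm) \<Rightarrow> bool" where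
  "smooth_curve M A I c \<longleftrightarrow> continuous_map (top_of_set I) M c \<and>
     (\<forall>(D, x)\<in>A. smooth_on {t\<in>I. c t \<in> x ` D} (inv_into D x \<circ> c))"

definition asymptotic_curve ::
  "'m topology \<Rightarrow> 'm parametrization set \<Rightarrow> ('m \<Rightarrow> quat) \<Rightarrow> real set \<Rightarrow> (real \<Rightarrow> 'm) \<Rightarrow> bool" where
  "asymptotic_curve M A f I c \<longleftrightarrow>
     smooth_curve M A I c \<and> unit_speed_curve I (f \<circ> c) \<and>
     (\<forall>(D, x)\<in>A. \<forall>t\<in>I. c t \<in> x ` D \<longrightarrow>
        (let w = inv_into D x \<circ> c; T = vector_derivative w (at t)
         in second_ff (f \<circ> x) (w t) T T = 0))"

text \<open>\<open>c\<^sub>1\<close> and \<open>c\<^sub>2\<close> are the two asymptotic curves through \<open>p\<close>; the condition on the velocities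
  says that they are transversal.\<close>

definition generic_point ::
  "'m topology \<Rightarrow> 'm parametrization set \<Rightarrow> ('m \<Rightarrow> quat) \<Rightarrow> 'm \<Rightarrow> bool" where
  "generic_point M A f p \<longleftrightarrow> p \<in> topspace M \<and>
     (\<exists>\<epsilon>>0. \<exists>c\<^sub>1 c\<^sub>2.
        asymptotic_curve M A f {-\<epsilon><..<\<epsilon>} c\<^sub>1 \<and> asymptotic_curve M A f {-\<epsilon><..<\<epsilon>} c\<^sub>2 \<and>
        c\<^sub>1 0 = p \<and> c\<^sub>2 0 = p \<and>
        velocity (f \<circ> c\<^sub>1) 0 \<noteq> velocity (f \<circ> c\<^sub>2) 0 \<and>
        velocity (f \<circ> c\<^sub>1) 0 \<noteq> - velocity (f \<circ> c\<^sub>2) 0 \<and>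
        curvature (f \<circ> c\<^sub>1) 0 \<noteq> 0 \<and> curvature (f \<circ> c\<^sub>2) 0 \<noteq> 0)"

text \<open>The open part \<open>U\<close> of the surface is parametrized as the product $\alpha(s)\cdot\beta(t)$, and
  the parameter curves $s \mapsto \alpha(s)\cdot\beta(t_0)$, $t \mapsto \alpha(s_0)\cdot\beta(t)$
  (translates of \<open>\<alpha>\<close> and \<open>\<beta>\<close>) are asymptotic curves.\<close>

definition asymptotic_product ::
  "'m topology \<Rightarrow> 'm parametrization set \<Rightarrow> ('m \<Rightarrow> quat) \<Rightarrow> 'm set \<Rightarrow> real set \<Rightarrow> real set
    \<Rightarrow> (real \<Rightarrow> quat) \<Rightarrow> (real \<Rightarrow> quat) \<Rightarrow> bool" where
  "asymptotic_product M A f U I J \<alpha> \<beta> \<longleftrightarrow>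
     (\<exists>x. product_param M A f I J \<alpha> \<beta> x \<and> x ` rect I J = U \<and>
        (\<forall>t\<in>J. asymptotic_curve M A f I (\<lambda>s. x (vector [s, t]))) \<and>
        (\<forall>s\<in>I. asymptotic_curve M A f J (\<lambda>t. x (vector [s, t]))))"


section \<open>Global hypotheses\<close>

text \<open>Analogue of the library's \<^const>\<open>simply_connected\<close> (any two loops are homotopic through
  loops, which includes path-connectedness) for abstract topologies; the empty space is excluded.\<close>

definition simply_connected_top :: "'m topology \<Rightarrow> bool" where
  "simply_connected_top M \<longleftrightarrow> topspace M \<noteq> {} \<and>
     (\<forall>p q. pathin M p \<and> p 1 = p 0 \<and> pathin M q \<and> q 1 = q 0 \<longrightarrow>
        homotopic_with (\<lambda>r. r 1 = r 0) (top_of_set {0..1}) M p q)"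

text \<open>Riemannian distance of the induced metric. Piecewise smooth curves would give the same
  infimum, since corners can be removed by stopping smoothly at them. The value is \<open>\<infinity>\<close>
  for points in different components.\<close>

definition induced_dist ::
  "'m topology \<Rightarrow> 'm parametrization set \<Rightarrow> ('m \<Rightarrow> quat) \<Rightarrow> 'm \<Rightarrow> 'm \<Rightarrow> ereal" where
  "induced_dist M A f p q =
     (INF c \<in> {c. c 0 = p \<and> c 1 = q \<and> (\<exists>\<epsilon>>0. smooth_curve M A {-\<epsilon><..<1+\<epsilon>} c)}.
        ereal (integral {0..1} (\<lambda>t. norm (velocity (f \<circ> c) t))))"

definition complete_surface ::
  "'m topology \<Rightarrow> 'm parametrization set \<Rightarrow> ('m \<Rightarrow> quat) \<Rightarrow> bool" where
  "complete_surface M A f \<longleftrightarrow>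
     (\<forall>\<sigma>::nat \<Rightarrow> 'm. range \<sigma> \<subseteq> topspace M \<and>
        (\<forall>\<epsilon>>0. \<exists>n\<^sub>0. \<forall>m\<ge>n\<^sub>0. \<forall>n\<ge>n\<^sub>0. induced_dist M A f (\<sigma> m) (\<sigma> n) < ereal \<epsilon>) \<longrightarrow>
        (\<exists>p\<in>topspace M. (\<lambda>n. induced_dist M A f (\<sigma> n) p) \<longlonglongrightarrow> 0))"

end

theory Submission
  imports Defs "HOL-Complex_Analysis.Conformal_Mappings"
begin

text \<open>The Gauss equation of a product \<open>a(s) \<odot> b(t)\<close> shows that a constant Gaussian curvature \<open>K\<close>
  must vanish: for \<open>K \<noteq> 0\<close> the curvature equation is a Chebyshev-type system whose solutions would
  satisfy a nontrivial trigonometric identity. For \<open>K = 0\<close> the equation says that the two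
  factors can be multiplied by motions along a fixed great circle, \<open>a(s) \<odot> c(s)\<close> and \<open>c(s)\<close> inverse
  times \<open>b(t)\<close>, so that both coordinate families become asymptotic; a unit speed curve whose
  left (right) velocity stays in a plane has torsion \<open>1\<close> (\<open>-1\<close>).

  For the global statement, two unit speed asymptotic charts agreeing at a point differ by
  reflections of the coordinates, and charts are uniformly bi-Lipschitz on compact sets. Completeness
  therefore extends a chart from discs of the plane to a map defined on the whole plane, which is a
  covering of \<open>M\<close> because any two such maps differ by an isometry of the plane, and a bijection
  because \<open>M\<close> is simply connected. Along it the immersion is again a product, since its
  logarithmic derivative in \<open>s\<close> does not depend on \<open>t\<close>.\<close>

section \<open>Calculus of smooth maps\<close>

text \<open>Two-sided multiplication by unit quaternions is an isometry. Hence the geometry of a(s)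
  b(t) depends only on the logarithmic velocities \<open>U\<close> = a^(-1) a' and \<open>V\<close>
  = b' b^(-1), curves in the Lie algebra, and the Gauss equation becomes K |U x V|^4 = (U' . (U x
  V)) (V' . (U x V)). For K = 0 a product of smooth functions vanishes, and a priori the vanishing
  factor could change from point to point; without analyticity this has to be excluded by
  differentiating. The outcome: either both factors vanish identically, or one of the two curves
  lies on a great circle and the other can be corrected along it. The torsions have opposite signs
  because the Levi-Civita connection is y' + U x y in left-translated form and y' - V x y in
  right-translated form, while the binormal is a fixed vector in the respective form. Globally,
  asymptotic lines carry no orientation, so coordinates are unique only up to translations and
  reflections. Continuation therefore proceeds by discs about one centre where the germ is pinned,
  and every gluing rests on the identity principle \<open>ladm_unique\<close>.\<close>

declare Ck_on.simps(2) [simp del]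

lemma Ck_on_frechet:
  "Ck_on (Suc n) S h \<Longrightarrow> Ck_on n S (\<lambda>x. frechet_derivative h (at x) v)"
  by (simp add: Ck_on.simps(2))

text \<open>\<open>frechet_derivative\<close> is a choice among the derivatives at \<open>x\<close>.
  Functions that agree near \<open>x\<close> have the same derivatives there, hence the same choice,
  even where there is none to choose.\<close>

lemma frechet_derivative_cong_open:
  assumes "open S" "x \<in> S" "\<And>y. y \<in> S \<Longrightarrow> f y = g y"
  shows "frechet_derivative f (at x) = frechet_derivative g (at x)"
proof -
  have "(f has_derivative D) (at x) = (g has_derivative D) (at x)" for D
    using assms has_derivative_transform_within_open[of f D x UNIV S g]
      has_derivative_transform_within_open[of g D x UNIV S f] by auto
  then show ?thesis unfolding frechet_derivative_def by simp
qed

lemma Ck_on_cong: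
  assumes "open S" "\<And>y. y \<in> S \<Longrightarrow> f y = g y"
  shows "Ck_on n S f \<longleftrightarrow> Ck_on n S g"
  using assms(2)
proof (induction n arbitrary: f g)
  case 0 then show ?case using continuous_on_cong[of S S f g] by simp
next
  case (Suc n)
  have fd: "frechet_derivative f (at x) = frechet_derivative g (at x)" if "x \<in> S" for x
    using frechet_derivative_cong_open[OF assms(1) that Suc.prems] .
  have "f differentiable at x \<longleftrightarrow> g differentiable at x" if "x \<in> S" for x
    unfolding differentiable_def
    using assms that Suc.prems has_derivative_transform_within_open[of f _ x UNIV S g]
      has_derivative_transform_within_open[of g _ x UNIV S f] by (metis (no_types, opaque_lifting))
  moreover have "Ck_on n S (\<lambda>x. frechet_derivative f (at x) v) = Ck_on n S (\<lambda>x. frechet_derivative g (at x) v)" for v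
    using Suc.IH[of "\<lambda>x. frechet_derivative f (at x) v" "\<lambda>x. frechet_derivative g (at x) v"] fd by simp
  ultimately show ?case by (simp add: Ck_on.simps(2))
qed

text \<open>By uniqueness of derivatives, a derivative \<open>D\<close> found by calculus rules may
  replace the chosen \<open>frechet_derivative\<close>.\<close>

lemma Ck_on_SucI:
  assumes "open S" "\<And>x. x \<in> S \<Longrightarrow> (h has_derivative D x) (at x)" "\<And>v. Ck_on n S (\<lambda>x. D x v)"
  shows "Ck_on (Suc n) S h"
proof -
  have "frechet_derivative h (at x) = D x" if "x \<in> S" for x
    using frechet_derivative_at[OF assms(2)[OF that]] by simp
  then have "Ck_on n S (\<lambda>x. frechet_derivative h (at x) v)" for v
    using Ck_on_cong[OF assms(1), of "\<lambda>x. frechet_derivative h (at x) v" "\<lambda>x. D x v" n] assms(3) by simp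
  then show ?thesis using assms(2) by (auto simp: differentiable_def Ck_on.simps(2))
qed

lemma Ck_on_SucD:
  "Ck_on (Suc n) S h \<Longrightarrow> Ck_on n S h"
proof (induction n arbitrary: h)
  case 0 then show ?case
    by (auto intro!: differentiable_imp_continuous_on simp: differentiable_on_def differentiable_at_withinI Ck_on.simps(2))
next
  case (Suc n) then show ?case by (metis Ck_on.simps(2))
qed

lemma Ck_on_has_derivative:
  "Ck_on (Suc n) S h \<Longrightarrow> x \<in> S \<Longrightarrow> (h has_derivative frechet_derivative h (at x)) (at x)"
  by (simp add: frechet_derivative_works Ck_on.simps(2))

lemma Ck_on_subset: "Ck_on n S h \<Longrightarrow> T \<subseteq> S \<Longrightarrow> Ck_on n T h"
  by (induction n arbitrary: h) (auto intro: continuous_on_subset simp: Ck_on.simps(2))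

lemma Ck_on_const: "Ck_on n S (\<lambda>x. c)"
proof (induction n arbitrary: c)
  case (Suc n) then show ?case by (simp add: frechet_derivative_const Ck_on.simps(2))
qed simp

lemma Ck_on_add:
  assumes "open S" shows "Ck_on n S f \<Longrightarrow> Ck_on n S g \<Longrightarrow> Ck_on n S (\<lambda>x. f x + g x)"
proof (induction n arbitrary: f g)
  case 0 then show ?case by (simp add: continuous_on_add)
next
  case (Suc n)
  show ?case
    by (rule Ck_on_SucI[OF assms, where D = "\<lambda>x v. frechet_derivative f (at x) v + frechet_derivative g (at x) v"])
      (use Suc in \<open>auto intro!: has_derivative_add Ck_on_has_derivative Ck_on_frechet Suc.IH\<close>)
qed

lemma (in bounded_bilinear) Ck_on:
  assumes "open S" shows "Ck_on n S f \<Longrightarrow> Ck_on n S g \<Longrightarrow> Ck_on n S (\<lambda>x. prod (f x) (g x))"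
proof (induction n arbitrary: f g)
  case 0 then show ?case by (simp add: continuous_on)
next
  case (Suc n)
  have "Ck_on n S f" "Ck_on n S g" using Suc.prems Ck_on_SucD by blast+
  with Suc show ?case
    by (intro Ck_on_SucI[OF assms, where D = "\<lambda>x v. prod (f x) (frechet_derivative g (at x) v)
        + prod (frechet_derivative f (at x) v) (g x)"] FDERIV Ck_on_add assms Suc.IH Ck_on_has_derivative Ck_on_frechet) auto
qed

lemma (in bounded_linear) Ck_on:
  assumes "open S" shows "Ck_on n S g \<Longrightarrow> Ck_on n S (\<lambda>x. f (g x))"
proof (induction n arbitrary: g)
  case 0 then show ?case by (simp add: continuous_on)
next
  case (Suc n) then show ?case
    by (intro Ck_on_SucI[OF assms, where D = "\<lambda>x v. f (frechet_derivative g (at x) v)"] has_derivative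
        Ck_on_has_derivative Suc.IH Ck_on_frechet) auto
qed

lemmas Ck_on_minus = bounded_linear.Ck_on[OF bounded_linear_minus[OF bounded_linear_ident]]
lemmas Ck_on_mult = bounded_bilinear.Ck_on[OF bounded_bilinear_mult]

lemma Ck_on_id: "open S \<Longrightarrow> Ck_on n S (\<lambda>x. x)"
proof (cases n)
  case (Suc m)
  assume "open S" then show ?thesis unfolding Suc
    by (intro Ck_on_SucI[where D = "\<lambda>x v. v"]) (auto intro: Ck_on_const)
qed auto

lemma Ck_on_sum:
  assumes "open S" "finite A" "\<And>i. i \<in> A \<Longrightarrow> Ck_on n S (f i)" shows "Ck_on n S (\<lambda>x. \<Sum>i\<in>A. f i x)"
  using assms(2,3) by induction (auto intro: Ck_on_const Ck_on_add[OF assms(1)])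

text \<open>\<open>Ck_on\<close> controls derivatives in fixed directions only, whereas the chain
  rule evaluates the derivative of \<open>g\<close> in the moving direction
  \<open>frechet_derivative f (at x) v\<close>. Expanding that vector in the basis of the
  intermediate Euclidean space gives a finite sum of products in which every direction is fixed, so
  the induction goes through.\<close>

lemma Ck_on_compose:
  fixes g :: "'b::euclidean_space \<Rightarrow> 'c::real_normed_vector"
  assumes "open S" "open T"
  shows "Ck_on n T g \<Longrightarrow> Ck_on n S f \<Longrightarrow> f ` S \<subseteq> T \<Longrightarrow> Ck_on n S (\<lambda>x. g (f x))"
proof (induction n arbitrary: f g)
  case 0 then show ?case using continuous_on_compose2 by auto
next
  case (Suc n)
  have f: "Ck_on n S f" using Suc.prems Ck_on_SucD by blast
  have 1: "((\<lambda>x. g (f x)) has_derivative (\<lambda>v. \<Sum>i\<in>Basis. (frechet_derivative f (at x) v \<bullet> i) *\<^sub>R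
      frechet_derivative g (at (f x)) i)) (at x)" if "x \<in> S" for x
  proof -
    have g': "(g has_derivative frechet_derivative g (at (f x))) (at (f x))"
      using Suc.prems(1,3) that by (intro Ck_on_has_derivative) auto
    have comp: "((\<lambda>x. g (f x)) has_derivative (\<lambda>v. frechet_derivative g (at (f x)) (frechet_derivative f (at x) v))) (at x)"
      using has_derivative_compose[OF Ck_on_has_derivative[OF Suc.prems(2) that] g'] .
    have lin: "linear (frechet_derivative g (at (f x)))" using g' has_derivative_linear by blast
    have "frechet_derivative g (at (f x)) (\<Sum>i\<in>Basis. (w \<bullet> i) *\<^sub>R i)
        = (\<Sum>i\<in>Basis. (w \<bullet> i) *\<^sub>R frechet_derivative g (at (f x)) i)" for w
      using linear_sum[OF lin, of "\<lambda>i. (w \<bullet> i) *\<^sub>R i" Basis] linear_scale[OF lin] by simp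
    then have rep: "frechet_derivative g (at (f x)) w = (\<Sum>i\<in>Basis. (w \<bullet> i) *\<^sub>R frechet_derivative g (at (f x)) i)" for w
      unfolding euclidean_representation .
    show ?thesis using comp by (rule has_derivative_eq_rhs) (rule ext, rule rep)
  qed
  show ?case
  proof (rule Ck_on_SucI[OF assms(1) 1])
    fix v
    have "Ck_on n S (\<lambda>x. frechet_derivative g (at (f x)) i)" for i
      using Suc.IH[of "\<lambda>y. frechet_derivative g (at y) i" f] Suc.prems f Ck_on_frechet by blast
    moreover have "Ck_on n S (\<lambda>x. frechet_derivative f (at x) v \<bullet> i)" for i
      using Suc.prems(2) by (intro bounded_linear.Ck_on[OF bounded_linear_inner_left assms(1)] Ck_on_frechet)
    ultimately show "Ck_on n S (\<lambda>x. \<Sum>i\<in>Basis. (frechet_derivative f (at x) v \<bullet> i) *\<^sub>R frechet_derivative g (at (f x)) i)"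
      by (intro Ck_on_sum assms bounded_bilinear.Ck_on[OF bounded_bilinear_scaleR]) auto
  qed
qed

lemma Ck_on_local:
  assumes "\<And>x. x \<in> S \<Longrightarrow> \<exists>T. open T \<and> x \<in> T \<and> Ck_on n T h" shows "Ck_on n S h"
  using assms
proof (induction n arbitrary: h)
  case 0
  have "continuous (at x within S) h" if "x \<in> S" for x
  proof -
    obtain T where "open T" "x \<in> T" "continuous_on T h" using 0[OF \<open>x \<in> S\<close>] unfolding Ck_on.simps(1) by blast
    then show "continuous (at x within S) h"
      using continuous_on_eq_continuous_at continuous_at_imp_continuous_at_within by blast
  qed
  then show ?case unfolding Ck_on.simps(1) continuous_on_eq_continuous_within by blast
next
  case (Suc n)
  have "h differentiable at x" if "x \<in> S" for x using Suc.prems[OF that] by (auto simp: Ck_on.simps(2))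
  moreover have "Ck_on n S (\<lambda>x. frechet_derivative h (at x) v)" for v
    by (rule Suc.IH) (blast dest: Suc.prems Ck_on_frechet)
  ultimately show ?case by (simp add: Ck_on.simps(2))
qed

lemma smooth_on_cong: "open S \<Longrightarrow> smooth_on S f \<Longrightarrow> (\<And>y. y \<in> S \<Longrightarrow> f y = g y) \<Longrightarrow> smooth_on S g"
  unfolding smooth_on_def using Ck_on_cong[of S f g] by blast

lemma smooth_on_subset: "smooth_on S h \<Longrightarrow> T \<subseteq> S \<Longrightarrow> smooth_on T h"
  unfolding smooth_on_def using Ck_on_subset by blast

lemma smooth_on_const: "smooth_on S (\<lambda>x. c)"
  by (simp add: smooth_on_def Ck_on_const)

lemma smooth_on_id: "open S \<Longrightarrow> smooth_on S (\<lambda>x. x)"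
  by (simp add: smooth_on_def Ck_on_id)

lemma smooth_on_add: "open S \<Longrightarrow> smooth_on S f \<Longrightarrow> smooth_on S g \<Longrightarrow> smooth_on S (\<lambda>x. f x + g x)"
  by (simp add: smooth_on_def Ck_on_add)

lemma (in bounded_bilinear) smooth_on:
  "open S \<Longrightarrow> smooth_on S f \<Longrightarrow> smooth_on S g \<Longrightarrow> smooth_on S (\<lambda>x. prod (f x) (g x))"
  by (simp add: smooth_on_def Ck_on)

lemma (in bounded_linear) smooth_on: "open S \<Longrightarrow> smooth_on S g \<Longrightarrow> smooth_on S (\<lambda>x. f (g x))"
  by (simp add: smooth_on_def Ck_on)

lemma smooth_on_compose:
  fixes g :: "'b::euclidean_space \<Rightarrow> 'c::real_normed_vector"
  shows "open S \<Longrightarrow> open T \<Longrightarrow> smooth_on T g \<Longrightarrow> smooth_on S f \<Longrightarrow> f ` S \<subseteq> T \<Longrightarrow> smooth_on S (\<lambda>x. g (f x))"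
  by (simp add: smooth_on_def Ck_on_compose)

lemma smooth_on_local: "(\<And>x. x \<in> S \<Longrightarrow> \<exists>T. open T \<and> x \<in> T \<and> smooth_on T h) \<Longrightarrow> smooth_on S h"
  unfolding smooth_on_def using Ck_on_local by meson

lemmas smooth_on_scaleR = bounded_bilinear.smooth_on[OF bounded_bilinear_scaleR]
lemmas smooth_on_mult = bounded_bilinear.smooth_on[OF bounded_bilinear_mult]
lemmas smooth_on_inner = bounded_bilinear.smooth_on[OF bounded_bilinear_inner]
lemmas smooth_on_minus = bounded_linear.smooth_on[OF bounded_linear_minus[OF bounded_linear_ident]]
lemmas smooth_on_vec_nth = bounded_linear.smooth_on[OF bounded_linear_vec_nth]
lemmas smooth_on_snd = bounded_linear.smooth_on[OF bounded_linear_snd]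

lemma smooth_on_diff: "open S \<Longrightarrow> smooth_on S f \<Longrightarrow> smooth_on S g \<Longrightarrow> smooth_on S (\<lambda>x. f x - g x)"
  using smooth_on_add[of S f "\<lambda>x. - g x"] smooth_on_minus[of S g] by simp

lemma smooth_on_has_derivative:
  "smooth_on S h \<Longrightarrow> x \<in> S \<Longrightarrow> (h has_derivative frechet_derivative h (at x)) (at x)"
  using Ck_on_has_derivative[of 0] by (auto simp: smooth_on_def)

lemma smooth_on_differentiable: "smooth_on S h \<Longrightarrow> x \<in> S \<Longrightarrow> h differentiable at x"
  using smooth_on_has_derivative differentiable_def by blast

lemma smooth_on_frechet: "smooth_on S h \<Longrightarrow> smooth_on S (\<lambda>x. frechet_derivative h (at x) v)"
  unfolding smooth_on_def by (metis Ck_on.simps(2))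

lemma smooth_on_continuous: "smooth_on S h \<Longrightarrow> continuous_on S h"
  unfolding smooth_on_def by (metis Ck_on.simps(1))

lemma smooth_on_I:
  assumes "open S" "\<And>x. x \<in> S \<Longrightarrow> (h has_derivative D x) (at x)" "\<And>v. smooth_on S (\<lambda>x. D x v)"
  shows "smooth_on S h"
  unfolding smooth_on_def
proof
  fix n show "Ck_on n S h"
    using Ck_on_SucD[OF Ck_on_SucI[OF assms(1,2), of n]] assms(3) unfolding smooth_on_def by blast
qed

lemma smooth_on_vector_derivative:
  assumes "open S" "smooth_on S \<gamma>" shows "smooth_on S (\<lambda>t. vector_derivative \<gamma> (at t))"
proof (rule smooth_on_cong[OF assms(1) smooth_on_frechet[OF assms(2), of 1]])
  fix t assume "t \<in> S"
  note D = smooth_on_has_derivative[OF assms(2) this]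
  from D
  have "(\<gamma> has_vector_derivative frechet_derivative \<gamma> (at t) 1) (at t)"
    unfolding has_vector_derivative_def
    by (rule has_derivative_eq_rhs)
      (rule ext, metis linear_scale[OF has_derivative_linear[OF D], of _ 1] mult.right_neutral real_scaleR_def)
  then show "frechet_derivative \<gamma> (at t) 1 = vector_derivative \<gamma> (at t)"
    by (simp add: vector_derivative_at)
qed

lemma smooth_on_has_vector_derivative:
  "smooth_on S \<gamma> \<Longrightarrow> t \<in> S \<Longrightarrow> (\<gamma> has_vector_derivative vector_derivative \<gamma> (at t)) (at t)"
  using smooth_on_differentiable vector_derivative_works by blast

lemma smooth_on_vectorI:
  assumes "open S" "\<And>t. t \<in> S \<Longrightarrow> (\<gamma> has_vector_derivative \<gamma>' t) (at t)" "smooth_on S \<gamma>'"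
  shows "smooth_on S \<gamma>"
  using assms(2) unfolding has_vector_derivative_def
  by (rule smooth_on_I[OF assms(1)]) (auto intro!: smooth_on_scaleR smooth_on_const assms)

lemma smooth_on_sin_cos: "smooth_on UNIV (sin :: real \<Rightarrow> real)" "smooth_on UNIV (cos :: real \<Rightarrow> real)"
proof -
  have "Ck_on n UNIV (sin :: real \<Rightarrow> real) \<and> Ck_on n UNIV (cos :: real \<Rightarrow> real)" for n
  proof (induction n)
    case 0 then show ?case by (auto intro!: continuous_intros)
  next
    case (Suc n)
    have "Ck_on (Suc n) UNIV (sin :: real \<Rightarrow> real)"
      by (rule Ck_on_SucI[where D = "\<lambda>x v. v * cos x"])
        (use Suc in \<open>auto intro!: derivative_eq_intros Ck_on_mult Ck_on_const\<close>)
    moreover have "Ck_on (Suc n) UNIV (cos :: real \<Rightarrow> real)"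
      by (rule Ck_on_SucI[where D = "\<lambda>x v. (- v) * sin x"])
        (use Suc in \<open>auto intro!: derivative_eq_intros Ck_on_minus Ck_on_mult Ck_on_const\<close>)
    ultimately show ?case by blast
  qed
  then show "smooth_on UNIV (sin :: real \<Rightarrow> real)" "smooth_on UNIV (cos :: real \<Rightarrow> real)"
    by (auto simp: smooth_on_def)
qed

lemma smooth_on_inverse_real: "smooth_on (- {0}) (inverse :: real \<Rightarrow> real)"
proof -
  have "Ck_on n (- {0}) (inverse :: real \<Rightarrow> real)" for n
  proof (induction n)
    case 0 then show ?case by (auto intro!: continuous_intros)
  next
    case (Suc n)
    show ?case
      by (rule Ck_on_SucI[where D = "\<lambda>x v. (- v) * (inverse x * inverse x)"])
       (use Suc in \<open>auto intro!: derivative_eq_intros Ck_on_minus Ck_on_mult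
         Ck_on_mult Ck_on_const\<close>)
  qed
  then show ?thesis by (simp add: smooth_on_def)
qed

lemma smooth_on_inverse:
  fixes f :: "'a::real_normed_vector \<Rightarrow> real"
  assumes "open S" "smooth_on S f" "\<And>x. x \<in> S \<Longrightarrow> f x \<noteq> 0" shows "smooth_on S (\<lambda>x. inverse (f x))"
  by (rule smooth_on_compose[OF assms(1) open_Compl[OF closed_singleton] smooth_on_inverse_real assms(2)])
    (use assms(3) in auto)

lemma smooth_on_divide:
  fixes f g :: "'a::real_normed_vector \<Rightarrow> real"
  assumes "open S" "smooth_on S f" "smooth_on S g" "\<And>x. x \<in> S \<Longrightarrow> g x \<noteq> 0" shows "smooth_on S (\<lambda>x. f x / g x)"
  unfolding divide_inverse using assms by (intro smooth_on_mult smooth_on_inverse)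

lemma smooth_on_sqrt_real: "smooth_on {0<..} sqrt"
proof -
  have "Ck_on n {0<..} sqrt" for n
  proof (induction n)
    case 0 then show ?case by (auto intro!: continuous_intros)
  next
    case (Suc n)
    have "Ck_on n {0<..} (\<lambda>x. inverse (sqrt x))"
      by (rule Ck_on_compose[OF open_greaterThan open_Compl[OF closed_singleton] _ Suc])
        (use smooth_on_inverse_real in \<open>auto simp: smooth_on_def\<close>)
    then have "Ck_on n {0<..} (\<lambda>x. inverse (sqrt x) / 2 * v)" for v :: real
      unfolding divide_inverse by (intro Ck_on_mult Ck_on_const open_greaterThan)
    moreover have "(sqrt has_derivative (\<lambda>v. inverse (sqrt x) / 2 * v)) (at x)" if "x > 0" for x
      using DERIV_real_sqrt[OF that] unfolding has_field_derivative_def .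
    ultimately show ?case by (intro Ck_on_SucI[where D = "\<lambda>x v. inverse (sqrt x) / 2 * v"]) auto
  qed
  then show ?thesis by (simp add: smooth_on_def)
qed

lemma smooth_on_sqrt:
  assumes "open S" "smooth_on S f" "\<And>x. x \<in> S \<Longrightarrow> f x > 0" shows "smooth_on S (\<lambda>x. sqrt (f x))"
  by (rule smooth_on_compose[OF assms(1) open_greaterThan smooth_on_sqrt_real assms(2)])
    (use assms(3) in auto)

lemma smooth_on_norm:
  fixes f :: "'a::real_normed_vector \<Rightarrow> 'b::real_inner"
  assumes "open S" "smooth_on S f" "\<And>x. x \<in> S \<Longrightarrow> f x \<noteq> 0" shows "smooth_on S (\<lambda>x. norm (f x))"
  unfolding norm_eq_sqrt_inner by (intro smooth_on_sqrt smooth_on_inner assms(1,2)) (use assms(3) in simp)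

lemma smooth_on_Pair:
  assumes "open S" "smooth_on S f" "smooth_on S g" shows "smooth_on S (\<lambda>x. (f x, g x))"
proof -
  have 1: "bounded_linear (\<lambda>x::'b. (x, 0::'c))" and 2: "bounded_linear (\<lambda>x::'c. (0::'b, x))"
    by (auto intro!: bounded_linear_Pair bounded_linear_ident bounded_linear_zero)
  from smooth_on_add[OF assms(1) bounded_linear.smooth_on[OF 1 assms(1,2)] bounded_linear.smooth_on[OF 2 assms(1,3)]]
  show ?thesis by simp
qed

text \<open>Bootstrapping: the derivative of \<open>g\<close> is
  \<open>inverse (deriv f (g y))\<close>, so regularity of order \<open>n\<close> yields order
  \<open>n + 1\<close>; the induction starts from continuity.\<close>

lemma smooth_on_real_inverse:
  fixes f g :: "real \<Rightarrow> real"
  assumes "open S" "open T" "smooth_on S f" "\<And>x. x \<in> S \<Longrightarrow> deriv f x \<noteq> 0"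
    "continuous_on T g" "g ` T \<subseteq> S" "\<And>y. y \<in> T \<Longrightarrow> f (g y) = y"
  shows "smooth_on T g"
proof -
  have f': "(f has_real_derivative deriv f x) (at x)" if "x \<in> S" for x
    using smooth_on_differentiable[OF assms(3) that] DERIV_deriv_iff_real_differentiable by blast
  have sm: "smooth_on S (\<lambda>x. inverse (deriv f x))"
  proof (rule smooth_on_inverse[OF assms(1) _ assms(4)])
    show "smooth_on S (deriv f)"
      by (rule smooth_on_cong[OF assms(1) smooth_on_vector_derivative[OF assms(1,3)]])
       (metis f' has_real_derivative_iff_has_vector_derivative vector_derivative_at)
  qed
  have g': "(g has_real_derivative inverse (deriv f (g y))) (at y)" if "y \<in> T" for y
  proof (rule has_field_derivative_inverse_basic[where f = f and t = T])
    show "isCont g y" using assms(2,5) that continuous_on_eq_continuous_at by blast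
  qed (use assms f' that in auto)
  have "Ck_on n T g" for n
  proof (induction n)
    case 0 then show ?case using assms by simp
  next
    case (Suc n)
    have "Ck_on n T (\<lambda>y. inverse (deriv f (g y)))"
      using Ck_on_compose[OF assms(2,1) _ Suc assms(6), of "\<lambda>x. inverse (deriv f x)"] sm
      by (auto simp: smooth_on_def)
    then have "Ck_on n T (\<lambda>y. inverse (deriv f (g y)) * v)" for v
      by (intro Ck_on_mult assms(2) Ck_on_const)
    then show ?case using g' unfolding has_field_derivative_def
      by (intro Ck_on_SucI[OF assms(2), where D = "\<lambda>y v. inverse (deriv f (g y)) * v"]) auto
  qed
  then show ?thesis by (simp add: smooth_on_def)
qed

text \<open>The second difference of \<open>F\<close> over a small square with corner
  \<open>(s0, t0)\<close> is evaluated by the mean value theorem in both orders; each gives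
  \<open>h * h\<close> times one mixed derivative somewhere in the square. Besides the symmetry of
  second derivatives this yields the integrability conditions \<open>gt_eq\<close> and
  \<open>compatibility\<close>, where explicit partial derivatives are at hand.\<close>

lemma mixed_partials_eq:
  fixes F F1 F2 F12 F21 :: "real \<Rightarrow> real \<Rightarrow> real"
  assumes e: "e > 0"
    and F1: "\<And>s t. \<bar>s - s0\<bar> < e \<Longrightarrow> \<bar>t - t0\<bar> < e \<Longrightarrow> ((\<lambda>s. F s t) has_real_derivative F1 s t) (at s)"
    and F2: "\<And>s t. \<bar>s - s0\<bar> < e \<Longrightarrow> \<bar>t - t0\<bar> < e \<Longrightarrow> ((\<lambda>t. F s t) has_real_derivative F2 s t) (at t)"
    and F12: "\<And>s t. \<bar>s - s0\<bar> < e \<Longrightarrow> \<bar>t - t0\<bar> < e \<Longrightarrow> ((\<lambda>t. F1 s t) has_real_derivative F12 s t) (at t)"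
    and F21: "\<And>s t. \<bar>s - s0\<bar> < e \<Longrightarrow> \<bar>t - t0\<bar> < e \<Longrightarrow> ((\<lambda>s. F2 s t) has_real_derivative F21 s t) (at s)"
    and c12: "isCont (\<lambda>(s,t). F12 s t) (s0,t0)" and c21: "isCont (\<lambda>(s,t). F21 s t) (s0,t0)"
  shows "F12 s0 t0 = F21 s0 t0"
proof (rule ccontr)
  assume ne: "F12 s0 t0 \<noteq> F21 s0 t0"
  define r where "r = \<bar>F12 s0 t0 - F21 s0 t0\<bar> / 2"
  have "r > 0" using ne by (simp add: r_def)
  obtain d1 where d1: "d1 > 0" "\<And>p. dist p (s0,t0) < d1 \<Longrightarrow> dist ((\<lambda>(s,t). F12 s t) p) (F12 s0 t0) < r"
    using c12 \<open>r > 0\<close> unfolding continuous_at_eps_delta by force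
  obtain d2 where d2: "d2 > 0" "\<And>p. dist p (s0,t0) < d2 \<Longrightarrow> dist ((\<lambda>(s,t). F21 s t) p) (F21 s0 t0) < r"
    using c21 \<open>r > 0\<close> unfolding continuous_at_eps_delta by force
  \<comment> \<open>Halved because points of the square are only estimated to lie within
    \<open>2 * h\<close> of the corner, by adding the coordinate differences.\<close>
  define h where "h = min e (min d1 d2) / 2"
  have h: "h > 0" "h < e" "2 * h \<le> d1" "2 * h \<le> d2" using e d1 d2 by (auto simp: h_def)
  have "\<exists>x. s0 < x \<and> x < s0 + h \<and> (F (s0+h) (t0+h) - F (s0+h) t0) - (F s0 (t0+h) - F s0 t0)
      = (s0 + h - s0) * (F1 x (t0+h) - F1 x t0)"
    by (rule MVT2[where f = "\<lambda>s. F s (t0+h) - F s t0"])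
      (use h in \<open>auto intro!: DERIV_diff F1\<close>)
  then obtain x where x: "s0 < x" "x < s0 + h" "(F (s0+h) (t0+h) - F (s0+h) t0) - (F s0 (t0+h) - F s0 t0)
      = (s0 + h - s0) * (F1 x (t0+h) - F1 x t0)" by blast
  have "\<exists>y. t0 < y \<and> y < t0 + h \<and> F1 x (t0+h) - F1 x t0 = (t0 + h - t0) * F12 x y"
    by (rule MVT2) (use h x(1,2) in \<open>auto intro!: F12\<close>)
  then obtain y where y: "t0 < y" "y < t0 + h" "F1 x (t0+h) - F1 x t0 = (t0 + h - t0) * F12 x y" by blast
  have "\<exists>y. t0 < y \<and> y < t0 + h \<and> (F (s0+h) (t0+h) - F s0 (t0+h)) - (F (s0+h) t0 - F s0 t0)
      = (t0 + h - t0) * (F2 (s0+h) y - F2 s0 y)"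
    by (rule MVT2[where f = "\<lambda>t. F (s0+h) t - F s0 t"])
      (use h in \<open>auto intro!: DERIV_diff F2\<close>)
  then obtain y' where y': "t0 < y'" "y' < t0 + h" "(F (s0+h) (t0+h) - F s0 (t0+h)) - (F (s0+h) t0 - F s0 t0)
      = (t0 + h - t0) * (F2 (s0+h) y' - F2 s0 y')" by blast
  have "\<exists>x. s0 < x \<and> x < s0 + h \<and> F2 (s0+h) y' - F2 s0 y' = (s0 + h - s0) * F21 x y'"
    by (rule MVT2[where f = "\<lambda>s. F2 s y'"]) (use h y'(1,2) in \<open>auto intro!: F21\<close>)
  then obtain x' where x': "s0 < x'" "x' < s0 + h" "F2 (s0+h) y' - F2 s0 y' = (s0 + h - s0) * F21 x' y'" by blast
  have "(F (s0+h) (t0+h) - F (s0+h) t0) - (F s0 (t0+h) - F s0 t0) = h * (h * F12 x y)"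
    using x(3) y(3) by simp
  moreover have "(F (s0+h) (t0+h) - F s0 (t0+h)) - (F (s0+h) t0 - F s0 t0) = h * (h * F21 x' y')"
    using y'(3) x'(3) by simp
  ultimately have "h * (h * F12 x y) = h * (h * F21 x' y')" by linarith
  then have eq: "F12 x y = F21 x' y'" using h by simp
  have *: "dist (a, b) (s0, t0) < 2 * h" if "s0 < a" "a < s0 + h" "t0 < b" "b < t0 + h" for a b
  proof -
    have "dist (a, b) (s0, t0) \<le> dist a s0 + dist b t0"
      unfolding dist_prod_def by (simp add: sqrt_sum_squares_le_sum)
    then show ?thesis using that by (simp add: dist_real_def)
  qed
  have "dist (F12 x y) (F12 s0 t0) < r" "dist (F21 x' y') (F21 s0 t0) < r"
    using d1(2)[of "(x,y)"] d2(2)[of "(x',y')"] *[of x y] *[of x' y'] x y x' y' h by auto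
  then show False using eq unfolding r_def dist_real_def by (simp add: abs_if split: if_splits)
qed

section \<open>Quaternions and the cross product of the 3-sphere\<close>

lemma bounded_bilinear_cross3: "bounded_bilinear cross3"
  using bilinear_cross bilinear_conv_bounded_bilinear by blast

interpretation cr: bounded_bilinear cross3 by (rule bounded_bilinear_cross3)

lemma bounded_bilinear_qmult: "bounded_bilinear (\<odot>)"
  unfolding bilinear_conv_bounded_bilinear[symmetric] bilinear_def
  by (auto simp: qmult_def prod_eq_iff cross3_simps forall_3 intro!: linearI)

interpretation qm: bounded_bilinear "(\<odot>)" by (rule bounded_bilinear_qmult)

lemma qmult_assoc: "p \<odot> q \<odot> r = p \<odot> (q \<odot> r)"
  by (simp add: qmult_def prod_eq_iff cross3_simps forall_3)

lemma qmult_one [simp]: "(1, 0) \<odot> p = p" "p \<odot> (1, 0) = p"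
  by (simp_all add: qmult_def prod_eq_iff)

lemma inner_quat: "(p::quat) \<bullet> q = fst p * fst q + snd p \<bullet> snd q"
  by (simp add: inner_prod_def)

lemma inner_qmult: "(p \<odot> a) \<bullet> (p \<odot> b) = (p \<bullet> p) * (a \<bullet> b)" "(a \<odot> p) \<bullet> (b \<odot> p) = (p \<bullet> p) * (a \<bullet> b)"
  by (simp_all add: qmult_def inner_quat cross3_simps)

lemma norm_qmult: "norm (p \<odot> q) = norm p * norm q"
  unfolding norm_eq_sqrt_inner inner_qmult by (simp add: real_sqrt_mult)

lemma S3_inner: "p \<in> S3 \<longleftrightarrow> p \<bullet> p = 1"
  by (simp add: norm_eq_1)

lemma S3_qmult: "p \<in> S3 \<Longrightarrow> q \<in> S3 \<Longrightarrow> p \<odot> q \<in> S3"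
  by (simp add: norm_qmult)

lemma S3_qconj: "p \<in> S3 \<Longrightarrow> qconj p \<in> S3"
  unfolding S3_inner by (simp add: inner_quat qconj_def)

lemma qconj_mult_self: "p \<in> S3 \<Longrightarrow> qconj p \<odot> p = (1, 0)" "p \<in> S3 \<Longrightarrow> p \<odot> qconj p = (1, 0)"
  unfolding S3_inner by (simp_all add: inner_quat qconj_def qmult_def)

lemma qconj_cancel: "p \<in> S3 \<Longrightarrow> p \<odot> (qconj p \<odot> q) = q" "p \<in> S3 \<Longrightarrow> qconj p \<odot> (p \<odot> q) = q"
  "p \<in> S3 \<Longrightarrow> q \<odot> qconj p \<odot> p = q" "p \<in> S3 \<Longrightarrow> q \<odot> p \<odot> qconj p = q"
  by (simp_all add: qmult_assoc qconj_mult_self flip: qmult_assoc[of p "qconj p" q] qmult_assoc[of "qconj p" p q])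

lemma qconj_qmult: "qconj (p \<odot> q) = qconj q \<odot> qconj p"
  by (simp add: qconj_def qmult_def prod_eq_iff cross3_simps forall_3)

lemma fst_qconj_mult: "fst (qconj p \<odot> q) = p \<bullet> q" "fst (q \<odot> qconj p) = p \<bullet> q"
  by (simp_all add: qconj_def qmult_def inner_quat inner_commute)

lemma inner_qconj_mult: "p \<in> S3 \<Longrightarrow> (qconj p \<odot> a) \<bullet> (qconj p \<odot> b) = a \<bullet> b"
  using S3_qconj[of p] unfolding S3_inner by (simp add: inner_qmult)

lemma imag_mult: "(0, a) \<odot> (0, b) = (- (a \<bullet> b), cross3 a b)"
  by (simp add: qmult_def)

text \<open>Bilinear and alternating, so a change of basis in the plane contributes its determinant.
  This is how the normal transforms under reparametrization.\<close>

lemma s3_cross_combination: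
  "s3_cross p (a *\<^sub>R v + b *\<^sub>R w) (c *\<^sub>R v + d *\<^sub>R w) = (a * d - b * c) *\<^sub>R s3_cross p v w"
proof -
  define x y where "x = snd (qconj p \<odot> v)" and "y = snd (qconj p \<odot> w)"
  have "cross3 (a *\<^sub>R x + b *\<^sub>R y) (c *\<^sub>R x + d *\<^sub>R y) = (a * d - b * c) *\<^sub>R cross3 x y"
    by (simp add: cross3_simps forall_3)
  moreover have "(0, r *\<^sub>R u) = r *\<^sub>R (0::real, u::real^3)" for r u by simp
  ultimately show ?thesis
    unfolding s3_cross_def qm.add_right qm.scaleR_right snd_add snd_scaleR x_def[symmetric] y_def[symmetric]
    by (metis qm.scaleR_right)
qed

text \<open>Expansion in the basis \<open>a\<close>, \<open>b\<close>, \<open>a\<close> x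
  \<open>b\<close>, which need not be orthogonal: the coefficients come from the inverse Gram matrix
  of \<open>a\<close> and \<open>b\<close>. Multiplying by the Gram determinant
  \<open>c \<bullet> c\<close> makes it a polynomial identity that holds for dependent vectors
  too.\<close>

lemma cross3_decompose:
  fixes a b x :: "real^3"
  defines "c \<equiv> cross3 a b"
  shows "(c \<bullet> c) *\<^sub>R x = (x \<bullet> c) *\<^sub>R c + ((b \<bullet> b) * (x \<bullet> a) - (a \<bullet> b) * (x \<bullet> b)) *\<^sub>R a
    + ((a \<bullet> a) * (x \<bullet> b) - (a \<bullet> b) * (x \<bullet> a)) *\<^sub>R b"
proof -
  have "(c \<bullet> c) * x $ 1 = (x \<bullet> c) * c $ 1 + ((b \<bullet> b) * (x \<bullet> a) - (a \<bullet> b) * (x \<bullet> b)) * a $ 1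
    + ((a \<bullet> a) * (x \<bullet> b) - (a \<bullet> b) * (x \<bullet> a)) * b $ 1"
    "(c \<bullet> c) * x $ 2 = (x \<bullet> c) * c $ 2 + ((b \<bullet> b) * (x \<bullet> a) - (a \<bullet> b) * (x \<bullet> b)) * a $ 2
    + ((a \<bullet> a) * (x \<bullet> b) - (a \<bullet> b) * (x \<bullet> a)) * b $ 2"
    "(c \<bullet> c) * x $ 3 = (x \<bullet> c) * c $ 3 + ((b \<bullet> b) * (x \<bullet> a) - (a \<bullet> b) * (x \<bullet> b)) * a $ 3
    + ((a \<bullet> a) * (x \<bullet> b) - (a \<bullet> b) * (x \<bullet> a)) * b $ 3"
    unfolding c_def inner_vec_def sum_3 cross_components inner_real_def by algebra+
  then show ?thesis by (simp add: vec_eq_iff forall_3)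
qed

text \<open>\<open>cross3_decompose\<close> transported from the unit element to \<open>p\<close> by
  left translation, which is an isometry. The last formula splits an inner product in four
  dimensions into normal, radial and tangential parts; applied to second derivatives of a
  parametrization it produces the Gauss equation.\<close>

lemma s3_cross_decompose:
  assumes p: "p \<in> S3" and v: "v \<bullet> p = 0" and w: "w \<bullet> p = 0"
  defines "c \<equiv> s3_cross p v w"
  shows "c \<bullet> c = (v \<bullet> v) * (w \<bullet> w) - (v \<bullet> w)\<^sup>2" "c \<bullet> p = 0" "c \<bullet> v = 0" "c \<bullet> w = 0"
    "(c \<bullet> c) * (x \<bullet> y) = (x \<bullet> c) * (y \<bullet> c) + (c \<bullet> c) * (x \<bullet> p) * (y \<bullet> p)
      + (w \<bullet> w) * (x \<bullet> v) * (y \<bullet> v) - (v \<bullet> w) * ((x \<bullet> v) * (y \<bullet> w) + (x \<bullet> w) * (y \<bullet> v))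
      + (v \<bullet> v) * (x \<bullet> w) * (y \<bullet> w)"
proof -
  define T where "T = (\<lambda>x. qconj p \<odot> x)"
  have inn: "x \<bullet> y = T x \<bullet> T y" for x y using inner_qconj_mult[OF p] by (simp add: T_def)
  obtain a where a: "T v = (0, a)" using fst_qconj_mult(1)[of p v] v unfolding T_def
    by (metis inner_commute prod.collapse)
  obtain b where b: "T w = (0, b)" using fst_qconj_mult(1)[of p w] w unfolding T_def
    by (metis inner_commute prod.collapse)
  have c: "T c = (0, cross3 a b)"
    using a b qconj_cancel(2)[OF p] by (simp add: T_def c_def s3_cross_def)
  have Tp: "T p = (1, 0)" using p by (simp add: T_def qconj_mult_self)
  note I = inn[of c c] inn[of c p] inn[of c v] inn[of c w] inn[of v v] inn[of w w] inn[of v w]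
    inn[of x y] inn[of x p] inn[of y p] inn[of x v] inn[of y v] inn[of x w] inn[of y w] inn[of x c] inn[of y c]
  obtain x0 x1 y0 y1 where x: "T x = (x0, x1)" and y: "T y = (y0, y1)" by fastforce
  have "(norm (cross3 a b))\<^sup>2 + (a \<bullet> b)\<^sup>2 = (norm a * norm b)\<^sup>2" by (rule norm_cross_dot)
  then show "c \<bullet> c = (v \<bullet> v) * (w \<bullet> w) - (v \<bullet> w)\<^sup>2"
    unfolding I unfolding a b c unfolding inner_quat by (simp add: power2_norm_eq_inner power_mult_distrib)
  show "c \<bullet> p = 0" "c \<bullet> v = 0" "c \<bullet> w = 0"
    unfolding I unfolding a b c Tp unfolding inner_quat by (simp_all add: dot_cross_self)
  from arg_cong[OF cross3_decompose[of a b x1], of "\<lambda>u. u \<bullet> y1"]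
  show "(c \<bullet> c) * (x \<bullet> y) = (x \<bullet> c) * (y \<bullet> c) + (c \<bullet> c) * (x \<bullet> p) * (y \<bullet> p)
      + (w \<bullet> w) * (x \<bullet> v) * (y \<bullet> v) - (v \<bullet> w) * ((x \<bullet> v) * (y \<bullet> w) + (x \<bullet> w) * (y \<bullet> v))
      + (v \<bullet> v) * (x \<bullet> w) * (y \<bullet> w)"
    unfolding I unfolding a b c Tp x y unfolding inner_quat
    by (simp add: inner_add_left inner_commute[of _ y1]) (simp add: algebra_simps)
qed

section \<open>Partial derivatives on the plane\<close>

lemma vec2_eq: "(z :: real^2) = z $ 1 *\<^sub>R axis 1 1 + z $ 2 *\<^sub>R axis 2 1"
  by (simp add: vec_eq_iff forall_2 axis_def)

lemma vector2_eq: "(vector [s, t] :: real^2) = s *\<^sub>R axis 1 1 + t *\<^sub>R axis 2 1"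
  by (simp add: vec_eq_iff forall_2 axis_def)

lemma vector2_collapse [simp]: "vector [z $ 1, z $ 2] = (z :: real^2)"
  by (simp add: vec_eq_iff forall_2)

lemma axis2_simps [simp]: "(axis 1 (1::real) :: real^2) $ 1 = 1" "(axis 1 (1::real) :: real^2) $ 2 = 0"
  "(axis 2 (1::real) :: real^2) $ 1 = 0" "(axis 2 (1::real) :: real^2) $ 2 = 1"
  by (simp_all add: axis_def)

lemma pd_eqI: "(h has_derivative D) (at z) \<Longrightarrow> pd i h z = D (axis i 1)"
  unfolding pd_def using frechet_derivative_at by metis

lemma pd_cong: "open S \<Longrightarrow> z \<in> S \<Longrightarrow> (\<And>w. w \<in> S \<Longrightarrow> h w = k w) \<Longrightarrow> pd i h z = pd i k z"
  unfolding pd_def using frechet_derivative_cong_open by metis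

lemma has_derivative_pd:
  assumes "h differentiable at z"
  shows "(h has_derivative (\<lambda>v. v $ 1 *\<^sub>R pd 1 h z + v $ 2 *\<^sub>R pd 2 h z)) (at z)"
proof -
  have D: "(h has_derivative frechet_derivative h (at z)) (at z)"
    using assms frechet_derivative_works by blast
  note lin = has_derivative_linear[OF D]
  have "frechet_derivative h (at z) (v $ 1 *\<^sub>R axis 1 1 + v $ 2 *\<^sub>R axis 2 1) = v $ 1 *\<^sub>R pd 1 h z + v $ 2 *\<^sub>R pd 2 h z" for v :: "real^2"
    unfolding pd_def linear_add[OF lin] linear_scale[OF lin] ..
  then have "frechet_derivative h (at z) v = v $ 1 *\<^sub>R pd 1 h z + v $ 2 *\<^sub>R pd 2 h z" for v :: "real^2"
    unfolding vec2_eq[symmetric] .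
  with D show ?thesis using has_derivative_eq_rhs by (metis (no_types, lifting) ext)
qed

lemma frechet_pd: "h differentiable at z \<Longrightarrow>
    frechet_derivative h (at z) v = v $ 1 *\<^sub>R pd 1 h z + v $ 2 *\<^sub>R pd 2 h z"
  using fun_cong[OF frechet_derivative_at[OF has_derivative_pd], of h z v] by simp

lemma smooth_on_pd: "smooth_on D X \<Longrightarrow> smooth_on D (pd i X)"
  unfolding pd_def[abs_def] by (rule smooth_on_frechet)

lemma (in bounded_bilinear) pd:
  assumes "f differentiable at z" "g differentiable at z"
  shows "pd i (\<lambda>w. prod (f w) (g w)) z = prod (f z) (pd i g z) + prod (pd i f z) (g z)"
  using pd_eqI[OF FDERIV[OF assms[unfolded frechet_derivative_works]]] unfolding pd_def .

lemmas pd_inner = bounded_bilinear.pd[OF bounded_bilinear_inner]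
lemmas pd_mult = bounded_bilinear.pd[OF bounded_bilinear_mult]
lemmas pd_scaleR = bounded_bilinear.pd[OF bounded_bilinear_scaleR]

lemma pd_add:
  assumes "f differentiable at z" "g differentiable at z"
  shows "pd i (\<lambda>w. f w + g w) z = pd i f z + pd i g z"
  using pd_eqI[OF has_derivative_add[OF assms[unfolded frechet_derivative_works]]] unfolding pd_def .

lemma pd_const: "pd i (\<lambda>w. c) z = 0"
  using pd_eqI[OF has_derivative_const] .

lemma pd_compose:
  fixes \<phi> :: "real^2 \<Rightarrow> real^2"
  assumes "\<phi> differentiable at z" "X differentiable at (\<phi> z)"
  shows "pd i (\<lambda>w. X (\<phi> w)) z = pd i \<phi> z $ 1 *\<^sub>R pd 1 X (\<phi> z) + pd i \<phi> z $ 2 *\<^sub>R pd 2 X (\<phi> z)"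
  using pd_eqI[OF has_derivative_compose[OF assms(1)[unfolded frechet_derivative_works] has_derivative_pd[OF assms(2)]]]
  by (simp add: pd_def[of _ \<phi>])

lemma pd_line_derivative:
  assumes "h differentiable at (vector [s, t])"
  shows "((\<lambda>s. h (vector [s, t])) has_vector_derivative pd 1 h (vector [s, t])) (at s)"
    "((\<lambda>t. h (vector [s, t])) has_vector_derivative pd 2 h (vector [s, t])) (at t)"
proof -
  have 1: "((\<lambda>s. vector [s, t] :: real^2) has_derivative (\<lambda>r. r *\<^sub>R axis 1 1)) (at s)"
    and 2: "((\<lambda>t. vector [s, t] :: real^2) has_derivative (\<lambda>r. r *\<^sub>R axis 2 1)) (at t)"
    unfolding vector2_eq by (auto intro!: derivative_eq_intros)
  show "((\<lambda>s. h (vector [s, t])) has_vector_derivative pd 1 h (vector [s, t])) (at s)"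
    "((\<lambda>t. h (vector [s, t])) has_vector_derivative pd 2 h (vector [s, t])) (at t)"
    unfolding has_vector_derivative_def
    using has_derivative_compose[OF 1 has_derivative_pd[OF assms]]
      has_derivative_compose[OF 2 has_derivative_pd[OF assms]] by simp_all
qed

lemma vector2_continuous: "continuous_on UNIV (\<lambda>(s,t). vector [s, t] :: real^2)"
  unfolding vector2_eq case_prod_unfold by (intro continuous_intros)

lemma dist_vector2: "dist (vector [s, t] :: real^2) (vector [s', t']) \<le> \<bar>s - s'\<bar> + \<bar>t - t'\<bar>"
proof -
  have "dist (vector [s, t] :: real^2) (vector [s', t']) = norm ((s - s') *\<^sub>R axis 1 1 + (t - t') *\<^sub>R (axis 2 1 :: real^2))"
    unfolding vector2_eq dist_norm by (simp add: algebra_simps)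
  also have "\<dots> \<le> \<bar>s - s'\<bar> + \<bar>t - t'\<bar>"
    by (rule order_trans[OF norm_triangle_ineq]) (simp add: norm_axis_1)
  finally show ?thesis .
qed

lemma pd_sym_real:
  fixes X :: "real^2 \<Rightarrow> real"
  assumes "open D" "smooth_on D X" "z \<in> D"
  shows "pd 2 (pd 1 X) z = pd 1 (pd 2 X) z"
proof -
  obtain e where e: "e > 0" "ball z e \<subseteq> D" using assms(1,3) openE by blast
  have inD: "vector [s, t] \<in> D" if "\<bar>s - z $ 1\<bar> < e/2" "\<bar>t - z $ 2\<bar> < e/2" for s t
    using dist_vector2[of s t "z $ 1" "z $ 2"] that e(2) by (auto simp: dist_commute)
  have der: "((\<lambda>s. h (vector [s, t])) has_real_derivative pd 1 h (vector [s, t])) (at s)"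
      "((\<lambda>t. h (vector [s, t])) has_real_derivative pd 2 h (vector [s, t])) (at t)"
    if "smooth_on D h" "\<bar>s - z $ 1\<bar> < e/2" "\<bar>t - z $ 2\<bar> < e/2" for h s t
    using pd_line_derivative[OF smooth_on_differentiable[OF that(1) inD[OF that(2,3)]]]
    by (simp_all add: has_real_derivative_iff_has_vector_derivative)
  have cont: "isCont (\<lambda>(s,t). h (vector [s, t])) (z $ 1, z $ 2)" if h: "smooth_on D h" for h :: "real^2 \<Rightarrow> real"
  proof -
    have "isCont (\<lambda>(s,t). vector [s, t] :: real^2) (z $ 1, z $ 2)"
      using continuous_on_eq_continuous_at[OF open_UNIV, THEN iffD1, OF vector2_continuous] by blast
    moreover have "isCont h z"
      using continuous_on_eq_continuous_at[OF assms(1), THEN iffD1, OF smooth_on_continuous[OF h]] assms(3) by blast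
    ultimately have "isCont (\<lambda>p. h ((\<lambda>(s,t). vector [s, t]) p)) (z $ 1, z $ 2)"
      using isCont_o2[of "(z $ 1, z $ 2)" "\<lambda>(s,t). vector [s, t]" h] by simp
    then show ?thesis by (simp add: case_prod_unfold)
  qed
  have "(\<lambda>s t. pd 2 (pd 1 X) (vector [s, t])) (z $ 1) (z $ 2) = (\<lambda>s t. pd 1 (pd 2 X) (vector [s, t])) (z $ 1) (z $ 2)"
    by (rule mixed_partials_eq[of "e/2" _ _ "\<lambda>s t. X (vector [s, t])"
          "\<lambda>s t. pd 1 X (vector [s, t])" "\<lambda>s t. pd 2 X (vector [s, t])"])
      (use e in \<open>simp_all add: der cont smooth_on_pd assms\<close>)
  then show ?thesis by simp
qed

lemma pd_inner_const:
  "h differentiable at z \<Longrightarrow> pd i (\<lambda>w. h w \<bullet> c) z = pd i h z \<bullet> c"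
  using pd_inner[of h z "\<lambda>_. c" i] by (simp add: pd_const)

lemma pd_sym:
  fixes X :: "real^2 \<Rightarrow> 'b::euclidean_space"
  assumes "open D" "smooth_on D X" "z \<in> D"
  shows "pd 2 (pd 1 X) z = pd 1 (pd 2 X) z"
proof (rule euclidean_eqI)
  fix c :: 'b
  have *: "pd i (pd j X) z \<bullet> c = pd i (pd j (\<lambda>w. X w \<bullet> c)) z" for i j
  proof -
    have "pd i (pd j (\<lambda>w. X w \<bullet> c)) z = pd i (\<lambda>w. pd j X w \<bullet> c) z"
      by (rule pd_cong[OF assms(1,3)]) (simp add: pd_inner_const smooth_on_differentiable[OF assms(2)])
    then show ?thesis using assms
      by (simp add: pd_inner_const smooth_on_differentiable[OF smooth_on_pd])
  qed
  show "pd 2 (pd 1 X) z \<bullet> c = pd 1 (pd 2 X) z \<bullet> c"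
    unfolding * using assms by (intro pd_sym_real smooth_on_inner smooth_on_const)
qed

section \<open>The Gauss equation\<close>

lemma matrix_inv_2:
  fixes A :: "real^2^2"
  assumes "det A \<noteq> 0"
  shows "matrix_inv A $ 1 $ 1 = A $ 2 $ 2 / det A" "matrix_inv A $ 1 $ 2 = - A $ 1 $ 2 / det A"
    "matrix_inv A $ 2 $ 1 = - A $ 2 $ 1 / det A" "matrix_inv A $ 2 $ 2 = A $ 1 $ 1 / det A"
proof -
  define B :: "real^2^2" where "B = (\<chi> i j. (if i = j then (if i = 1 then A $ 2 $ 2 else A $ 1 $ 1) else - A $ i $ j) / det A)"
  have "A $ 1 $ 1 * A $ 2 $ 2 - A $ 1 $ 2 * A $ 2 $ 1 = det A" by (simp add: det_2)
  then have "B ** A = mat 1"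
    using assms
    by (simp add: vec_eq_iff forall_2 matrix_matrix_mult_def sum_2 B_def mat_def field_simps)
  moreover have "A ** matrix_inv A = mat 1"
    using assms invertible_det_nz[of A] someI_ex[of "\<lambda>B. A ** B = mat 1 \<and> B ** A = mat 1"]
    unfolding invertible_def matrix_inv_def by blast
  ultimately have "matrix_inv A = B"
    by (metis matrix_mul_assoc matrix_mul_lid matrix_mul_rid)
  then show "matrix_inv A $ 1 $ 1 = A $ 2 $ 2 / det A" "matrix_inv A $ 1 $ 2 = - A $ 1 $ 2 / det A"
    "matrix_inv A $ 2 $ 1 = - A $ 2 $ 1 / det A" "matrix_inv A $ 2 $ 2 = A $ 1 $ 1 / det A"
    by (simp_all add: B_def)
qed

text \<open>Obtained by differentiating \<open>X w \<bullet> X w = 1\<close> and then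
  \<open>pd j X w \<bullet> X w = 0\<close>. Through the second formula the curvature 1 of the
  ambient sphere enters the Gauss equation.\<close>

lemma sphere_tangent:
  assumes "open D" "smooth_on D X" "X ` D \<subseteq> S3" "z \<in> D"
  shows "pd i X z \<bullet> X z = 0" "pd i (pd j X) z \<bullet> X z = - (pd i X z \<bullet> pd j X z)"
proof -
  note df = smooth_on_differentiable
  have 1: "pd i X w \<bullet> X w = 0" if "w \<in> D" for i w
  proof -
    have "pd i (\<lambda>w. X w \<bullet> X w) w = pd i (\<lambda>w. 1) w"
      by (rule pd_cong[OF assms(1) that]) (use assms(3) S3_inner in blast)
    then show ?thesis using df[OF assms(2) that] by (simp add: pd_inner pd_const inner_commute)
  qed
  show "pd i X z \<bullet> X z = 0" using 1 assms(4) .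
  have "pd i (\<lambda>w. pd j X w \<bullet> X w) z = pd i (\<lambda>w. 0) z"
    by (rule pd_cong[OF assms(1,4)]) (rule 1)
  then show "pd i (pd j X) z \<bullet> X z = - (pd i X z \<bullet> pd j X z)"
    using df[OF assms(2,4)] df[OF smooth_on_pd[OF assms(2)] assms(4)]
    by (simp add: pd_inner pd_const inner_commute)
qed

lemma pd_sym':
  fixes X :: "real^2 \<Rightarrow> 'b::euclidean_space"
  assumes "open D" "smooth_on D X" "z \<in> D"
  shows "pd i (pd j X) z = pd j (pd i X) z"
  using pd_sym[OF assms] exhaust_2[of i] exhaust_2[of j] by auto

lemma first_ff_nth: "first_ff X w $ i $ j = pd i X w \<bullet> pd j X w"
  by (simp add: first_ff_def)

lemma det_first_ff: "det (first_ff X w) = (pd 1 X w \<bullet> pd 1 X w) * (pd 2 X w \<bullet> pd 2 X w) - (pd 1 X w \<bullet> pd 2 X w)\<^sup>2"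
  by (simp add: det_2 first_ff_nth power2_eq_square inner_commute)

text \<open>For an induced metric the three derivatives of metric coefficients collapse to
  \<open>2 * (pd i (pd j X) w \<bullet> pd l X w)\<close>. The Christoffel symbols thus solve a
  linear system whose matrix is the first fundamental form.\<close>

lemma christoffel_eq:
  assumes "open D" "smooth_on D X" "w \<in> D" "det (first_ff X w) \<noteq> 0"
  defines "d \<equiv> det (first_ff X w)"
  shows "christoffel X 1 i j w = ((pd 2 X w \<bullet> pd 2 X w) * (pd i (pd j X) w \<bullet> pd 1 X w)
      - (pd 1 X w \<bullet> pd 2 X w) * (pd i (pd j X) w \<bullet> pd 2 X w)) / d"
    "christoffel X 2 i j w = ((pd 1 X w \<bullet> pd 1 X w) * (pd i (pd j X) w \<bullet> pd 2 X w)
      - (pd 1 X w \<bullet> pd 2 X w) * (pd i (pd j X) w \<bullet> pd 1 X w)) / d"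
proof -
  note df = smooth_on_differentiable[OF smooth_on_pd[OF assms(2)] assms(3)]
  have dg: "pd i (\<lambda>w. first_ff X w $ j $ l) w = pd j X w \<bullet> pd i (pd l X) w + pd i (pd j X) w \<bullet> pd l X w" for i j l
    unfolding first_ff_nth by (rule pd_inner[OF df df])
  have t: "pd i (\<lambda>w. first_ff X w $ j $ l) w + pd j (\<lambda>w. first_ff X w $ i $ l) w
      - pd l (\<lambda>w. first_ff X w $ i $ j) w = 2 * (pd i (pd j X) w \<bullet> pd l X w)" for l
    unfolding dg pd_sym'[OF assms(1-3), of j i] pd_sym'[OF assms(1-3), of l i] pd_sym'[OF assms(1-3), of l j]
    by (simp add: inner_commute)
  have "christoffel X k i j w = (\<Sum>l\<in>UNIV. matrix_inv (first_ff X w) $ k $ l * (pd i (pd j X) w \<bullet> pd l X w))" for k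
    unfolding christoffel_def t by (simp add: sum_divide_distrib)
  then show "christoffel X 1 i j w = ((pd 2 X w \<bullet> pd 2 X w) * (pd i (pd j X) w \<bullet> pd 1 X w)
      - (pd 1 X w \<bullet> pd 2 X w) * (pd i (pd j X) w \<bullet> pd 2 X w)) / d"
    "christoffel X 2 i j w = ((pd 1 X w \<bullet> pd 1 X w) * (pd i (pd j X) w \<bullet> pd 2 X w)
      - (pd 1 X w \<bullet> pd 2 X w) * (pd i (pd j X) w \<bullet> pd 1 X w)) / d"
    using assms(4) unfolding d_def
    by (simp_all add: sum_2 matrix_inv_2 first_ff_nth diff_divide_distrib inner_commute)
qed

text \<open>Stated with the unnormalized normal \<open>c\<close> and multiplied by
  \<open>d\<^sup>2\<close>, so that no square roots or quotients remain. The curvature is defined by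
  derivatives of Christoffel symbols, which are quotients; lowering an index first avoids
  differentiating these quotients.\<close>

lemma gauss_equation:
  assumes D: "open D" and X: "smooth_on D X" and sph: "X ` D \<subseteq> S3"
    and imm: "\<And>w. w \<in> D \<Longrightarrow> det (first_ff X w) \<noteq> 0" and z: "z \<in> D"
  defines "c \<equiv> s3_cross (X z) (pd 1 X z) (pd 2 X z)" and "d \<equiv> det (first_ff X z)"
  shows "gauss_curvature X z * d\<^sup>2 = d\<^sup>2 + (pd 1 (pd 1 X) z \<bullet> c) * (pd 2 (pd 2 X) z \<bullet> c) - (pd 1 (pd 2 X) z \<bullet> c)\<^sup>2"
    and "d = c \<bullet> c"
proof -
  note smX = smooth_on_pd[OF X] and smXX = smooth_on_pd[OF smooth_on_pd[OF X]]
  note df = smooth_on_differentiable[OF _ z]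
  define \<Gamma> where "\<Gamma> = (\<lambda>k i j. christoffel X k i j z)"
  define a where "a = (\<lambda>i j w. pd i (pd j X) w \<bullet> pd 1 X w)"
  define b where "b = (\<lambda>i j w. pd i (pd j X) w \<bullet> pd 2 X w)"
  define E F G where "E = (\<lambda>w. pd 1 X w \<bullet> pd 1 X w)" and "F = (\<lambda>w. pd 1 X w \<bullet> pd 2 X w)"
    and "G = (\<lambda>w. pd 2 X w \<bullet> pd 2 X w)"
  have det: "det (first_ff X w) = E w * G w - (F w)\<^sup>2" for w
    by (simp add: det_first_ff E_def F_def G_def)
  have smE: "smooth_on D E" "smooth_on D F" "smooth_on D G" "smooth_on D (a i j)" "smooth_on D (b i j)" for i j
    unfolding E_def F_def G_def a_def b_def by (intro smooth_on_inner D smX smXX)+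
  have smdet: "smooth_on D (\<lambda>w. E w * G w - (F w)\<^sup>2)"
    unfolding power2_eq_square by (intro smooth_on_diff smooth_on_mult smE D)
  have chr: "christoffel X 1 i j w = (G w * a i j w - F w * b i j w) / (E w * G w - (F w)\<^sup>2)"
    "christoffel X 2 i j w = (E w * b i j w - F w * a i j w) / (E w * G w - (F w)\<^sup>2)" if "w \<in> D" for i j w
    using christoffel_eq[OF D X that imm[OF that]] unfolding det
    unfolding E_def F_def G_def a_def b_def by blast+
  have dchr: "christoffel X k i j differentiable at z" for k i j
  proof -
    have "smooth_on D (christoffel X 1 i j)"
      by (rule smooth_on_cong[OF D, of "\<lambda>w. (G w * a i j w - F w * b i j w) / (E w * G w - (F w)\<^sup>2)"])
       (use chr imm det in \<open>auto intro!: smooth_on_divide smooth_on_diff smooth_on_mult smE smdet D\<close>)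
    moreover have "smooth_on D (christoffel X 2 i j)"
      by (rule smooth_on_cong[OF D, of "\<lambda>w. (E w * b i j w - F w * a i j w) / (E w * G w - (F w)\<^sup>2)"])
       (use chr imm det in \<open>auto intro!: smooth_on_divide smooth_on_diff smooth_on_mult smE smdet D\<close>)
    ultimately show ?thesis using df exhaust_2[of k] by metis
  qed
  \<comment> \<open>The symbols with lowered index are polynomial in derivatives of
    \<open>X\<close>. Differentiating this relation gives exactly the combinations of derivatives of
    Christoffel symbols that occur in the curvature.\<close>
  have low: "E w * christoffel X 1 i j w + F w * christoffel X 2 i j w = a i j w" if "w \<in> D" for i j w
  proof -
    have "(E w * G w - (F w)\<^sup>2) \<noteq> 0" using imm[OF that] det by simp
    then show ?thesis unfolding chr[OF that] by (simp add: divide_simps) (simp add: algebra_simps power2_eq_square)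
  qed
  have dlow: "E z * pd m (christoffel X 1 i j) z + pd m E z * \<Gamma> 1 i j + (F z * pd m (christoffel X 2 i j) z + pd m F z * \<Gamma> 2 i j)
      = pd m (a i j) z" for m i j
  proof -
    have "pd m (\<lambda>w. E w * christoffel X 1 i j w + F w * christoffel X 2 i j w) z = pd m (a i j) z"
      by (rule pd_cong[OF D z]) (rule low)
    moreover have "(\<lambda>w. E w * christoffel X 1 i j w) differentiable at z" "(\<lambda>w. F w * christoffel X 2 i j w) differentiable at z"
      using df[OF smE(1)] df[OF smE(2)] dchr differentiable_mult by blast+
    ultimately show ?thesis using df[OF smE(1)] df[OF smE(2)] dchr by (simp add: pd_add pd_mult \<Gamma>_def)
  qed
  define A11 A12 A22 B11 B12 B22 where AB: "A11 = a 1 1 z" "A12 = a 1 2 z" "A22 = a 2 2 z"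
    "B11 = b 1 1 z" "B12 = b 1 2 z" "B22 = b 2 2 z"
  have sym: "pd 2 (pd 1 X) z = pd 1 (pd 2 X) z" by (rule pd_sym[OF D X z])
  have dE: "pd 1 E z = 2 * A11" "pd 2 E z = 2 * A12" "pd 1 F z = B11 + A12" "pd 2 F z = B12 + A22"
    unfolding E_def F_def AB a_def b_def using sym by (simp_all add: pd_inner df[OF smX] inner_commute)
  \<comment> \<open>The third derivatives of \<open>X\<close> cancel by symmetry; only inner
    products of second derivatives survive.\<close>
  have da: "pd 1 (a 2 2) z - pd 2 (a 1 2) z = pd 2 (pd 2 X) z \<bullet> pd 1 (pd 1 X) z - pd 1 (pd 2 X) z \<bullet> pd 1 (pd 2 X) z"
    unfolding a_def using sym pd_sym[OF D smX z, of 2]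
    by (simp add: pd_inner df[OF smX] df[OF smXX] inner_commute)
  have lowz: "E z * \<Gamma> 1 i j + F z * \<Gamma> 2 i j = a i j z" for i j using low[OF z] by (simp add: \<Gamma>_def)
  have \<Gamma>sym: "\<Gamma> k 2 1 = \<Gamma> k 1 2" for k
    using exhaust_2[of k] chr[OF z, of 2 1] chr[OF z, of 1 2] sym by (auto simp: \<Gamma>_def a_def b_def)
  have ch: "christoffel X k i j z = \<Gamma> k i j" for k i j by (simp add: \<Gamma>_def)
  define S where "S = pd 2 (pd 2 X) z \<bullet> pd 1 (pd 1 X) z - pd 1 (pd 2 X) z \<bullet> pd 1 (pd 2 X) z"
  have num: "(\<Sum>l\<in>UNIV. riemann X l 1 2 2 z * first_ff X z $ l $ 1)
      = S - A11 * \<Gamma> 1 2 2 - B11 * \<Gamma> 2 2 2 + A12 * \<Gamma> 1 1 2 + B12 * \<Gamma> 2 1 2"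
  proof -
    have l: "E z * \<Gamma> 1 1 1 + F z * \<Gamma> 2 1 1 = A11" "E z * \<Gamma> 1 1 2 + F z * \<Gamma> 2 1 2 = A12" "E z * \<Gamma> 1 2 2 + F z * \<Gamma> 2 2 2 = A22"
      using lowz by (simp_all add: AB)
    have F1: "first_ff X z $ 1 $ 1 = E z" "first_ff X z $ 2 $ 1 = F z"
      by (simp_all add: first_ff_nth E_def F_def inner_commute)
    have "(\<Sum>l\<in>UNIV. riemann X l 1 2 2 z * first_ff X z $ l $ 1) =
       (E z * pd 1 (christoffel X 1 2 2) z + F z * pd 1 (christoffel X 2 2 2) z)
       - (E z * pd 2 (christoffel X 1 1 2) z + F z * pd 2 (christoffel X 2 1 2) z)
       + \<Gamma> 1 2 2 * (E z * \<Gamma> 1 1 1 + F z * \<Gamma> 2 1 1) + \<Gamma> 2 2 2 * (E z * \<Gamma> 1 1 2 + F z * \<Gamma> 2 1 2)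
       - \<Gamma> 1 1 2 * (E z * \<Gamma> 1 1 2 + F z * \<Gamma> 2 1 2) - \<Gamma> 2 1 2 * (E z * \<Gamma> 1 2 2 + F z * \<Gamma> 2 2 2)"
      unfolding sum_2 riemann_def F1 ch \<Gamma>sym by (simp add: algebra_simps)
    also have "E z * pd 1 (christoffel X 1 2 2) z + F z * pd 1 (christoffel X 2 2 2) z
        = pd 1 (a 2 2) z - 2 * A11 * \<Gamma> 1 2 2 - (B11 + A12) * \<Gamma> 2 2 2"
      using dlow[of 1 2 2] dE by (simp add: algebra_simps)
    also have "E z * pd 2 (christoffel X 1 1 2) z + F z * pd 2 (christoffel X 2 1 2) z
        = pd 2 (a 1 2) z - 2 * A12 * \<Gamma> 1 1 2 - (B12 + A22) * \<Gamma> 2 1 2"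
      using dlow[of 2 1 2] dE by (simp add: algebra_simps)
    finally show ?thesis unfolding l using da unfolding S_def by (simp add: algebra_simps)
  qed
  have p: "X z \<in> S3" using sph z by blast
  note tan = sphere_tangent[OF D X sph z]
  note dec = s3_cross_decompose[OF p tan(1)[of 1] tan(1)[of 2], folded c_def]
  show dc: "d = c \<bullet> c" unfolding d_def det_first_ff dec(1) ..
  have dEG: "d = E z * G z - (F z)\<^sup>2" by (simp add: d_def det)
  have d0: "d \<noteq> 0" using imm[OF z] by (simp add: d_def)
  \<comment> \<open>Normal, radial and tangential parts of the second derivatives. The tangential
    parts cancel against the Christoffel terms of \<open>num\<close>, and the radial parts add up to
    \<open>d * (E z * G z - (F z)\<^sup>2)\<close>, that is \<open>d\<^sup>2\<close>.\<close>
  have i1: "d * (pd 2 (pd 2 X) z \<bullet> pd 1 (pd 1 X) z) = (pd 2 (pd 2 X) z \<bullet> c) * (pd 1 (pd 1 X) z \<bullet> c) + d * G z * E z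
     + G z * A22 * A11 - F z * (A22 * B11 + B22 * A11) + E z * B22 * B11"
    using dec(5)[of "pd 2 (pd 2 X) z" "pd 1 (pd 1 X) z"] unfolding dc[symmetric] tan(2)
    by (simp add: AB a_def b_def E_def F_def G_def)
  have i2: "d * (pd 1 (pd 2 X) z \<bullet> pd 1 (pd 2 X) z) = (pd 1 (pd 2 X) z \<bullet> c)\<^sup>2 + d * F z * F z
     + G z * A12 * A12 - F z * (A12 * B12 + B12 * A12) + E z * B12 * B12"
    using dec(5)[of "pd 1 (pd 2 X) z" "pd 1 (pd 2 X) z"] unfolding dc[symmetric] tan(2)
    by (simp add: AB a_def b_def E_def F_def G_def power2_eq_square)
  have g: "d * \<Gamma> 1 2 2 = G z * A22 - F z * B22" "d * \<Gamma> 2 2 2 = E z * B22 - F z * A22"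
    "d * \<Gamma> 1 1 2 = G z * A12 - F z * B12" "d * \<Gamma> 2 1 2 = E z * B12 - F z * A12"
    using d0 chr[OF z] by (simp_all add: \<Gamma>_def AB dEG)
  have "gauss_curvature X z * d\<^sup>2 = d * (\<Sum>l\<in>UNIV. riemann X l 1 2 2 z * first_ff X z $ l $ 1)"
    using d0 by (simp add: gauss_curvature_def d_def power2_eq_square)
  also have "\<dots> = d * (pd 2 (pd 2 X) z \<bullet> pd 1 (pd 1 X) z) - d * (pd 1 (pd 2 X) z \<bullet> pd 1 (pd 2 X) z)
      - A11 * (d * \<Gamma> 1 2 2) - B11 * (d * \<Gamma> 2 2 2) + A12 * (d * \<Gamma> 1 1 2) + B12 * (d * \<Gamma> 2 1 2)"
    unfolding num S_def by (simp add: algebra_simps)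
  also have "\<dots> = d * (E z * G z - (F z)\<^sup>2) + (pd 1 (pd 1 X) z \<bullet> c) * (pd 2 (pd 2 X) z \<bullet> c) - (pd 1 (pd 2 X) z \<bullet> c)\<^sup>2"
    unfolding i1 i2 g by (simp add: algebra_simps power2_eq_square)
  finally show "gauss_curvature X z * d\<^sup>2 = d\<^sup>2 + (pd 1 (pd 1 X) z \<bullet> c) * (pd 2 (pd 2 X) z \<bullet> c) - (pd 1 (pd 2 X) z \<bullet> c)\<^sup>2"
    unfolding dEG[symmetric] by (simp add: power2_eq_square)
qed

section \<open>Change of parameters\<close>

text \<open>The second derivatives of \<open>\<phi>\<close> multiply tangent vectors only, and these
  are orthogonal to \<open>n\<close>.\<close>

lemma second_derivative_compose_normal:
  fixes \<phi> :: "real^2 \<Rightarrow> real^2"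
  assumes U: "open U" and \<phi>: "smooth_on U \<phi>" and D: "open D" and X: "smooth_on D X" and im: "\<phi> ` U \<subseteq> D" and z: "z \<in> U"
    and n: "pd 1 X (\<phi> z) \<bullet> n = 0" "pd 2 X (\<phi> z) \<bullet> n = 0"
  shows "pd i (pd j (\<lambda>w. X (\<phi> w))) z \<bullet> n =
    (\<Sum>k\<in>UNIV. \<Sum>l\<in>UNIV. pd i \<phi> z $ k * pd j \<phi> z $ l * (pd k (pd l X) (\<phi> z) \<bullet> n))"
proof -
  note d\<phi> = smooth_on_differentiable[OF \<phi>] and dp\<phi> = smooth_on_differentiable[OF smooth_on_pd[OF \<phi>] z]
  have \<phi>z: "\<phi> z \<in> D" using im z by blast
  note dX = smooth_on_differentiable[OF X] and dpX = smooth_on_differentiable[OF smooth_on_pd[OF X] \<phi>z]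
  have dpn: "(\<lambda>w. pd j \<phi> w $ k) differentiable at z" for k
    using differentiableI[OF bounded_linear.has_derivative[OF bounded_linear_vec_nth dp\<phi>[unfolded frechet_derivative_works]]] .
  have pdn: "pd i (\<lambda>w. pd j \<phi> w $ k) z = pd i (pd j \<phi>) z $ k" for k
    using pd_eqI[OF bounded_linear.has_derivative[OF bounded_linear_vec_nth dp\<phi>[unfolded frechet_derivative_works]], of i j k]
    by (simp add: pd_def)
  have dc: "(\<lambda>w. pd l X (\<phi> w)) differentiable at z" for l
    using differentiable_chain_at[OF d\<phi>[OF z] dpX] by (simp add: o_def)
  have "pd i (pd j (\<lambda>w. X (\<phi> w))) z = pd i (\<lambda>w. pd j \<phi> w $ 1 *\<^sub>R pd 1 X (\<phi> w) + pd j \<phi> w $ 2 *\<^sub>R pd 2 X (\<phi> w)) z"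
    by (rule pd_cong[OF U z]) (use pd_compose[OF d\<phi> dX] im in blast)
  also have "\<dots> = pd j \<phi> z $ 1 *\<^sub>R pd i (\<lambda>w. pd 1 X (\<phi> w)) z + pd i (pd j \<phi>) z $ 1 *\<^sub>R pd 1 X (\<phi> z)
     + (pd j \<phi> z $ 2 *\<^sub>R pd i (\<lambda>w. pd 2 X (\<phi> w)) z + pd i (pd j \<phi>) z $ 2 *\<^sub>R pd 2 X (\<phi> z))"
    by (simp add: pd_add pd_scaleR differentiable_scaleR dpn dc pdn)
  finally show ?thesis
    by (simp add: sum_2 inner_add_left n pd_compose[OF d\<phi>[OF z] dpX] algebra_simps)
qed

text \<open>The unit normal flips with the orientation of the parameters, so the second fundamental
  form is a tensor only up to the sign of the Jacobian.\<close>

lemma reparametrization: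
  fixes \<phi> :: "real^2 \<Rightarrow> real^2"
  assumes U: "open U" and \<phi>: "smooth_on U \<phi>" and D: "open D" and X: "smooth_on D X" and im: "\<phi> ` U \<subseteq> D"
    and sph: "X ` D \<subseteq> S3" and z: "z \<in> U"
  defines "\<delta> \<equiv> pd 1 \<phi> z $ 1 * pd 2 \<phi> z $ 2 - pd 1 \<phi> z $ 2 * pd 2 \<phi> z $ 1"
  shows "s3_cross (X (\<phi> z)) (pd 1 (\<lambda>w. X (\<phi> w)) z) (pd 2 (\<lambda>w. X (\<phi> w)) z)
      = \<delta> *\<^sub>R s3_cross (X (\<phi> z)) (pd 1 X (\<phi> z)) (pd 2 X (\<phi> z))"
    and "second_ff (\<lambda>w. X (\<phi> w)) z v u = sgn \<delta> * second_ff X (\<phi> z) (frechet_derivative \<phi> (at z) v) (frechet_derivative \<phi> (at z) u)"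
proof -
  have \<phi>z: "\<phi> z \<in> D" using im z by blast
  note d\<phi> = smooth_on_differentiable[OF \<phi> z] and dX = smooth_on_differentiable[OF X \<phi>z]
  show c: "s3_cross (X (\<phi> z)) (pd 1 (\<lambda>w. X (\<phi> w)) z) (pd 2 (\<lambda>w. X (\<phi> w)) z)
      = \<delta> *\<^sub>R s3_cross (X (\<phi> z)) (pd 1 X (\<phi> z)) (pd 2 X (\<phi> z))"
    unfolding pd_compose[OF d\<phi> dX] s3_cross_combination by (simp add: \<delta>_def)
  define n where "n = unit_normal X (\<phi> z)"
  have n': "unit_normal (\<lambda>w. X (\<phi> w)) z = sgn \<delta> *\<^sub>R n"
    unfolding unit_normal_def c n_def by (simp add: sgn_scaleR)
  have p: "X (\<phi> z) \<in> S3" using sph \<phi>z by blast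
  note tan = sphere_tangent[OF D X sph \<phi>z]
  note dec = s3_cross_decompose[OF p tan(1)[of 1] tan(1)[of 2]]
  have n: "pd 1 X (\<phi> z) \<bullet> n = 0" "pd 2 X (\<phi> z) \<bullet> n = 0"
    using dec(3,4) unfolding n_def unit_normal_def sgn_div_norm by (simp_all add: inner_commute)
  note sd = second_derivative_compose_normal[OF U \<phi> D X im z n]
  show "second_ff (\<lambda>w. X (\<phi> w)) z v u = sgn \<delta> * second_ff X (\<phi> z) (frechet_derivative \<phi> (at z) v) (frechet_derivative \<phi> (at z) u)"
    unfolding second_ff_def n' n_def[symmetric] inner_scaleR_right frechet_pd[OF d\<phi>] sd sum_2
    by (simp add: algebra_simps)
qed

text \<open>Instead of transforming Christoffel symbols, both curvatures are expressed by
  \<open>gauss_equation\<close>: the extrinsic side and the squared Gram determinant both scale by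
  the fourth power of the Jacobian.\<close>

lemma gauss_curvature_compose:
  fixes \<phi> :: "real^2 \<Rightarrow> real^2"
  assumes U: "open U" and \<phi>: "smooth_on U \<phi>" and D: "open D" and X: "smooth_on D X" and im: "\<phi> ` U \<subseteq> D"
    and sph: "X ` D \<subseteq> S3" and z: "z \<in> U"
    and imm: "\<And>w. w \<in> D \<Longrightarrow> det (first_ff X w) \<noteq> 0"
    and jac: "\<And>w. w \<in> U \<Longrightarrow> pd 1 \<phi> w $ 1 * pd 2 \<phi> w $ 2 - pd 1 \<phi> w $ 2 * pd 2 \<phi> w $ 1 \<noteq> 0"
  shows "gauss_curvature (\<lambda>w. X (\<phi> w)) z = gauss_curvature X (\<phi> z)"
proof -
  have \<phi>z: "\<phi> z \<in> D" using im z by blast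
  define J where "J = (\<lambda>w. pd 1 \<phi> w $ 1 * pd 2 \<phi> w $ 2 - pd 1 \<phi> w $ 2 * pd 2 \<phi> w $ 1)"
  have det: "det (first_ff (\<lambda>w. X (\<phi> w)) w) = (J w)\<^sup>2 * det (first_ff X (\<phi> w))" if "w \<in> U" for w
  proof -
    have wD: "\<phi> w \<in> D" using im that by blast
    note d\<phi> = smooth_on_differentiable[OF \<phi> that] and dX = smooth_on_differentiable[OF X wD]
    show ?thesis unfolding det_first_ff pd_compose[OF d\<phi> dX] J_def
      by (simp add: inner_add_left inner_add_right inner_commute algebra_simps power2_eq_square)
  qed
  have Y: "smooth_on U (\<lambda>w. X (\<phi> w))" by (rule smooth_on_compose[OF U D X \<phi> im])
  have sphY: "(\<lambda>w. X (\<phi> w)) ` U \<subseteq> S3" using sph im by blast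
  have immY: "det (first_ff (\<lambda>w. X (\<phi> w)) w) \<noteq> 0" if "w \<in> U" for w
    using det[OF that] jac[OF that] imm im that unfolding J_def by auto
  define c where "c = s3_cross (X (\<phi> z)) (pd 1 X (\<phi> z)) (pd 2 X (\<phi> z))"
  have p: "X (\<phi> z) \<in> S3" using sph \<phi>z by blast
  note tan = sphere_tangent[OF D X sph \<phi>z]
  note dec = s3_cross_decompose[OF p tan(1)[of 1] tan(1)[of 2], folded c_def]
  have n: "pd 1 X (\<phi> z) \<bullet> c = 0" "pd 2 X (\<phi> z) \<bullet> c = 0" using dec(3,4) by (simp_all add: inner_commute)
  note sd = second_derivative_compose_normal[OF U \<phi> D X im z n]
  define d where "d = det (first_ff X (\<phi> z))"
  note g1 = gauss_equation(1)[OF D X sph imm \<phi>z, folded c_def d_def]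
  note g2 = gauss_equation(1)[OF U Y sphY immY z, unfolded reparametrization(1)[OF U \<phi> D X im sph z], folded c_def,
      unfolded det[OF z] inner_scaleR_right sd sum_2 pd_sym'[OF D X \<phi>z, of 2 1], folded d_def]
  define p q r s where "p = pd 1 \<phi> z $ 1" and "q = pd 1 \<phi> z $ 2" and "r = pd 2 \<phi> z $ 1" and "s = pd 2 \<phi> z $ 2"
  have "gauss_curvature (\<lambda>w. X (\<phi> w)) z * ((J z)\<^sup>2 * d)\<^sup>2 = (J z)^4 * (gauss_curvature X (\<phi> z) * d\<^sup>2)"
    using g1 g2 unfolding J_def p_def[symmetric] q_def[symmetric] r_def[symmetric] s_def[symmetric] by algebra
  then have "((J z)\<^sup>2 * d)\<^sup>2 * (gauss_curvature (\<lambda>w. X (\<phi> w)) z - gauss_curvature X (\<phi> z)) = 0"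
    by (simp add: algebra_simps power2_eq_square power4_eq_xxxx)
  moreover have "((J z)\<^sup>2 * d)\<^sup>2 \<noteq> 0" using imm[OF \<phi>z] jac[OF z] by (simp add: d_def J_def)
  ultimately show ?thesis by simp
qed

lemma second_ff_cong:
  assumes S: "open S" "z \<in> S" and eq: "\<And>w. w \<in> S \<Longrightarrow> X w = Y w"
  shows "second_ff X z = second_ff Y z"
proof -
  have 1: "pd i X w = pd i Y w" if "w \<in> S" for i w using pd_cong[OF S(1) that eq] .
  have 2: "pd i (pd j X) z = pd i (pd j Y) z" for i j using pd_cong[OF S 1] .
  show ?thesis unfolding second_ff_def[abs_def] unit_normal_def 2 1[OF S(2)] eq[OF S(2)] ..
qed

lemma gauss_curvature_cong:
  assumes S: "open S" "z \<in> S" and eq: "\<And>w. w \<in> S \<Longrightarrow> X w = Y w"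
  shows "gauss_curvature X z = gauss_curvature Y z"
proof -
  have 1: "first_ff X w = first_ff Y w" if "w \<in> S" for w
    unfolding first_ff_def using pd_cong[OF S(1) that eq] by simp
  have 2: "christoffel X k i j w = christoffel Y k i j w" if "w \<in> S" for k i j w
  proof -
    have "pd m (\<lambda>w. first_ff X w $ n $ l) w = pd m (\<lambda>w. first_ff Y w $ n $ l) w" for m n l
      by (rule pd_cong[OF S(1) that]) (simp add: 1)
    then show ?thesis unfolding christoffel_def 1[OF that] by simp
  qed
  have "riemann X l i j k z = riemann Y l i j k z" for l i j k
    unfolding riemann_def 2[OF S(2)] using pd_cong[OF S 2] by simp
  then show ?thesis unfolding gauss_curvature_def 1[OF S(2)] by simp
qed

section \<open>Products of two curves\<close>

text \<open>The left logarithmic derivative a^(-1) a' as an element of the Lie algebra; on the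
  sphere the real part that \<open>snd\<close> discards is zero. For a product a(s) b(t) the partial
  derivatives are a U b and a V b, with \<open>U\<close> the left velocity of the first and
  \<open>V\<close> the right velocity of the second factor.\<close>

definition left_vel :: "(real \<Rightarrow> quat) \<Rightarrow> real \<Rightarrow> real^3" where
  "left_vel a s = snd (qconj (a s) \<odot> velocity a s)"

definition right_vel :: "(real \<Rightarrow> quat) \<Rightarrow> real \<Rightarrow> real^3" where
  "right_vel b t = snd (velocity b t \<odot> qconj (b t))"

lemma deriv_locally_constant:
  fixes f :: "real \<Rightarrow> 'a::real_normed_vector"
  assumes "open I" "s \<in> I" "(f has_vector_derivative d) (at s)" "\<And>x. x \<in> I \<Longrightarrow> f x = c"
  shows "d = 0"
proof -
  have "((\<lambda>_. c) has_vector_derivative d) (at s)"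
    by (rule has_vector_derivative_transform_within_open[OF assms(3,1,2)]) (rule assms(4))
  from vector_derivative_unique_at[OF this has_vector_derivative_const] show ?thesis .
qed

lemma bounded_linear_qconj: "bounded_linear qconj"
  unfolding qconj_def[abs_def]
  by (intro bounded_linear_Pair bounded_linear_fst bounded_linear_minus bounded_linear_snd)

lemma smooth_on_velocity: "open I \<Longrightarrow> smooth_on I a \<Longrightarrow> smooth_on I (velocity a)"
  unfolding velocity_def[abs_def] by (rule smooth_on_vector_derivative)

lemma has_velocity: "smooth_on I a \<Longrightarrow> s \<in> I \<Longrightarrow> (a has_vector_derivative velocity a s) (at s)"
  unfolding velocity_def by (rule smooth_on_has_vector_derivative)

lemma smooth_on_left_vel: "open I \<Longrightarrow> smooth_on I a \<Longrightarrow> smooth_on I (left_vel a)"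
  unfolding left_vel_def[abs_def]
  by (intro smooth_on_snd qm.smooth_on bounded_linear.smooth_on[OF bounded_linear_qconj] smooth_on_velocity)

lemma smooth_on_right_vel: "open I \<Longrightarrow> smooth_on I a \<Longrightarrow> smooth_on I (right_vel a)"
  unfolding right_vel_def[abs_def]
  by (intro smooth_on_snd qm.smooth_on bounded_linear.smooth_on[OF bounded_linear_qconj] smooth_on_velocity)

lemma velocity_tangent:
  assumes "open I" "smooth_on I a" "a ` I \<subseteq> S3" "s \<in> I"
  shows "a s \<bullet> velocity a s = 0"
proof -
  have "((\<lambda>s. a s \<bullet> a s) has_vector_derivative (a s \<bullet> velocity a s + velocity a s \<bullet> a s)) (at s)"
    using bounded_bilinear.has_vector_derivative[OF bounded_bilinear_inner has_velocity[OF assms(2,4)] has_velocity[OF assms(2,4)]] .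
  moreover have "a x \<bullet> a x = 1" if "x \<in> I" for x using assms(3) that S3_inner by blast
  ultimately have "a s \<bullet> velocity a s + velocity a s \<bullet> a s = 0"
    using deriv_locally_constant[OF assms(1,4)] by blast
  then show ?thesis by (simp add: inner_commute)
qed

lemma velocity_left_right:
  assumes "open I" "smooth_on I a" "a ` I \<subseteq> S3" "s \<in> I"
  shows "velocity a s = a s \<odot> (0, left_vel a s)" "velocity a s = (0, right_vel a s) \<odot> a s"
    "norm (left_vel a s) = norm (velocity a s)" "norm (right_vel a s) = norm (velocity a s)"
proof -
  have S: "a s \<in> S3" using assms by blast
  have 0: "(0, left_vel a s) = qconj (a s) \<odot> velocity a s" "(0, right_vel a s) = velocity a s \<odot> qconj (a s)"
    using velocity_tangent[OF assms] by (simp_all add: left_vel_def right_vel_def prod_eq_iff fst_qconj_mult)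
  show 1: "velocity a s = a s \<odot> (0, left_vel a s)" "velocity a s = (0, right_vel a s) \<odot> a s"
    unfolding 0 qconj_cancel[OF S] by simp_all
  show "norm (left_vel a s) = norm (velocity a s)" unfolding 1(1) norm_qmult using S by (simp add: norm_Pair)
  show "norm (right_vel a s) = norm (velocity a s)" unfolding 1(2) norm_qmult using S by (simp add: norm_Pair)
qed

lemma left_velI: "a s \<in> S3 \<Longrightarrow> velocity a s = a s \<odot> (0, u) \<Longrightarrow> left_vel a s = u"
  by (simp add: left_vel_def qconj_cancel)

lemma right_velI: "a s \<in> S3 \<Longrightarrow> velocity a s = (0, u) \<odot> a s \<Longrightarrow> right_vel a s = u"
  by (simp add: right_vel_def qconj_cancel)

lemma pd_product:
  assumes P: "(P has_vector_derivative P') (at (z $ 1))" and Q: "(Q has_vector_derivative Q') (at (z $ 2))"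
  shows "pd 1 (\<lambda>w. P (w $ 1) \<odot> Q (w $ 2)) z = P' \<odot> Q (z $ 2)" "pd 2 (\<lambda>w. P (w $ 1) \<odot> Q (w $ 2)) z = P (z $ 1) \<odot> Q'"
proof -
  have n: "((\<lambda>w::real^2. w $ i) has_derivative (\<lambda>v. v $ i)) (at z)" for i
    using bounded_linear_imp_has_derivative[OF bounded_linear_vec_nth] .
  have "((\<lambda>w. P (w $ 1)) has_derivative (\<lambda>v. v $ 1 *\<^sub>R P')) (at z)"
    using has_derivative_compose[OF n P[unfolded has_vector_derivative_def]] .
  moreover have "((\<lambda>w. Q (w $ 2)) has_derivative (\<lambda>v. v $ 2 *\<^sub>R Q')) (at z)"
    using has_derivative_compose[OF n Q[unfolded has_vector_derivative_def]] .
  ultimately have "((\<lambda>w. P (w $ 1) \<odot> Q (w $ 2)) has_derivative (\<lambda>v. P (z $ 1) \<odot> (v $ 2 *\<^sub>R Q') + (v $ 1 *\<^sub>R P') \<odot> Q (z $ 2))) (at z)"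
    by (rule qm.FDERIV)
  from pd_eqI[OF this, of 1] pd_eqI[OF this, of 2]
  show "pd 1 (\<lambda>w. P (w $ 1) \<odot> Q (w $ 2)) z = P' \<odot> Q (z $ 2)" "pd 2 (\<lambda>w. P (w $ 1) \<odot> Q (w $ 2)) z = P (z $ 1) \<odot> Q'"
    by (simp_all add: qm.zero_left qm.zero_right)
qed

lemma open_rect: "open I \<Longrightarrow> open J \<Longrightarrow> open (rect I J)"
proof -
  assume *: "open I" "open J"
  have "rect I J = (\<lambda>z. z $ 1) -` I \<inter> (\<lambda>z. z $ 2) -` J" by (auto simp: rect_def)
  moreover have "open ((\<lambda>z::real^2. z $ i) -` K)" if "open K" for K i
    using that by (intro open_vimage continuous_intros)
  ultimately show ?thesis using * by auto
qed

lemma norm_orth_sandwich: "p \<in> S3 \<Longrightarrow> q \<in> S3 \<Longrightarrow> (p \<odot> x \<odot> q) \<bullet> (p \<odot> y \<odot> q) = x \<bullet> y"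
  unfolding S3_inner inner_qmult by simp

locale product_surface =
  fixes I J :: "real set" and a b :: "real \<Rightarrow> quat"
  assumes I: "open I" and J: "open J" and a: "smooth_on I a" and b: "smooth_on J b"
    and aS: "a ` I \<subseteq> S3" and bS: "b ` J \<subseteq> S3"
begin

definition X :: "real^2 \<Rightarrow> quat" where "X z = a (z $ 1) \<odot> b (z $ 2)"
abbreviation "U \<equiv> left_vel a"
abbreviation "V \<equiv> right_vel b"
abbreviation "dU s \<equiv> vector_derivative U (at s)"
abbreviation "dV t \<equiv> vector_derivative V (at t)"
abbreviation "R \<equiv> rect I J"

lemma memR: "z \<in> R \<Longrightarrow> z $ 1 \<in> I" "z \<in> R \<Longrightarrow> z $ 2 \<in> J"
  by (simp_all add: rect_def)

lemma S3: "s \<in> I \<Longrightarrow> a s \<in> S3" "t \<in> J \<Longrightarrow> b t \<in> S3"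
  using aS bS by blast+

lemma smooth_X: "smooth_on R X"
proof -
  have n: "smooth_on R (\<lambda>z. z $ i)" for i by (intro smooth_on_vec_nth open_rect I J smooth_on_id)
  have "smooth_on R (\<lambda>z. a (z $ 1))" "smooth_on R (\<lambda>z. b (z $ 2))"
    using memR by (auto intro!: smooth_on_compose[OF open_rect[OF I J] I a n] smooth_on_compose[OF open_rect[OF I J] J b n])
  then show ?thesis unfolding X_def[abs_def] by (rule qm.smooth_on[OF open_rect[OF I J]])
qed

lemma X_S3: "X ` R \<subseteq> S3"
  using S3 S3_qmult memR unfolding X_def by blast

lemma da: "s \<in> I \<Longrightarrow> (a has_vector_derivative a s \<odot> (0, U s)) (at s)"
  using has_velocity[OF a] velocity_left_right(1)[OF I a aS] by metis

lemma db: "t \<in> J \<Longrightarrow> (b has_vector_derivative (0, V t) \<odot> b t) (at t)"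
  using has_velocity[OF b] velocity_left_right(2)[OF J b bS] by metis

lemma dU: "s \<in> I \<Longrightarrow> (U has_vector_derivative dU s) (at s)"
  using smooth_on_has_vector_derivative[OF smooth_on_left_vel[OF I a]] .

lemma dV: "t \<in> J \<Longrightarrow> (V has_vector_derivative dV t) (at t)"
  using smooth_on_has_vector_derivative[OF smooth_on_right_vel[OF J b]] .

lemma has_vector_derivative_imag: "(f has_vector_derivative f') (at x) \<Longrightarrow> ((\<lambda>s. (0::real, f s)) has_vector_derivative (0, f')) (at x)"
  using has_vector_derivative_Pair[OF has_vector_derivative_const] by blast

lemma dda: "s \<in> I \<Longrightarrow> ((\<lambda>s. a s \<odot> (0, U s)) has_vector_derivative a s \<odot> (- (U s \<bullet> U s), dU s)) (at s)"
  using qm.has_vector_derivative[OF da has_vector_derivative_imag[OF dU]]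
  by (simp add: qmult_assoc imag_mult flip: qm.add_right)

lemma ddb: "t \<in> J \<Longrightarrow> ((\<lambda>t. (0, V t) \<odot> b t) has_vector_derivative (- (V t \<bullet> V t), dV t) \<odot> b t) (at t)"
  using qm.has_vector_derivative[OF has_vector_derivative_imag[OF dV] db]
  by (simp add: imag_mult flip: qm.add_left qmult_assoc)

lemma pd_X:
  assumes z: "z \<in> R"
  shows "pd 1 X z = a (z $ 1) \<odot> (0, U (z $ 1)) \<odot> b (z $ 2)" "pd 2 X z = a (z $ 1) \<odot> (0, V (z $ 2)) \<odot> b (z $ 2)"
  unfolding X_def[abs_def] pd_product[OF da[OF memR(1)[OF z]] db[OF memR(2)[OF z]]] by (simp_all add: qmult_assoc)

lemma pd_pd_X:
  assumes z: "z \<in> R"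
  shows "pd 1 (pd 1 X) z = a (z $ 1) \<odot> (- (U (z $ 1) \<bullet> U (z $ 1)), dU (z $ 1)) \<odot> b (z $ 2)"
    "pd 1 (pd 2 X) z = a (z $ 1) \<odot> (- (U (z $ 1) \<bullet> V (z $ 2)), cross3 (U (z $ 1)) (V (z $ 2))) \<odot> b (z $ 2)"
    "pd 2 (pd 2 X) z = a (z $ 1) \<odot> (- (V (z $ 2) \<bullet> V (z $ 2)), dV (z $ 2)) \<odot> b (z $ 2)"
proof -
  note R = open_rect[OF I J]
  show "pd 1 (pd 1 X) z = a (z $ 1) \<odot> (- (U (z $ 1) \<bullet> U (z $ 1)), dU (z $ 1)) \<odot> b (z $ 2)"
    using pd_cong[OF R z pd_X(1)] pd_product(1)[OF dda[OF memR(1)[OF z]] db[OF memR(2)[OF z]]] by simp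
  have "pd 1 (pd 2 X) z = a (z $ 1) \<odot> (0, U (z $ 1)) \<odot> ((0, V (z $ 2)) \<odot> b (z $ 2))"
    using pd_cong[OF R z pd_X(2)] pd_product(1)[OF da[OF memR(1)[OF z]] ddb[OF memR(2)[OF z]]] by (simp add: qmult_assoc)
  then show "pd 1 (pd 2 X) z = a (z $ 1) \<odot> (- (U (z $ 1) \<bullet> V (z $ 2)), cross3 (U (z $ 1)) (V (z $ 2))) \<odot> b (z $ 2)"
    by (simp add: qmult_assoc flip: imag_mult)
  show "pd 2 (pd 2 X) z = a (z $ 1) \<odot> (- (V (z $ 2) \<bullet> V (z $ 2)), dV (z $ 2)) \<odot> b (z $ 2)"
    using pd_cong[OF R z pd_X(2)] pd_product(2)[OF da[OF memR(1)[OF z]] ddb[OF memR(2)[OF z]]] by (simp add: qmult_assoc)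
qed

text \<open>\<open>s3_cross\<close> translates by the inverse of a b, which leaves the conjugates of
  \<open>U\<close> and \<open>V\<close> by b. Conjugation by a unit quaternion is a rotation and
  commutes with the cross product; this is read off the imaginary part of a product of imaginary
  quaternions.\<close>

lemma s3_cross_X:
  assumes z: "z \<in> R"
  shows "s3_cross (X z) (pd 1 X z) (pd 2 X z) = a (z $ 1) \<odot> (0, cross3 (U (z $ 1)) (V (z $ 2))) \<odot> b (z $ 2)"
proof -
  note m = S3(1)[OF memR(1)[OF z]] S3(2)[OF memR(2)[OF z]]
  define u v where "u = U (z $ 1)" and "v = V (z $ 2)"
  define p q where "p = a (z $ 1)" and "q = b (z $ 2)"
  have pq: "p \<in> S3" "q \<in> S3" using m by (auto simp: p_def q_def)
  have c: "qconj (p \<odot> q) \<odot> (p \<odot> x \<odot> q) = qconj q \<odot> x \<odot> q" for x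
    using qconj_cancel(2)[OF pq(1)] by (simp add: qconj_qmult qmult_assoc)
  obtain u' where u': "qconj q \<odot> (0, u) \<odot> q = (0, u')"
  proof
    have "fst (qconj q \<odot> (0, u) \<odot> q) = 0" unfolding qmult_assoc fst_qconj_mult
      by (simp add: qmult_def inner_quat cross3_simps)
    then show "qconj q \<odot> (0, u) \<odot> q = (0, snd (qconj q \<odot> (0, u) \<odot> q))" by (simp add: prod_eq_iff)
  qed
  obtain v' where v': "qconj q \<odot> (0, v) \<odot> q = (0, v')"
  proof
    have "fst (qconj q \<odot> (0, v) \<odot> q) = 0" unfolding qmult_assoc fst_qconj_mult
      by (simp add: qmult_def inner_quat cross3_simps)
    then show "qconj q \<odot> (0, v) \<odot> q = (0, snd (qconj q \<odot> (0, v) \<odot> q))" by (simp add: prod_eq_iff)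
  qed
  have "(0, u') \<odot> (0, v') = qconj q \<odot> ((0, u) \<odot> (0, v)) \<odot> q"
    unfolding u'[symmetric] v'[symmetric] using qconj_cancel(1)[OF pq(2)] by (simp add: qmult_assoc)
  then have uv: "(- (u' \<bullet> v'), cross3 u' v') = qconj q \<odot> (- (u \<bullet> v), cross3 u v) \<odot> q"
    unfolding imag_mult .
  have re: "qconj q \<odot> (r, 0) \<odot> q = (r, 0)" for r
  proof -
    have "qconj q \<odot> (r *\<^sub>R (1, 0)) \<odot> q = r *\<^sub>R (1, 0)"
      unfolding qm.scaleR_right qm.scaleR_left qmult_one qconj_mult_self(1)[OF pq(2)] ..
    then show ?thesis by simp
  qed
  have split: "(r, x) = (r, 0) + (0, x)" for r :: real and x :: "real^3" by simp
  have sp: "qconj q \<odot> (r, x) \<odot> q = (r, 0) + qconj q \<odot> (0, x) \<odot> q" for r x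
    by (subst split) (simp only: qm.add_right qm.add_left re)
  have "(- (u' \<bullet> v'), cross3 u' v') = (- (u \<bullet> v), 0) + qconj q \<odot> (0, cross3 u v) \<odot> q"
    by (rule trans[OF uv sp])
  moreover have "u' \<bullet> v' = u \<bullet> v"
    using norm_orth_sandwich[OF S3_qconj[OF pq(2)] pq(2), of "(0,u)" "(0,v)"] unfolding u' v' by (simp add: inner_quat)
  ultimately have "(0, cross3 u' v') = qconj q \<odot> (0, cross3 u v) \<odot> q"
    using split[of "- (u \<bullet> v)" "cross3 u' v'"] by (metis add_left_cancel)
  then show ?thesis
    unfolding s3_cross_def pd_X[OF z] X_def u_def[symmetric] v_def[symmetric] p_def[symmetric] q_def[symmetric] c u' v'
    using qconj_cancel(1)[OF pq(2)] by (simp add: qmult_assoc)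
qed

lemma inner_sandwich:
  "z \<in> R \<Longrightarrow> (a (z $ 1) \<odot> x \<odot> b (z $ 2)) \<bullet> (a (z $ 1) \<odot> y \<odot> b (z $ 2)) = x \<bullet> y"
  using norm_orth_sandwich S3 memR by blast

lemma det_first_ff_X:
  assumes "z \<in> R"
  shows "det (first_ff X z) = (norm (cross3 (U (z $ 1)) (V (z $ 2))))\<^sup>2"
  unfolding det_first_ff pd_X[OF assms] inner_sandwich[OF assms]
  using norm_cross_dot[of "U (z $ 1)" "V (z $ 2)"]
  by (simp add: inner_quat power_mult_distrib power2_norm_eq_inner)

lemma second_ff_X:
  assumes z: "z \<in> R" and c: "cross3 (U (z $ 1)) (V (z $ 2)) \<noteq> 0"
  defines "c \<equiv> cross3 (U (z $ 1)) (V (z $ 2))"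
  shows "second_ff X z v w * norm c = v $ 1 * w $ 1 * (dU (z $ 1) \<bullet> c) + (v $ 1 * w $ 2 + v $ 2 * w $ 1) * (c \<bullet> c)
    + v $ 2 * w $ 2 * (dV (z $ 2) \<bullet> c)"
proof -
  define n where "n = a (z $ 1) \<odot> (0, c) \<odot> b (z $ 2)"
  have "norm n = norm c" using inner_sandwich[OF z, of "(0,c)" "(0,c)"]
    unfolding n_def norm_eq_sqrt_inner by (simp add: inner_quat)
  moreover have "unit_normal X z = n /\<^sub>R norm n"
    unfolding unit_normal_def s3_cross_X[OF z] n_def c_def sgn_div_norm ..
  ultimately have "(x \<bullet> unit_normal X z) * norm c = x \<bullet> n" for x
    using c by (simp add: c_def)
  then have "second_ff X z v w * norm c = (\<Sum>i\<in>UNIV. \<Sum>j\<in>UNIV. v $ i * w $ j * (pd i (pd j X) z \<bullet> n))"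
    unfolding second_ff_def sum_distrib_right by (metis (no_types, lifting) mult.assoc sum.cong)
  also have "\<dots> = v $ 1 * w $ 1 * (dU (z $ 1) \<bullet> c) + (v $ 1 * w $ 2 + v $ 2 * w $ 1) * (c \<bullet> c)
    + v $ 2 * w $ 2 * (dV (z $ 2) \<bullet> c)"
    unfolding sum_2 pd_sym[OF open_rect[OF I J] smooth_X z] pd_pd_X[OF z] n_def inner_sandwich[OF z]
    by (simp add: inner_quat c_def algebra_simps)
  finally show ?thesis .
qed

text \<open>The normal component of the mixed second derivative is \<open>c \<bullet> c\<close>,
  which is also the Gram determinant. Its square cancels the contribution of the ambient curvature,
  and only the product of the two pure second derivatives is left.\<close>

lemma gauss_X:
  assumes z: "z \<in> R" and c: "\<And>w. w \<in> R \<Longrightarrow> cross3 (U (w $ 1)) (V (w $ 2)) \<noteq> 0"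
  defines "c \<equiv> cross3 (U (z $ 1)) (V (z $ 2))"
  shows "gauss_curvature X z * (c \<bullet> c)\<^sup>2 = (dU (z $ 1) \<bullet> c) * (dV (z $ 2) \<bullet> c)"
proof -
  have "det (first_ff X w) \<noteq> 0" if "w \<in> R" for w using c[OF that] det_first_ff_X[OF that] by simp
  note g = gauss_equation[OF open_rect[OF I J] smooth_X X_S3 this z]
  have d: "det (first_ff X z) = c \<bullet> c" using det_first_ff_X[OF z] by (simp add: c_def power2_norm_eq_inner)
  show ?thesis using g(1) unfolding d s3_cross_X[OF z] pd_pd_X[OF z] inner_sandwich[OF z] c_def[symmetric]
    by (simp add: inner_quat power2_eq_square)
qed

end

section \<open>Vanishing of the curvature\<close>

lemma isCont_fst_snd:
  fixes f :: "real \<Rightarrow> 'a::topological_space"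
  assumes "open I" "continuous_on I f" "s \<in> I"
  shows "isCont (\<lambda>p::real\<times>real. f (fst p)) (s, t)" "isCont (\<lambda>p::real\<times>real. f (snd p)) (t, s)"
proof -
  have f: "isCont f s" using continuous_on_eq_continuous_at[OF assms(1)] assms(2,3) by blast
  show "isCont (\<lambda>p::real\<times>real. f (fst p)) (s, t)"
    by (rule isCont_o2[where g = f]) (use f in \<open>auto intro: continuous_intros\<close>)
  show "isCont (\<lambda>p::real\<times>real. f (snd p)) (t, s)"
    by (rule isCont_o2[where g = f]) (use f in \<open>auto intro: continuous_intros\<close>)
qed

text \<open>A frame \<open>(u, p, n)\<close> along a curve of unit vectors, with speed \<open>lam\<close> and geodesic curvature
  \<open>k\<close>, together with a second curve \<open>V\<close>. Seen from \<open>u s\<close>, the direction of \<open>V t\<close> has polar angle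
  \<open>\<omega>\<close> and azimuth \<open>\<psi>\<close>; then \<open>q = cot \<psi>\<close>, \<open>g = cot \<omega> sin \<psi>\<close> and \<open>W\<close> is proportional to
  \<open>sin \<omega> / sin \<psi>\<close>. The equation \<open>chebyshev\<close> is the condition of constant nonzero curvature.\<close>

locale spherical_frame =
  fixes I J :: "real set" and u p n V :: "real \<Rightarrow> real^3" and lam k j :: "real \<Rightarrow> real"
  assumes I: "open I" and J: "open J"
    and sm: "smooth_on I u" "smooth_on I p" "smooth_on I n" "smooth_on I lam" "smooth_on I k" "smooth_on I j"
    and smV: "smooth_on J V"
    and du: "\<And>s. s \<in> I \<Longrightarrow> (u has_vector_derivative lam s *\<^sub>R p s) (at s)"
    and dp: "\<And>s. s \<in> I \<Longrightarrow> (p has_vector_derivative - lam s *\<^sub>R u s + (lam s * k s) *\<^sub>R n s) (at s)"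
    and dn: "\<And>s. s \<in> I \<Longrightarrow> (n has_vector_derivative - (lam s * k s) *\<^sub>R p s) (at s)"
    and lam: "\<And>s. s \<in> I \<Longrightarrow> lam s \<noteq> 0" and j: "\<And>s. s \<in> I \<Longrightarrow> j s \<noteq> 0"
    and nz: "\<And>s t. s \<in> I \<Longrightarrow> t \<in> J \<Longrightarrow> n s \<bullet> V t \<noteq> 0"
    and chebyshev: "\<And>s t. s \<in> I \<Longrightarrow> t \<in> J \<Longrightarrow>
      (p s \<bullet> V t) * (n s \<bullet> vector_derivative V (at t)) - (n s \<bullet> V t) * (p s \<bullet> vector_derivative V (at t))
      = - j s * ((p s \<bullet> V t)\<^sup>2 + (n s \<bullet> V t)\<^sup>2)\<^sup>2 / (n s \<bullet> V t)"
begin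

definition x where "x s t = u s \<bullet> V t"
definition y where "y s t = p s \<bullet> V t"
definition z where "z s t = n s \<bullet> V t"
definition q where "q s t = - y s t / z s t"
definition g where "g s t = x s t * z s t / ((y s t)\<^sup>2 + (z s t)\<^sup>2)"
definition W where "W s t = ((y s t)\<^sup>2 + (z s t)\<^sup>2) / z s t"
text \<open>Minus the logarithmic derivative of \<open>j\<close> with respect to the arc length of
  \<open>u\<close>.\<close>

definition l where "l s = - deriv j s / (lam s * j s)"
abbreviation "dV t \<equiv> vector_derivative V (at t)"

lemma z0: "s \<in> I \<Longrightarrow> t \<in> J \<Longrightarrow> z s t \<noteq> 0" using nz by (simp add: z_def)

lemma rho0: "s \<in> I \<Longrightarrow> t \<in> J \<Longrightarrow> (y s t)\<^sup>2 + (z s t)\<^sup>2 \<noteq> 0"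
  using z0 by (simp add: sum_power2_eq_zero_iff)

lemma W0: "s \<in> I \<Longrightarrow> t \<in> J \<Longrightarrow> W s t \<noteq> 0"
  using z0 rho0 by (simp add: W_def)

lemma dxyz_s:
  assumes "s \<in> I"
  shows "((\<lambda>s. x s t) has_real_derivative lam s * y s t) (at s)"
    "((\<lambda>s. y s t) has_real_derivative lam s * (k s * z s t - x s t)) (at s)"
    "((\<lambda>s. z s t) has_real_derivative - lam s * k s * y s t) (at s)"
  unfolding x_def y_def z_def has_real_derivative_iff_has_vector_derivative
  using bounded_linear.has_vector_derivative[OF bounded_linear_inner_left[of "V t"] du[OF assms]]
    bounded_linear.has_vector_derivative[OF bounded_linear_inner_left[of "V t"] dp[OF assms]]
    bounded_linear.has_vector_derivative[OF bounded_linear_inner_left[of "V t"] dn[OF assms]]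
  by (simp_all add: inner_add_left inner_diff_left algebra_simps)

lemma dxyz_t:
  assumes "t \<in> J"
  shows "((\<lambda>t. x s t) has_real_derivative u s \<bullet> dV t) (at t)"
    "((\<lambda>t. y s t) has_real_derivative p s \<bullet> dV t) (at t)"
    "((\<lambda>t. z s t) has_real_derivative n s \<bullet> dV t) (at t)"
  unfolding x_def y_def z_def has_real_derivative_iff_has_vector_derivative
  by (rule bounded_linear.has_vector_derivative[OF bounded_linear_inner_right
      smooth_on_has_vector_derivative[OF smV assms]])+

text \<open>With \<open>q\<close> = cot \<psi> this reads \<psi>_s = lam (k - g), and
  \<open>dq_t\<close> reads \<psi>_t = j W.\<close>

lemma dq_s:
  assumes s: "s \<in> I" and t: "t \<in> J"
  shows "((\<lambda>s. q s t) has_real_derivative - lam s * (1 + (q s t)\<^sup>2) * (k s - g s t)) (at s)"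
  unfolding q_def
  by (rule derivative_eq_intros dxyz_s s z0 t refl)+
    (use z0[OF s t] rho0[OF s t] in \<open>simp add: g_def divide_simps, simp add: algebra_simps power2_eq_square\<close>)

lemma dg_s:
  assumes s: "s \<in> I" and t: "t \<in> J"
  shows "((\<lambda>s. g s t) has_real_derivative lam s * (- q s t / (1 + (q s t)\<^sup>2) + q s t * g s t * (k s - 2 * g s t))) (at s)"
proof -
  have h: "q s t / (1 + (q s t)\<^sup>2) = - (y s t * z s t) / ((y s t)\<^sup>2 + (z s t)\<^sup>2)"
    unfolding q_def using z0[OF s t] rho0[OF s t]
    by (simp add: divide_simps) (simp add: algebra_simps power2_eq_square)
  show ?thesis
    unfolding minus_divide_left[symmetric] h unfolding q_def g_def
    by (rule derivative_eq_intros dxyz_s s rho0 t refl)+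
      (use z0[OF s t] rho0[OF s t] in \<open>simp add: divide_simps, simp add: algebra_simps power2_eq_square\<close>)
qed

lemma dW_s:
  assumes s: "s \<in> I" and t: "t \<in> J"
  shows "((\<lambda>s. W s t) has_real_derivative lam s * W s t * q s t * (2 * g s t - k s)) (at s)"
  unfolding W_def q_def g_def
  by (rule derivative_eq_intros dxyz_s s z0 t refl)+
    (use z0[OF s t] rho0[OF s t] in \<open>simp add: divide_simps, simp add: algebra_simps power2_eq_square\<close>)

text \<open>\<open>chebyshev\<close> enters here: its left side is, up to the factor -z^2, the
  derivative of \<open>q\<close> along \<open>V\<close>, so it prescribes how fast the azimuth
  turns.\<close>

lemma dq_t:
  assumes s: "s \<in> I" and t: "t \<in> J"
  shows "((\<lambda>t. q s t) has_real_derivative - (1 + (q s t)\<^sup>2) * j s * W s t) (at t)"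
proof -
  have "((\<lambda>t. q s t) has_real_derivative (y s t * (n s \<bullet> dV t) - z s t * (p s \<bullet> dV t)) / (z s t)\<^sup>2) (at t)"
    unfolding q_def
    by (rule derivative_eq_intros dxyz_t s z0 t refl)+
      (use z0[OF s t] in \<open>simp add: divide_simps, simp add: algebra_simps power2_eq_square\<close>)
  moreover have "y s t * (n s \<bullet> dV t) - z s t * (p s \<bullet> dV t) = - j s * ((y s t)\<^sup>2 + (z s t)\<^sup>2)\<^sup>2 / z s t"
    using chebyshev[OF s t] by (simp add: y_def z_def)
  ultimately show ?thesis using z0[OF s t]
    by (simp add: q_def W_def divide_simps) (simp add: algebra_simps power2_eq_square)
qed

text \<open>The t-derivative of \<open>g\<close> by the quotient rule. It contains
  \<open>u s \<bullet> dV t\<close>, about which the hypotheses say nothing directly;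
  \<open>gt_eq\<close> determines it from an integrability condition.\<close>

definition gt where "gt s t = ((u s \<bullet> dV t * z s t + (n s \<bullet> dV t) * x s t) * ((y s t)\<^sup>2 + (z s t)\<^sup>2)
    - x s t * z s t * (2 * y s t * (p s \<bullet> dV t) + 2 * z s t * (n s \<bullet> dV t))) / ((y s t)\<^sup>2 + (z s t)\<^sup>2)\<^sup>2"

lemma dg_t_raw:
  assumes s: "s \<in> I" and t: "t \<in> J"
  shows "((\<lambda>t. g s t) has_real_derivative gt s t) (at t)"
  unfolding g_def gt_def
  by (rule derivative_eq_intros dxyz_t s rho0 t refl)+
    (use rho0[OF s t] in \<open>simp add: divide_simps, simp add: algebra_simps power2_eq_square\<close>)

lemma dj: "s \<in> I \<Longrightarrow> (j has_real_derivative deriv j s) (at s)"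
  "s \<in> I \<Longrightarrow> (k has_real_derivative deriv k s) (at s)" "s \<in> I \<Longrightarrow> (l has_real_derivative deriv l s) (at s)"
  and cont: "continuous_on I u" "continuous_on I p" "continuous_on I n" "continuous_on I lam" "continuous_on I k"
    "continuous_on I j" "continuous_on I (deriv j)" "continuous_on I l" "continuous_on I (deriv l)" "continuous_on I (deriv k)"
    "continuous_on J V" "continuous_on J (\<lambda>t. dV t)"
proof -
  have d: "(f has_real_derivative deriv f s) (at s)" if "smooth_on I f" "s \<in> I" for f s
    using smooth_on_differentiable[OF that] DERIV_deriv_iff_real_differentiable by blast
  have smd: "smooth_on I (deriv f)" if "smooth_on I f" for f
    by (rule smooth_on_cong[OF I smooth_on_vector_derivative[OF I that]])
      (metis d[OF that] has_real_derivative_iff_has_vector_derivative vector_derivative_at)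
  have sml: "smooth_on I l"
    unfolding l_def[abs_def] using lam j
    by (intro smooth_on_divide smooth_on_minus smooth_on_mult smd sm I) auto
  show "s \<in> I \<Longrightarrow> (j has_real_derivative deriv j s) (at s)"
    "s \<in> I \<Longrightarrow> (k has_real_derivative deriv k s) (at s)" "s \<in> I \<Longrightarrow> (l has_real_derivative deriv l s) (at s)"
    using d sm sml by blast+
  show "continuous_on I u" "continuous_on I p" "continuous_on I n" "continuous_on I lam" "continuous_on I k"
    "continuous_on I j" "continuous_on I (deriv j)" "continuous_on I l" "continuous_on I (deriv l)" "continuous_on I (deriv k)"
    "continuous_on J V" "continuous_on J (\<lambda>t. dV t)"
    using sm smV sml by (auto intro!: smooth_on_continuous smd smooth_on_vector_derivative J)
qed

lemma joint_continuity:
  assumes s: "s \<in> I" and t: "t \<in> J"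
  shows "isCont (\<lambda>p. x (fst p) (snd p)) (s, t)" "isCont (\<lambda>p. y (fst p) (snd p)) (s, t)" "isCont (\<lambda>p. z (fst p) (snd p)) (s, t)"
    "isCont (\<lambda>p. q (fst p) (snd p)) (s, t)" "isCont (\<lambda>p. g (fst p) (snd p)) (s, t)" "isCont (\<lambda>p. W (fst p) (snd p)) (s, t)"
    "isCont (\<lambda>p. gt (fst p) (snd p)) (s, t)"
proof -
  note c = isCont_fst_snd(1)[OF I _ s, of _ t] isCont_fst_snd(2)[OF J _ t, of _ s]
  show xyz: "isCont (\<lambda>p. x (fst p) (snd p)) (s, t)" "isCont (\<lambda>p. y (fst p) (snd p)) (s, t)" "isCont (\<lambda>p. z (fst p) (snd p)) (s, t)"
    unfolding x_def y_def z_def by (intro continuous_inner c cont)+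
  show "isCont (\<lambda>p. q (fst p) (snd p)) (s, t)" "isCont (\<lambda>p. g (fst p) (snd p)) (s, t)" "isCont (\<lambda>p. W (fst p) (snd p)) (s, t)"
    unfolding q_def g_def W_def using z0[OF s t] rho0[OF s t]
    by (auto intro!: continuous_intros xyz)
  show "isCont (\<lambda>p. gt (fst p) (snd p)) (s, t)"
    unfolding gt_def using rho0[OF s t]
    by (auto intro!: continuous_intros xyz continuous_inner c cont)
qed

lemma box:
  assumes "s0 \<in> I" "t0 \<in> J"
  obtains e where "e > 0" "\<And>s. \<bar>s - s0\<bar> < e \<Longrightarrow> s \<in> I" "\<And>t. \<bar>t - t0\<bar> < e \<Longrightarrow> t \<in> J"
proof -
  obtain a b where "a > 0" "ball s0 a \<subseteq> I" "b > 0" "ball t0 b \<subseteq> J" using assms I J openE by metis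
  then show ?thesis by (intro that[of "min a b"]) (auto simp: dist_real_def subset_iff abs_minus_commute)
qed

text \<open>Equality of the mixed derivatives of \<open>q\<close>. Of its two first derivatives only
  the one in s, once differentiated in t, brings in \<open>gt\<close>, and it does so linearly with
  the nonzero coefficient \<open>lam s * (1 + (q s t)\<^sup>2)\<close>.\<close>

lemma gt_eq:
  assumes s: "s \<in> I" and t: "t \<in> J"
  shows "gt s t = j s * W s t * (l s - q s t * (2 * g s t - k s))"
proof -
  obtain e where e: "e > 0" "\<And>s'. \<bar>s' - s\<bar> < e \<Longrightarrow> s' \<in> I" "\<And>t'. \<bar>t' - t\<bar> < e \<Longrightarrow> t' \<in> J" by (rule box[OF s t]) blast
  define F12 where "F12 = (\<lambda>s t. - lam s * (2 * q s t * (- (1 + (q s t)\<^sup>2) * j s * W s t) * (k s - g s t) - (1 + (q s t)\<^sup>2) * gt s t))"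
  define F21 where "F21 = (\<lambda>s t. - (2 * q s t * (- lam s * (1 + (q s t)\<^sup>2) * (k s - g s t)) * (j s * W s t)
      + (1 + (q s t)\<^sup>2) * (deriv j s * W s t + j s * (lam s * W s t * q s t * (2 * g s t - k s)))))"
  note c = isCont_fst_snd(1)[OF I _ s, of _ t] isCont_fst_snd(2)[OF J _ t, of _ s]
  have "F12 s t = F21 s t"
  proof (rule mixed_partials_eq[OF e(1), of s t q "\<lambda>s t. - lam s * (1 + (q s t)\<^sup>2) * (k s - g s t)" "\<lambda>s t. - (1 + (q s t)\<^sup>2) * j s * W s t"])
    fix s' t' assume *: "\<bar>s' - s\<bar> < e" "\<bar>t' - t\<bar> < e"
    note m = e(2)[OF *(1)] e(3)[OF *(2)]
    show "((\<lambda>s. q s t') has_real_derivative - lam s' * (1 + (q s' t')\<^sup>2) * (k s' - g s' t')) (at s')" by (rule dq_s[OF m])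
    show "((\<lambda>t. q s' t) has_real_derivative - (1 + (q s' t')\<^sup>2) * j s' * W s' t') (at t')" by (rule dq_t[OF m])
    show "((\<lambda>t. - lam s' * (1 + (q s' t)\<^sup>2) * (k s' - g s' t)) has_real_derivative F12 s' t') (at t')"
      unfolding F12_def by (rule derivative_eq_intros dq_t[OF m] dg_t_raw[OF m] refl)+ (simp add: algebra_simps)
    show "((\<lambda>s. - (1 + (q s t')\<^sup>2) * j s * W s t') has_real_derivative F21 s' t') (at s')"
      unfolding F21_def by (rule derivative_eq_intros dq_s[OF m] dW_s[OF m] dj(1)[OF m(1)] refl)+ (simp add: algebra_simps)
  next
    show "isCont (\<lambda>(s, t). F12 s t) (s, t)" "isCont (\<lambda>(s, t). F21 s t) (s, t)"
      unfolding F12_def F21_def case_prod_unfold by (intro continuous_intros joint_continuity[OF s t] c cont)+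
  qed
  then have "lam s * (1 + (q s t)\<^sup>2) * gt s t = - (1 + (q s t)\<^sup>2) * (deriv j s * W s t + j s * lam s * W s t * q s t * (2 * g s t - k s))"
    unfolding F12_def F21_def by (simp add: algebra_simps)
  moreover have "1 + (q s t)\<^sup>2 \<noteq> 0" by (metis add_pos_nonneg less_irrefl zero_le_power2 zero_less_one)
  moreover from calculation have "(1 + (q s t)\<^sup>2) * (lam s * gt s t)
      = (1 + (q s t)\<^sup>2) * (- (deriv j s * W s t + j s * lam s * W s t * q s t * (2 * g s t - k s)))"
    by (simp add: algebra_simps)
  ultimately have "lam s * gt s t = - (deriv j s * W s t + j s * lam s * W s t * q s t * (2 * g s t - k s))"
    using mult_cancel_left by blast
  moreover have "deriv j s = - l s * lam s * j s" using lam[OF s] j[OF s] by (simp add: l_def)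
  ultimately have "lam s * gt s t = lam s * (j s * W s t * (l s - q s t * (2 * g s t - k s)))"
    by (simp add: algebra_simps)
  then show ?thesis using lam[OF s] by simp
qed

lemma dg_t:
  assumes s: "s \<in> I" and t: "t \<in> J"
  shows "((\<lambda>t. g s t) has_real_derivative j s * W s t * (l s - q s t * (2 * g s t - k s))) (at t)"
  using dg_t_raw[OF s t] unfolding gt_eq[OF s t] .

text \<open>Equality of the mixed derivatives of \<open>g\<close>. All first derivatives are now
  known in terms of \<open>q\<close>, \<open>g\<close> and \<open>W\<close>, and the factor
  \<open>lam s * j s * W s t\<close> cancels, so an algebraic relation between \<open>q\<close> and
  \<open>Y\<close> with coefficients depending on s alone remains. The shift by
  \<open>k s / 2\<close> is natural because \<open>dg_t\<close> and \<open>dW_s\<close> contain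
  \<open>g\<close> in the form \<open>2 * g s t - k s\<close>.\<close>

lemma compatibility:
  assumes s: "s \<in> I" and t: "t \<in> J"
  defines "Y \<equiv> g s t - k s / 2"
  shows "4 * (1 + 3 * (q s t)\<^sup>2) * Y\<^sup>2 - 8 * l s * q s t * Y + ((l s)\<^sup>2 - 3 - deriv l s / lam s) + 4 / (1 + (q s t)\<^sup>2)
    - (deriv k s / lam s + l s * k s) * q s t = 0"
proof -
  obtain e where e: "e > 0" "\<And>s'. \<bar>s' - s\<bar> < e \<Longrightarrow> s' \<in> I" "\<And>t'. \<bar>t' - t\<bar> < e \<Longrightarrow> t' \<in> J" by (rule box[OF s t]) blast
  have q1: "1 + (q s t)\<^sup>2 \<noteq> 0" for s t by (metis add_pos_nonneg less_irrefl zero_le_power2 zero_less_one)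
  define qt where "qt = (\<lambda>s t. - (1 + (q s t)\<^sup>2) * j s * W s t)"
  define gT where "gT = (\<lambda>s t. j s * W s t * (l s - q s t * (2 * g s t - k s)))"
  define qs where "qs = (\<lambda>s t. - lam s * (1 + (q s t)\<^sup>2) * (k s - g s t))"
  define gs where "gs = (\<lambda>s t. lam s * (- q s t / (1 + (q s t)\<^sup>2) + q s t * g s t * (k s - 2 * g s t)))"
  define F12 where "F12 = (\<lambda>s t. lam s * (- (qt s t * (1 - (q s t)\<^sup>2)) / (1 + (q s t)\<^sup>2)\<^sup>2 + qt s t * g s t * (k s - 2 * g s t)
      + q s t * gT s t * (k s - 4 * g s t)))"
  define F21 where "F21 = (\<lambda>s t. (deriv j s * W s t + j s * (lam s * W s t * q s t * (2 * g s t - k s))) * (l s - q s t * (2 * g s t - k s))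
      + j s * W s t * (deriv l s - qs s t * (2 * g s t - k s) - q s t * (2 * gs s t - deriv k s)))"
  note c = isCont_fst_snd(1)[OF I _ s, of _ t] isCont_fst_snd(2)[OF J _ t, of _ s]
  have "F12 s t = F21 s t"
  proof (rule mixed_partials_eq[OF e(1), of s t g gs gT])
    fix s' t' assume *: "\<bar>s' - s\<bar> < e" "\<bar>t' - t\<bar> < e"
    note m = e(2)[OF *(1)] e(3)[OF *(2)]
    show dgs: "((\<lambda>s. g s t') has_real_derivative gs s' t') (at s')" unfolding gs_def by (rule dg_s[OF m])
    show dgT: "((\<lambda>t. g s' t) has_real_derivative gT s' t') (at t')" unfolding gT_def by (rule dg_t[OF m])
    have dqs: "((\<lambda>s. q s t') has_real_derivative qs s' t') (at s')" unfolding qs_def by (rule dq_s[OF m])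
    have dqt: "((\<lambda>t. q s' t) has_real_derivative qt s' t') (at t')" unfolding qt_def by (rule dq_t[OF m])
    show "((\<lambda>t. gs s' t) has_real_derivative F12 s' t') (at t')"
      unfolding gs_def
      by (rule derivative_eq_intros dqt dgT refl q1)+
        (use q1[of s' t'] in \<open>simp add: F12_def divide_simps, simp add: algebra_simps power2_eq_square\<close>)
    show "((\<lambda>s. gT s t') has_real_derivative F21 s' t') (at s')"
      unfolding gT_def F21_def
      by (rule derivative_eq_intros dqs dgs dW_s[OF m] dj[OF m(1)] refl)+
        (simp add: algebra_simps)
  next
    show "isCont (\<lambda>(s, t). F12 s t) (s, t)"
      unfolding F12_def qt_def gT_def case_prod_unfold using q1[of s t]
      by (auto intro!: continuous_intros joint_continuity[OF s t] c cont)
    show "isCont (\<lambda>(s, t). F21 s t) (s, t)"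
      unfolding F21_def qs_def gs_def case_prod_unfold using q1[of s t]
      by (auto intro!: continuous_intros joint_continuity[OF s t] c cont)
  qed
  define L K where "L = deriv l s / lam s" and "K = deriv k s / lam s"
  have LK: "deriv l s = lam s * L" "deriv k s = lam s * K" "deriv j s = - l s * lam s * j s"
    using lam[OF s] j[OF s] by (simp_all add: L_def K_def l_def)
  \<comment> \<open>This is the squared sine of \<psi>. As a separate unknown subject to one
    polynomial relation it keeps the final identity within reach of polynomial algebra.\<close>
  define h where "h = 1 / (1 + (q s t)\<^sup>2)"
  have h: "h * (1 + (q s t)\<^sup>2) = 1" using q1[of s t] by (simp add: h_def)
  define E where "E = 4 * (1 + 3 * (q s t)\<^sup>2) * Y\<^sup>2 - 8 * l s * q s t * Y + ((l s)\<^sup>2 - 3 - L) + 4 * h - (K + l s * k s) * q s t"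
  have g: "g s t = Y + k s / 2" by (simp add: Y_def)
  define Q where "Q = q s t"
  have 1: "F12 s t = (lam s * j s * W s t) * ((1 - Q\<^sup>2) * h - (1 + Q\<^sup>2) * g s t * (k s - 2 * g s t)
      + Q * (l s - Q * (2 * g s t - k s)) * (k s - 4 * g s t))"
    unfolding F12_def qt_def gT_def Q_def[symmetric] h_def using q1[of s t, folded Q_def]
    by (simp add: divide_simps) (simp add: algebra_simps power2_eq_square)
  have 2: "F21 s t = (lam s * j s * W s t) * ((Q * (2 * g s t - k s) - l s) * (l s - Q * (2 * g s t - k s))
      + (L + (1 + Q\<^sup>2) * (k s - g s t) * (2 * g s t - k s) - Q * (2 * (- Q * h + Q * g s t * (k s - 2 * g s t)) - K)))"
    unfolding F21_def qs_def gs_def LK Q_def[symmetric] h_def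
    by (simp add: algebra_simps)
  have nz: "lam s * j s * W s t \<noteq> 0" using lam[OF s] j[OF s] W0[OF s t] by simp
  have "(1 - Q\<^sup>2) * h - (1 + Q\<^sup>2) * g s t * (k s - 2 * g s t) + Q * (l s - Q * (2 * g s t - k s)) * (k s - 4 * g s t)
      = (Q * (2 * g s t - k s) - l s) * (l s - Q * (2 * g s t - k s))
      + (L + (1 + Q\<^sup>2) * (k s - g s t) * (2 * g s t - k s) - Q * (2 * (- Q * h + Q * g s t * (k s - 2 * g s t)) - K))"
    using \<open>F12 s t = F21 s t\<close> nz unfolding 1 2 by simp
  moreover obtain c where c: "k s = 2 * c" by (metis field_sum_of_halves mult_2)
  moreover have "g s t = Y + c" using g c by simp
  ultimately have "E = 0"
    using h unfolding E_def Q_def[symmetric] by algebra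
  then show ?thesis unfolding E_def h_def L_def K_def by simp
qed

text \<open>For fixed \<open>s\<close> the quantity \<open>Y sin\<^sup>2 \<psi> - l / 2 (\<psi> - sin \<psi> cos \<psi>)\<close> is constant along \<open>V\<close>, which turns
  \<open>compatibility\<close> into a polynomial identity in \<open>\<psi>\<close>, \<open>sin \<psi>\<close> and \<open>cos \<psi>\<close> on an interval, hence everywhere.\<close>

lemma trigonometric_identity:
  assumes s: "s \<in> I" and t0: "t0 \<in> J"
  obtains C \<alpha> \<beta> where "\<alpha> < \<beta>" "\<And>\<psi>. \<alpha> \<le> \<psi> \<Longrightarrow> \<psi> \<le> \<beta> \<Longrightarrow>
    4 * (1 + 2 * (cos \<psi>)^2) * (l s / 2 * (\<psi> - sin \<psi> * cos \<psi>) + C)^2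
    - 8 * l s * cos \<psi> * (sin \<psi>)^3 * (l s / 2 * (\<psi> - sin \<psi> * cos \<psi>) + C)
    + ((l s)\<^sup>2 - 3 - deriv l s / lam s) * (sin \<psi>)^6 + 4 * (sin \<psi>)^8
    - (deriv k s / lam s + l s * k s) * cos \<psi> * (sin \<psi>)^5 = 0"
proof -
  obtain e where e: "e > 0" "\<And>t. \<bar>t - t0\<bar> < e \<Longrightarrow> t \<in> J" by (rule box[OF s t0]) blast
  define Y where "Y = (\<lambda>t. g s t - k s / 2)"
  \<comment> \<open>The branch of the inverse cotangent with values between 0 and pi, where the sine
    is positive.\<close>
  define \<psi> where "\<psi> = (\<lambda>t. pi / 2 - arctan (q s t))"
  have q1: "1 + (q s t)\<^sup>2 \<noteq> 0" for t by (metis add_pos_nonneg less_irrefl zero_le_power2 zero_less_one)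
  have sin_pos: "sin (\<psi> t) > 0" for t
    unfolding \<psi>_def using arctan_bounded[of "q s t"] by (intro sin_gt_zero) auto
  have cos_eq: "cos (\<psi> t) = q s t * sin (\<psi> t)" for t
    using tan_arctan[of "q s t"] cos_arctan_not_zero[of "q s t"] unfolding \<psi>_def sin_diff cos_diff
    by (simp add: tan_def field_simps)
  have sin2: "(1 + (q s t)\<^sup>2) * (sin (\<psi> t))\<^sup>2 = 1" for t
    using sin_cos_squared_add[of "\<psi> t"] unfolding cos_eq by (simp add: algebra_simps power_mult_distrib)
  have d\<psi>: "(\<psi> has_real_derivative j s * W s t) (at t)" if "t \<in> J" for t
    unfolding \<psi>_def
    by (rule derivative_eq_intros dq_t[OF s that] refl)+ (use q1[of t] in \<open>simp add: divide_simps, simp add: algebra_simps\<close>)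
  have dY: "(Y has_real_derivative j s * W s t * (l s - 2 * q s t * Y t)) (at t)" if "t \<in> J" for t
    unfolding Y_def by (rule derivative_eq_intros dg_t[OF s that] refl)+ (simp add: algebra_simps)
  \<comment> \<open>Dividing \<open>dY\<close> by \<open>d\<psi>\<close> gives the linear equation
    dY/d\<psi> = l - 2 Y cot \<psi>. Its integrating factor is the squared sine of \<psi>, whose
    antiderivative is half of \<psi> - sin \<psi> cos \<psi>.\<close>
  define P where "P = (\<lambda>t. Y t * (sin (\<psi> t))^2 - l s / 2 * (\<psi> t - sin (\<psi> t) * cos (\<psi> t)))"
  have dP: "(P has_real_derivative 0) (at t)" if "t \<in> J" for t
  proof -
    have A: "(P has_real_derivative (j s * W s t * (l s - 2 * q s t * Y t)) * (sin (\<psi> t))^2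
        + Y t * (2 * sin (\<psi> t) * (cos (\<psi> t) * (j s * W s t)))
        - l s / 2 * (j s * W s t - (cos (\<psi> t) * (j s * W s t) * cos (\<psi> t) - sin (\<psi> t) * (sin (\<psi> t) * (j s * W s t))))) (at t)"
      unfolding P_def by (rule derivative_eq_intros d\<psi>[OF that] dY[OF that] refl)+ simp
    have B: "j s * W s t - (cos (\<psi> t) * (j s * W s t) * cos (\<psi> t) - sin (\<psi> t) * (sin (\<psi> t) * (j s * W s t)))
       = j s * W s t * (2 * (sin (\<psi> t))^2)"
      using sin_cos_squared_add[of "\<psi> t"] by algebra
    show ?thesis using A unfolding B unfolding cos_eq by (simp add: algebra_simps power2_eq_square)
  qed
  define C where "C = P t0"
  have PC: "P t = C" if "\<bar>t - t0\<bar> < e" for t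
  proof -
    have "P constant_on ball t0 e"
      using dP e by (intro has_field_derivative_0_imp_constant_on) (auto simp: dist_real_def abs_minus_commute)
    then show ?thesis unfolding constant_on_def C_def
      using that e(1) by (metis abs_minus_commute centre_in_ball dist_real_def mem_ball)
  qed
  \<comment> \<open>The derivative \<open>j s * W s t\<close> of \<psi> never vanishes, so \<psi>
    takes all values of a nondegenerate interval.\<close>
  obtain t1 where t1: "t0 < t1" "t1 < t0 + e" "\<psi> t1 \<noteq> \<psi> t0"
  proof -
    have "\<exists>z>t0. z < t0 + e/2 \<and> \<psi> (t0 + e/2) - \<psi> t0 = (t0 + e/2 - t0) * (j s * W s z)"
      using e d\<psi> by (intro MVT2) auto
    then obtain z where "t0 < z" "z < t0 + e/2" "\<psi> (t0 + e/2) - \<psi> t0 = e/2 * (j s * W s z)" by auto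
    moreover have "j s * W s z \<noteq> 0" using calculation e j[OF s] W0[OF s] by auto
    ultimately show ?thesis using e(1) by (intro that[of "t0 + e/2"]) auto
  qed
  have cont\<psi>: "continuous_on {t0..t1} \<psi>"
    using d\<psi> e t1 by (intro DERIV_continuous_on[of _ _ "\<lambda>t. j s * W s t"]) (auto intro: has_field_derivative_at_within)
  define \<alpha> \<beta> where "\<alpha> = min (\<psi> t0) (\<psi> t1)" and "\<beta> = max (\<psi> t0) (\<psi> t1)"
  show ?thesis
  proof
    show "\<alpha> < \<beta>" using t1 by (auto simp: \<alpha>_def \<beta>_def)
    fix x assume x: "\<alpha> \<le> x" "x \<le> \<beta>"
    have "\<exists>t\<in>{t0..t1}. \<psi> t = x"
    proof (cases "\<psi> t0 \<le> \<psi> t1")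
      case True
      then show ?thesis using IVT'[of \<psi> t0 x t1] x t1 cont\<psi> by (auto simp: \<alpha>_def \<beta>_def)
    next
      case False
      then show ?thesis using IVT2'[of \<psi> t1 x t0] x t1 cont\<psi> by (auto simp: \<alpha>_def \<beta>_def)
    qed
    then obtain t where t: "t0 \<le> t" "t \<le> t1" "\<psi> t = x" by auto
    have tJ: "t \<in> J" "\<bar>t - t0\<bar> < e" using t t1 e by auto
    define S where "S = sin (\<psi> t)"
    define Q where "Q = q s t"
    have S: "(1 + Q\<^sup>2) * S\<^sup>2 = 1" using sin2 by (simp add: S_def Q_def)
    have "4 / (1 + Q\<^sup>2) = 4 * S\<^sup>2" using q1[of t] S by (simp add: divide_simps Q_def algebra_simps)
    with compatibility[OF s tJ(1)] have E: "4 * (1 + 3 * Q\<^sup>2) * (Y t)\<^sup>2 - 8 * l s * Q * Y t + ((l s)\<^sup>2 - 3 - deriv l s / lam s) + 4 * S\<^sup>2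
      - (deriv k s / lam s + l s * k s) * Q = 0" unfolding Y_def Q_def by simp
    have P: "l s / 2 * (x - sin x * cos x) + C = Y t * S\<^sup>2" using PC[OF tJ(2)] t(3) unfolding P_def S_def by simp
    have c: "cos x = Q * S" "sin x = S" using cos_eq[of t] t(3) by (simp_all add: Q_def S_def)
    define B D where "B = (l s)\<^sup>2 - 3 - deriv l s / lam s" and "D = deriv k s / lam s + l s * k s"
    have 1: "(1 + 2 * (Q * S)\<^sup>2) = S\<^sup>2 * (1 + 3 * Q\<^sup>2)" using S by algebra
    \<comment> \<open>\<open>compatibility\<close> times the sixth power of the sine: this clears
      \<open>Q\<close> = cot \<psi> and turns every \<open>Y t\<close> into
      \<open>Y t * S\<^sup>2\<close>, which the first integral expresses by \<psi>.\<close>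
    have "4 * (1 + 2 * (Q * S)\<^sup>2) * (Y t * S\<^sup>2)\<^sup>2 - 8 * l s * (Q * S) * S ^ 3 * (Y t * S\<^sup>2) + B * S ^ 6 + 4 * S ^ 8 - D * (Q * S) * S ^ 5
       = S^6 * (4 * (1 + 3 * Q\<^sup>2) * (Y t)\<^sup>2 - 8 * l s * Q * Y t + B + 4 * S\<^sup>2 - D * Q)"
      unfolding 1 by algebra
    then show "4 * (1 + 2 * (cos x)^2) * (l s / 2 * (x - sin x * cos x) + C)^2
      - 8 * l s * cos x * (sin x)^3 * (l s / 2 * (x - sin x * cos x) + C)
      + ((l s)\<^sup>2 - 3 - deriv l s / lam s) * (sin x)^6 + 4 * (sin x)^8
      - (deriv k s / lam s + l s * k s) * cos x * (sin x)^5 = 0"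
      unfolding P unfolding c B_def[symmetric] D_def[symmetric] using E[folded B_def D_def] by simp
  qed
qed

end

text \<open>The left side is the restriction of an entire function, so it vanishes on the whole real
  line. At 0 only 12 C^2 remains, so C = 0; at pi the value is 12 (l pi / 2)^2, so l = 0; at pi/2 it
  follows that B = -4; but the values at pi/4 and -pi/4 add up to B/4 + 1/2, which forces B =
  -2.\<close>

lemma trigonometric_identity_impossible:
  fixes l B C D \<alpha> \<beta> :: real
  assumes "\<alpha> < \<beta>" and eq: "\<And>\<psi>. \<alpha> \<le> \<psi> \<Longrightarrow> \<psi> \<le> \<beta> \<Longrightarrow>
    4 * (1 + 2 * (cos \<psi>)^2) * (l / 2 * (\<psi> - sin \<psi> * cos \<psi>) + C)^2
    - 8 * l * cos \<psi> * (sin \<psi>)^3 * (l / 2 * (\<psi> - sin \<psi> * cos \<psi>) + C)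
    + B * (sin \<psi>)^6 + 4 * (sin \<psi>)^8 - D * cos \<psi> * (sin \<psi>)^5 = 0"
  shows False
proof -
  define H where "H = (\<lambda>\<psi>::real. 4 * (1 + 2 * (cos \<psi>)^2) * (l / 2 * (\<psi> - sin \<psi> * cos \<psi>) + C)^2
    - 8 * l * cos \<psi> * (sin \<psi>)^3 * (l / 2 * (\<psi> - sin \<psi> * cos \<psi>) + C)
    + B * (sin \<psi>)^6 + 4 * (sin \<psi>)^8 - D * cos \<psi> * (sin \<psi>)^5)"
  define Hc where "Hc = (\<lambda>\<psi>::complex. 4 * (1 + 2 * (cos \<psi>)^2) * (of_real l / 2 * (\<psi> - sin \<psi> * cos \<psi>) + of_real C)^2
    - 8 * of_real l * cos \<psi> * (sin \<psi>)^3 * (of_real l / 2 * (\<psi> - sin \<psi> * cos \<psi>) + of_real C)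
    + of_real B * (sin \<psi>)^6 + 4 * (sin \<psi>)^8 - of_real D * cos \<psi> * (sin \<psi>)^5)"
  have Hc: "Hc (of_real x) = of_real (H x)" for x
    unfolding Hc_def H_def by (simp add: sin_of_real cos_of_real)
  have "Hc w = 0" for w
  proof (rule analytic_continuation[of Hc UNIV "complex_of_real ` {\<alpha>..\<beta>}" "of_real \<alpha>"])
    show "Hc holomorphic_on UNIV" unfolding Hc_def by (intro holomorphic_intros) auto
    show "complex_of_real \<alpha> islimpt complex_of_real ` {\<alpha>..\<beta>}"
      unfolding islimpt_approachable
    proof (intro allI impI)
      fix e :: real assume "e > 0"
      define d where "d = min (e / 2) (\<beta> - \<alpha>)"
      have d: "d > 0" "d < e" "d \<le> \<beta> - \<alpha>" using \<open>e > 0\<close> assms(1) by (auto simp: d_def)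
      have "dist (complex_of_real (\<alpha> + d)) (of_real \<alpha>) < e" using d by (simp add: dist_norm)
      then show "\<exists>x'\<in>complex_of_real ` {\<alpha>..\<beta>}. x' \<noteq> complex_of_real \<alpha> \<and> dist x' (complex_of_real \<alpha>) < e"
        using d by (intro bexI[of _ "of_real (\<alpha> + d)"] imageI) auto
    qed
    show "Hc z = 0" if z: "z \<in> complex_of_real ` {\<alpha>..\<beta>}" for z
    proof -
      obtain x where x: "z = of_real x" "\<alpha> \<le> x" "x \<le> \<beta>" using z by auto
      have "H x = 0" unfolding H_def by (rule eq[OF x(2,3)])
      then show ?thesis unfolding x(1) Hc by simp
    qed
  qed auto
  then have H0: "H x = 0" for x using Hc[of x] by simp
  have C: "C = 0" using H0[of 0] by (simp add: H_def)
  have l: "l = 0" using H0[of pi] by (simp add: H_def C)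
  have "B = - 4" using H0[of "pi/2"] by (simp add: H_def C l)
  moreover have s: "sin (pi/4) ^ 2 = 1/2" "cos (pi/4) * sin (pi/4) = 1/2" by (simp_all add: sin_45 cos_45 power_divide)
  have e: "sin (pi/4) ^ 6 = 1/8" "sin (pi/4) ^ 8 = 1/16" "cos (pi/4) * sin (pi/4) ^ 5 = 1/8"
  proof -
    have "sin (pi/4) ^ 6 = (sin (pi/4) ^ 2) ^ 3" "sin (pi/4) ^ 8 = (sin (pi/4) ^ 2) ^ 4"
      "cos (pi/4) * sin (pi/4) ^ 5 = (cos (pi/4) * sin (pi/4)) * (sin (pi/4) ^ 2) ^ 2" by algebra+
    then show "sin (pi/4) ^ 6 = 1/8" "sin (pi/4) ^ 8 = 1/16" "cos (pi/4) * sin (pi/4) ^ 5 = 1/8"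
      unfolding s by (simp_all add: power_divide)
  qed
  have "B / 8 + 1 / 4 - D / 8 = 0" using H0[of "pi/4"] unfolding H_def C l mult.assoc[of D] e by simp
  moreover have "B / 8 + 1 / 4 + D / 8 = 0"
    using H0[of "- (pi/4)"] unfolding H_def C l mult.assoc[of D] sin_minus cos_minus power_minus_odd
    by (simp add: e)
  ultimately show False by simp
qed

text \<open>Reduction to \<open>spherical_frame\<close>: \<open>u\<close> is the direction of
  \<open>U\<close>, \<open>p\<close> its unit tangent and \<open>n\<close> = \<open>u\<close> x
  \<open>p\<close>. Since \<open>K\<close> is nonzero and the cross product never vanishes, neither
  factor on the right side can vanish; this makes the frame exist (\<open>du0\<close>) and gives the
  condition \<open>nz\<close> of the locale.\<close>

lemma curvature_equation_impossible:
  fixes U V :: "real \<Rightarrow> real^3"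
  assumes I: "open I" "s0 \<in> I" and J: "open J" "t0 \<in> J" and U: "smooth_on I U" and V: "smooth_on J V"
    and c0: "\<And>s t. s \<in> I \<Longrightarrow> t \<in> J \<Longrightarrow> cross3 (U s) (V t) \<noteq> 0" and K: "K \<noteq> 0"
    and eq: "\<And>s t. s \<in> I \<Longrightarrow> t \<in> J \<Longrightarrow> K * (cross3 (U s) (V t) \<bullet> cross3 (U s) (V t))\<^sup>2
      = (vector_derivative U (at s) \<bullet> cross3 (U s) (V t)) * (vector_derivative V (at t) \<bullet> cross3 (U s) (V t))"
  shows False
proof -
  define m where "m s = norm (U s)" for s
  define u where "u s = (1 / m s) *\<^sub>R U s" for s
  define du where "du s = vector_derivative u (at s)" for s
  define lam where "lam s = norm (du s)" for s
  define p where "p s = (1 / lam s) *\<^sub>R du s" for s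
  define n where "n s = cross3 (u s) (p s)" for s
  define dp where "dp s = vector_derivative p (at s)" for s
  define k where "k s = (dp s \<bullet> n s) / lam s" for s
  define j where "j s = K * m s / lam s" for s
  have m0: "m s > 0" if "s \<in> I" for s using c0[OF that J(2)] by (auto simp: m_def)
  have sm_m: "smooth_on I m" using m0 unfolding m_def[abs_def]
    by (intro smooth_on_norm I U) (auto simp: m_def)
  have sm_u: "smooth_on I u" using m0 unfolding u_def[abs_def]
    by (intro smooth_on_scaleR smooth_on_divide smooth_on_const sm_m U I) force+
  have dm: "(m has_real_derivative deriv m s) (at s)" if "s \<in> I" for s
    using smooth_on_differentiable[OF sm_m that] DERIV_deriv_iff_real_differentiable by blast
  have du: "(u has_vector_derivative du s) (at s)" if "s \<in> I" for s
    using smooth_on_has_vector_derivative[OF sm_u that] by (simp add: du_def)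
  have Um: "U s = m s *\<^sub>R u s" if "s \<in> I" for s using m0[OF that] by (simp add: u_def)
  have uu: "u s \<bullet> u s = 1" if "s \<in> I" for s
    using m0[OF that] by (simp add: u_def m_def power2_norm_eq_inner[symmetric] power2_eq_square)
  have udu: "u s \<bullet> du s = 0" if "s \<in> I" for s
  proof -
    have "((\<lambda>s. u s \<bullet> u s) has_vector_derivative (u s \<bullet> du s + du s \<bullet> u s)) (at s)"
      using bounded_bilinear.has_vector_derivative[OF bounded_bilinear_inner du[OF that] du[OF that]] .
    from deriv_locally_constant[OF I(1) that this uu] show ?thesis by (simp add: inner_commute)
  qed
  have dU: "vector_derivative U (at s) = m s *\<^sub>R du s + deriv m s *\<^sub>R u s" if "s \<in> I" for s
  proof -
    have "((\<lambda>s. m s *\<^sub>R u s) has_vector_derivative m s *\<^sub>R du s + deriv m s *\<^sub>R u s) (at s)"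
      using has_vector_derivative_scaleR[OF dm[OF that] du[OF that]] .
    then have "(U has_vector_derivative m s *\<^sub>R du s + deriv m s *\<^sub>R u s) (at s)"
      by (rule has_vector_derivative_transform_within_open[OF _ I(1) that]) (simp add: Um)
    then show ?thesis by (rule vector_derivative_at)
  qed
  have eq': "K * ((m s)\<^sup>2 * (cross3 (u s) (V t) \<bullet> cross3 (u s) (V t)))\<^sup>2
      = ((m s)\<^sup>2 * (du s \<bullet> cross3 (u s) (V t))) * (m s * (vector_derivative V (at t) \<bullet> cross3 (u s) (V t)))"
    if "s \<in> I" "t \<in> J" for s t
    using eq[OF that] unfolding dU[OF that(1)] unfolding Um[OF that(1)] cross_mult_left
    by (simp add: inner_add_left dot_cross_self power2_eq_square mult_ac)
  \<comment> \<open>A stationary direction would make the right side of \<open>eq'\<close>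
    zero.\<close>
  have du0: "du s \<noteq> 0" if "s \<in> I" for s
  proof
    assume "du s = 0"
    then have "cross3 (U s) (V t0) = 0" using eq'[OF that J(2)] K m0[OF that] Um[OF that]
      by (simp add: cross_mult_left)
    then show False using c0 that J by blast
  qed
  have lam0: "lam s > 0" if "s \<in> I" for s using du0[OF that] by (simp add: lam_def)
  have sm_du: "smooth_on I du" unfolding du_def[abs_def] by (rule smooth_on_vector_derivative[OF I(1) sm_u])
  have sm_lam: "smooth_on I lam" unfolding lam_def[abs_def] by (rule smooth_on_norm[OF I(1) sm_du du0])
  have sm_p: "smooth_on I p" using lam0 unfolding p_def[abs_def]
    by (intro smooth_on_scaleR smooth_on_divide smooth_on_const sm_lam sm_du I) force+
  have sm_n: "smooth_on I n" unfolding n_def[abs_def] by (rule cr.smooth_on[OF I(1) sm_u sm_p])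
  have sm_dp: "smooth_on I dp" unfolding dp_def[abs_def] by (rule smooth_on_vector_derivative[OF I(1) sm_p])
  have sm_k: "smooth_on I k" using lam0 unfolding k_def[abs_def]
    by (intro smooth_on_divide smooth_on_inner sm_dp sm_n sm_lam I) force+
  have sm_j: "smooth_on I j" using lam0 unfolding j_def[abs_def]
    by (intro smooth_on_divide smooth_on_mult smooth_on_const sm_m sm_lam I) force+
  have dp: "(p has_vector_derivative dp s) (at s)" if "s \<in> I" for s
    using smooth_on_has_vector_derivative[OF sm_p that] by (simp add: dp_def)
  have du_p: "du s = lam s *\<^sub>R p s" if "s \<in> I" for s using lam0[OF that] by (simp add: p_def)
  have pp: "p s \<bullet> p s = 1" if "s \<in> I" for s
    using lam0[OF that] by (simp add: p_def lam_def power2_norm_eq_inner[symmetric] power2_eq_square)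
  have up: "u s \<bullet> p s = 0" if "s \<in> I" for s using udu[OF that] by (simp add: p_def)
  have pdp: "p s \<bullet> dp s = 0" if "s \<in> I" for s
  proof -
    have "((\<lambda>s. p s \<bullet> p s) has_vector_derivative (p s \<bullet> dp s + dp s \<bullet> p s)) (at s)"
      using bounded_bilinear.has_vector_derivative[OF bounded_bilinear_inner dp[OF that] dp[OF that]] .
    from deriv_locally_constant[OF I(1) that this pp] show ?thesis by (simp add: inner_commute)
  qed
  have udp: "u s \<bullet> dp s = - lam s" if "s \<in> I" for s
  proof -
    have "((\<lambda>s. u s \<bullet> p s) has_vector_derivative (u s \<bullet> dp s + du s \<bullet> p s)) (at s)"
      using bounded_bilinear.has_vector_derivative[OF bounded_bilinear_inner du[OF that] dp[OF that]] .
    from deriv_locally_constant[OF I(1) that this up] show ?thesis by (simp add: du_p[OF that] pp[OF that])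
  qed
  have nn: "n s \<bullet> n s = 1" if "s \<in> I" for s
    using norm_cross_dot[of "u s" "p s"] uu[OF that] pp[OF that] up[OF that]
    by (simp add: n_def power_mult_distrib power2_norm_eq_inner)
  have expand: "x = (x \<bullet> n s) *\<^sub>R n s + (x \<bullet> u s) *\<^sub>R u s + (x \<bullet> p s) *\<^sub>R p s" if "s \<in> I" for s x
    using cross3_decompose[of "u s" "p s" x] nn[OF that] uu[OF that] pp[OF that] up[OF that] by (simp add: n_def)
  have dp_eq: "dp s = - lam s *\<^sub>R u s + (lam s * k s) *\<^sub>R n s" if "s \<in> I" for s
    using expand[OF that, of "dp s"] pdp[OF that] udp[OF that] lam0[OF that]
    by (simp add: inner_commute k_def)
  have un: "cross3 (u s) (n s) = - p s" "cross3 (p s) (n s) = u s" if "s \<in> I" for s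
    using Lagrange[of "u s" "u s" "p s"] Lagrange[of "p s" "u s" "p s"] uu[OF that] pp[OF that] up[OF that]
    by (simp_all add: n_def inner_commute)
  have dn: "(n has_vector_derivative - (lam s * k s) *\<^sub>R p s) (at s)" if "s \<in> I" for s
  proof -
    have "(n has_vector_derivative (cross3 (u s) (dp s) + cross3 (du s) (p s))) (at s)"
      unfolding n_def[abs_def] by (rule cr.has_vector_derivative[OF du[OF that] dp[OF that]])
    then show ?thesis unfolding dp_eq[OF that] du_p[OF that]
      by (simp add: cross_add_right cross_mult_right cross_mult_left un[OF that] cr.diff_right)
  qed
  \<comment> \<open>The component of \<open>V t\<close> along \<open>u s\<close> is invisible to the
    cross product; only its components in the tangent plane spanned by \<open>p s\<close> and
    \<open>n s\<close> count.\<close>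
  have W: "x \<bullet> cross3 (u s) (V t) = (p s \<bullet> V t) * (n s \<bullet> x) - (n s \<bullet> V t) * (p s \<bullet> x)" if "s \<in> I" for s t x
  proof -
    have "x \<bullet> cross3 (u s) (V t) = x \<bullet> cross3 (u s) ((V t \<bullet> n s) *\<^sub>R n s + (V t \<bullet> u s) *\<^sub>R u s + (V t \<bullet> p s) *\<^sub>R p s)"
      using expand[OF that, of "V t"] by simp
    also have "\<dots> = (V t \<bullet> n s) * (x \<bullet> - p s) + (V t \<bullet> p s) * (x \<bullet> n s)"
      unfolding cross_add_right cross_mult_right un[OF that] by (simp add: inner_add_right inner_diff_right n_def)
    finally show ?thesis by (simp add: inner_commute)
  qed
  have cc: "cross3 (u s) (V t) \<bullet> cross3 (u s) (V t) = (p s \<bullet> V t)\<^sup>2 + (n s \<bullet> V t)\<^sup>2" if "s \<in> I" for s t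
  proof -
    have "n s \<bullet> cross3 (u s) (V t) = p s \<bullet> V t" "p s \<bullet> cross3 (u s) (V t) = - (n s \<bullet> V t)" "u s \<bullet> cross3 (u s) (V t) = 0"
      unfolding W[OF that] using nn[OF that] pp[OF that] up[OF that] by (simp_all add: n_def dot_cross_self inner_commute)
    then show ?thesis unfolding W[OF that, of "cross3 (u s) (V t)" t] by (simp add: power2_eq_square)
  qed
  have key: "lam s * (n s \<bullet> V t) * ((p s \<bullet> V t) * (n s \<bullet> vector_derivative V (at t)) - (n s \<bullet> V t) * (p s \<bullet> vector_derivative V (at t)))
      = - K * m s * ((p s \<bullet> V t)\<^sup>2 + (n s \<bullet> V t)\<^sup>2)\<^sup>2" if "s \<in> I" "t \<in> J" for s t
  proof -
    have "du s \<bullet> cross3 (u s) (V t) = - lam s * (n s \<bullet> V t)"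
      unfolding du_p[OF that(1)] W[OF that(1)] using pp[OF that(1)] by (simp add: n_def dot_cross_self inner_commute)
    with eq'[OF that] have "(m s)^3 * (lam s * (n s \<bullet> V t) * (vector_derivative V (at t) \<bullet> cross3 (u s) (V t)))
      = (m s)^3 * (- K * m s * ((p s \<bullet> V t)\<^sup>2 + (n s \<bullet> V t)\<^sup>2)\<^sup>2)"
      unfolding cc[OF that(1)] by (simp add: algebra_simps power2_eq_square power3_eq_cube)
    moreover have "(m s)^3 \<noteq> 0" using m0[OF that(1)] by simp
    ultimately show ?thesis unfolding W[OF that(1), symmetric] using mult_left_cancel by blast
  qed
  have nV: "n s \<bullet> V t \<noteq> 0" if "s \<in> I" "t \<in> J" for s t
  proof
    assume "n s \<bullet> V t = 0"
    then have "cross3 (u s) (V t) \<bullet> cross3 (u s) (V t) = 0" using key[OF that] K m0[OF that(1)] unfolding cc[OF that(1)] by simp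
    then show False using c0[OF that] Um[OF that(1)] by (simp add: cross_mult_left)
  qed
  interpret spherical_frame I J u p n V lam k j
  proof
    show "(p s \<bullet> V t) * (n s \<bullet> vector_derivative V (at t)) - (n s \<bullet> V t) * (p s \<bullet> vector_derivative V (at t))
      = - j s * ((p s \<bullet> V t)\<^sup>2 + (n s \<bullet> V t)\<^sup>2)\<^sup>2 / (n s \<bullet> V t)" if "s \<in> I" "t \<in> J" for s t
      using key[OF that] nV[OF that] lam0[OF that(1)] by (simp add: j_def divide_simps) (simp add: algebra_simps)
  qed (use assms(1,3) sm_u sm_p sm_n sm_lam sm_k sm_j V du du_p dp dp_eq dn lam0 m0 K nV in \<open>auto simp: j_def less_imp_neq[symmetric]\<close>)
  from trigonometric_identity[OF assms(2,4)] trigonometric_identity_impossible show False by metis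
qed

section \<open>Normal forms of the two curves\<close>

definition Ad :: "quat \<Rightarrow> real^3 \<Rightarrow> real^3" where
  "Ad q u = snd (q \<odot> (0, u) \<odot> qconj q)"

lemma qconj_qconj [simp]: "qconj (qconj q) = q" by (simp add: qconj_def)

lemma Ad_eq: "(0, Ad q u) = q \<odot> (0, u) \<odot> qconj q"
proof -
  have "fst (q \<odot> (0, u) \<odot> qconj q) = 0" unfolding fst_qconj_mult
    by (simp add: qmult_def inner_quat cross3_simps)
  then show ?thesis by (simp add: Ad_def prod_eq_iff)
qed

lemma Ad_inner: "q \<in> S3 \<Longrightarrow> Ad q u \<bullet> Ad q v = u \<bullet> v"
  using norm_orth_sandwich[OF _ S3_qconj, of q q "(0, u)" "(0, v)"] unfolding Ad_eq[symmetric]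
  by (simp add: inner_quat)

lemma Ad_cross:
  assumes "q \<in> S3" shows "Ad q (cross3 u v) = cross3 (Ad q u) (Ad q v)"
proof -
  have "(0, Ad q u) \<odot> (0, Ad q v) = q \<odot> ((0, u) \<odot> (0, v)) \<odot> qconj q"
    unfolding Ad_eq using qconj_cancel(2)[OF assms] by (simp add: qmult_assoc)
  then have uv: "(- (Ad q u \<bullet> Ad q v), cross3 (Ad q u) (Ad q v)) = q \<odot> (- (u \<bullet> v), cross3 u v) \<odot> qconj q"
    unfolding imag_mult .
  have re: "snd (q \<odot> (r, 0) \<odot> qconj q) = 0" for r
  proof -
    have "q \<odot> (r *\<^sub>R (1, 0)) \<odot> qconj q = r *\<^sub>R (1, 0)"
      unfolding qm.scaleR_right qm.scaleR_left qmult_one qconj_mult_self(2)[OF assms] ..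
    then show ?thesis by simp
  qed
  have "(- (u \<bullet> v), cross3 u v) = (- (u \<bullet> v), 0) + (0, cross3 u v)" by simp
  then have "snd (q \<odot> (- (u \<bullet> v), cross3 u v) \<odot> qconj q) = Ad q (cross3 u v)"
    unfolding Ad_def by (simp only: qm.add_left qm.add_right snd_add re) simp
  with arg_cong[OF uv, of snd] show ?thesis by simp
qed

text \<open>For a unit vector \<open>u\<close> this is the exponential of \<theta> u: a
  one-parameter subgroup, and a great circle through 1 at unit speed.\<close>

definition circle :: "real^3 \<Rightarrow> real \<Rightarrow> quat" where
  "circle u \<theta> = (cos \<theta>, sin \<theta> *\<^sub>R u)"

lemma circle_S3: "norm u = 1 \<Longrightarrow> circle u \<theta> \<in> S3"
  unfolding S3_inner by (simp add: circle_def inner_quat power2_norm_eq_inner[symmetric] flip: power2_eq_square)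

lemma circle_add: "norm u = 1 \<Longrightarrow> circle u (\<theta> + \<eta>) = circle u \<theta> \<odot> circle u \<eta>"
  by (simp add: circle_def qmult_def cos_add sin_add norm_eq_1 scaleR_add_left cross_mult_left cross_mult_right algebra_simps)

lemma qconj_circle: "qconj (circle u \<theta>) = circle u (- \<theta>)"
  by (simp add: circle_def qconj_def)

lemma circle_commute: "(0, u) \<odot> circle u \<theta> = circle u \<theta> \<odot> (0, u)"
  by (simp add: circle_def qmult_def cross_mult_left cross_mult_right)

lemma circle_deriv:
  assumes "norm u = 1"
  shows "(circle u has_vector_derivative circle u \<theta> \<odot> (0, u)) (at \<theta>)"
proof -
  have "((\<lambda>\<theta>. (cos \<theta>, sin \<theta> *\<^sub>R u)) has_vector_derivative (- sin \<theta>, cos \<theta> *\<^sub>R u)) (at \<theta>)"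
    by (intro has_vector_derivative_Pair) (auto intro!: derivative_eq_intros simp flip: has_real_derivative_iff_has_vector_derivative)
  moreover have "circle u \<theta> \<odot> (0, u) = (- sin \<theta>, cos \<theta> *\<^sub>R u)"
    using assms by (simp add: circle_def qmult_def norm_eq_1 cross_mult_left)
  ultimately show ?thesis by (simp add: circle_def[abs_def])
qed

lemma smooth_on_circle: "smooth_on UNIV (circle u)"
  unfolding circle_def[abs_def]
  by (intro smooth_on_Pair smooth_on_scaleR smooth_on_const smooth_on_sin_cos open_UNIV)

lemma circle_compose_deriv:
  assumes "norm u = 1" "(h has_real_derivative h') (at s)"
  shows "((\<lambda>s. circle u (h s)) has_vector_derivative h' *\<^sub>R (circle u (h s) \<odot> (0, u))) (at s)"
  using vector_diff_chain_at[OF assms(2)[unfolded has_real_derivative_iff_has_vector_derivative] circle_deriv[OF assms(1)]]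
  by (simp add: o_def)

lemma smooth_on_circle_compose:
  assumes "open I" "smooth_on I h" shows "smooth_on I (\<lambda>s. circle u (h s))"
  by (rule smooth_on_compose[OF assms(1) open_UNIV smooth_on_circle assms(2)]) auto

section \<open>Antiderivatives, arc length and straightening of a factor\<close>

lemma smooth_antiderivative:
  fixes m :: "real \<Rightarrow> real"
  assumes "open I" "is_interval I" "smooth_on I m"
  obtains M where "smooth_on I M" "\<And>s. s \<in> I \<Longrightarrow> (M has_real_derivative m s) (at s)"
proof (cases "I = {}")
  case True then show ?thesis using that[of "\<lambda>_. 0"] by (auto simp: smooth_on_const)
next
  case False
  then obtain c where c: "c \<in> I" by blast
  define M where "M s = (if c \<le> s then integral {c..s} m else - integral {s..c} m)" for s
  have d: "(M has_real_derivative m s) (at s)" if s: "s \<in> I" for s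
  proof -
    obtain e where e: "e > 0" "cball s e \<subseteq> I" using open_contains_cball[THEN iffD1, OF assms(1)] s by blast
    define lo hi where "lo = min c (s - e)" and "hi = max c (s + e)"
    have sub: "{lo..hi} \<subseteq> I"
    proof -
      have "s - e \<in> I" "s + e \<in> I" using e by (auto simp: dist_real_def subset_iff)
      then have "lo \<in> I" "hi \<in> I" using c by (auto simp: lo_def hi_def min_def max_def)
      then show ?thesis using assms(2) by (meson atLeastAtMost_iff is_interval_1 subsetI)
    qed
    have cont: "continuous_on {lo..hi} m" using continuous_on_subset[OF smooth_on_continuous[OF assms(3)] sub] .
    have I: "m integrable_on {x..y}" if "lo \<le> x" "y \<le> hi" for x y
      using that by (intro integrable_continuous_interval continuous_on_subset[OF cont]) auto
    have "((\<lambda>x. integral {lo..x} m) has_vector_derivative m s) (at s within {lo..hi})"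
      using e by (intro integral_has_vector_derivative cont) (auto simp: lo_def hi_def)
    moreover have "at s within {lo..hi} = at s"
      using e by (intro at_within_Icc_at) (auto simp: lo_def hi_def)
    ultimately have "((\<lambda>x. integral {lo..x} m - integral {lo..c} m) has_real_derivative m s) (at s)"
      unfolding has_real_derivative_iff_has_vector_derivative
      by (metis (no_types) has_vector_derivative_diff_const)
    then show ?thesis
    proof (rule has_field_derivative_transform_within_open[where S = "{lo<..<hi}"])
      fix x assume x: "x \<in> {lo<..<hi}"
      show "integral {lo..x} m - integral {lo..c} m = M x"
      proof (cases "c \<le> x")
        case True
        then show ?thesis using Henstock_Kurzweil_Integration.integral_combine[of lo c x m] I x by (auto simp: M_def lo_def)
      next
        case False
        then show ?thesis using Henstock_Kurzweil_Integration.integral_combine[of lo x c m] I x by (auto simp: M_def lo_def hi_def)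
      qed
    qed (use e in \<open>auto simp: lo_def hi_def\<close>)
  qed
  show ?thesis
  proof
    show "smooth_on I M"
      by (rule smooth_on_vectorI[OF assms(1) _ assms(3)]) (use d in \<open>simp add: has_real_derivative_iff_has_vector_derivative\<close>)
  qed (rule d)
qed

lemma arclength_parameter:
  fixes m :: "real \<Rightarrow> real"
  assumes I: "open_interval I" and m: "smooth_on I m" "\<And>s. s \<in> I \<Longrightarrow> m s > 0"
  obtains \<sigma> S where "smooth_on I \<sigma>" "open_interval (\<sigma> ` I)" "smooth_on (\<sigma> ` I) S"
    "\<And>s. s \<in> I \<Longrightarrow> S (\<sigma> s) = s" "\<And>r. r \<in> \<sigma> ` I \<Longrightarrow> \<sigma> (S r) = r \<and> S r \<in> I"
    "\<And>s. s \<in> I \<Longrightarrow> (\<sigma> has_real_derivative m s) (at s)"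
    "\<And>r. r \<in> \<sigma> ` I \<Longrightarrow> (S has_real_derivative 1 / m (S r)) (at r)"
proof -
  have oI: "open I" "is_interval I" "I \<noteq> {}" using I by (auto simp: open_interval_def)
  obtain \<sigma> where \<sigma>: "smooth_on I \<sigma>" "\<And>s. s \<in> I \<Longrightarrow> (\<sigma> has_real_derivative m s) (at s)"
    using smooth_antiderivative[OF oI(1,2) m(1)] by blast
  have mono: "\<sigma> s < \<sigma> t" if "s \<in> I" "t \<in> I" "s < t" for s t
  proof (rule DERIV_pos_imp_increasing[OF that(3)])
    fix x assume "s \<le> x" "x \<le> t"
    then have "x \<in> I" using oI(2) that by (meson is_interval_1)
    then show "\<exists>y. (\<sigma> has_real_derivative y) (at x) \<and> y > 0" using \<sigma>(2) m(2) by blast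
  qed
  have inj: "inj_on \<sigma> I" by (intro inj_onI) (metis mono less_irrefl linorder_neqE_linordered_idom)
  define S where "S = inv_into I \<sigma>"
  have S: "S (\<sigma> s) = s" if "s \<in> I" for s using that inj by (simp add: S_def)
  have S': "\<sigma> (S r) = r \<and> S r \<in> I" if "r \<in> \<sigma> ` I" for r
    using that by (simp add: S_def f_inv_into_f inv_into_into)
  have c\<sigma>: "continuous_on I \<sigma>" using smooth_on_continuous[OF \<sigma>(1)] .
  have op: "open (\<sigma> ` I)"
    using injective_eq_1d_open_map_UNIV[OF c\<sigma> oI(2)] inj oI(1) by blast
  have conn: "is_interval (\<sigma> ` I)"
    using connected_continuous_image[OF c\<sigma>] oI(2) by (simp add: is_interval_connected_1)
  have cS: "continuous_on (\<sigma> ` I) S"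
    by (rule continuous_on_inverse_open[OF oI(1) c\<sigma>]) (use S inj in auto)
  have "deriv \<sigma> s \<noteq> 0" if "s \<in> I" for s using DERIV_imp_deriv[OF \<sigma>(2)[OF that]] m(2)[OF that] by simp
  then have smS: "smooth_on (\<sigma> ` I) S"
    using smooth_on_real_inverse[OF oI(1) op \<sigma>(1) _ cS] S' by blast
  have dS: "(S has_real_derivative 1 / m (S r)) (at r)" if "r \<in> \<sigma> ` I" for r
  proof -
    have "(S has_real_derivative inverse (m (S r))) (at r)"
    proof (rule has_field_derivative_inverse_basic[where f = \<sigma> and t = "\<sigma> ` I"])
      show "isCont S r" using cS op that continuous_on_eq_continuous_at by blast
    qed (use S' that \<sigma>(2) m(2) op in \<open>auto simp: less_imp_neq[symmetric]\<close>)
    then show ?thesis by (simp add: divide_inverse)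
  qed
  show ?thesis
    by (rule that[OF \<sigma>(1) _ smS S S' \<sigma>(2) dS]) (use op conn oI in \<open>auto simp: open_interval_def\<close>)
qed

lemma left_vel_reparam:
  assumes "open I" "smooth_on I a" "a ` I \<subseteq> S3" and S: "(S has_real_derivative d) (at r)" "S r \<in> I"
  shows "velocity (\<lambda>r. a (S r)) r = d *\<^sub>R velocity a (S r)"
    "left_vel (\<lambda>r. a (S r)) r = d *\<^sub>R left_vel a (S r)" "right_vel (\<lambda>r. a (S r)) r = d *\<^sub>R right_vel a (S r)"
proof -
  have "((\<lambda>r. a (S r)) has_vector_derivative d *\<^sub>R velocity a (S r)) (at r)"
    using vector_diff_chain_at[OF S(1)[unfolded has_real_derivative_iff_has_vector_derivative] has_velocity[OF assms(2) S(2)]]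
    by (simp add: o_def)
  then show v: "velocity (\<lambda>r. a (S r)) r = d *\<^sub>R velocity a (S r)"
    unfolding velocity_def[of "\<lambda>r. a (S r)"] by (rule vector_derivative_at)
  show "left_vel (\<lambda>r. a (S r)) r = d *\<^sub>R left_vel a (S r)" "right_vel (\<lambda>r. a (S r)) r = d *\<^sub>R right_vel a (S r)"
    unfolding left_vel_def right_vel_def v by (simp_all add: qm.scaleR_right qm.scaleR_left)
qed

text \<open>Right multiplication by a suitable motion along the great circle through \<open>v\<close> turns the
  velocity of \<open>a\<close> into a plane containing \<open>v\<close>: the condition on the angle \<open>h\<close> is
  \<open>h' = - U' \<bullet> (U \<times> v) / (2 \<bar>U \<times> v\<bar>\<^sup>2)\<close>.\<close>

lemma straighten_left:
  assumes I: "open I" "is_interval I" and a: "smooth_on I a" "a ` I \<subseteq> S3" and v: "norm v = 1"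
    and c0: "\<And>s. s \<in> I \<Longrightarrow> cross3 (left_vel a s) v \<noteq> 0"
  obtains h where "smooth_on I h"
    "\<And>s. s \<in> I \<Longrightarrow> vector_derivative (left_vel (\<lambda>s. a s \<odot> circle v (h s))) (at s)
      \<bullet> cross3 (left_vel (\<lambda>s. a s \<odot> circle v (h s)) s) v = 0"
proof -
  define U where "U = left_vel a"
  define dU where "dU s = vector_derivative U (at s)" for s
  have smU: "smooth_on I U" unfolding U_def by (rule smooth_on_left_vel[OF I(1) a(1)])
  have dU: "(U has_vector_derivative dU s) (at s)" if "s \<in> I" for s
    using smooth_on_has_vector_derivative[OF smU that] by (simp add: dU_def)
  have smdU: "smooth_on I dU" unfolding dU_def[abs_def] by (rule smooth_on_vector_derivative[OF I(1) smU])
  define h' where "h' s = - (dU s \<bullet> cross3 (U s) v) / (2 * (cross3 (U s) v \<bullet> cross3 (U s) v))" for s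
  have "smooth_on I h'"
    unfolding h'_def[abs_def] using c0
    by (intro smooth_on_divide smooth_on_minus smooth_on_mult smooth_on_inner smooth_on_const cr.smooth_on smdU smU I(1))
      (simp add: U_def)
  then obtain h where h: "smooth_on I h" "\<And>s. s \<in> I \<Longrightarrow> (h has_real_derivative h' s) (at s)"
    using smooth_antiderivative[OF I] by blast
  define e where "e s = circle v (h s)" for s
  have eS: "e s \<in> S3" "qconj (e s) \<in> S3" for s using circle_S3[OF v] S3_qconj by (auto simp: e_def)
  have de: "(e has_vector_derivative h' s *\<^sub>R (e s \<odot> (0, v))) (at s)" if "s \<in> I" for s
    using circle_compose_deriv[OF v h(2)[OF that]] by (simp add: e_def[abs_def])
  have dce: "((\<lambda>s. qconj (e s)) has_vector_derivative - h' s *\<^sub>R ((0, v) \<odot> qconj (e s))) (at s)" if "s \<in> I" for s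
  proof -
    have "qconj (h' s *\<^sub>R (e s \<odot> (0, v))) = h' s *\<^sub>R qconj (e s \<odot> (0, v))" by (simp add: qconj_def)
    also have "\<dots> = h' s *\<^sub>R (- (0, v) \<odot> qconj (e s))" unfolding qconj_qmult by (simp add: qconj_def)
    also have "\<dots> = - h' s *\<^sub>R ((0, v) \<odot> qconj (e s))" by (simp only: qm.minus_left scaleR_minus_left scaleR_minus_right)
    finally show ?thesis
      using bounded_linear.has_vector_derivative[OF bounded_linear_qconj de[OF that]] by simp
  qed
  define am where "am = (\<lambda>s. a s \<odot> e s)"
  have ams: "am s = a s \<odot> e s" for s by (simp add: am_def)
  have smam: "smooth_on I am" unfolding am_def e_def
    by (intro qm.smooth_on a smooth_on_circle_compose h I)
  have amS: "am s \<in> S3" if "s \<in> I" for s using a(2) that eS S3_qmult unfolding ams by blast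
  \<comment> \<open>The inserted motion rotates the velocity about the axis \<open>v\<close> and
    adds a multiple of \<open>v\<close>.\<close>
  have lv: "left_vel am s = Ad (qconj (e s)) (U s) + h' s *\<^sub>R v" if "s \<in> I" for s
  proof (rule left_velI[of am s, OF amS[OF that]])
    have "velocity am s = a s \<odot> (h' s *\<^sub>R (e s \<odot> (0, v))) + velocity a s \<odot> e s"
      unfolding am_def velocity_def[of "\<lambda>s. a s \<odot> e s"]
      by (rule vector_derivative_at[OF qm.has_vector_derivative[OF has_velocity[OF a(1) that] de[OF that]]])
    also have "velocity a s \<odot> e s = a s \<odot> e s \<odot> (qconj (e s) \<odot> (0, U s) \<odot> e s)"
      unfolding velocity_left_right(1)[OF I(1) a that] U_def using qconj_cancel(1)[OF eS(1)[of s]] by (simp add: qmult_assoc)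
    also have "qconj (e s) \<odot> (0, U s) \<odot> e s = (0, Ad (qconj (e s)) (U s))" unfolding Ad_eq by simp
    finally have "velocity am s = am s \<odot> (h' s *\<^sub>R (0, v) + (0, Ad (qconj (e s)) (U s)))"
      by (simp only: ams[of s] qm.add_right qm.scaleR_right qmult_assoc)
    then show "velocity am s = am s \<odot> (0, Ad (qconj (e s)) (U s) + h' s *\<^sub>R v)" by (simp add: add.commute)
  qed
  have fixv: "Ad (qconj (e s)) v = v" for s
    unfolding Ad_def e_def qconj_qconj qmult_assoc circle_commute using qconj_cancel(2)[OF circle_S3[OF v]] by simp
  \<comment> \<open>Conjugation by \<open>circle v (h s)\<close> turns through twice the angle,
    whence the factor 2 here and in the denominator of \<open>h'\<close>. That choice of
    \<open>h'\<close> makes the vector inside orthogonal to \<open>cross3 (U s) v\<close>.\<close>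
  have dAd: "((\<lambda>s. Ad (qconj (e s)) (U s)) has_vector_derivative Ad (qconj (e s)) (dU s + (2 * h' s) *\<^sub>R cross3 (U s) v)) (at s)"
    if "s \<in> I" for s
  proof -
    define w where "w = (\<lambda>s. qconj (e s) \<odot> (0, U s) \<odot> e s)"
    have U0: "((\<lambda>s. (0::real, U s)) has_vector_derivative (0, dU s)) (at s)"
      using has_vector_derivative_Pair[OF has_vector_derivative_const dU[OF that]] .
    have "(w has_vector_derivative qconj (e s) \<odot> (0, U s) \<odot> (h' s *\<^sub>R (e s \<odot> (0, v))) +
       (qconj (e s) \<odot> (0, dU s) + (- h' s *\<^sub>R ((0, v) \<odot> qconj (e s))) \<odot> (0, U s)) \<odot> e s) (at s)"
      unfolding w_def by (intro qm.has_vector_derivative dce de U0 that)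
    also have "qconj (e s) \<odot> (0, U s) \<odot> (h' s *\<^sub>R (e s \<odot> (0, v))) +
       (qconj (e s) \<odot> (0, dU s) + (- h' s *\<^sub>R ((0, v) \<odot> qconj (e s))) \<odot> (0, U s)) \<odot> e s
       = qconj (e s) \<odot> (h' s *\<^sub>R ((0, U s) \<odot> (0, v)) + ((0, dU s) + - h' s *\<^sub>R ((0, v) \<odot> (0, U s)))) \<odot> e s"
    proof -
      have 1: "e s \<odot> (0, v) = (0, v) \<odot> e s" "(0, v) \<odot> qconj (e s) = qconj (e s) \<odot> (0, v)"
        unfolding e_def qconj_circle circle_commute by simp_all
      show ?thesis unfolding 1 by (simp only: qm.add_left qm.add_right qm.scaleR_left qm.scaleR_right qmult_assoc)
    qed
    also have "h' s *\<^sub>R ((0, U s) \<odot> (0, v)) + ((0, dU s) + - h' s *\<^sub>R ((0, v) \<odot> (0, U s)))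
       = (0, dU s + (2 * h' s) *\<^sub>R cross3 (U s) v)"
      unfolding imag_mult by (simp add: inner_commute cross_skew[of v] algebra_simps flip: scaleR_add_left)
    finally have "(w has_vector_derivative (0, Ad (qconj (e s)) (dU s + (2 * h' s) *\<^sub>R cross3 (U s) v))) (at s)"
      unfolding Ad_eq by simp
    from bounded_linear.has_vector_derivative[OF bounded_linear_snd this]
    show ?thesis unfolding w_def Ad_def by simp
  qed
  have smh': "smooth_on I h'" by fact
  have "vector_derivative (left_vel am) (at s) \<bullet> cross3 (left_vel am s) v = 0" if "s \<in> I" for s
  proof -
    note sI = that
    obtain h'' where h'': "(h' has_vector_derivative h'') (at s)"
      using smooth_on_has_vector_derivative[OF smh' sI] by blast
    have "((\<lambda>s. Ad (qconj (e s)) (U s) + h' s *\<^sub>R v) has_vector_derivative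
       Ad (qconj (e s)) (dU s + (2 * h' s) *\<^sub>R cross3 (U s) v) + h'' *\<^sub>R v) (at s)"
      by (intro has_vector_derivative_add dAd[OF that]
          bounded_linear.has_vector_derivative[OF bounded_linear_scaleR_left h''])
    then have "(left_vel am has_vector_derivative
       Ad (qconj (e s)) (dU s + (2 * h' s) *\<^sub>R cross3 (U s) v) + h'' *\<^sub>R v) (at s)"
      by (rule has_vector_derivative_transform_within_open[OF _ I(1) that]) (simp add: lv)
    then have 1: "vector_derivative (left_vel am) (at s) = Ad (qconj (e s)) (dU s + (2 * h' s) *\<^sub>R cross3 (U s) v) + h'' *\<^sub>R v"
      by (rule vector_derivative_at)
    have 2: "cross3 (left_vel am s) v = Ad (qconj (e s)) (cross3 (U s) v)"
      unfolding lv[OF that] cross_add_left cross_mult_left Ad_cross[OF eS(2)] fixv by simp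
    have 3: "v \<bullet> Ad (qconj (e s)) (cross3 (U s) v) = 0"
      using Ad_inner[OF eS(2)[of s], of v "cross3 (U s) v"] unfolding fixv by (simp add: dot_cross_self)
    show ?thesis unfolding 1 2 inner_add_left inner_scaleR_left 3 Ad_inner[OF eS(2)]
      using c0[OF that] by (simp add: h'_def U_def)
  qed
  then show ?thesis using that[of h] h(1) unfolding am_def e_def by blast
qed

text \<open>Conjugation reverses products, so it exchanges left and right velocities up to sign.
  Right-hand versions of the normal forms are derived from the left-hand ones through it.\<close>

lemma right_vel_qconj:
  assumes "open I" "smooth_on I b" "b ` I \<subseteq> S3" "t \<in> I"
  shows "left_vel (\<lambda>t. qconj (b t)) t = - right_vel b t"
proof (rule left_velI)
  show "qconj (b t) \<in> S3" using assms S3_qconj by blast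
  have "velocity (\<lambda>t. qconj (b t)) t = qconj (velocity b t)"
    unfolding velocity_def[of "\<lambda>t. qconj (b t)"]
    by (rule vector_derivative_at[OF bounded_linear.has_vector_derivative[OF bounded_linear_qconj has_velocity[OF assms(2,4)]]])
  also have "\<dots> = qconj (b t) \<odot> (0, - right_vel b t)"
    unfolding velocity_left_right(2)[OF assms] qconj_qmult by (simp add: qconj_def)
  finally show "velocity (\<lambda>t. qconj (b t)) t = qconj (b t) \<odot> (0, - right_vel b t)" .
qed

lemma straighten_right:
  assumes J: "open J" "is_interval J" and b: "smooth_on J b" "b ` J \<subseteq> S3" and u: "norm u = 1"
    and c0: "\<And>t. t \<in> J \<Longrightarrow> cross3 u (right_vel b t) \<noteq> 0"
  obtains h where "smooth_on J h"
    "\<And>t. t \<in> J \<Longrightarrow> vector_derivative (right_vel (\<lambda>t. circle u (h t) \<odot> b t)) (at t)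
      \<bullet> cross3 u (right_vel (\<lambda>t. circle u (h t) \<odot> b t) t) = 0"
proof -
  define a where "a t = qconj (b t)" for t
  have a: "smooth_on J a" "a ` J \<subseteq> S3"
    unfolding a_def[abs_def] using b(2) S3_qconj bounded_linear.smooth_on[OF bounded_linear_qconj J(1) b(1)] by blast+
  have lva: "left_vel a t = - right_vel b t" if "t \<in> J" for t
    unfolding a_def[abs_def] by (rule right_vel_qconj[OF J(1) b that])
  have "cross3 (left_vel a t) u \<noteq> 0" if "t \<in> J" for t
    using c0[OF that] by (simp add: lva[OF that] cross_skew[of u])
  then obtain h where h: "smooth_on J h" "\<And>t. t \<in> J \<Longrightarrow> vector_derivative (left_vel (\<lambda>s. a s \<odot> circle u (h s))) (at t)
      \<bullet> cross3 (left_vel (\<lambda>s. a s \<odot> circle u (h s)) t) u = 0"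
    using straighten_left[OF J a u] by blast
  define c where "c t = circle u (- h t) \<odot> b t" for t
  have cS: "c ` J \<subseteq> S3" using b(2) circle_S3[OF u] S3_qmult unfolding c_def by blast
  have smc: "smooth_on J c" unfolding c_def[abs_def]
    by (intro qm.smooth_on b smooth_on_circle_compose smooth_on_minus h J)
  have "qconj (c t) = a t \<odot> circle u (h t)" for t by (simp add: c_def a_def qconj_qmult qconj_circle)
  then have lv: "left_vel (\<lambda>s. a s \<odot> circle u (h s)) t = - right_vel c t" if "t \<in> J" for t
    using right_vel_qconj[OF J(1) smc cS that] by simp
  have "vector_derivative (right_vel c) (at t) \<bullet> cross3 u (right_vel c t) = 0" if "t \<in> J" for t
  proof -
    have "((\<lambda>s. - right_vel c s) has_vector_derivative - vector_derivative (right_vel c) (at t)) (at t)"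
      using smooth_on_has_vector_derivative[OF smooth_on_right_vel[OF J(1) smc] that] by (rule has_vector_derivative_minus)
    then have "(left_vel (\<lambda>s. a s \<odot> circle u (h s)) has_vector_derivative - vector_derivative (right_vel c) (at t)) (at t)"
      by (rule has_vector_derivative_transform_within_open[OF _ J(1) that]) (simp add: lv)
    from vector_derivative_at[OF this] h(2)[OF that] show ?thesis
      unfolding lv[OF that] by (simp add: cross_skew[of u])
  qed
  then show ?thesis using that[of "\<lambda>t. - h t"] h(1) smooth_on_minus[OF J(1)] unfolding c_def[abs_def] by blast
qed

section \<open>Velocities of constant direction\<close>

lemma unit_direction_derivative:
  fixes V :: "real \<Rightarrow> real^3"
  assumes J: "open J" and V: "smooth_on J V" and V0: "\<And>t. t \<in> J \<Longrightarrow> V t \<noteq> 0" and t: "t \<in> J"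
    and cross0: "cross3 (V t) (vector_derivative V (at t)) = 0"
  shows "((\<lambda>t. (1 / norm (V t)) *\<^sub>R V t) has_vector_derivative 0) (at t)"
proof -
  define v where "v = (\<lambda>t. (1 / norm (V t)) *\<^sub>R V t)"
  have Vv: "V t = norm (V t) *\<^sub>R v t" for t by (simp add: v_def)
  have smn: "smooth_on J (\<lambda>t. norm (V t))" by (rule smooth_on_norm[OF J V V0])
  have smv: "smooth_on J v"
    unfolding v_def using V0 by (intro smooth_on_scaleR smooth_on_divide smooth_on_const smn V J) auto
  have dv: "(v has_vector_derivative vector_derivative v (at t)) (at t)"
    using smooth_on_has_vector_derivative[OF smv t] .
  obtain n' where n': "((\<lambda>t. norm (V t)) has_real_derivative n') (at t)"
    using smooth_on_differentiable[OF smn t] DERIV_deriv_iff_real_differentiable by blast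
  have "(V has_vector_derivative norm (V t) *\<^sub>R vector_derivative v (at t) + n' *\<^sub>R v t) (at t)"
    using has_vector_derivative_scaleR[OF n' dv] unfolding Vv[symmetric] .
  then have "vector_derivative V (at t) = norm (V t) *\<^sub>R vector_derivative v (at t) + n' *\<^sub>R v t"
    by (rule vector_derivative_at)
  with cross0 have "cross3 (v t) (vector_derivative v (at t)) = 0"
    using V0[OF t] Vv[of t] by (metis (no_types, lifting) add.right_neutral cross_add_right cross_mult_left cross_mult_right
        cross_refl norm_eq_zero scaleR_eq_0_iff)
  moreover have "v t \<bullet> vector_derivative v (at t) = 0"
  proof -
    have "v x \<bullet> v x = 1" if "x \<in> J" for x using V0[OF that]
      by (simp add: v_def power2_norm_eq_inner[symmetric] power2_eq_square)
    from deriv_locally_constant[OF J t bounded_bilinear.has_vector_derivative[OF bounded_bilinear_inner dv dv] this]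
    show ?thesis by (simp add: inner_commute)
  qed
  ultimately have "vector_derivative v (at t) = 0"
    using V0[OF t] norm_and_cross_eq_0[of "v t" "vector_derivative v (at t)"] by (auto simp: v_def)
  with dv show ?thesis by (simp add: v_def)
qed

lemma constant_direction:
  fixes V :: "real \<Rightarrow> real^3"
  assumes J: "open_interval J" and V: "smooth_on J V" and V0: "\<And>t. t \<in> J \<Longrightarrow> V t \<noteq> 0"
    and cross0: "\<And>t. t \<in> J \<Longrightarrow> cross3 (V t) (vector_derivative V (at t)) = 0"
  obtains v where "norm v = 1" "\<And>t. t \<in> J \<Longrightarrow> V t = norm (V t) *\<^sub>R v"
proof -
  have oJ: "open J" "connected J" "J \<noteq> {}" using J by (auto simp: open_interval_def is_interval_connected_1)
  obtain c where c: "c \<in> J" using oJ(3) by blast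
  define v where "v = (\<lambda>t. (1 / norm (V t)) *\<^sub>R V t)"
  have vc: "v t = v c" if "t \<in> J" for t
    by (rule has_derivative_zero_unique_connected[OF oJ(1,2) _ that c])
      (use unit_direction_derivative[OF oJ(1) V V0 _ cross0] in \<open>simp add: has_vector_derivative_def v_def\<close>)
  show ?thesis
  proof
    show "norm (v c) = 1" using V0[OF c] by (simp add: v_def)
    fix t assume t: "t \<in> J"
    have "V t = norm (V t) *\<^sub>R v t" using V0[OF t] by (simp add: v_def)
    then show "V t = norm (V t) *\<^sub>R v c" unfolding vc[OF t] .
  qed
qed

text \<open>Near a parameter where the first factor is nonzero the second one vanishes for an open
  set of s. Differentiating this in s shows that \<open>V\<close> does not turn at
  \<open>t1\<close>; and as long as its direction is unchanged, the first factor stays nonzero. An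
  open-closed argument then fixes the direction of \<open>V\<close> on all of
  \<open>J\<close>.\<close>

lemma rotating_direction_forces_constant:
  fixes U V :: "real \<Rightarrow> real^3"
  assumes I: "open I" and J: "open J" "is_interval J" and U: "smooth_on I U" and V: "smooth_on J V"
    and c0: "\<And>s t. s \<in> I \<Longrightarrow> t \<in> J \<Longrightarrow> cross3 (U s) (V t) \<noteq> 0"
    and eq: "\<And>s t. s \<in> I \<Longrightarrow> t \<in> J \<Longrightarrow>
      (vector_derivative U (at s) \<bullet> cross3 (U s) (V t)) * (vector_derivative V (at t) \<bullet> cross3 (U s) (V t)) = 0"
    and 1: "s1 \<in> I" "t1 \<in> J" "vector_derivative U (at s1) \<bullet> cross3 (U s1) (V t1) \<noteq> 0"
  obtains v where "norm v = 1" "\<And>t. t \<in> J \<Longrightarrow> V t = norm (V t) *\<^sub>R v"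
proof -
  define dU dV where "dU s = vector_derivative U (at s)" and "dV t = vector_derivative V (at t)" for s t
  have V0: "V t \<noteq> 0" if "t \<in> J" for t using c0[OF 1(1) that] by auto
  define v where "v t = (1 / norm (V t)) *\<^sub>R V t" for t
  have Vv: "V t = norm (V t) *\<^sub>R v t" for t by (simp add: v_def)
  have smn: "smooth_on J (\<lambda>t. norm (V t))" by (rule smooth_on_norm[OF J(1) V V0])
  have smv: "smooth_on J v"
    unfolding v_def[abs_def] using V0 by (intro smooth_on_scaleR smooth_on_divide smooth_on_const smn V J) auto
  have contV: "continuous_on J V" and contv: "continuous_on J v" using smooth_on_continuous V smv by blast+
  have smdU: "smooth_on I dU" unfolding dU_def[abs_def] by (rule smooth_on_vector_derivative[OF I U])
  have contU: "continuous_on I U" "continuous_on I dU" using smooth_on_continuous U smdU by blast+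
  \<comment> \<open>The second factor is the triple product of \<open>dV t\<close>,
    \<open>U s\<close>, \<open>V t\<close>, hence linear in \<open>U s\<close> and equal to
    \<open>U s \<bullet> N\<close> up to sign. It vanishes for s near \<open>s1\<close>, so its
    derivative in s vanishes as well.\<close>
  have cross0: "cross3 (V t) (dV t) = 0" if t: "t \<in> J" and ne: "dU s1 \<bullet> cross3 (U s1) (V t) \<noteq> 0" for t
  proof -
    define N where "N = cross3 (V t) (dV t)"
    have "continuous_on I (\<lambda>s. dU s \<bullet> cross3 (U s) (V t))"
      by (intro continuous_intros cr.continuous_on contU)
    then have op: "open {s \<in> I. dU s \<bullet> cross3 (U s) (V t) \<in> - {0}}"
      using continuous_open_preimage[OF _ I open_Compl[OF closed_singleton], of "\<lambda>s. dU s \<bullet> cross3 (U s) (V t)" 0]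
      by (simp add: vimage_def Int_def)
    have UN: "U s \<bullet> N = 0" if "s \<in> {s \<in> I. dU s \<bullet> cross3 (U s) (V t) \<in> - {0}}" for s
    proof -
      have "dV t \<bullet> cross3 (U s) (V t) = 0" using eq[of s t] that t by (auto simp: dU_def dV_def)
      then show ?thesis by (simp add: N_def cross3_simps)
    qed
    have s1: "s1 \<in> {s \<in> I. dU s \<bullet> cross3 (U s) (V t) \<in> - {0}}" using 1 ne by simp
    have "((\<lambda>s. U s \<bullet> N) has_vector_derivative dU s1 \<bullet> N) (at s1)"
      unfolding dU_def using bounded_linear.has_vector_derivative[OF bounded_linear_inner_left
          smooth_on_has_vector_derivative[OF U 1(1)]] .
    from deriv_locally_constant[OF op s1 this UN] have "dU s1 \<bullet> N = 0" .
    moreover have "U s1 \<bullet> N = 0" using UN[OF s1] .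
    moreover have "V t \<bullet> N = 0" by (simp add: N_def dot_cross_self)
    \<comment> \<open>Cramer's rule: \<open>N\<close> is orthogonal to \<open>dU s1\<close>,
      \<open>U s1\<close> and \<open>V t\<close>, and the scalar is the determinant of these three
      vectors.\<close>
    ultimately have "(dU s1 \<bullet> cross3 (U s1) (V t)) *\<^sub>R N = 0"
      by (simp add: vec_eq_iff forall_3 cross3_def inner_vec_def sum_3) algebra
    then show ?thesis using ne by (simp add: N_def)
  qed
  have dv0: "(v has_vector_derivative 0) (at t)" if t: "t \<in> J" and ne: "dU s1 \<bullet> cross3 (U s1) (V t) \<noteq> 0" for t
    using unit_direction_derivative[OF J(1) V V0 t cross0[OF t ne, unfolded dV_def]] by (simp add: v_def[abs_def])
  \<comment> \<open>The factor depends on \<open>V t\<close> only through its direction and a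
    positive scale, so it remains nonzero where the direction is that of \<open>t1\<close>.\<close>
  have ne: "dU s1 \<bullet> cross3 (U s1) (V t) \<noteq> 0" if "t \<in> J" "v t = v t1" for t
  proof -
    have "dU s1 \<bullet> cross3 (U s1) (V x) = norm (V x) * (dU s1 \<bullet> cross3 (U s1) (v x))" for x
      by (subst Vv) (simp add: cross_mult_right)
    then show ?thesis using 1 V0[OF that(1)] that(2) by (simp add: dU_def)
  qed
  have "v constant_on J"
  proof -
    define C where "C = {t \<in> J. v t = v t1}"
    have "openin (top_of_set J) C"
      unfolding openin_contains_ball
    proof (intro conjI ballI)
      show "C \<subseteq> J" by (auto simp: C_def)
      fix t assume t: "t \<in> C"
      have "open {t \<in> J. dU s1 \<bullet> cross3 (U s1) (V t) \<in> - {0}}"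
        using continuous_open_preimage[OF _ J(1) open_Compl[OF closed_singleton], of "\<lambda>t. dU s1 \<bullet> cross3 (U s1) (V t)" 0] contV
        by (simp add: vimage_def Int_def continuous_intros cr.continuous_on)
      moreover have "t \<in> {t \<in> J. dU s1 \<bullet> cross3 (U s1) (V t) \<in> - {0}}" using t ne by (auto simp: C_def)
      ultimately obtain e where e: "e > 0" "ball t e \<subseteq> {t \<in> J. dU s1 \<bullet> cross3 (U s1) (V t) \<in> - {0}}"
        using openE by blast
      have "v x = v t" if "x \<in> ball t e" for x
        by (rule has_derivative_zero_unique_connected[of "ball t e" v])
         (use e that dv0 in \<open>auto simp: has_vector_derivative_def\<close>)
      then have "ball t e \<inter> J \<subseteq> C" using t by (auto simp: C_def)
      then show "\<exists>e>0. ball t e \<inter> J \<subseteq> C" using e by blast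
    qed
    moreover have "closedin (top_of_set J) C"
      unfolding C_def by (rule continuous_closedin_preimage_constant[OF contv])
    moreover have "t1 \<in> C" using 1 by (simp add: C_def)
    moreover have "connected J" using J(2) by (simp add: is_interval_connected_1)
    ultimately have "C = J" using connected_clopen by blast
    then show ?thesis unfolding constant_on_def C_def by blast
  qed
  then obtain w where w: "\<And>t. t \<in> J \<Longrightarrow> v t = w" unfolding constant_on_def by blast
  show ?thesis
  proof
    show "norm w = 1" using w[OF 1(2)] V0[OF 1(2)] by (auto simp: v_def)
    show "V t = norm (V t) *\<^sub>R w" if "t \<in> J" for t using Vv[of t] w[OF that] by simp
  qed
qed

section \<open>Torsion of the two curves\<close>

text \<open>Fields along the curve are written in left-translated form. The covariant derivative
  becomes y' + U x y: for left-invariant fields on the group the connection is half the Lie bracket,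
  and the bracket of imaginary quaternions is twice the cross product.\<close>

lemma curve_right_mult_derivative:
  assumes "open I" "smooth_on I \<alpha>" "\<alpha> ` I \<subseteq> S3" "s \<in> I" "(y has_vector_derivative y') (at s)"
  shows "((\<lambda>s. \<alpha> s \<odot> (0, y s)) has_vector_derivative \<alpha> s \<odot> (- (left_vel \<alpha> s \<bullet> y s), cross3 (left_vel \<alpha> s) (y s) + y')) (at s)"
    "cov_deriv \<alpha> (\<lambda>s. \<alpha> s \<odot> (0, y s)) s = \<alpha> s \<odot> (0, cross3 (left_vel \<alpha> s) (y s) + y')"
proof -
  have S: "\<alpha> s \<in> S3" using assms by blast
  have y: "((\<lambda>s. (0::real, y s)) has_vector_derivative (0, y')) (at s)"
    using has_vector_derivative_Pair[OF has_vector_derivative_const assms(5)] .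
  have a: "(\<alpha> has_vector_derivative \<alpha> s \<odot> (0, left_vel \<alpha> s)) (at s)"
    using has_velocity[OF assms(2,4)] unfolding velocity_left_right(1)[OF assms(1-4)] .
  show d: "((\<lambda>s. \<alpha> s \<odot> (0, y s)) has_vector_derivative \<alpha> s \<odot> (- (left_vel \<alpha> s \<bullet> y s), cross3 (left_vel \<alpha> s) (y s) + y')) (at s)"
    using qm.has_vector_derivative[OF a y]
    by (simp add: qmult_assoc imag_mult add.commute flip: qm.add_right)
  have "(\<alpha> s \<odot> q) \<bullet> \<alpha> s = fst q" for q
    using inner_qmult(1)[of "\<alpha> s" q "(1, 0)"] S unfolding S3_inner by (simp add: inner_quat)
  then have "cov_deriv \<alpha> (\<lambda>s. \<alpha> s \<odot> (0, y s)) s = \<alpha> s \<odot> (- (left_vel \<alpha> s \<bullet> y s), cross3 (left_vel \<alpha> s) (y s) + y')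
     - (- (left_vel \<alpha> s \<bullet> y s)) *\<^sub>R (\<alpha> s \<odot> (1, 0))"
    unfolding cov_deriv_def vector_derivative_at[OF d] by simp
  also have "\<dots> = \<alpha> s \<odot> (0, cross3 (left_vel \<alpha> s) (y s) + y')"
    unfolding qm.scaleR_right[symmetric] qm.diff_right[symmetric] by simp
  finally show "cov_deriv \<alpha> (\<lambda>s. \<alpha> s \<odot> (0, y s)) s = \<alpha> s \<odot> (0, cross3 (left_vel \<alpha> s) (y s) + y')" .
qed

text \<open>In right-translated form the cross product appears with the opposite sign. This is the
  source of the torsion -1 of the second factor.\<close>

lemma curve_left_mult_derivative:
  assumes "open J" "smooth_on J \<beta>" "\<beta> ` J \<subseteq> S3" "t \<in> J" "(y has_vector_derivative y') (at t)"
  shows "cov_deriv \<beta> (\<lambda>t. (0, y t) \<odot> \<beta> t) t = (0, cross3 (y t) (right_vel \<beta> t) + y') \<odot> \<beta> t"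
proof -
  have S: "\<beta> t \<in> S3" using assms by blast
  have y: "((\<lambda>s. (0::real, y s)) has_vector_derivative (0, y')) (at t)"
    using has_vector_derivative_Pair[OF has_vector_derivative_const assms(5)] .
  have b: "(\<beta> has_vector_derivative (0, right_vel \<beta> t) \<odot> \<beta> t) (at t)"
    using has_velocity[OF assms(2,4)] unfolding velocity_left_right(2)[OF assms(1-4)] .
  have d: "((\<lambda>t. (0, y t) \<odot> \<beta> t) has_vector_derivative (- (y t \<bullet> right_vel \<beta> t), cross3 (y t) (right_vel \<beta> t) + y') \<odot> \<beta> t) (at t)"
    using qm.has_vector_derivative[OF y b]
    by (simp add: imag_mult flip: qm.add_left qmult_assoc)
  have "(q \<odot> \<beta> t) \<bullet> \<beta> t = fst q" for q
    using inner_qmult(2)[of q "\<beta> t" "(1, 0)"] S unfolding S3_inner by (simp add: inner_quat)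
  then have "cov_deriv \<beta> (\<lambda>t. (0, y t) \<odot> \<beta> t) t = (- (y t \<bullet> right_vel \<beta> t), cross3 (y t) (right_vel \<beta> t) + y') \<odot> \<beta> t
     - (- (y t \<bullet> right_vel \<beta> t)) *\<^sub>R ((1, 0) \<odot> \<beta> t)"
    unfolding cov_deriv_def vector_derivative_at[OF d] by simp
  also have "\<dots> = (0, cross3 (y t) (right_vel \<beta> t) + y') \<odot> \<beta> t"
    unfolding qm.scaleR_left[symmetric] qm.diff_left[symmetric] by simp
  finally show ?thesis .
qed

lemma cov_deriv_cong:
  fixes V W :: "real \<Rightarrow> quat"
  assumes "open I" "s \<in> I" "\<And>r. r \<in> I \<Longrightarrow> V r = W r"
  shows "cov_deriv \<gamma> V s = cov_deriv \<gamma> W s"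
proof -
  have "(V has_vector_derivative d) (at s) = (W has_vector_derivative d) (at s)" for d
    using assms has_vector_derivative_transform_within_open[of V d s I W]
      has_vector_derivative_transform_within_open[of W d s I V] by auto
  then have "vector_derivative V (at s) = vector_derivative W (at s)" unfolding vector_derivative_def by simp
  then show ?thesis unfolding cov_deriv_def by simp
qed

lemma cov_deriv_velocity:
  assumes "open I" "smooth_on I \<alpha>" "\<alpha> ` I \<subseteq> S3" "s \<in> I"
  shows "cov_deriv \<alpha> (velocity \<alpha>) s = \<alpha> s \<odot> (0, vector_derivative (left_vel \<alpha>) (at s))"
    "cov_deriv \<alpha> (velocity \<alpha>) s = (0, vector_derivative (right_vel \<alpha>) (at s)) \<odot> \<alpha> s"
  using cov_deriv_cong[OF assms(1,4) velocity_left_right(1)[OF assms(1-3)], where \<gamma> = \<alpha>]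
    curve_right_mult_derivative(2)[OF assms smooth_on_has_vector_derivative[OF smooth_on_left_vel[OF assms(1,2)] assms(4)]]
    cov_deriv_cong[OF assms(1,4) velocity_left_right(2)[OF assms(1-3)], where \<gamma> = \<alpha>]
    curve_left_mult_derivative[OF assms smooth_on_has_vector_derivative[OF smooth_on_right_vel[OF assms(1,2)] assms(4)]]
  by simp_all

lemma curvature_eq:
  assumes "open I" "smooth_on I \<alpha>" "\<alpha> ` I \<subseteq> S3" "s \<in> I"
  shows "curvature \<alpha> s = norm (vector_derivative (left_vel \<alpha>) (at s))"
    "curvature \<alpha> s = norm (vector_derivative (right_vel \<alpha>) (at s))"
proof -
  have "norm (\<alpha> s) = 1" using assms by auto
  then show "curvature \<alpha> s = norm (vector_derivative (left_vel \<alpha>) (at s))"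
    unfolding curvature_def cov_deriv_velocity(1)[OF assms] norm_qmult by (simp add: norm_Pair)
  show "curvature \<alpha> s = norm (vector_derivative (right_vel \<alpha>) (at s))"
    using \<open>norm (\<alpha> s) = 1\<close> unfolding curvature_def cov_deriv_velocity(2)[OF assms] norm_qmult by (simp add: norm_Pair)
qed

text \<open>For a unit vector \<open>U s\<close> moving in the plane orthogonal to \<open>w\<close>,
  the vectors \<open>U s\<close>, \<open>cross3 w (U s)\<close>, \<open>w\<close> form an
  orthonormal frame, and the derivative is a signed multiple of the middle one.\<close>

lemma planar_derivative:
  fixes U :: "real \<Rightarrow> real^3"
  assumes I: "open I" and U: "smooth_on I U" "\<And>s. s \<in> I \<Longrightarrow> norm (U s) = 1" "\<And>s. s \<in> I \<Longrightarrow> U s \<bullet> w = 0"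
    and w: "norm w = 1" and s: "s \<in> I"
  defines "dU \<equiv> vector_derivative U (at s)"
  shows "dU = (dU \<bullet> cross3 w (U s)) *\<^sub>R cross3 w (U s)" "cross3 w (cross3 w (U s)) = - U s"
    "cross3 (U s) (cross3 w (U s)) = w" "norm (cross3 w (U s)) = 1"
proof -
  have d: "(U has_vector_derivative dU) (at s)"
    unfolding dU_def using smooth_on_has_vector_derivative[OF U(1) s] .
  have uu: "U x \<bullet> U x = 1" if "x \<in> I" for x using U(2)[OF that] by (simp add: norm_eq_1)
  have ww: "w \<bullet> w = 1" using w by (simp add: norm_eq_1)
  have 1: "U s \<bullet> dU = 0"
    using deriv_locally_constant[OF I s bounded_bilinear.has_vector_derivative[OF bounded_bilinear_inner d d] uu]
    by (simp add: inner_commute)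
  have 2: "dU \<bullet> w = 0"
    using deriv_locally_constant[OF I s bounded_linear.has_vector_derivative[OF bounded_linear_inner_left d] U(3)] .
  have c: "cross3 w (U s) \<bullet> cross3 w (U s) = 1"
    using norm_cross_dot[of w "U s"] U(2,3)[OF s] w by (simp add: power2_norm_eq_inner inner_commute)
  then show "norm (cross3 w (U s)) = 1" by (simp add: norm_eq_1)
  show "dU = (dU \<bullet> cross3 w (U s)) *\<^sub>R cross3 w (U s)"
    using cross3_decompose[of w "U s" dU] 1 2 c by (simp add: inner_commute)
  show "cross3 w (cross3 w (U s)) = - U s" "cross3 (U s) (cross3 w (U s)) = w"
    using Lagrange[of w w "U s"] Lagrange[of "U s" w "U s"] ww uu[OF s] U(3)[OF s] by (simp_all add: inner_commute)
qed

text \<open>The plane of the velocity gives the frame: N is the translate of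
  \<open>cross3 w (U s)\<close> and B the translate of the fixed \<open>w\<close>. As
  \<open>w\<close> is constant, the covariant derivative of B is the translate of
  \<open>cross3 (U s) w\<close>, that is -N. The signed \<open>\<kappa>\<close> keeps the frame
  smooth across zeros of the curvature.\<close>

lemma has_torsion_left:
  assumes I: "open I" and u: "unit_speed_curve I \<alpha>" and w: "norm w = 1" "\<And>s. s \<in> I \<Longrightarrow> left_vel \<alpha> s \<bullet> w = 0"
  shows "has_torsion I \<alpha> (\<lambda>s. 1)"
proof -
  define U where "U = left_vel \<alpha>"
  define \<kappa> where "\<kappa> s = vector_derivative U (at s) \<bullet> cross3 w (U s)" for s
  have a: "smooth_on I \<alpha>" "\<alpha> ` I \<subseteq> S3" "\<And>s. s \<in> I \<Longrightarrow> norm (velocity \<alpha> s) = 1"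
    using u by (auto simp: unit_speed_curve_def)
  have S: "\<alpha> s \<in> S3" if "s \<in> I" for s using a that by blast
  have smU: "smooth_on I U" unfolding U_def by (rule smooth_on_left_vel[OF I a(1)])
  have U1: "norm (U s) = 1" if "s \<in> I" for s
    using velocity_left_right(3)[OF I a(1,2) that] a(3)[OF that] by (simp add: U_def)
  have Uw: "U s \<bullet> w = 0" if "s \<in> I" for s using w(2)[OF that] by (simp add: U_def)
  have pl: "vector_derivative U (at s) = \<kappa> s *\<^sub>R cross3 w (U s)" "cross3 w (cross3 w (U s)) = - U s"
    "cross3 (U s) (cross3 w (U s)) = w" "norm (cross3 w (U s)) = 1" if "s \<in> I" for s
    using planar_derivative[OF I smU _ _ w(1) that] U1 Uw unfolding \<kappa>_def by blast+
  define N B where "N s = \<alpha> s \<odot> (0, cross3 w (U s))" and "B s = \<alpha> s \<odot> (0, w)" for s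
  have smI: "smooth_on I (\<lambda>s. (0::real, y s))" if "smooth_on I y" for y :: "real \<Rightarrow> real^3"
    using that by (intro smooth_on_Pair smooth_on_const I)
  have T: "velocity \<alpha> s = \<alpha> s \<odot> (0, U s)" if "s \<in> I" for s
    using velocity_left_right(1)[OF I a(1,2) that] by (simp add: U_def)
  have inn: "(\<alpha> s \<odot> p) \<bullet> (\<alpha> s \<odot> q) = p \<bullet> q" if "s \<in> I" for s p q
    using S[OF that] unfolding inner_qmult S3_inner by simp
  have "frenet_frame I \<alpha> (velocity \<alpha>) N B \<kappa> (\<lambda>s. 1)"
    unfolding frenet_frame_def
  proof (intro conjI ballI)
    show "unit_speed_curve I \<alpha>" by (rule u)
    show "smooth_on I N" "smooth_on I B"
      unfolding N_def[abs_def] B_def[abs_def] by (intro qm.smooth_on a smI cr.smooth_on smooth_on_const smU I)+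
    fix s assume s: "s \<in> I"
    show "norm (N s) = 1" unfolding N_def norm_qmult using S[OF s] pl(4)[OF s] by (simp add: norm_Pair)
    show "N s \<bullet> \<alpha> s = 0" using inn[OF s, of "(0, cross3 w (U s))" "(1, 0)"] by (simp add: N_def inner_quat)
    show "N s \<bullet> velocity \<alpha> s = 0" unfolding N_def T[OF s] inn[OF s] by (simp add: inner_quat dot_cross_self)
    show "B s = s3_cross (\<alpha> s) (velocity \<alpha> s) (N s)"
      unfolding s3_cross_def N_def T[OF s] B_def qconj_cancel(2)[OF S[OF s]] by (simp add: pl(3)[OF s])
    show "cov_deriv \<alpha> (velocity \<alpha>) s = \<kappa> s *\<^sub>R N s"
      unfolding cov_deriv_velocity(1)[OF I a(1,2) s] N_def U_def[symmetric] qm.scaleR_right[symmetric]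
      using pl(1)[OF s] by simp
    have "((\<lambda>s. cross3 w (U s)) has_vector_derivative cross3 w (vector_derivative U (at s))) (at s)"
      using bounded_linear.has_vector_derivative[OF cr.bounded_linear_right smooth_on_has_vector_derivative[OF smU s]] .
    then have "cov_deriv \<alpha> N s = \<alpha> s \<odot> (0, w + cross3 w (\<kappa> s *\<^sub>R cross3 w (U s)))"
      unfolding N_def[abs_def] using curve_right_mult_derivative(2)[OF I a(1,2) s] pl(1,3)[OF s] by (simp add: U_def)
    also have "\<dots> = - \<kappa> s *\<^sub>R velocity \<alpha> s + 1 *\<^sub>R B s"
      unfolding T[OF s] B_def qm.scaleR_right[symmetric] qm.add_right[symmetric] cross_mult_right pl(2)[OF s] by simp
    finally show "cov_deriv \<alpha> N s = - \<kappa> s *\<^sub>R velocity \<alpha> s + 1 *\<^sub>R B s" .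
    have "cov_deriv \<alpha> B s = \<alpha> s \<odot> (0, cross3 (U s) w)"
      unfolding B_def[abs_def] using curve_right_mult_derivative(2)[OF I a(1,2) s has_vector_derivative_const, of w] by (simp add: U_def)
    also have "(0, cross3 (U s) w) = - (1::real) *\<^sub>R (0::real, cross3 w (U s))" by (simp add: cross_skew[of "U s"])
    finally show "cov_deriv \<alpha> B s = - 1 *\<^sub>R N s" unfolding N_def qm.scaleR_right .
  qed simp
  then show ?thesis unfolding has_torsion_def by blast
qed

text \<open>The same frame in right-translated form, where the fixed vector \<open>w\<close> has
  covariant derivative \<open>cross3 w (U s)\<close>, hence +N instead of -N.\<close>

lemma has_torsion_right:
  assumes I: "open I" and u: "unit_speed_curve I \<beta>" and w: "norm w = 1" "\<And>s. s \<in> I \<Longrightarrow> right_vel \<beta> s \<bullet> w = 0"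
  shows "has_torsion I \<beta> (\<lambda>s. -1)"
proof -
  define U where "U = right_vel \<beta>"
  define \<kappa> where "\<kappa> s = vector_derivative U (at s) \<bullet> cross3 w (U s)" for s
  have a: "smooth_on I \<beta>" "\<beta> ` I \<subseteq> S3" "\<And>s. s \<in> I \<Longrightarrow> norm (velocity \<beta> s) = 1"
    using u by (auto simp: unit_speed_curve_def)
  have S: "\<beta> s \<in> S3" if "s \<in> I" for s using a that by blast
  have smU: "smooth_on I U" unfolding U_def by (rule smooth_on_right_vel[OF I a(1)])
  have U1: "norm (U s) = 1" if "s \<in> I" for s
    using velocity_left_right(4)[OF I a(1,2) that] a(3)[OF that] by (simp add: U_def)
  have Uw: "U s \<bullet> w = 0" if "s \<in> I" for s using w(2)[OF that] by (simp add: U_def)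
  have pl: "vector_derivative U (at s) = \<kappa> s *\<^sub>R cross3 w (U s)" "cross3 w (cross3 w (U s)) = - U s"
    "cross3 (U s) (cross3 w (U s)) = w" "norm (cross3 w (U s)) = 1" if "s \<in> I" for s
    using planar_derivative[OF I smU _ _ w(1) that] U1 Uw unfolding \<kappa>_def by blast+
  define N B where "N s = (0, cross3 w (U s)) \<odot> \<beta> s" and "B s = (0, w) \<odot> \<beta> s" for s
  have smI: "smooth_on I (\<lambda>s. (0::real, y s))" if "smooth_on I y" for y :: "real \<Rightarrow> real^3"
    using that by (intro smooth_on_Pair smooth_on_const I)
  have T: "velocity \<beta> s = (0, U s) \<odot> \<beta> s" if "s \<in> I" for s
    using velocity_left_right(2)[OF I a(1,2) that] by (simp add: U_def)
  have inn: "(p \<odot> \<beta> s) \<bullet> (q \<odot> \<beta> s) = p \<bullet> q" if "s \<in> I" for s p q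
    using S[OF that] unfolding inner_qmult S3_inner by simp
  have "frenet_frame I \<beta> (velocity \<beta>) N B \<kappa> (\<lambda>s. -1)"
    unfolding frenet_frame_def
  proof (intro conjI ballI)
    show "unit_speed_curve I \<beta>" by (rule u)
    show "smooth_on I N" "smooth_on I B"
      unfolding N_def[abs_def] B_def[abs_def] by (intro qm.smooth_on a smI cr.smooth_on smooth_on_const smU I)+
    fix s assume s: "s \<in> I"
    show "norm (N s) = 1" unfolding N_def norm_qmult using S[OF s] pl(4)[OF s] by (simp add: norm_Pair)
    show "N s \<bullet> \<beta> s = 0" using inn[OF s, of "(0, cross3 w (U s))" "(1, 0)"] by (simp add: N_def inner_quat)
    show "N s \<bullet> velocity \<beta> s = 0" unfolding N_def T[OF s] inn[OF s] by (simp add: inner_quat dot_cross_self)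
    \<comment> \<open>\<open>s3_cross\<close> is defined by left translation while this frame is
      right-translated. The two forms differ by the rotation \<open>Ad\<close>, which respects the
      cross product, so the frame is positively oriented here as well.\<close>
    have Adq: "qconj (\<beta> s) \<odot> ((0, x) \<odot> \<beta> s) = (0, Ad (qconj (\<beta> s)) x)" for x
      unfolding Ad_eq by (simp add: qmult_assoc)
    have "s3_cross (\<beta> s) (velocity \<beta> s) (N s) = \<beta> s \<odot> (0, Ad (qconj (\<beta> s)) (cross3 (U s) (cross3 w (U s))))"
      unfolding s3_cross_def N_def T[OF s] Adq Ad_cross[OF S3_qconj[OF S[OF s]]] by simp
    also have "\<dots> = B s"
      unfolding pl(3)[OF s] Ad_eq B_def using qconj_cancel(1)[OF S[OF s]] by (simp add: qmult_assoc)
    finally show "B s = s3_cross (\<beta> s) (velocity \<beta> s) (N s)" by simp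
    show "cov_deriv \<beta> (velocity \<beta>) s = \<kappa> s *\<^sub>R N s"
      unfolding cov_deriv_velocity(2)[OF I a(1,2) s] N_def U_def[symmetric] qm.scaleR_left[symmetric]
      using pl(1)[OF s] by simp
    have "((\<lambda>s. cross3 w (U s)) has_vector_derivative cross3 w (vector_derivative U (at s))) (at s)"
      using bounded_linear.has_vector_derivative[OF cr.bounded_linear_right smooth_on_has_vector_derivative[OF smU s]] .
    then have "cov_deriv \<beta> N s = (0, - w + cross3 w (\<kappa> s *\<^sub>R cross3 w (U s))) \<odot> \<beta> s"
      unfolding N_def[abs_def] using curve_left_mult_derivative[OF I a(1,2) s] pl(1,3)[OF s]
      by (simp add: U_def cross_skew[of "cross3 w (right_vel \<beta> s)" "right_vel \<beta> s"])
    also have "\<dots> = - \<kappa> s *\<^sub>R velocity \<beta> s + (-1) *\<^sub>R B s"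
      unfolding T[OF s] B_def qm.scaleR_left[symmetric] qm.add_left[symmetric] cross_mult_right pl(2)[OF s]
      by (simp add: algebra_simps)
    finally show "cov_deriv \<beta> N s = - \<kappa> s *\<^sub>R velocity \<beta> s + (-1) *\<^sub>R B s" .
    have "cov_deriv \<beta> B s = (0, cross3 w (U s)) \<odot> \<beta> s"
      unfolding B_def[abs_def] using curve_left_mult_derivative[OF I a(1,2) s has_vector_derivative_const, of w] by (simp add: U_def)
    then show "cov_deriv \<beta> B s = - (-1) *\<^sub>R N s" by (simp add: N_def)
  qed simp
  then show ?thesis unfolding has_torsion_def by blast
qed

section \<open>Parametrizations of immersed surfaces\<close>

text \<open>A homeomorphism onto an open set is an injective map that is continuous and open; in
  this form subspace topologies disappear.\<close>

lemma topological_param_iff: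
  "topological_param M (D, x) \<longleftrightarrow> open D \<and> inj_on x D \<and> x ` D \<subseteq> topspace M \<and>
    (\<forall>S. open S \<and> S \<subseteq> D \<longrightarrow> openin M (x ` S)) \<and> (\<forall>W. openin M W \<longrightarrow> open {z \<in> D. x z \<in> W})"
proof
  assume "topological_param M (D, x)"
  then have D: "open D" "openin M (x ` D)" and h: "homeomorphic_map (top_of_set D) (subtopology M (x ` D)) x"
    by (auto simp: topological_param_def)
  have sub: "x ` D \<subseteq> topspace M" using D(2) openin_subset by blast
  have c: "continuous_map (top_of_set D) (subtopology M (x ` D)) x" and o: "open_map (top_of_set D) (subtopology M (x ` D)) x"
    and i: "inj_on x D"
    using homeomorphic_imp_continuous_map[OF h] homeomorphic_imp_open_map[OF h]
      homeomorphic_imp_injective_map[OF h] unfolding topspace_euclidean_subtopology .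
  have "openin M (x ` S)" if "open S" "S \<subseteq> D" for S
  proof -
    have "openin (subtopology M (x ` D)) (x ` S)"
      using o[unfolded open_map_def, rule_format, of S] openin_open_eq[OF D(1), of S] \<open>open S\<close> \<open>S \<subseteq> D\<close> by blast
    then show ?thesis using openin_open_subtopology[OF D(2)] by blast
  qed
  moreover have "open {z \<in> D. x z \<in> W}" if W: "openin M W" for W
  proof -
    have "openin (subtopology M (x ` D)) (W \<inter> x ` D)" using W by (auto simp: openin_subtopology)
    then have "openin (top_of_set D) {z \<in> topspace (top_of_set D). x z \<in> W \<inter> x ` D}"
      by (rule openin_continuous_map_preimage[OF c])
    moreover have "{z \<in> topspace (top_of_set D). x z \<in> W \<inter> x ` D} = {z \<in> D. x z \<in> W}" by auto
    ultimately show ?thesis using D(1) openin_open_eq by metis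
  qed
  ultimately show "open D \<and> inj_on x D \<and> x ` D \<subseteq> topspace M \<and>
    (\<forall>S. open S \<and> S \<subseteq> D \<longrightarrow> openin M (x ` S)) \<and> (\<forall>W. openin M W \<longrightarrow> open {z \<in> D. x z \<in> W})"
    using D i sub by blast
next
  assume *: "open D \<and> inj_on x D \<and> x ` D \<subseteq> topspace M \<and>
    (\<forall>S. open S \<and> S \<subseteq> D \<longrightarrow> openin M (x ` S)) \<and> (\<forall>W. openin M W \<longrightarrow> open {z \<in> D. x z \<in> W})"
  then have xD: "openin M (x ` D)" by blast
  have "homeomorphic_map (top_of_set D) (subtopology M (x ` D)) x"
  proof (rule bijective_open_imp_homeomorphic_map)
    show "continuous_map (top_of_set D) (subtopology M (x ` D)) x"
      unfolding continuous_map_def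
    proof (intro conjI allI impI)
      show "x \<in> topspace (top_of_set D) \<rightarrow> topspace (subtopology M (x ` D))" using * by auto
      fix U assume "openin (subtopology M (x ` D)) U"
      then have "openin M U" "U \<subseteq> x ` D" using xD by (auto simp: openin_open_subtopology)
      moreover have "{z \<in> topspace (top_of_set D). x z \<in> U} = {z \<in> D. x z \<in> U}" by simp
      ultimately show "openin (top_of_set D) {z \<in> topspace (top_of_set D). x z \<in> U}"
        using * openin_open_eq[of D "{z \<in> D. x z \<in> U}"] by auto
    qed
    show "open_map (top_of_set D) (subtopology M (x ` D)) x"
      unfolding open_map_def using * xD by (auto simp: openin_open_eq openin_open_subtopology)
    show "x ` topspace (top_of_set D) = topspace (subtopology M (x ` D))" using * by auto
    show "inj_on x (topspace (top_of_set D))" using * by simp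
  qed
  with xD * show "topological_param M (D, x)" by (simp add: topological_param_def)
qed

lemma det_first_ff_compose:
  fixes \<phi> :: "real^2 \<Rightarrow> real^2"
  assumes "\<phi> differentiable at w" "X differentiable at (\<phi> w)"
  shows "det (first_ff (\<lambda>w. X (\<phi> w)) w) = (pd 1 \<phi> w $ 1 * pd 2 \<phi> w $ 2 - pd 1 \<phi> w $ 2 * pd 2 \<phi> w $ 1)\<^sup>2 * det (first_ff X (\<phi> w))"
  unfolding det_first_ff pd_compose[OF assms]
  by (simp add: inner_add_left inner_add_right inner_commute algebra_simps power2_eq_square)

text \<open>A vanishing Gram determinant is equality in the Cauchy-Schwarz inequality, so the
  partial derivatives are parallel and one of \<open>vector [- norm q, norm p]\<close>,
  \<open>vector [norm q, norm p]\<close> lies in the kernel. If that vector is zero, then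
  \<open>p\<close> is zero and the first axis lies in the kernel.\<close>

lemma inj_derivative_imp_det_first_ff:
  assumes d: "X differentiable at z" and inj: "inj (frechet_derivative X (at z))"
  shows "det (first_ff X z) \<noteq> 0"
proof
  define p q where "p = pd 1 X z" and "q = pd 2 X z"
  assume "det (first_ff X z) = 0"
  then have "(p \<bullet> q)\<^sup>2 = (p \<bullet> p) * (q \<bullet> q)" by (simp add: det_first_ff p_def q_def)
  then have "(p \<bullet> q)\<^sup>2 = (norm p * norm q)\<^sup>2" by (simp add: power2_norm_eq_inner power_mult_distrib)
  then have "\<bar>p \<bullet> q\<bar> = \<bar>norm p * norm q\<bar>" unfolding power2_eq_iff abs_eq_iff .
  then have "\<bar>p \<bullet> q\<bar> = norm p * norm q" by simp
  then have c: "norm p *\<^sub>R q = norm q *\<^sub>R p \<or> norm p *\<^sub>R q = - norm q *\<^sub>R p"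
    unfolding norm_cauchy_schwarz_abs_eq .
  have D: "frechet_derivative X (at z) v = v $ 1 *\<^sub>R p + v $ 2 *\<^sub>R q" for v
    unfolding p_def q_def by (rule frechet_pd[OF d])
  have "frechet_derivative X (at z) (vector [- norm q, norm p]) = 0 \<or> frechet_derivative X (at z) (vector [norm q, norm p]) = 0"
    unfolding D using c by auto
  moreover have "v = 0" if "frechet_derivative X (at z) v = 0" for v
    using injD[OF inj, of v 0] that D[of 0] by simp
  ultimately have "(vector [- norm q, norm p] :: real^2) = 0 \<or> (vector [norm q, norm p] :: real^2) = 0" by blast
  then have "norm p = 0" by (metis vector_2(2) zero_index)
  then have "frechet_derivative X (at z) (axis 1 1) = 0" unfolding D by simp
  then have "axis 1 1 = (0 :: real^2)" using \<open>\<And>v. frechet_derivative X (at z) v = 0 \<Longrightarrow> v = 0\<close> by blast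
  then show False by (metis axis2_simps(1) zero_index zero_neq_one)
qed

section \<open>Local parametrizations in the maximal atlas\<close>

locale immersed =
  fixes M :: "'m topology" and A :: "'m parametrization set" and f :: "'m \<Rightarrow> quat"
  assumes immersed: "immersed_surface M A f"
begin

lemma hausdorff: "Hausdorff_space M"
  using immersed unfolding immersed_surface_def by (elim conjE)

lemma atlas_topological: "c \<in> A \<Longrightarrow> topological_param M c"
  using immersed unfolding immersed_surface_def by (elim conjE) (rule bspec[of A "topological_param M"])

lemma atlas_covers: "(\<Union>(D, x)\<in>A. x ` D) = topspace M"
  using immersed unfolding immersed_surface_def by (elim conjE)

lemma atlas_transition: "c \<in> A \<Longrightarrow> c' \<in> A \<Longrightarrow> smooth_transition c c'"
  using immersed unfolding immersed_surface_def by (elim conjE)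
    (rule bspec[of A "smooth_transition c"], rule bspec[of A "\<lambda>c. Ball A (smooth_transition c)"])

lemma image_S3: "f ` topspace M \<subseteq> S3"
  using immersed unfolding immersed_surface_def by (elim conjE)

lemma atlas_immersion: "\<forall>(D, x)\<in>A. smooth_on D (f \<circ> x) \<and> (\<forall>z\<in>D. inj (frechet_derivative (f \<circ> x) (at z)))"
  using immersed unfolding immersed_surface_def by (elim conjE)

lemma local_paramD:
  assumes "local_param M A D x"
  shows "open D" "inj_on x D" "x ` D \<subseteq> topspace M" "\<And>S. open S \<Longrightarrow> S \<subseteq> D \<Longrightarrow> openin M (x ` S)"
    "\<And>W. openin M W \<Longrightarrow> open {z \<in> D. x z \<in> W}"
  using assms unfolding local_param_def topological_param_iff by auto

lemma atlas_local_param: "(D, x) \<in> A \<Longrightarrow> local_param M A D x"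
  unfolding local_param_def using atlas_topological atlas_transition by blast

lemma atlas_cover:
  assumes "p \<in> topspace M" obtains D x z where "(D, x) \<in> A" "z \<in> D" "p = x z"
  using assms unfolding atlas_covers[symmetric] by blast

lemma f_S3: "p \<in> topspace M \<Longrightarrow> f p \<in> S3"
  using image_S3 by blast

lemma open_overlap: "local_param M A D x \<Longrightarrow> local_param M A E y \<Longrightarrow> open {z \<in> D. x z \<in> y ` E}"
  using local_paramD(4)[of E y E] local_paramD(1)[of E y] local_paramD(5)[of D x "y ` E"] by simp

text \<open>By definition members of the maximal atlas are compared with charts of \<open>A\<close>
  only; the transition between two of them factors locally through such a chart.\<close>

lemma smooth_transition_local_param:
  assumes x: "local_param M A D x" and y: "local_param M A E y"
  shows "smooth_on {z \<in> D. x z \<in> y ` E} (\<lambda>z. inv_into E y (x z))"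
proof (rule smooth_on_local)
  fix z assume z: "z \<in> {z \<in> D. x z \<in> y ` E}"
  then have "x z \<in> topspace M" using local_paramD(3)[OF x] by auto
  then obtain C c w where c: "(C, c) \<in> A" "w \<in> C" "x z = c w" by (rule atlas_cover)
  note lc = atlas_local_param[OF c(1)]
  define T where "T = {z \<in> D. x z \<in> y ` E} \<inter> {z \<in> D. x z \<in> c ` C}"
  have T: "open T" unfolding T_def by (intro open_Int open_overlap x y lc)
  have s1: "smooth_on T (\<lambda>z. inv_into C c (x z))"
    using x c(1) unfolding local_param_def smooth_transition_def
    by (auto intro: smooth_on_subset simp: T_def o_def)
  have s2: "smooth_on {w \<in> C. c w \<in> y ` E} (\<lambda>w. inv_into E y (c w))"
    using y c(1) unfolding local_param_def smooth_transition_def by (auto simp: o_def)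
  have m: "inv_into C c (x z) \<in> C \<and> c (inv_into C c (x z)) = x z" if "z \<in> T" for z
    using that by (auto simp: T_def inv_into_into f_inv_into_f)
  have mm: "inv_into C c (x z) \<in> {w \<in> C. c w \<in> y ` E}" if "z \<in> T" for z
    using m[OF that] that by (simp add: T_def)
  have "smooth_on T (\<lambda>z. inv_into E y (c (inv_into C c (x z))))"
    by (rule smooth_on_compose[OF T open_overlap[OF lc y] s2 s1]) (use mm in blast)
  then have "smooth_on T (\<lambda>z. inv_into E y (x z))"
    by (rule smooth_on_cong[OF T]) (simp add: m)
  moreover have "z \<in> T" using z c by (auto simp: T_def)
  ultimately show "\<exists>T. open T \<and> z \<in> T \<and> smooth_on T (\<lambda>z. inv_into E y (x z))"
    using T by blast
qed

lemma transition_jacobian: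
  assumes x: "local_param M A D x" and y: "local_param M A E y" and z: "z \<in> D" "x z \<in> y ` E"
  defines "\<phi> \<equiv> \<lambda>z. inv_into E y (x z)"
  shows "pd 1 \<phi> z $ 1 * pd 2 \<phi> z $ 2 - pd 1 \<phi> z $ 2 * pd 2 \<phi> z $ 1 \<noteq> 0"
proof -
  define U where "U = {z \<in> D. x z \<in> y ` E}"
  define \<psi> where "\<psi> = (\<lambda>w. inv_into D x (y w))"
  have U: "open U" "z \<in> U" using open_overlap[OF x y] z by (auto simp: U_def)
  have \<phi>: "\<phi> w \<in> E \<and> y (\<phi> w) = x w" if "w \<in> U" for w
    using that by (auto simp: U_def \<phi>_def inv_into_into f_inv_into_f)
  have d\<phi>: "\<phi> differentiable at z"
    using smooth_on_differentiable[OF smooth_transition_local_param[OF x y]] z by (simp add: \<phi>_def)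
  have "\<phi> z \<in> {w \<in> E. y w \<in> x ` D}" using \<phi>[OF U(2)] z by auto
  then have d\<psi>: "\<psi> differentiable at (\<phi> z)"
    using smooth_on_differentiable[OF smooth_transition_local_param[OF y x]] by (simp add: \<psi>_def)
  have id: "\<psi> (\<phi> w) = w" if "w \<in> U" for w
    using \<phi>[OF that] local_paramD(2)[OF x] that by (simp add: \<psi>_def U_def)
  have "pd i (\<lambda>w. \<psi> (\<phi> w)) z = axis i 1" for i
    using pd_cong[OF U id, where i = i] pd_eqI[OF has_derivative_ident, where i = i and z = z] by simp
  note e = this[unfolded pd_compose[OF d\<phi> d\<psi>]]
  define a b where "a = pd 1 \<psi> (\<phi> z)" and "b = pd 2 \<psi> (\<phi> z)"
  have "pd 1 \<phi> z $ 1 * a $ 1 + pd 1 \<phi> z $ 2 * b $ 1 = 1" "pd 1 \<phi> z $ 1 * a $ 2 + pd 1 \<phi> z $ 2 * b $ 2 = 0"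
    "pd 2 \<phi> z $ 1 * a $ 1 + pd 2 \<phi> z $ 2 * b $ 1 = 0" "pd 2 \<phi> z $ 1 * a $ 2 + pd 2 \<phi> z $ 2 * b $ 2 = 1"
    using arg_cong[OF e[of 1], of "\<lambda>v. v $ 1"] arg_cong[OF e[of 1], of "\<lambda>v. v $ 2"]
      arg_cong[OF e[of 2], of "\<lambda>v. v $ 1"] arg_cong[OF e[of 2], of "\<lambda>v. v $ 2"]
    by (simp_all add: a_def b_def)
  then show ?thesis by algebra
qed

lemma smooth_immersion_atlas:
  assumes "(D, x) \<in> A"
  shows "smooth_on D (\<lambda>z. f (x z))" "z \<in> D \<Longrightarrow> det (first_ff (\<lambda>z. f (x z)) z) \<noteq> 0"
proof -
  show s: "smooth_on D (\<lambda>z. f (x z))"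
    using bspec[OF atlas_immersion assms] by (simp add: o_def)
  show "det (first_ff (\<lambda>z. f (x z)) z) \<noteq> 0" if "z \<in> D"
    by (rule inj_derivative_imp_det_first_ff[OF smooth_on_differentiable[OF s that]])
     (use bspec[OF atlas_immersion assms] that in \<open>simp add: o_def\<close>)
qed

lemma sphere_param: "local_param M A D x \<Longrightarrow> (\<lambda>z. f (x z)) ` D \<subseteq> S3"
  using f_S3 local_paramD(3) by blast

lemma change_of_param:
  assumes x: "local_param M A D x" and y: "local_param M A E y"
    and \<phi>: "\<phi> = (\<lambda>z. inv_into E y (x z))" and U: "U = {z \<in> D. x z \<in> y ` E}"
  shows "open U" "smooth_on U \<phi>" "\<phi> ` U \<subseteq> E" "\<And>z. z \<in> U \<Longrightarrow> y (\<phi> z) = x z" "\<And>z. z \<in> U \<Longrightarrow> f (x z) = f (y (\<phi> z))"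
  using open_overlap[OF x y] smooth_transition_local_param[OF x y] unfolding U \<phi>
  by (auto simp: inv_into_into f_inv_into_f)

lemma smooth_immersion:
  assumes x: "local_param M A D x"
  shows "smooth_on D (\<lambda>z. f (x z))" "\<And>z. z \<in> D \<Longrightarrow> det (first_ff (\<lambda>z. f (x z)) z) \<noteq> 0"
proof -
  have *: "\<exists>T. open T \<and> z \<in> T \<and> smooth_on T (\<lambda>z. f (x z)) \<and> det (first_ff (\<lambda>z. f (x z)) z) \<noteq> 0" if z: "z \<in> D" for z
  proof -
    have "x z \<in> topspace M" using local_paramD(3)[OF x] z by auto
    then obtain C c w where c: "(C, c) \<in> A" "w \<in> C" "x z = c w" by (rule atlas_cover)
    note lc = atlas_local_param[OF c(1)]
    define U where "U = {z \<in> D. x z \<in> c ` C}"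
    define \<phi> where "\<phi> = (\<lambda>z. inv_into C c (x z))"
    have zU: "z \<in> U" using c z by (auto simp: U_def)
    note ch = change_of_param[OF x lc \<phi>_def U_def]
    note C = local_paramD(1)[OF lc]
    have s: "smooth_on U (\<lambda>z. f (c (\<phi> z)))"
      by (rule smooth_on_compose[OF ch(1) C smooth_immersion_atlas(1)[OF c(1)] ch(2,3)])
    have s': "smooth_on U (\<lambda>z. f (x z))" by (rule smooth_on_cong[OF ch(1) s]) (simp add: ch(5))
    have \<phi>z: "\<phi> z \<in> C" using ch(3) zU by blast
    have "pd i (\<lambda>z. f (x z)) z = pd i (\<lambda>z. f (c (\<phi> z))) z" for i
      by (rule pd_cong[OF ch(1) zU]) (rule ch(5))
    then have "det (first_ff (\<lambda>z. f (x z)) z) = det (first_ff (\<lambda>z. f (c (\<phi> z))) z)" by (simp add: det_first_ff)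
    also have "\<dots> \<noteq> 0"
      unfolding det_first_ff_compose[OF smooth_on_differentiable[OF ch(2) zU]
          smooth_on_differentiable[OF smooth_immersion_atlas(1)[OF c(1)] \<phi>z]]
      using transition_jacobian[OF x lc z, folded \<phi>_def] c smooth_immersion_atlas(2)[OF c(1) \<phi>z] by simp
    finally show ?thesis using s' ch(1) zU by blast
  qed
  show "smooth_on D (\<lambda>z. f (x z))" by (rule smooth_on_local) (use * in blast)
  show "\<And>z. z \<in> D \<Longrightarrow> det (first_ff (\<lambda>z. f (x z)) z) \<noteq> 0" using * by blast
qed

lemma second_ff_change:
  assumes x: "local_param M A D x" and y: "local_param M A E y" and z: "z \<in> D" "x z \<in> y ` E"
  defines "\<phi> \<equiv> \<lambda>z. inv_into E y (x z)"
  shows "second_ff (\<lambda>z. f (x z)) z v w = sgn (pd 1 \<phi> z $ 1 * pd 2 \<phi> z $ 2 - pd 1 \<phi> z $ 2 * pd 2 \<phi> z $ 1)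
     * second_ff (\<lambda>z. f (y z)) (\<phi> z) (frechet_derivative \<phi> (at z) v) (frechet_derivative \<phi> (at z) w)"
proof -
  define U where "U = {z \<in> D. x z \<in> y ` E}"
  note ch = change_of_param[OF x y \<phi>_def[THEN meta_eq_to_obj_eq] U_def]
  have zU: "z \<in> U" using z by (simp add: U_def)
  have "second_ff (\<lambda>z. f (x z)) z = second_ff (\<lambda>z. f (y (\<phi> z))) z"
    by (rule second_ff_cong[OF ch(1) zU]) (rule ch(5))
  then show ?thesis
    using reparametrization(2)[OF ch(1,2) local_paramD(1)[OF y] smooth_immersion(1)[OF y] ch(3) sphere_param[OF y] zU] by simp
qed

text \<open>The hypothesis speaks of charts of \<open>A\<close>; invariance under change of
  parameters carries the constant to every member of the maximal atlas, in particular to product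
  parametrizations.\<close>

lemma gauss_curvature_constant:
  assumes "constant_gauss_curvature A f"
  obtains K where "\<And>D x z. local_param M A D x \<Longrightarrow> z \<in> D \<Longrightarrow> gauss_curvature (\<lambda>z. f (x z)) z = K"
proof -
  obtain K where K: "\<And>D x z. (D, x) \<in> A \<Longrightarrow> z \<in> D \<Longrightarrow> gauss_curvature (\<lambda>z. f (x z)) z = K"
    using assms unfolding constant_gauss_curvature_def o_def by blast
  show ?thesis
  proof (rule that)
    fix D x z assume x: "local_param M A D x" and z: "z \<in> D"
    have "x z \<in> topspace M" using local_paramD(3)[OF x] z by auto
    then obtain C c w where c: "(C, c) \<in> A" "w \<in> C" "x z = c w" by (rule atlas_cover)
    note lc = atlas_local_param[OF c(1)]
    define U where "U = {z \<in> D. x z \<in> c ` C}"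
    define \<phi> where "\<phi> = (\<lambda>z. inv_into C c (x z))"
    have zU: "z \<in> U" using c z by (auto simp: U_def)
    note ch = change_of_param[OF x lc \<phi>_def U_def]
    have "gauss_curvature (\<lambda>z. f (x z)) z = gauss_curvature (\<lambda>z. f (c (\<phi> z))) z"
      by (rule gauss_curvature_cong[OF ch(1) zU]) (rule ch(5))
    also have "\<dots> = gauss_curvature (\<lambda>z. f (c z)) (\<phi> z)"
      by (rule gauss_curvature_compose[OF ch(1,2) local_paramD(1)[OF lc] smooth_immersion(1)[OF lc] ch(3)
            sphere_param[OF lc] zU smooth_immersion(2)[OF lc]])
       (use transition_jacobian[OF x lc] in \<open>auto simp: \<phi>_def U_def\<close>)
    also have "\<dots> = K" using K[OF c(1)] ch(3) zU by blast
    finally show "gauss_curvature (\<lambda>z. f (x z)) z = K" .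
  qed
qed

text \<open>\<open>\<theta>\<close> is a diffeomorphism onto an open part of \<open>D0\<close>, with
  inverse the restriction of \<open>\<eta>\<close>. Since \<open>\<eta>\<close> may be defined
  beyond that image, it is asked to be a right inverse only where \<open>\<eta> w\<close> lands in
  \<open>D'\<close>; sheared and restricted parametrizations have this shape.\<close>

lemma local_param_compose:
  assumes x: "local_param M A D x" and D': "open D'" and \<theta>: "smooth_on D' \<theta>" "\<theta> ` D' \<subseteq> D0"
    and D0: "open D0" "D0 \<subseteq> D" and \<eta>: "smooth_on D0 \<eta>" "\<And>z. z \<in> D' \<Longrightarrow> \<eta> (\<theta> z) = z"
    "\<And>w. w \<in> D0 \<Longrightarrow> \<eta> w \<in> D' \<Longrightarrow> \<theta> (\<eta> w) = w"
  shows "local_param M A D' (\<lambda>z. x (\<theta> z))"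
proof -
  note lx = local_paramD[OF x]
  have oimg: "open (\<theta> ` S)" if S: "open S" "S \<subseteq> D'" for S
  proof -
    \<comment> \<open>Images under \<open>\<theta>\<close> are preimages under
      \<open>\<eta>\<close>, so openness follows from continuity of \<open>\<eta>\<close>.\<close>
    have "\<theta> ` S = D0 \<inter> \<eta> -` S" using S \<theta>(2) \<eta>(2,3) by (force simp: image_iff)
    then show ?thesis using continuous_open_preimage[OF smooth_on_continuous[OF \<eta>(1)] D0(1) S(1)] by simp
  qed
  have opre: "open {z \<in> D'. \<theta> z \<in> V}" if V: "open V" for V
    using continuous_open_preimage[OF smooth_on_continuous[OF \<theta>(1)] D' V] by (simp add: vimage_def Int_def)
  have img: "\<theta> z \<in> D" if "z \<in> D'" for z using that \<theta>(2) D0(2) by blast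
  have inj: "inj_on (\<lambda>z. x (\<theta> z)) D'"
    using lx(2) img \<eta>(2) by (intro inj_onI) (metis inj_onD)
  have tp: "topological_param M (D', \<lambda>z. x (\<theta> z))"
    unfolding topological_param_iff
  proof (intro conjI allI impI)
    show "(\<lambda>z. x (\<theta> z)) ` D' \<subseteq> topspace M" using img lx(3) by blast
    fix S :: "(real^2) set" assume S: "open S \<and> S \<subseteq> D'"
    have "\<theta> ` S \<subseteq> D" using S img by blast
    with lx(4)[OF oimg] S show "openin M ((\<lambda>z. x (\<theta> z)) ` S)" by (simp add: image_image)
  next
    fix W assume "openin M W"
    from opre[OF lx(5)[OF this]] show "open {z \<in> D'. x (\<theta> z) \<in> W}" using img by (simp cong: conj_cong)
  qed (rule D' inj)+
  show ?thesis unfolding local_param_def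
  proof (intro conjI ballI tp)
    fix c assume cA: "c \<in> A"
    obtain E y where c: "c = (E, y)" by fastforce
    note ly = atlas_local_param[OF cA[unfolded c]]
    define U where "U = {z \<in> D'. x (\<theta> z) \<in> y ` E}"
    have "U = {z \<in> D'. \<theta> z \<in> {w \<in> D. x w \<in> y ` E}}" using img by (auto simp: U_def)
    then have U: "open U" using opre[OF open_overlap[OF x ly]] by simp
    have "smooth_on U (\<lambda>z. inv_into E y (x (\<theta> z)))"
      by (rule smooth_on_compose[OF U open_overlap[OF x ly] smooth_transition_local_param[OF x ly]])
        (use \<theta>(1) img in \<open>auto simp: U_def intro: smooth_on_subset\<close>)
    then show "smooth_transition (D', \<lambda>z. x (\<theta> z)) c"
      by (simp add: smooth_transition_def c U_def o_def)
    define V where "V = {w \<in> E. y w \<in> (\<lambda>z. x (\<theta> z)) ` D'}"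
    have "openin M ((\<lambda>z. x (\<theta> z)) ` D')" using tp D' unfolding topological_param_iff by blast
    then have V: "open V" unfolding V_def by (rule local_paramD(5)[OF ly])
    have inv: "inv_into D x (y w) \<in> D0 \<and> inv_into D' (\<lambda>z. x (\<theta> z)) (y w) = \<eta> (inv_into D x (y w))" if w: "w \<in> V" for w
    proof -
      obtain z where z: "z \<in> D'" "y w = x (\<theta> z)" using w by (auto simp: V_def)
      then show ?thesis using inv_into_f_f[OF inj z(1)] inv_into_f_f[OF lx(2) img[OF z(1)]] \<theta>(2) \<eta>(2) by auto
    qed
    have s1: "smooth_on V (\<lambda>w. inv_into D x (y w))"
      by (rule smooth_on_subset[OF smooth_transition_local_param[OF ly x]]) (use img in \<open>auto simp: V_def\<close>)
    have "smooth_on V (\<lambda>w. \<eta> (inv_into D x (y w)))"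
      by (rule smooth_on_compose[OF V D0(1) \<eta>(1) s1]) (use inv in auto)
    then have "smooth_on V (\<lambda>w. inv_into D' (\<lambda>z. x (\<theta> z)) (y w))"
      by (rule smooth_on_cong[OF V]) (simp add: inv)
    then show "smooth_transition c (D', \<lambda>z. x (\<theta> z))"
      by (simp add: smooth_transition_def c V_def o_def)
  qed
qed

section \<open>Curves on the surface seen in local parametrizations\<close>

lemma smooth_curve_param:
  assumes I: "open I" and c: "smooth_curve M A I c" and x: "local_param M A D x"
  shows "open {t \<in> I. c t \<in> x ` D}" "smooth_on {t \<in> I. c t \<in> x ` D} (\<lambda>t. inv_into D x (c t))"
proof -
  have op: "open {t \<in> I. c t \<in> y ` E}" if "local_param M A E y" for E y
  proof -
    have "openin M (y ` E)" using local_paramD(4)[OF that local_paramD(1)[OF that]] by simp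
    then have "openin (top_of_set I) {t \<in> topspace (top_of_set I). c t \<in> y ` E}"
      using c openin_continuous_map_preimage unfolding smooth_curve_def by blast
    then show ?thesis unfolding topspace_euclidean_subtopology openin_open_eq[OF I] by blast
  qed
  show "open {t \<in> I. c t \<in> x ` D}" by (rule op[OF x])
  show "smooth_on {t \<in> I. c t \<in> x ` D} (\<lambda>t. inv_into D x (c t))"
  proof (rule smooth_on_local)
    fix t assume t: "t \<in> {t \<in> I. c t \<in> x ` D}"
    then have "c t \<in> topspace M" using local_paramD(3)[OF x] by auto
    then obtain E y w where y: "(E, y) \<in> A" "w \<in> E" "c t = y w" by (rule atlas_cover)
    note ly = atlas_local_param[OF y(1)]
    define T where "T = {t \<in> I. c t \<in> x ` D} \<inter> {t \<in> I. c t \<in> y ` E}"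
    have T: "open T" unfolding T_def by (intro open_Int op x ly)
    have s: "smooth_on T (\<lambda>t. inv_into E y (c t))"
      using c y(1) unfolding smooth_curve_def by (auto intro: smooth_on_subset simp: T_def o_def)
    have m: "inv_into E y (c t) \<in> E \<and> y (inv_into E y (c t)) = c t" if "t \<in> T" for t
      using that by (auto simp: T_def inv_into_into f_inv_into_f)
    have mm: "inv_into E y (c t) \<in> {w \<in> E. y w \<in> x ` D}" if "t \<in> T" for t
      using m[OF that] that by (simp add: T_def)
    have "smooth_on T (\<lambda>t. inv_into D x (y (inv_into E y (c t))))"
      by (rule smooth_on_compose[OF T open_overlap[OF ly x] smooth_transition_local_param[OF ly x] s])
        (use mm in blast)
    then have "smooth_on T (\<lambda>t. inv_into D x (c t))" by (rule smooth_on_cong[OF T]) (simp add: m)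
    moreover have "t \<in> T" using t y by (auto simp: T_def)
    ultimately show "\<exists>T. open T \<and> t \<in> T \<and> smooth_on T (\<lambda>t. inv_into D x (c t))"
      using T by blast
  qed
qed

lemma smooth_curveI:
  assumes I: "open I" and loc: "\<And>t. t \<in> I \<Longrightarrow> \<exists>T D x w. open T \<and> t \<in> T \<and> T \<subseteq> I \<and> local_param M A D x
      \<and> smooth_on T w \<and> w ` T \<subseteq> D \<and> (\<forall>r\<in>T. c r = x (w r))"
  shows "smooth_curve M A I c"
proof -
  have pre: "open {t \<in> I. c t \<in> W}" if W: "openin M W" for W
    unfolding open_subopen[of "{t \<in> I. c t \<in> W}"]
  proof
    fix t assume t: "t \<in> {t \<in> I. c t \<in> W}"
    then have "t \<in> I" by simp
    from loc[OF this] obtain T D x w where *: "open T" "t \<in> T" "T \<subseteq> I" "local_param M A D x"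
      "smooth_on T w" "w ` T \<subseteq> D" "\<forall>r\<in>T. c r = x (w r)" by (elim exE conjE) (rule that)
    have "open {r \<in> T. w r \<in> {z \<in> D. x z \<in> W}}"
      using continuous_open_preimage[OF smooth_on_continuous[OF *(5)] *(1) local_paramD(5)[OF *(4) W]]
      by (simp add: vimage_def Int_def)
    moreover have "{r \<in> T. w r \<in> {z \<in> D. x z \<in> W}} \<subseteq> {t \<in> I. c t \<in> W}" using *(3,7) by auto
    moreover have "t \<in> {r \<in> T. w r \<in> {z \<in> D. x z \<in> W}}" using t *(2,6,7) by auto
    ultimately show "\<exists>T. open T \<and> t \<in> T \<and> T \<subseteq> {t \<in> I. c t \<in> W}" by blast
  qed
  have "continuous_map (top_of_set I) M c"
    unfolding continuous_map_def
  proof (intro conjI allI impI)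
    show "c \<in> topspace (top_of_set I) \<rightarrow> topspace M"
    proof
      fix t assume "t \<in> topspace (top_of_set I)"
      then have "t \<in> I" by simp
      from loc[OF this] obtain T D x w where *: "t \<in> T" "local_param M A D x" "w ` T \<subseteq> D" "\<forall>r\<in>T. c r = x (w r)"
        by (elim exE conjE) (rule that)
      then show "c t \<in> topspace M" using local_paramD(3)[OF *(2)] by (metis image_subset_iff)
    qed
    fix W assume "openin M W"
    from pre[OF this] show "openin (top_of_set I) {t \<in> topspace (top_of_set I). c t \<in> W}"
      using openin_open_eq[OF I, of "{t \<in> I. c t \<in> W}"] by auto
  qed
  moreover have "\<forall>(E, y)\<in>A. smooth_on {t \<in> I. c t \<in> y ` E} (inv_into E y \<circ> c)"
  proof clarify
    fix E y assume "(E, y) \<in> A"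
    note ly = atlas_local_param[OF this]
    show "smooth_on {t \<in> I. c t \<in> y ` E} (inv_into E y \<circ> c)"
    proof (rule smooth_on_local)
      fix t assume t: "t \<in> {t \<in> I. c t \<in> y ` E}"
      then have "t \<in> I" by simp
      from loc[OF this] obtain T D x w where *: "open T" "t \<in> T" "T \<subseteq> I" "local_param M A D x"
        "smooth_on T w" "w ` T \<subseteq> D" "\<forall>r\<in>T. c r = x (w r)" by (elim exE conjE) (rule that)
      define T' where "T' = T \<inter> {t \<in> I. c t \<in> y ` E}"
      have T': "open T'" unfolding T'_def using pre[OF local_paramD(4)[OF ly local_paramD(1)[OF ly]]] *(1) by auto
      have "smooth_on T' (\<lambda>r. inv_into E y (x (w r)))"
        by (rule smooth_on_compose[OF T' open_overlap[OF *(4) ly] smooth_transition_local_param[OF *(4) ly]])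
          (use *(3,5,6,7) in \<open>auto simp: T'_def intro: smooth_on_subset\<close>)
      then have "smooth_on T' (inv_into E y \<circ> c)" by (rule smooth_on_cong[OF T']) (use *(7) in \<open>auto simp: T'_def\<close>)
      moreover have "t \<in> T'" using t *(2) by (auto simp: T'_def)
      ultimately show "\<exists>T. open T \<and> t \<in> T \<and> smooth_on T (inv_into E y \<circ> c)"
        using T' by blast
    qed
  qed
  ultimately show ?thesis unfolding smooth_curve_def ..
qed

text \<open>A change of parametrization multiplies the second fundamental form by the sign of the
  Jacobian, which is nonzero, and maps tangent vectors to tangent vectors. So the vanishing on the
  tangent vector does not depend on the chart, although the value may.\<close>

lemma second_ff_curve:
  assumes I: "open I" and c: "smooth_curve M A I c" and x: "local_param M A D x" and y: "local_param M A E y"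
    and t: "t \<in> I" "c t \<in> x ` D" "c t \<in> y ` E"
  defines "w \<equiv> \<lambda>t. inv_into D x (c t)" and "w' \<equiv> \<lambda>t. inv_into E y (c t)"
  shows "second_ff (\<lambda>z. f (x z)) (w t) (vector_derivative w (at t)) (vector_derivative w (at t)) = 0 \<longleftrightarrow>
    second_ff (\<lambda>z. f (y z)) (w' t) (vector_derivative w' (at t)) (vector_derivative w' (at t)) = 0"
proof -
  define \<phi> where "\<phi> = (\<lambda>z. inv_into E y (x z))"
  define T where "T = {t \<in> I. c t \<in> x ` D} \<inter> {t \<in> I. c t \<in> y ` E}"
  note cx = smooth_curve_param[OF I c x]
  have T: "open T" "t \<in> T" unfolding T_def using cx(1) smooth_curve_param(1)[OF I c y] t by auto
  have m: "w r \<in> D \<and> x (w r) = c r" if "r \<in> T" for r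
    using that by (auto simp: T_def w_def inv_into_into f_inv_into_f)
  have ww: "\<phi> (w r) = w' r" if "r \<in> T" for r using m[OF that] by (simp add: \<phi>_def w'_def)
  have zt: "w t \<in> D" "x (w t) \<in> y ` E" using m[OF T(2)] t by auto
  have dw: "(w has_vector_derivative vector_derivative w (at t)) (at t)"
    unfolding w_def by (rule smooth_on_has_vector_derivative[OF cx(2)]) (use t in simp)
  have d\<phi>: "\<phi> differentiable at (w t)"
    using smooth_on_differentiable[OF smooth_transition_local_param[OF x y]] zt by (simp add: \<phi>_def)
  have "((\<lambda>r. \<phi> (w r)) has_vector_derivative frechet_derivative \<phi> (at (w t)) (vector_derivative w (at t))) (at t)"
    using vector_derivative_diff_chain_within[OF dw has_derivative_at_withinI[OF d\<phi>[unfolded frechet_derivative_works]]]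
    by (simp add: o_def)
  then have "(w' has_vector_derivative frechet_derivative \<phi> (at (w t)) (vector_derivative w (at t))) (at t)"
    by (rule has_vector_derivative_transform_within_open[OF _ T]) (rule ww)
  then have dw': "vector_derivative w' (at t) = frechet_derivative \<phi> (at (w t)) (vector_derivative w (at t))"
    by (rule vector_derivative_at)
  show ?thesis
    unfolding second_ff_change[OF x y zt] \<phi>_def[symmetric] ww[OF T(2), unfolded \<phi>_def] dw'
    using transition_jacobian[OF x y zt, folded \<phi>_def] by (simp add: sgn_eq_0_iff)
qed

lemma asymptotic_curve_param:
  assumes I: "open I" and c: "asymptotic_curve M A f I c" and x: "local_param M A D x" and t: "t \<in> I" "c t \<in> x ` D"
  defines "w \<equiv> \<lambda>t. inv_into D x (c t)"
  shows "second_ff (\<lambda>z. f (x z)) (w t) (vector_derivative w (at t)) (vector_derivative w (at t)) = 0"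
proof -
  have sc: "smooth_curve M A I c" using c by (simp add: asymptotic_curve_def)
  have "c t \<in> topspace M" using local_paramD(3)[OF x] t by auto
  then obtain E y z where y: "(E, y) \<in> A" "z \<in> E" "c t = y z" by (rule atlas_cover)
  have "second_ff (\<lambda>z. f (y z)) (inv_into E y (c t)) (vector_derivative (\<lambda>t. inv_into E y (c t)) (at t))
      (vector_derivative (\<lambda>t. inv_into E y (c t)) (at t)) = 0"
    using c y t unfolding asymptotic_curve_def Let_def o_def by fastforce
  then show ?thesis
    using second_ff_curve[OF I sc x atlas_local_param[OF y(1)] t] y unfolding w_def by auto
qed

lemma asymptotic_curveI:
  assumes I: "open I" and x: "local_param M A D x" and w: "smooth_on I w" "w ` I \<subseteq> D" "\<And>t. t \<in> I \<Longrightarrow> c t = x (w t)"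
    and us: "unit_speed_curve I (f \<circ> c)"
    and II: "\<And>t. t \<in> I \<Longrightarrow> second_ff (\<lambda>z. f (x z)) (w t) (vector_derivative w (at t)) (vector_derivative w (at t)) = 0"
  shows "asymptotic_curve M A f I c"
  unfolding asymptotic_curve_def
proof (intro conjI us)
  show sc: "smooth_curve M A I c"
    by (rule smooth_curveI[OF I]) (use I x w in blast)
  have wt: "inv_into D x (c t) = w t" if "t \<in> I" for t
    using w that local_paramD(2)[OF x] by (simp add: image_subset_iff)
  show "\<forall>(E, y)\<in>A. \<forall>t\<in>I. c t \<in> y ` E \<longrightarrow> (let w = inv_into E y \<circ> c; T = vector_derivative w (at t)
         in second_ff (f \<circ> y) (w t) T T = 0)"
  proof safe
    fix E y t z assume y: "(E, y) \<in> A" and t: "t \<in> I" "c t = y z" "z \<in> E"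
    have "c t \<in> x ` D" unfolding w(3)[OF t(1)] using w(2) t(1) by blast
    moreover have "vector_derivative (\<lambda>t. inv_into D x (c t)) (at t) = vector_derivative w (at t)"
    proof (rule vector_derivative_at)
      show "((\<lambda>t. inv_into D x (c t)) has_vector_derivative vector_derivative w (at t)) (at t)"
        by (rule has_vector_derivative_transform_within_open[OF smooth_on_has_vector_derivative[OF w(1) t(1)] I t(1)])
          (simp add: wt)
    qed
    ultimately show "let w = inv_into E y \<circ> c; T = vector_derivative w (at t) in second_ff (f \<circ> y) (w t) T T = 0"
      using second_ff_curve[OF I sc x atlas_local_param[OF y] t(1)] II[OF t(1)] t(2,3) wt[OF t(1)]
      unfolding Let_def o_def by auto
  qed
qed

end

section \<open>Asymptotic product charts\<close>

lemma vector_in_rect [simp]: "vector [s, t] \<in> rect I J \<longleftrightarrow> s \<in> I \<and> t \<in> J"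
  by (simp add: rect_def)

lemma smooth_on_vector2:
  "open S \<Longrightarrow> smooth_on S p \<Longrightarrow> smooth_on S q \<Longrightarrow> smooth_on S (\<lambda>z. vector [p z, q z] :: real^2)"
  unfolding vector2_eq by (intro smooth_on_add smooth_on_scaleR smooth_on_const)

lemma smooth_on_coordinate:
  assumes "open S" "open I" "smooth_on I h" "\<And>z. z \<in> S \<Longrightarrow> z $ i \<in> I"
  shows "smooth_on S (\<lambda>z::real^2. h (z $ i))"
  by (rule smooth_on_compose[OF assms(1,2,3)]) (use assms in \<open>auto intro: smooth_on_vec_nth smooth_on_id\<close>)

lemma rect_neighbourhood:
  assumes "open \<Omega>" "w \<in> \<Omega>"
  obtains e where "e > 0" "rect (ball (w $ 1) e) (ball (w $ 2) e) \<subseteq> \<Omega>"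
proof -
  obtain e where e: "e > 0" "ball w e \<subseteq> \<Omega>" using assms openE by blast
  have "z \<in> \<Omega>" if z: "z \<in> rect (ball (w $ 1) (e/2)) (ball (w $ 2) (e/2))" for z
  proof -
    have "dist w z \<le> \<bar>w $ 1 - z $ 1\<bar> + \<bar>w $ 2 - z $ 2\<bar>"
      using dist_vector2[of "w $ 1" "w $ 2" "z $ 1" "z $ 2"] by simp
    then show ?thesis using z e(2) by (auto simp: rect_def dist_real_def)
  qed
  then show ?thesis using e(1) by (intro that[of "e/2"]) auto
qed

lemma open_interval_ball: "e > 0 \<Longrightarrow> open_interval (ball (r::real) e)"
  by (auto simp: open_interval_def is_interval_ball_real)

text \<open>After rescaling and reparametrizing, the derivative of a velocity still lies in the span
  of the old velocity and its derivative. Hence arc length and reflections preserve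
  \<open>straight\<close>.\<close>

lemma scaled_derivative_orthogonal:
  fixes U :: "real \<Rightarrow> real^3"
  assumes I: "open I" "r \<in> I" and W: "\<And>r. r \<in> I \<Longrightarrow> W r = d r *\<^sub>R U (S r)"
    and d: "(d has_real_derivative d') (at r)" and S: "(S has_real_derivative S') (at r)"
    and U: "(U has_vector_derivative dU) (at (S r))" and n: "U (S r) \<bullet> n = 0" "dU \<bullet> n = 0"
  shows "vector_derivative W (at r) \<bullet> n = 0"
proof -
  have "((\<lambda>r. U (S r)) has_vector_derivative S' *\<^sub>R dU) (at r)"
    using vector_diff_chain_at[OF S[unfolded has_real_derivative_iff_has_vector_derivative] U] by (simp add: o_def)
  from has_vector_derivative_scaleR[OF d this]
  have "(W has_vector_derivative d r *\<^sub>R S' *\<^sub>R dU + d' *\<^sub>R U (S r)) (at r)"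
    by (rule has_vector_derivative_transform_within_open[OF _ I]) (simp add: W)
  then show ?thesis using n by (simp add: vector_derivative_at inner_add_left)
qed

text \<open>If the velocity has constant direction \<open>u\<close>, then a(s) times
  \<open>circle u (- \<sigma> s)\<close> has derivative zero; the factors commute because both lie
  along \<open>u\<close>.\<close>

lemma great_circle_left:
  assumes I: "open_interval I" and a: "smooth_on I a" "a ` I \<subseteq> S3" and u: "norm u = 1"
    and U: "\<And>s. s \<in> I \<Longrightarrow> left_vel a s = m s *\<^sub>R u" and \<sigma>: "\<And>s. s \<in> I \<Longrightarrow> (\<sigma> has_real_derivative m s) (at s)"
  obtains g where "g \<in> S3" "\<And>s. s \<in> I \<Longrightarrow> a s = g \<odot> circle u (\<sigma> s)"
proof -
  have oI: "open I" "connected I" "I \<noteq> {}" using I by (auto simp: open_interval_def is_interval_connected_1)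
  obtain c where c: "c \<in> I" using oI by blast
  define e where "e s = a s \<odot> circle u (- \<sigma> s)" for s
  have "(e has_derivative (\<lambda>x. 0)) (at s)" if s: "s \<in> I" for s
  proof -
    have "((\<lambda>s. - \<sigma> s) has_real_derivative - m s) (at s)" using \<sigma>[OF s] by (rule DERIV_minus)
    from circle_compose_deriv[OF u this]
    have "(e has_vector_derivative a s \<odot> (- m s *\<^sub>R (circle u (- \<sigma> s) \<odot> (0, u))) + velocity a s \<odot> circle u (- \<sigma> s)) (at s)"
      unfolding e_def[abs_def] by (rule qm.has_vector_derivative[OF has_velocity[OF a(1) s]])
    moreover have "velocity a s = m s *\<^sub>R (a s \<odot> (0, u))"
      unfolding velocity_left_right(1)[OF oI(1) a s] U[OF s] qm.scaleR_right[symmetric] by simp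
    ultimately have "(e has_vector_derivative 0) (at s)"
      by (simp add: qm.scaleR_right qm.scaleR_left qm.minus_right qmult_assoc circle_commute)
    then show ?thesis by (simp add: has_vector_derivative_def)
  qed
  then have ec: "e s = e c" if "s \<in> I" for s
    using has_derivative_zero_unique_connected[OF oI(1,2) _ that c] by blast
  have S3: "circle u \<theta> \<in> S3" for \<theta> by (rule circle_S3[OF u])
  show ?thesis
  proof
    show "e c \<in> S3" unfolding e_def using a(2) c by (intro S3_qmult S3) auto
    fix s assume s: "s \<in> I"
    have "e s \<odot> circle u (\<sigma> s) = a s"
      unfolding e_def using qconj_cancel(4)[OF S3, of "a s" "- \<sigma> s"] by (simp add: qconj_circle)
    then show "a s = e c \<odot> circle u (\<sigma> s)" unfolding ec[OF s] by simp
  qed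
qed

lemma great_circle_right:
  assumes J: "open_interval J" and b: "smooth_on J b" "b ` J \<subseteq> S3" and u: "norm u = 1"
    and V: "\<And>s. s \<in> J \<Longrightarrow> right_vel b s = m s *\<^sub>R u" and \<sigma>: "\<And>s. s \<in> J \<Longrightarrow> (\<sigma> has_real_derivative m s) (at s)"
  obtains g where "g \<in> S3" "\<And>s. s \<in> J \<Longrightarrow> b s = circle u (\<sigma> s) \<odot> g"
proof -
  have oJ: "open J" using J by (simp add: open_interval_def)
  define a where "a = (\<lambda>s. qconj (b s))"
  have a: "smooth_on J a" "a ` J \<subseteq> S3"
    unfolding a_def using b(2) S3_qconj bounded_linear.smooth_on[OF bounded_linear_qconj oJ b(1)] by blast+
  have U: "left_vel a s = m s *\<^sub>R (- u)" if "s \<in> J" for s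
    unfolding a_def using right_vel_qconj[OF oJ b that] V[OF that] by simp
  obtain g where g: "g \<in> S3" "\<And>s. s \<in> J \<Longrightarrow> a s = g \<odot> circle (- u) (\<sigma> s)"
    using great_circle_left[OF J a _ U \<sigma>] u by (metis norm_minus_cancel)
  show ?thesis
  proof
    show "qconj g \<in> S3" by (rule S3_qconj[OF g(1)])
    fix s assume "s \<in> J"
    from arg_cong[OF g(2)[OF this], of qconj] show "b s = circle u (\<sigma> s) \<odot> qconj g"
      unfolding a_def qconj_qmult qconj_qconj by (simp add: qconj_circle) (simp add: circle_def)
  qed
qed

section \<open>Product parametrizations and their asymptotic normal form\<close>

context immersed
begin

lemma product_paramD:
  assumes "product_param M A f I J a b x"
  shows "open_interval I" "open_interval J" "open I" "open J" "smooth_on I a" "smooth_on J b" "a ` I \<subseteq> S3" "b ` J \<subseteq> S3"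
    "local_param M A (rect I J) x" "\<And>z. z \<in> rect I J \<Longrightarrow> f (x z) = a (z $ 1) \<odot> b (z $ 2)" "product_surface I J a b"
proof -
  note p = assms[unfolded product_param_def]
  show "open_interval I" "open_interval J" "open I" "open J" "smooth_on I a" "smooth_on J b" "a ` I \<subseteq> S3" "b ` J \<subseteq> S3"
    "local_param M A (rect I J) x"
    using p by (auto simp: open_interval_def)
  show "product_surface I J a b" using p by unfold_locales (auto simp: open_interval_def)
  fix z assume "z \<in> rect I J"
  then have "z $ 1 \<in> I" "z $ 2 \<in> J" by (auto simp: rect_def)
  then have "f (x (vector [z $ 1, z $ 2])) = a (z $ 1) \<odot> b (z $ 2)" using p by blast
  then show "f (x z) = a (z $ 1) \<odot> b (z $ 2)" by simp
qed

lemma product_paramI: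
  assumes "open_interval I" "open_interval J" "smooth_on I a" "smooth_on J b" "a ` I \<subseteq> S3" "b ` J \<subseteq> S3"
    "local_param M A (rect I J) x" "\<And>z. z \<in> rect I J \<Longrightarrow> f (x z) = a (z $ 1) \<odot> b (z $ 2)"
  shows "product_param M A f I J a b x"
  unfolding product_param_def using assms by simp

text \<open>The Gram determinant of a product is the squared norm of this cross product, so this is
  the immersion property.\<close>

lemma product_cross:
  assumes p: "product_param M A f I J a b x" and st: "s \<in> I" "t \<in> J"
  shows "cross3 (left_vel a s) (right_vel b t) \<noteq> 0"
proof -
  note D = product_paramD[OF p]
  interpret product_surface I J a b by (rule D(11))
  have z: "vector [s, t] \<in> rect I J" using st by simp
  have "pd i (\<lambda>z. f (x z)) (vector [s, t]) = pd i X (vector [s, t])" for i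
    by (rule pd_cong[OF open_rect[OF D(3,4)] z]) (simp add: D(10) X_def)
  then have "det (first_ff (\<lambda>z. f (x z)) (vector [s, t])) = det (first_ff X (vector [s, t]))" by (simp add: det_first_ff)
  then show ?thesis using smooth_immersion(2)[OF D(9) z] det_first_ff_X[OF z] by auto
qed

lemma product_second_ff:
  assumes p: "product_param M A f I J a b x" and z: "z \<in> rect I J"
  defines "c \<equiv> cross3 (left_vel a (z $ 1)) (right_vel b (z $ 2))"
  shows "second_ff (\<lambda>z. f (x z)) z v w * norm c = v $ 1 * w $ 1 * (vector_derivative (left_vel a) (at (z $ 1)) \<bullet> c)
    + (v $ 1 * w $ 2 + v $ 2 * w $ 1) * (c \<bullet> c) + v $ 2 * w $ 2 * (vector_derivative (right_vel b) (at (z $ 2)) \<bullet> c)"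
proof -
  note D = product_paramD[OF p]
  interpret product_surface I J a b by (rule D(11))
  have "second_ff (\<lambda>z. f (x z)) z = second_ff X z"
    by (rule second_ff_cong[OF open_rect[OF D(3,4)] z]) (simp add: D(10) X_def)
  then show ?thesis using second_ff_X[OF z] product_cross[OF p memR[OF z]] by (simp add: c_def)
qed

lemma product_gauss:
  assumes p: "product_param M A f I J a b x" and st: "s \<in> I" "t \<in> J"
    and K: "gauss_curvature (\<lambda>z. f (x z)) (vector [s, t]) = K"
  defines "c \<equiv> cross3 (left_vel a s) (right_vel b t)"
  shows "K * (c \<bullet> c)\<^sup>2 = (vector_derivative (left_vel a) (at s) \<bullet> c) * (vector_derivative (right_vel b) (at t) \<bullet> c)"
proof -
  note D = product_paramD[OF p]
  interpret product_surface I J a b by (rule D(11))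
  have z: "vector [s, t] \<in> rect I J" using st by simp
  have "gauss_curvature (\<lambda>z. f (x z)) (vector [s, t]) = gauss_curvature X (vector [s, t])"
    by (rule gauss_curvature_cong[OF open_rect[OF D(3,4)] z]) (simp add: D(10) X_def)
  then show ?thesis using gauss_X[OF z product_cross[OF p memR]] K by (simp add: c_def)
qed

text \<open>By \<open>product_second_ff\<close>, straight means that the coordinate curves are asymptotic.\<close>

definition straight where
  "straight I J a b \<longleftrightarrow> (\<forall>s\<in>I. \<forall>t\<in>J.
     vector_derivative (left_vel a) (at s) \<bullet> cross3 (left_vel a s) (right_vel b t) = 0 \<and>
     vector_derivative (right_vel b) (at t) \<bullet> cross3 (left_vel a s) (right_vel b t) = 0)"

text \<open>Both coordinate families consist of unit speed asymptotic curves, that is, the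
  coordinates form an asymptotic Chebyshev net. Such coordinates are rigid: two of them differ by
  translations and reflections only (\<open>adapted_germ\<close>), which makes continuation
  possible.\<close>

definition adapted where
  "adapted I J a b x \<longleftrightarrow> product_param M A f I J a b x \<and> straight I J a b \<and>
     (\<forall>s\<in>I. norm (velocity a s) = 1) \<and> (\<forall>t\<in>J. norm (velocity b t) = 1)"

text \<open>Each factor is reparametrized by its own arc length. Translates of a factor have the
  same speed, so all coordinate curves become unit speed at once.\<close>

lemma normalize_speed:
  assumes p: "product_param M A f I J a b x" and st: "straight I J a b" and s0: "s0 \<in> I" and t0: "t0 \<in> J"
  obtains I' J' a' b' x' s1 t1 where "adapted I' J' a' b' x'" "s1 \<in> I'" "t1 \<in> J'" "x (vector [s0, t0]) = x' (vector [s1, t1])"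
proof -
  note D = product_paramD[OF p]
  define m n where "m s = norm (left_vel a s)" and "n t = norm (right_vel b t)" for s t
  have U0: "left_vel a s \<noteq> 0" if "s \<in> I" for s using product_cross[OF p that t0] by auto
  have V0: "right_vel b t \<noteq> 0" if "t \<in> J" for t using product_cross[OF p s0 that] by auto
  have smm: "smooth_on I m" "smooth_on J n"
    unfolding m_def[abs_def] n_def[abs_def]
    by (intro smooth_on_norm D smooth_on_left_vel smooth_on_right_vel U0 V0; assumption)+
  have m0: "m s > 0" if "s \<in> I" for s using U0[OF that] by (simp add: m_def)
  have n0: "n t > 0" if "t \<in> J" for t using V0[OF that] by (simp add: n_def)
  obtain \<sigma> S where \<sigma>: "smooth_on I \<sigma>" "open_interval (\<sigma> ` I)" "smooth_on (\<sigma> ` I) S"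
    "\<And>s. s \<in> I \<Longrightarrow> S (\<sigma> s) = s" "\<And>r. r \<in> \<sigma> ` I \<Longrightarrow> \<sigma> (S r) = r \<and> S r \<in> I"
    "\<And>s. s \<in> I \<Longrightarrow> (\<sigma> has_real_derivative m s) (at s)"
    "\<And>r. r \<in> \<sigma> ` I \<Longrightarrow> (S has_real_derivative 1 / m (S r)) (at r)"
    using arclength_parameter[OF D(1) smm(1) m0] by blast
  obtain \<tau> T where \<tau>: "smooth_on J \<tau>" "open_interval (\<tau> ` J)" "smooth_on (\<tau> ` J) T"
    "\<And>s. s \<in> J \<Longrightarrow> T (\<tau> s) = s" "\<And>r. r \<in> \<tau> ` J \<Longrightarrow> \<tau> (T r) = r \<and> T r \<in> J"
    "\<And>s. s \<in> J \<Longrightarrow> (\<tau> has_real_derivative n s) (at s)"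
    "\<And>r. r \<in> \<tau> ` J \<Longrightarrow> (T has_real_derivative 1 / n (T r)) (at r)"
    using arclength_parameter[OF D(2) smm(2) n0] by blast
  define I' J' where "I' = \<sigma> ` I" and "J' = \<tau> ` J"
  have oI': "open I'" "open J'" using \<sigma>(2) \<tau>(2) by (auto simp: open_interval_def I'_def J'_def)
  define a' b' where "a' = (\<lambda>r. a (S r))" and "b' = (\<lambda>r. b (T r))"
  have S': "S r \<in> I" "(S has_real_derivative 1 / m (S r)) (at r)" if "r \<in> I'" for r
    using \<sigma>(5,7) that by (auto simp: I'_def)
  have T': "T r \<in> J" "(T has_real_derivative 1 / n (T r)) (at r)" if "r \<in> J'" for r
    using \<tau>(5,7) that by (auto simp: J'_def)
  have sma': "smooth_on I' a'" unfolding a'_def I'_def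
    by (rule smooth_on_compose[OF oI'(1)[unfolded I'_def] D(3,5) \<sigma>(3)]) (use \<sigma>(5) in blast)
  have smb': "smooth_on J' b'" unfolding b'_def J'_def
    by (rule smooth_on_compose[OF oI'(2)[unfolded J'_def] D(4,6) \<tau>(3)]) (use \<tau>(5) in blast)
  define \<theta> \<eta> where "\<theta> z = (vector [S (z $ 1), T (z $ 2)] :: real^2)" and "\<eta> z = (vector [\<sigma> (z $ 1), \<tau> (z $ 2)] :: real^2)" for z :: "real^2"
  have lp: "local_param M A (rect I' J') (\<lambda>z. x (\<theta> z))"
  proof (rule local_param_compose[OF D(9) open_rect[OF oI'] _ _ open_rect[OF D(3,4)] subset_refl])
    show "smooth_on (rect I' J') \<theta>" unfolding \<theta>_def[abs_def]
      by (intro smooth_on_vector2 smooth_on_coordinate[where I = I'] smooth_on_coordinate[where I = J'] open_rect oI')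
       (use \<sigma>(3) \<tau>(3) in \<open>auto simp: I'_def J'_def rect_def\<close>)
    show "\<theta> ` rect I' J' \<subseteq> rect I J" using S' T' by (auto simp: \<theta>_def rect_def)
    show "smooth_on (rect I J) \<eta>" unfolding \<eta>_def[abs_def]
      by (intro smooth_on_vector2 smooth_on_coordinate[where I = I] smooth_on_coordinate[where I = J] open_rect D(3,4) \<sigma>(1) \<tau>(1))
       (auto simp: rect_def)
    show "\<eta> (\<theta> z) = z" if "z \<in> rect I' J'" for z using that \<sigma>(5) \<tau>(5) by (simp add: \<eta>_def \<theta>_def rect_def I'_def J'_def)
    show "\<theta> (\<eta> w) = w" if "w \<in> rect I J" for w using that \<sigma>(4) \<tau>(4) by (simp add: \<eta>_def \<theta>_def rect_def)
  qed
  have lv: "velocity a' r = (1 / m (S r)) *\<^sub>R velocity a (S r)" "left_vel a' r = (1 / m (S r)) *\<^sub>R left_vel a (S r)" if "r \<in> I'" for r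
    unfolding a'_def using left_vel_reparam(1,2)[OF D(3,5,7) S'(2)[OF that] S'(1)[OF that]] by simp_all
  have rv: "velocity b' r = (1 / n (T r)) *\<^sub>R velocity b (T r)" "right_vel b' r = (1 / n (T r)) *\<^sub>R right_vel b (T r)" if "r \<in> J'" for r
    unfolding b'_def using left_vel_reparam(1,3)[OF D(4,6,8) T'(2)[OF that] T'(1)[OF that]] by simp_all
  have dm: "((\<lambda>r. 1 / m (S r)) has_real_derivative deriv (\<lambda>r. 1 / m (S r)) r) (at r)" if "r \<in> I'" for r
  proof -
    have "smooth_on I' (\<lambda>r. 1 / m (S r))"
      by (intro smooth_on_divide smooth_on_const smooth_on_compose[OF oI'(1) D(3) smm(1)] oI' \<sigma>(3)[folded I'_def])
        (use m0 S' in \<open>auto simp: less_imp_neq[symmetric]\<close>)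
    then show ?thesis using smooth_on_differentiable that DERIV_deriv_iff_real_differentiable by blast
  qed
  have dn: "((\<lambda>r. 1 / n (T r)) has_real_derivative deriv (\<lambda>r. 1 / n (T r)) r) (at r)" if "r \<in> J'" for r
  proof -
    have "smooth_on J' (\<lambda>r. 1 / n (T r))"
      by (intro smooth_on_divide smooth_on_const smooth_on_compose[OF oI'(2) D(4) smm(2)] oI' \<tau>(3)[folded J'_def])
        (use n0 T' in \<open>auto simp: less_imp_neq[symmetric]\<close>)
    then show ?thesis using smooth_on_differentiable that DERIV_deriv_iff_real_differentiable by blast
  qed
  have pp: "product_param M A f I' J' a' b' (\<lambda>z. x (\<theta> z))"
  proof (rule product_paramI[OF \<sigma>(2)[folded I'_def] \<tau>(2)[folded J'_def] sma' smb' _ _ lp])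
    show "a' ` I' \<subseteq> S3" "b' ` J' \<subseteq> S3" using D(7,8) S'(1) T'(1) unfolding a'_def b'_def by blast+
    fix z assume "z \<in> rect I' J'"
    then have "\<theta> z \<in> rect I J" using S' T' by (auto simp: \<theta>_def rect_def)
    then show "f (x (\<theta> z)) = a' (z $ 1) \<odot> b' (z $ 2)" using D(10) by (simp add: \<theta>_def a'_def b'_def)
  qed
  have st': "straight I' J' a' b'"
    unfolding straight_def
  proof (intro ballI conjI)
    fix r q assume rq: "r \<in> I'" "q \<in> J'"
    note s1 = st[unfolded straight_def, rule_format, OF S'(1)[OF rq(1)] T'(1)[OF rq(2)]]
    define c where "c = cross3 (left_vel a' r) (right_vel b' q)"
    have c: "c = (1 / m (S r) * (1 / n (T q))) *\<^sub>R cross3 (left_vel a (S r)) (right_vel b (T q))"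
      unfolding c_def lv(2)[OF rq(1)] rv(2)[OF rq(2)] by (simp add: cross_mult_left cross_mult_right)
    show "vector_derivative (left_vel a') (at r) \<bullet> c = 0"
      by (rule scaled_derivative_orthogonal[OF oI'(1) rq(1) lv(2) dm[OF rq(1)] S'(2)[OF rq(1)]
            smooth_on_has_vector_derivative[OF smooth_on_left_vel[OF D(3,5)] S'(1)[OF rq(1)]]])
        (use s1 in \<open>simp_all add: c dot_cross_self\<close>)
    show "vector_derivative (right_vel b') (at q) \<bullet> c = 0"
      by (rule scaled_derivative_orthogonal[OF oI'(2) rq(2) rv(2) dn[OF rq(2)] T'(2)[OF rq(2)]
            smooth_on_has_vector_derivative[OF smooth_on_right_vel[OF D(4,6)] T'(1)[OF rq(2)]]])
        (use s1 in \<open>simp_all add: c dot_cross_self\<close>)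
  qed
  have "norm (velocity a' r) = 1" if "r \<in> I'" for r
    using lv(1)[OF that] velocity_left_right(3)[OF D(3,5,7) S'(1)[OF that]] m0[OF S'(1)[OF that]] by (simp add: m_def)
  moreover have "norm (velocity b' r) = 1" if "r \<in> J'" for r
    using rv(1)[OF that] velocity_left_right(4)[OF D(4,6,8) T'(1)[OF that]] n0[OF T'(1)[OF that]] by (simp add: n_def)
  ultimately have ad: "adapted I' J' a' b' (\<lambda>z. x (\<theta> z))" using pp st' by (simp add: adapted_def)
  show ?thesis
    by (rule that[OF ad, of "\<sigma> s0" "\<tau> t0"]) (use s0 t0 \<sigma>(4) \<tau>(4) in \<open>auto simp: I'_def J'_def \<theta>_def\<close>)
qed

text \<open>Here a(s) = g exp(\<sigma>(s) u) runs on a great circle, so a(s) b(t) = g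
  exp((\<sigma>(s) - h(t)) u) (exp(h(t) u) b(t)). With r = \<sigma>(s) - h(t) and t as new
  coordinates this is again a product. The first factor has constant velocity \<open>u\<close>, and
  \<open>h\<close> is chosen by \<open>straighten_right\<close> so that the second one is
  straight.\<close>

lemma shear_left:
  assumes p: "product_param M A f I J a b x" and s0: "s0 \<in> I" and t0: "t0 \<in> J"
    and u: "norm u = 1" "\<And>s. s \<in> I \<Longrightarrow> left_vel a s = norm (left_vel a s) *\<^sub>R u"
  obtains I' J' a' b' x' s1 t1 where "product_param M A f I' J' a' b' x'" "straight I' J' a' b'"
    "s1 \<in> I'" "t1 \<in> J'" "x (vector [s0, t0]) = x' (vector [s1, t1])"
proof -
  note D = product_paramD[OF p]
  define m where "m s = norm (left_vel a s)" for s
  have U0: "left_vel a s \<noteq> 0" if "s \<in> I" for s using product_cross[OF p that t0] by auto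
  have smm: "smooth_on I m"
    unfolding m_def[abs_def] by (intro smooth_on_norm D smooth_on_left_vel U0; assumption)
  have m0: "m s > 0" if "s \<in> I" for s using U0[OF that] by (simp add: m_def)
  obtain \<sigma> S where \<sigma>: "smooth_on I \<sigma>" "open_interval (\<sigma> ` I)" "smooth_on (\<sigma> ` I) S"
    "\<And>s. s \<in> I \<Longrightarrow> S (\<sigma> s) = s" "\<And>r. r \<in> \<sigma> ` I \<Longrightarrow> \<sigma> (S r) = r \<and> S r \<in> I"
    "\<And>s. s \<in> I \<Longrightarrow> (\<sigma> has_real_derivative m s) (at s)"
    "\<And>r. r \<in> \<sigma> ` I \<Longrightarrow> (S has_real_derivative 1 / m (S r)) (at r)"
    using arclength_parameter[OF D(1) smm m0] by blast
  obtain g where g: "g \<in> S3" "\<And>s. s \<in> I \<Longrightarrow> a s = g \<odot> circle u (\<sigma> s)"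
    using great_circle_left[OF D(1,5,7) u(1) u(2)[folded m_def] \<sigma>(6)] by blast
  have "cross3 u (right_vel b t) \<noteq> 0" if t: "t \<in> J" for t
  proof
    assume "cross3 u (right_vel b t) = 0"
    then have "cross3 (left_vel a s0) (right_vel b t) = 0" by (subst u(2)[OF s0]) (simp add: cross_mult_left)
    then show False using product_cross[OF p s0 t] by simp
  qed
  then obtain h where h: "smooth_on J h"
    "\<And>t. t \<in> J \<Longrightarrow> vector_derivative (right_vel (\<lambda>t. circle u (h t) \<odot> b t)) (at t)
      \<bullet> cross3 u (right_vel (\<lambda>t. circle u (h t) \<odot> b t) t) = 0"
    using straighten_right[OF D(4) _ D(6,8) u(1)] D(2) unfolding open_interval_def by blast
  define a' b' where "a' r = g \<odot> circle u r" and "b' t = circle u (h t) \<odot> b t" for r t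
  \<comment> \<open>The sheared image of a rectangle is no rectangle; a small square around the
    image \<open>w\<close> of the given point is cut out of it.\<close>
  define \<Omega> where "\<Omega> = {z::real^2. z $ 2 \<in> J} \<inter> (\<lambda>z. z $ 1 + h (z $ 2)) -` (\<sigma> ` I)"
  have o\<sigma>: "open (\<sigma> ` I)" using \<sigma>(2) by (simp add: open_interval_def)
  have oJ2: "open {z::real^2. z $ 2 \<in> J}"
    using open_vimage[OF D(4), of "\<lambda>z::real^2. z $ 2"] by (simp add: vimage_def continuous_on_component)
  have smh: "smooth_on {z::real^2. z $ 2 \<in> J} (\<lambda>z. z $ 1 + h (z $ 2))"
    by (intro smooth_on_add smooth_on_coordinate[OF _ D(4) h(1)] smooth_on_vec_nth smooth_on_id oJ2) simp
  have o\<Omega>: "open \<Omega>" unfolding \<Omega>_def by (rule continuous_open_preimage[OF smooth_on_continuous[OF smh] oJ2 o\<sigma>])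
  define w where "w = (vector [\<sigma> s0 - h t0, t0] :: real^2)"
  have "w \<in> \<Omega>" using s0 t0 by (simp add: w_def \<Omega>_def)
  then obtain e where e: "e > 0" "rect (ball (w $ 1) e) (ball (w $ 2) e) \<subseteq> \<Omega>" using rect_neighbourhood[OF o\<Omega>] by blast
  define I' J' where "I' = ball (w $ 1) e" and "J' = ball (w $ 2) e"
  have oI: "open_interval I'" "open_interval J'" "open I'" "open J'"
    using e(1) open_interval_ball by (auto simp: I'_def J'_def)
  have sub: "z $ 2 \<in> J" "z $ 1 + h (z $ 2) \<in> \<sigma> ` I" if "z \<in> rect I' J'" for z
    using that e(2) by (auto simp: I'_def J'_def \<Omega>_def)
  have J'J: "t \<in> J" if "t \<in> J'" for t using sub(1)[of "vector [w $ 1, t]"] that e(1) by (simp add: I'_def)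
  define \<theta> \<eta> where "\<theta> z = (vector [S (z $ 1 + h (z $ 2)), z $ 2] :: real^2)"
    and "\<eta> z = (vector [\<sigma> (z $ 1) - h (z $ 2), z $ 2] :: real^2)" for z :: "real^2"
  note R = open_rect[OF oI(3,4)]
  have lp: "local_param M A (rect I' J') (\<lambda>z. x (\<theta> z))"
  proof (rule local_param_compose[OF D(9) R _ _ open_rect[OF D(3,4)] subset_refl])
    have 1: "smooth_on (rect I' J') (\<lambda>z. z $ 1 + h (z $ 2))"
      by (rule smooth_on_subset[OF smh]) (use sub in auto)
    show "smooth_on (rect I' J') \<theta>" unfolding \<theta>_def[abs_def]
      by (intro smooth_on_vector2 smooth_on_compose[OF R o\<sigma> \<sigma>(3) 1] smooth_on_vec_nth smooth_on_id R) (use sub in auto)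
    show "\<theta> ` rect I' J' \<subseteq> rect I J" using sub \<sigma>(5) by (auto simp: \<theta>_def rect_def)
    show "smooth_on (rect I J) \<eta>" unfolding \<eta>_def[abs_def]
      by (intro smooth_on_vector2 smooth_on_diff smooth_on_coordinate[where I = I] smooth_on_coordinate[where I = J]
          smooth_on_vec_nth smooth_on_id open_rect D(3,4) \<sigma>(1) h(1)) (auto simp: rect_def)
    show "\<eta> (\<theta> z) = z" if "z \<in> rect I' J'" for z using sub[OF that] \<sigma>(5) by (simp add: \<eta>_def \<theta>_def)
    show "\<theta> (\<eta> w) = w" if "w \<in> rect I J" for w using that \<sigma>(4) by (simp add: \<eta>_def \<theta>_def rect_def)
  qed
  have pp: "product_param M A f I' J' a' b' (\<lambda>z. x (\<theta> z))"
  proof (rule product_paramI[OF oI(1,2) _ _ _ _ lp])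
    show "smooth_on I' a'" unfolding a'_def[abs_def]
      by (intro qm.smooth_on smooth_on_const smooth_on_circle_compose smooth_on_id oI)
    show "smooth_on J' b'" unfolding b'_def[abs_def]
      by (intro qm.smooth_on smooth_on_circle_compose oI) (use J'J h(1) D(6) in \<open>auto intro: smooth_on_subset\<close>)
    show "a' ` I' \<subseteq> S3" using S3_qmult[OF g(1) circle_S3[OF u(1)]] unfolding a'_def by blast
    show "b' ` J' \<subseteq> S3" using S3_qmult[OF circle_S3[OF u(1)]] D(8) J'J unfolding b'_def by blast
    fix z assume z: "z \<in> rect I' J'"
    have "\<theta> z \<in> rect I J" using sub[OF z] \<sigma>(5) by (auto simp: \<theta>_def rect_def)
    then show "f (x (\<theta> z)) = a' (z $ 1) \<odot> b' (z $ 2)"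
      using D(10) g(2) sub[OF z] \<sigma>(5) by (simp add: \<theta>_def a'_def b'_def circle_add[OF u(1)] qmult_assoc)
  qed
  have lv: "left_vel a' r = u" if "r \<in> I'" for r
  proof (rule left_velI)
    show "a' r \<in> S3" unfolding a'_def by (rule S3_qmult[OF g(1) circle_S3[OF u(1)]])
    show "velocity a' r = a' r \<odot> (0, u)"
      unfolding velocity_def a'_def[abs_def] qmult_assoc
      by (rule vector_derivative_at[OF bounded_linear.has_vector_derivative[OF qm.bounded_linear_right circle_deriv[OF u(1)]]])
  qed
  have st: "straight I' J' a' b'"
    unfolding straight_def
  proof (intro ballI conjI)
    fix r t assume rt: "r \<in> I'" "t \<in> J'"
    have "(left_vel a' has_vector_derivative 0) (at r)"
      by (rule has_vector_derivative_transform_within_open[OF has_vector_derivative_const oI(3) rt(1)]) (simp add: lv)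
    then show "vector_derivative (left_vel a') (at r) \<bullet> cross3 (left_vel a' r) (right_vel b' t) = 0"
      by (simp add: vector_derivative_at)
    show "vector_derivative (right_vel b') (at t) \<bullet> cross3 (left_vel a' r) (right_vel b' t) = 0"
      unfolding lv[OF rt(1)] b'_def[abs_def] using h(2)[OF J'J[OF rt(2)]] .
  qed
  have "w $ 1 \<in> I'" "w $ 2 \<in> J'" using e(1) by (auto simp: I'_def J'_def)
  then show ?thesis
    by (rule that[OF pp st]) (simp add: \<theta>_def w_def \<sigma>(4)[OF s0])
qed

text \<open>Mirror image of \<open>shear_left\<close>: with b(t) = exp(\<sigma>(t) u) g, the product
  is (a(s) exp(h(s) u)) (exp((\<sigma>(t) - h(s)) u) g), and the new second coordinate is
  \<sigma>(t) - h(s).\<close>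

lemma shear_right:
  assumes p: "product_param M A f I J a b x" and s0: "s0 \<in> I" and t0: "t0 \<in> J"
    and u: "norm u = 1" "\<And>t. t \<in> J \<Longrightarrow> right_vel b t = norm (right_vel b t) *\<^sub>R u"
  obtains I' J' a' b' x' s1 t1 where "product_param M A f I' J' a' b' x'" "straight I' J' a' b'"
    "s1 \<in> I'" "t1 \<in> J'" "x (vector [s0, t0]) = x' (vector [s1, t1])"
proof -
  note D = product_paramD[OF p]
  define m where "m s = norm (right_vel b s)" for s
  have U0: "right_vel b s \<noteq> 0" if "s \<in> J" for s using product_cross[OF p s0 that] by auto
  have smm: "smooth_on J m"
    unfolding m_def[abs_def] by (intro smooth_on_norm D smooth_on_right_vel U0; assumption)
  have m0: "m s > 0" if "s \<in> J" for s using U0[OF that] by (simp add: m_def)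
  obtain \<sigma> S where \<sigma>: "smooth_on J \<sigma>" "open_interval (\<sigma> ` J)" "smooth_on (\<sigma> ` J) S"
    "\<And>s. s \<in> J \<Longrightarrow> S (\<sigma> s) = s" "\<And>r. r \<in> \<sigma> ` J \<Longrightarrow> \<sigma> (S r) = r \<and> S r \<in> J"
    "\<And>s. s \<in> J \<Longrightarrow> (\<sigma> has_real_derivative m s) (at s)"
    "\<And>r. r \<in> \<sigma> ` J \<Longrightarrow> (S has_real_derivative 1 / m (S r)) (at r)"
    using arclength_parameter[OF D(2) smm m0] by blast
  obtain g where g: "g \<in> S3" "\<And>s. s \<in> J \<Longrightarrow> b s = circle u (\<sigma> s) \<odot> g"
    using great_circle_right[OF D(2,6,8) u(1) u(2)[folded m_def] \<sigma>(6)] by blast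
  have "cross3 (left_vel a s) u \<noteq> 0" if s: "s \<in> I" for s
  proof
    assume "cross3 (left_vel a s) u = 0"
    then have "cross3 (left_vel a s) (right_vel b t0) = 0" by (subst u(2)[OF t0]) (simp add: cross_mult_right)
    then show False using product_cross[OF p s t0] by simp
  qed
  then obtain h where h: "smooth_on I h"
    "\<And>s. s \<in> I \<Longrightarrow> vector_derivative (left_vel (\<lambda>s. a s \<odot> circle u (h s))) (at s)
      \<bullet> cross3 (left_vel (\<lambda>s. a s \<odot> circle u (h s)) s) u = 0"
    using straighten_left[OF D(3) _ D(5,7) u(1)] D(1) unfolding open_interval_def by blast
  define a' b' where "a' s = a s \<odot> circle u (h s)" and "b' r = circle u r \<odot> g" for r s
  define \<Omega> where "\<Omega> = {z::real^2. z $ 1 \<in> I} \<inter> (\<lambda>z. z $ 2 + h (z $ 1)) -` (\<sigma> ` J)"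
  have o\<sigma>: "open (\<sigma> ` J)" using \<sigma>(2) by (simp add: open_interval_def)
  have oJ2: "open {z::real^2. z $ 1 \<in> I}"
    using open_vimage[OF D(3), of "\<lambda>z::real^2. z $ 1"] by (simp add: vimage_def continuous_on_component)
  have smh: "smooth_on {z::real^2. z $ 1 \<in> I} (\<lambda>z. z $ 2 + h (z $ 1))"
    by (intro smooth_on_add smooth_on_coordinate[OF _ D(3) h(1)] smooth_on_vec_nth smooth_on_id oJ2) simp
  have o\<Omega>: "open \<Omega>" unfolding \<Omega>_def by (rule continuous_open_preimage[OF smooth_on_continuous[OF smh] oJ2 o\<sigma>])
  define w where "w = (vector [s0, \<sigma> t0 - h s0] :: real^2)"
  have "w \<in> \<Omega>" using s0 t0 by (simp add: w_def \<Omega>_def)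
  then obtain e where e: "e > 0" "rect (ball (w $ 1) e) (ball (w $ 2) e) \<subseteq> \<Omega>" using rect_neighbourhood[OF o\<Omega>] by blast
  define I' J' where "I' = ball (w $ 1) e" and "J' = ball (w $ 2) e"
  have oI: "open_interval I'" "open_interval J'" "open I'" "open J'"
    using e(1) open_interval_ball by (auto simp: I'_def J'_def)
  have sub: "z $ 1 \<in> I" "z $ 2 + h (z $ 1) \<in> \<sigma> ` J" if "z \<in> rect I' J'" for z
    using that e(2) by (auto simp: I'_def J'_def \<Omega>_def)
  have J'J: "s \<in> I" if "s \<in> I'" for s using sub(1)[of "vector [s, w $ 2]"] that e(1) by (simp add: J'_def)
  define \<theta> \<eta> where "\<theta> z = (vector [z $ 1, S (z $ 2 + h (z $ 1))] :: real^2)"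
    and "\<eta> z = (vector [z $ 1, \<sigma> (z $ 2) - h (z $ 1)] :: real^2)" for z :: "real^2"
  note R = open_rect[OF oI(3,4)]
  have lp: "local_param M A (rect I' J') (\<lambda>z. x (\<theta> z))"
  proof (rule local_param_compose[OF D(9) R _ _ open_rect[OF D(3,4)] subset_refl])
    have 1: "smooth_on (rect I' J') (\<lambda>z. z $ 2 + h (z $ 1))"
      by (rule smooth_on_subset[OF smh]) (use sub in auto)
    show "smooth_on (rect I' J') \<theta>" unfolding \<theta>_def[abs_def]
      by (intro smooth_on_vector2 smooth_on_compose[OF R o\<sigma> \<sigma>(3) 1] smooth_on_vec_nth smooth_on_id R) (use sub in auto)
    show "\<theta> ` rect I' J' \<subseteq> rect I J" using sub \<sigma>(5) by (auto simp: \<theta>_def rect_def)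
    show "smooth_on (rect I J) \<eta>" unfolding \<eta>_def[abs_def]
      by (intro smooth_on_vector2 smooth_on_diff smooth_on_coordinate[where I = I] smooth_on_coordinate[where I = J]
          smooth_on_vec_nth smooth_on_id open_rect D(3,4) \<sigma>(1) h(1)) (auto simp: rect_def)
    show "\<eta> (\<theta> z) = z" if "z \<in> rect I' J'" for z using sub[OF that] \<sigma>(5) by (simp add: \<eta>_def \<theta>_def)
    show "\<theta> (\<eta> w) = w" if "w \<in> rect I J" for w using that \<sigma>(4) by (simp add: \<eta>_def \<theta>_def rect_def)
  qed
  have pp: "product_param M A f I' J' a' b' (\<lambda>z. x (\<theta> z))"
  proof (rule product_paramI[OF oI(1,2) _ _ _ _ lp])
    show "smooth_on J' b'" unfolding b'_def[abs_def]
      by (intro qm.smooth_on smooth_on_const smooth_on_circle_compose smooth_on_id oI)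
    show "smooth_on I' a'" unfolding a'_def[abs_def]
      by (intro qm.smooth_on smooth_on_circle_compose oI) (use J'J h(1) D(5) in \<open>auto intro: smooth_on_subset\<close>)
    show "b' ` J' \<subseteq> S3" using S3_qmult[OF circle_S3[OF u(1)] g(1)] unfolding b'_def by blast
    show "a' ` I' \<subseteq> S3" using S3_qmult[OF _ circle_S3[OF u(1)]] D(7) J'J unfolding a'_def by blast
    fix z assume z: "z \<in> rect I' J'"
    have "\<theta> z \<in> rect I J" using sub[OF z] \<sigma>(5) by (auto simp: \<theta>_def rect_def)
    then show "f (x (\<theta> z)) = a' (z $ 1) \<odot> b' (z $ 2)"
      using D(10) g(2) sub[OF z] \<sigma>(5)
      by (simp add: \<theta>_def a'_def b'_def circle_add[OF u(1)] qmult_assoc add.commute[of "z $ 2"])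
  qed
  have rv: "right_vel b' r = u" if "r \<in> J'" for r
  proof (rule right_velI)
    show "b' r \<in> S3" unfolding b'_def by (rule S3_qmult[OF circle_S3[OF u(1)] g(1)])
    show "velocity b' r = (0, u) \<odot> b' r"
      unfolding velocity_def b'_def[abs_def] qmult_assoc[symmetric] circle_commute
      by (rule vector_derivative_at[OF bounded_linear.has_vector_derivative[OF qm.bounded_linear_left circle_deriv[OF u(1)]]])
  qed
  have st: "straight I' J' a' b'"
    unfolding straight_def
  proof (intro ballI conjI)
    fix s r assume rt: "s \<in> I'" "r \<in> J'"
    have "(right_vel b' has_vector_derivative 0) (at r)"
      by (rule has_vector_derivative_transform_within_open[OF has_vector_derivative_const oI(4) rt(2)]) (simp add: rv)
    then show "vector_derivative (right_vel b') (at r) \<bullet> cross3 (left_vel a' s) (right_vel b' r) = 0"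
      by (simp add: vector_derivative_at)
    show "vector_derivative (left_vel a') (at s) \<bullet> cross3 (left_vel a' s) (right_vel b' r) = 0"
      unfolding rv[OF rt(2)] a'_def[abs_def] using h(2)[OF J'J[OF rt(1)]] .
  qed
  have "w $ 1 \<in> I'" "w $ 2 \<in> J'" using e(1) by (auto simp: I'_def J'_def)
  then show ?thesis
    by (rule that[OF pp st]) (simp add: \<theta>_def w_def \<sigma>(4)[OF t0])
qed

text \<open>Once the curvature is known to be zero, either the given product is straight, or one of
  the two factors in \<open>eq0\<close> is nonzero somewhere. In the latter case the other curve has
  constant direction and the product is sheared along its great circle.\<close>

lemma adapted_exists:
  assumes ts: "translation_surface M A f" and cg: "constant_gauss_curvature A f" and pM: "p \<in> topspace M"
  obtains I J a b x s t where "adapted I J a b x" "s \<in> I" "t \<in> J" "p = x (vector [s, t])"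
proof -
  obtain I J a b x where p: "product_param M A f I J a b x" and px: "p \<in> x ` rect I J"
    using ts pM unfolding translation_surface_def by blast
  note D = product_paramD[OF p]
  obtain s0 t0 where st0: "s0 \<in> I" "t0 \<in> J" "p = x (vector [s0, t0])"
    using px by (auto simp: rect_def)
  obtain K where K: "\<And>D x z. local_param M A D x \<Longrightarrow> z \<in> D \<Longrightarrow> gauss_curvature (\<lambda>z. f (x z)) z = K"
    using gauss_curvature_constant[OF cg] by blast
  define U V where "U = left_vel a" and "V = right_vel b"
  have eq: "K * (cross3 (U s) (V t) \<bullet> cross3 (U s) (V t))\<^sup>2
      = (vector_derivative U (at s) \<bullet> cross3 (U s) (V t)) * (vector_derivative V (at t) \<bullet> cross3 (U s) (V t))"
    if "s \<in> I" "t \<in> J" for s t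
    using product_gauss[OF p that K[OF D(9)]] that by (simp add: U_def V_def)
  have smU: "smooth_on I U" and smV: "smooth_on J V"
    unfolding U_def V_def using smooth_on_left_vel[OF D(3,5)] smooth_on_right_vel[OF D(4,6)] by auto
  have c0: "cross3 (U s) (V t) \<noteq> 0" if "s \<in> I" "t \<in> J" for s t
    using product_cross[OF p that] by (simp add: U_def V_def)
  have K0: "K = 0"
    using curvature_equation_impossible[OF D(3) st0(1) D(4) st0(2) smU smV c0 _ eq] by blast
  have eq0: "(vector_derivative U (at s) \<bullet> cross3 (U s) (V t)) * (vector_derivative V (at t) \<bullet> cross3 (U s) (V t)) = 0"
    if "s \<in> I" "t \<in> J" for s t using eq[OF that] K0 by simp
  have iv: "is_interval I" "is_interval J" using D(1,2) by (auto simp: open_interval_def)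
  have "\<exists>I' J' a' b' x' s1 t1. product_param M A f I' J' a' b' x' \<and> straight I' J' a' b' \<and>
    s1 \<in> I' \<and> t1 \<in> J' \<and> x (vector [s0, t0]) = x' (vector [s1, t1])"
  proof (cases "straight I J a b")
    case True
    then show ?thesis using p st0 by blast
  next
    case False
    then obtain s1 t1 where 1: "s1 \<in> I" "t1 \<in> J" "vector_derivative U (at s1) \<bullet> cross3 (U s1) (V t1) \<noteq> 0 \<or>
        vector_derivative V (at t1) \<bullet> cross3 (U s1) (V t1) \<noteq> 0"
      unfolding straight_def U_def V_def by blast
    show ?thesis
    proof (cases "vector_derivative U (at s1) \<bullet> cross3 (U s1) (V t1) = 0")
      case False
      obtain v where v: "norm v = 1" "\<And>t. t \<in> J \<Longrightarrow> V t = norm (V t) *\<^sub>R v"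
        using rotating_direction_forces_constant[OF D(3,4) iv(2) smU smV c0 eq0 1(1,2) False] by blast
      show ?thesis using shear_right[OF p st0(1,2) v[unfolded V_def]] by metis
    next
      case True
      then have ne: "vector_derivative V (at t1) \<bullet> cross3 (V t1) (U s1) \<noteq> 0" using 1(3) by (simp add: cross_skew[of "V t1"])
      have c0': "cross3 (V t) (U s) \<noteq> 0" if "t \<in> J" "s \<in> I" for s t
        using c0[OF that(2,1)] by (simp add: cross_skew[of "V t"])
      have eq0': "(vector_derivative V (at t) \<bullet> cross3 (V t) (U s)) * (vector_derivative U (at s) \<bullet> cross3 (V t) (U s)) = 0"
        if "t \<in> J" "s \<in> I" for s t using eq0[OF that(2,1)] by (auto simp: cross_skew[of "V t"])
      obtain v where v: "norm v = 1" "\<And>s. s \<in> I \<Longrightarrow> U s = norm (U s) *\<^sub>R v"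
        using rotating_direction_forces_constant[OF D(4,3) iv(1) smV smU c0' eq0' 1(2,1) ne] by blast
      show ?thesis using shear_left[OF p st0(1,2) v[unfolded U_def]] by metis
    qed
  qed
  then obtain I' J' a' b' x' s1 t1 where q: "product_param M A f I' J' a' b' x'" "straight I' J' a' b'"
    "s1 \<in> I'" "t1 \<in> J'" "x (vector [s0, t0]) = x' (vector [s1, t1])" by blast
  obtain I'' J'' a'' b'' x'' s2 t2 where n: "adapted I'' J'' a'' b'' x''" "s2 \<in> I''" "t2 \<in> J''"
    "x' (vector [s1, t1]) = x'' (vector [s2, t2])"
    by (rule normalize_speed[OF q(1-4)])
  show ?thesis by (rule that[OF n(1-3)]) (use n(4) q(5) st0(3) in simp)
qed

lemma adaptedD:
  assumes "adapted I J a b x"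
  shows "product_param M A f I J a b x" "straight I J a b" "unit_speed_curve I a" "unit_speed_curve J b"
    "\<And>s. s \<in> I \<Longrightarrow> norm (left_vel a s) = 1" "\<And>t. t \<in> J \<Longrightarrow> norm (right_vel b t) = 1"
proof -
  show p: "product_param M A f I J a b x" and "straight I J a b" using assms by (auto simp: adapted_def)
  note D = product_paramD[OF p]
  show "unit_speed_curve I a" "unit_speed_curve J b"
    using assms D(5-8) by (auto simp: adapted_def unit_speed_curve_def)
  show "norm (left_vel a s) = 1" if "s \<in> I" for s
    using velocity_left_right(3)[OF D(3,5,7) that] assms that by (simp add: adapted_def)
  show "norm (right_vel b t) = 1" if "t \<in> J" for t
    using velocity_left_right(4)[OF D(4,6,8) that] assms that by (simp add: adapted_def)
qed

text \<open>Only the mixed coefficient survives, so the coordinate directions are exactly the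
  asymptotic ones. Its positive sign matters too: it later excludes that a transition exchanges the
  two coordinates.\<close>

lemma adapted_second_ff:
  assumes "adapted I J a b x" "z \<in> rect I J"
  shows "second_ff (\<lambda>z. f (x z)) z v w
    = (v $ 1 * w $ 2 + v $ 2 * w $ 1) * norm (cross3 (left_vel a (z $ 1)) (right_vel b (z $ 2)))"
    "norm (cross3 (left_vel a (z $ 1)) (right_vel b (z $ 2))) > 0"
proof -
  define c where "c = cross3 (left_vel a (z $ 1)) (right_vel b (z $ 2))"
  note A = adaptedD[OF assms(1)]
  have z: "z $ 1 \<in> I" "z $ 2 \<in> J" using assms(2) by (auto simp: rect_def)
  have c0: "c \<noteq> 0" using product_cross[OF A(1) z] by (simp add: c_def)
  then show "norm (cross3 (left_vel a (z $ 1)) (right_vel b (z $ 2))) > 0" by (simp add: c_def)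
  have s: "vector_derivative (left_vel a) (at (z $ 1)) \<bullet> c = 0" "vector_derivative (right_vel b) (at (z $ 2)) \<bullet> c = 0"
    using A(2)[unfolded straight_def] z unfolding c_def by blast+
  have "second_ff (\<lambda>z. f (x z)) z v w * norm c = (v $ 1 * w $ 2 + v $ 2 * w $ 1) * (norm c * norm c)"
    using product_second_ff[OF A(1) assms(2), of v w, folded c_def] s
    by (simp add: power2_norm_eq_inner[symmetric] power2_eq_square)
  then show "second_ff (\<lambda>z. f (x z)) z v w
    = (v $ 1 * w $ 2 + v $ 2 * w $ 1) * norm (cross3 (left_vel a (z $ 1)) (right_vel b (z $ 2)))"
    using c0 unfolding c_def[symmetric] by (simp add: mult.assoc[symmetric])
qed

section \<open>Asymptotic curves and torsion of adapted parametrizations\<close>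

lemma unit_speed_translate:
  assumes "unit_speed_curve I a" "open I" "q \<in> S3"
  shows "unit_speed_curve I (\<lambda>s. a s \<odot> q)" "unit_speed_curve I (\<lambda>s. q \<odot> a s)"
    "s \<in> I \<Longrightarrow> velocity (\<lambda>s. a s \<odot> q) s = velocity a s \<odot> q" "s \<in> I \<Longrightarrow> velocity (\<lambda>s. q \<odot> a s) s = q \<odot> velocity a s"
proof -
  have a: "smooth_on I a" "a ` I \<subseteq> S3" "\<And>s. s \<in> I \<Longrightarrow> norm (velocity a s) = 1"
    using assms by (auto simp: unit_speed_curve_def)
  show v: "velocity (\<lambda>s. a s \<odot> q) s = velocity a s \<odot> q" "velocity (\<lambda>s. q \<odot> a s) s = q \<odot> velocity a s" if "s \<in> I" for s
    unfolding velocity_def[of "\<lambda>s. a s \<odot> q"] velocity_def[of "\<lambda>s. q \<odot> a s"]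
    by (rule vector_derivative_at[OF bounded_linear.has_vector_derivative[OF _ has_velocity[OF a(1) that]]];
        rule qm.bounded_linear_left qm.bounded_linear_right)+
  have q: "norm q = 1" using assms(3) by simp
  have "(\<lambda>s. a s \<odot> q) ` I \<subseteq> S3" "(\<lambda>s. q \<odot> a s) ` I \<subseteq> S3" using a(2) S3_qmult assms(3) by blast+
  moreover have "smooth_on I (\<lambda>s. a s \<odot> q)" "smooth_on I (\<lambda>s. q \<odot> a s)"
    by (intro qm.smooth_on a smooth_on_const assms(2))+
  ultimately show "unit_speed_curve I (\<lambda>s. a s \<odot> q)" "unit_speed_curve I (\<lambda>s. q \<odot> a s)"
    unfolding unit_speed_curve_def using v a(3) q by (simp_all add: norm_qmult)
qed

lemma unit_speed_cong:
  assumes "unit_speed_curve I a" "open I" "\<And>s. s \<in> I \<Longrightarrow> a s = b s"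
  shows "unit_speed_curve I b"
proof -
  have "velocity b s = velocity a s" if "s \<in> I" for s
    using has_vector_derivative_transform_within_open[OF has_velocity[of I a s] assms(2) that assms(3)] assms(1) that
    unfolding velocity_def[of b] unit_speed_curve_def by (blast intro: vector_derivative_at)
  moreover have "smooth_on I b" using assms smooth_on_cong unfolding unit_speed_curve_def by blast
  moreover have "b ` I \<subseteq> S3" using assms unfolding unit_speed_curve_def by auto
  ultimately show ?thesis using assms(1) unfolding unit_speed_curve_def by simp
qed

lemma adapted_asymptotic_product:
  assumes "adapted I J a b x"
  shows "asymptotic_product M A f (x ` rect I J) I J a b"
  unfolding asymptotic_product_def
proof (intro exI[of _ x] conjI ballI refl)
  note A = adaptedD[OF assms]
  show "product_param M A f I J a b x" by (rule A(1))
  note D = product_paramD[OF A(1)]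
  have d1: "vector_derivative (\<lambda>s. vector [s, t] :: real^2) (at s) = axis 1 1" for s t
    by (rule vector_derivative_at) (auto simp: vector2_eq intro!: derivative_eq_intros)
  have d2: "vector_derivative (\<lambda>t. vector [s, t] :: real^2) (at t) = axis 2 1" for s t
    by (rule vector_derivative_at) (auto simp: vector2_eq intro!: derivative_eq_intros)
  show "asymptotic_curve M A f I (\<lambda>s. x (vector [s, t]))" if t: "t \<in> J" for t
  proof (rule asymptotic_curveI[OF D(3,9), where w = "\<lambda>s. vector [s, t]"])
    show "smooth_on I (\<lambda>s. vector [s, t] :: real^2)" by (intro smooth_on_vector2 smooth_on_id smooth_on_const D(3))
    have "b t \<in> S3" using D(8) t by blast
    from unit_speed_translate(1)[OF A(3) D(3) this] show "unit_speed_curve I (f \<circ> (\<lambda>s. x (vector [s, t])))"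
      by (rule unit_speed_cong[OF _ D(3)]) (use D(10) t in simp)
    show "second_ff (\<lambda>z. f (x z)) (vector [s, t]) (vector_derivative (\<lambda>s. vector [s, t]) (at s)) (vector_derivative (\<lambda>s. vector [s, t]) (at s)) = 0"
      if "s \<in> I" for s unfolding d1 using adapted_second_ff(1)[OF assms, of "vector [s, t]"] that t by simp
  qed (use t in auto)
  show "asymptotic_curve M A f J (\<lambda>t. x (vector [s, t]))" if s: "s \<in> I" for s
  proof (rule asymptotic_curveI[OF D(4,9), where w = "\<lambda>t. vector [s, t]"])
    show "smooth_on J (\<lambda>t. vector [s, t] :: real^2)" by (intro smooth_on_vector2 smooth_on_id smooth_on_const D(4))
    have "a s \<in> S3" using D(7) s by blast
    from unit_speed_translate(2)[OF A(4) D(4) this] show "unit_speed_curve J (f \<circ> (\<lambda>t. x (vector [s, t])))"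
      by (rule unit_speed_cong[OF _ D(4)]) (use D(10) s in simp)
    show "second_ff (\<lambda>z. f (x z)) (vector [s, t]) (vector_derivative (\<lambda>t. vector [s, t]) (at t)) (vector_derivative (\<lambda>t. vector [s, t]) (at t)) = 0"
      if "t \<in> J" for t unfolding d2 using adapted_second_ff(1)[OF assms, of "vector [s, t]"] that s by simp
  qed (use s in auto)
qed

text \<open>The normal \<open>cross3 (W s) v\<close> to the plane of \<open>W s\<close> and
  \<open>v\<close> does not turn: (W x v) x (W' x v) = - (W' . (W x v)) v, which vanishes by
  \<open>orth\<close>. Hence \<open>W\<close> stays in one fixed plane through
  \<open>v\<close>.\<close>

lemma direction_of_normal:
  fixes W :: "real \<Rightarrow> real^3"
  assumes I: "open_interval I" and W: "smooth_on I W" and c0: "\<And>s. s \<in> I \<Longrightarrow> cross3 (W s) v \<noteq> 0"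
    and orth: "\<And>s. s \<in> I \<Longrightarrow> vector_derivative W (at s) \<bullet> cross3 (W s) v = 0"
  obtains w where "norm w = 1" "\<And>s. s \<in> I \<Longrightarrow> W s \<bullet> w = 0"
proof -
  have oI: "open I" "I \<noteq> {}" using I by (auto simp: open_interval_def)
  have sm: "smooth_on I (\<lambda>s. cross3 (W s) v)" by (intro cr.smooth_on W smooth_on_const oI)
  have d: "vector_derivative (\<lambda>s. cross3 (W s) v) (at s) = cross3 (vector_derivative W (at s)) v" if "s \<in> I" for s
    by (rule vector_derivative_at[OF bounded_linear.has_vector_derivative[OF cr.bounded_linear_left
          smooth_on_has_vector_derivative[OF W that]]])
  have "cross3 (cross3 (W s) v) (vector_derivative (\<lambda>s. cross3 (W s) v) (at s)) = 0" if "s \<in> I" for s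
  proof -
    define y where "y = vector_derivative W (at s)"
    have "cross3 (cross3 (W s) v) (cross3 y v) = - (y \<bullet> cross3 (W s) v) *\<^sub>R v"
      by (simp add: vec_eq_iff forall_3 cross3_def inner_vec_def sum_3) algebra
    then show ?thesis unfolding d[OF that] using orth[OF that] by (simp add: y_def)
  qed
  from constant_direction[OF I sm c0 this] obtain w where w: "norm w = 1"
    "\<And>s. s \<in> I \<Longrightarrow> cross3 (W s) v = norm (cross3 (W s) v) *\<^sub>R w" by blast
  show ?thesis
  proof (rule that[OF w(1)])
    fix s assume s: "s \<in> I"
    have "norm (cross3 (W s) v) * (W s \<bullet> w) = W s \<bullet> cross3 (W s) v"
      by (subst (2) w(2)[OF s]) simp
    then show "W s \<bullet> w = 0" using c0[OF s] by (simp add: dot_cross_self)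
  qed
qed

text \<open>The velocity of one factor at a single parameter serves as the fixed vector for the
  other: it pins the plane in which that other velocity moves.\<close>

lemma adapted_torsion:
  assumes "adapted I J a b x"
  shows "has_torsion I a (\<lambda>s. 1)" "has_torsion J b (\<lambda>t. -1)"
proof -
  note A = adaptedD[OF assms]
  note D = product_paramD[OF A(1)]
  obtain s0 t0 where 0: "s0 \<in> I" "t0 \<in> J" using D(1,2) by (auto simp: open_interval_def)
  obtain w where w: "norm w = 1" "\<And>s. s \<in> I \<Longrightarrow> left_vel a s \<bullet> w = 0"
    by (rule direction_of_normal[OF D(1) smooth_on_left_vel[OF D(3,5)], of "right_vel b t0"])
      (use product_cross[OF A(1)] A(2)[unfolded straight_def] 0 in blast)+
  show "has_torsion I a (\<lambda>s. 1)" by (rule has_torsion_left[OF D(3) A(3) w])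
  have c: "cross3 (right_vel b t) (left_vel a s0) = - cross3 (left_vel a s0) (right_vel b t)" for t
    by (rule cross_skew)
  obtain w' where w': "norm w' = 1" "\<And>t. t \<in> J \<Longrightarrow> right_vel b t \<bullet> w' = 0"
    by (rule direction_of_normal[OF D(2) smooth_on_right_vel[OF D(4,6)], of "left_vel a s0"])
      (use product_cross[OF A(1)] A(2)[unfolded straight_def] 0 in \<open>auto simp: c\<close>)
  show "has_torsion J b (\<lambda>t. -1)" by (rule has_torsion_right[OF D(4) A(4) w'])
qed

lemma adapted_restrict:
  assumes "adapted I J a b x" "open_interval I'" "open_interval J'" "I' \<subseteq> I" "J' \<subseteq> J"
  shows "adapted I' J' a b x"
proof -
  note A = adaptedD[OF assms(1)]
  note D = product_paramD[OF A(1)]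
  have o: "open I'" "open J'" using assms(2,3) by (auto simp: open_interval_def)
  have sub: "rect I' J' \<subseteq> rect I J" using assms(4,5) by (auto simp: rect_def)
  note R = open_rect[OF o]
  have lp: "local_param M A (rect I' J') (\<lambda>z. x z)"
    by (rule local_param_compose[OF D(9) R _ _ R sub, where \<theta> = "\<lambda>z. z" and \<eta> = "\<lambda>z. z"])
      (auto intro: smooth_on_id R)
  have "a ` I' \<subseteq> S3" "b ` J' \<subseteq> S3" using D(7,8) assms(4,5) by blast+
  then have "product_param M A f I' J' a b x"
    by (rule product_paramI[OF assms(2,3) smooth_on_subset[OF D(5) assms(4)] smooth_on_subset[OF D(6) assms(5)] _ _ lp])
      (use D(10) sub in blast)
  then show ?thesis using assms unfolding adapted_def straight_def by blast
qed

text \<open>In an adapted chart an asymptotic curve has coordinate velocities with product zero;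
  unit speed makes the other one 1 or -1. So near 0 it is a coordinate line, a translate of
  \<open>a\<close> or \<open>b\<close>, and shares the curvature of that factor. This carries the
  curvatures in the definition of a generic point over to the two factors.\<close>

lemma asymptotic_curve_in_adapted:
  assumes ad: "adapted I J a b x" and e: "e > 0" and c: "asymptotic_curve M A f {-e<..<e} c"
    and c0: "c 0 = x (vector [s0, t0])" and st: "s0 \<in> I" "t0 \<in> J"
  obtains (left) \<epsilon> where "\<epsilon> = 1 \<or> \<epsilon> = -1" "velocity (f \<circ> c) 0 = \<epsilon> *\<^sub>R (velocity a s0 \<odot> b t0)" "curvature (f \<circ> c) 0 = curvature a s0"
    | (right) \<epsilon> where "\<epsilon> = 1 \<or> \<epsilon> = -1" "velocity (f \<circ> c) 0 = \<epsilon> *\<^sub>R (a s0 \<odot> velocity b t0)" "curvature (f \<circ> c) 0 = curvature b t0"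
proof -
  note A = adaptedD[OF ad]
  note D = product_paramD[OF A(1)]
  interpret product_surface I J a b by (rule D(11))
  define E where "E = {-e<..<e}"
  have E: "open E" "0 \<in> E" using e by (auto simp: E_def)
  note c' = c[folded E_def]
  have sc: "smooth_curve M A E c" and us: "unit_speed_curve E (f \<circ> c)" using c' by (auto simp: asymptotic_curve_def)
  define T where "T = {t \<in> E. c t \<in> x ` rect I J}"
  define w where "w = (\<lambda>t. inv_into (rect I J) x (c t))"
  note cp = smooth_curve_param[OF E(1) sc D(9), folded T_def w_def]
  have T0: "0 \<in> T" using c0 st E by (auto simp: T_def)
  have w: "w t \<in> rect I J \<and> x (w t) = c t" if "t \<in> T" for t
    using that by (auto simp: T_def w_def inv_into_into f_inv_into_f)
  have w0: "w 0 = vector [s0, t0]" unfolding w_def c0 using local_paramD(2)[OF D(9)] st by simp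
  define w' where "w' t = vector_derivative w (at t)" for t
  have dw: "(w has_vector_derivative w' t) (at t)" if "t \<in> T" for t
    unfolding w'_def by (rule smooth_on_has_vector_derivative[OF cp(2) that])
  have smw': "smooth_on T w'" unfolding w'_def[abs_def] by (rule smooth_on_vector_derivative[OF cp])
  have prod0: "w' t $ 1 * w' t $ 2 = 0" if t: "t \<in> T" for t
  proof -
    have "second_ff (\<lambda>z. f (x z)) (w t) (w' t) (w' t) = 0"
      using asymptotic_curve_param[OF E(1) c' D(9), of t] t unfolding w'_def w_def T_def by auto
    then show ?thesis using adapted_second_ff[OF ad] w[OF t] by auto
  qed
  have vel: "((f \<circ> c) has_vector_derivative (w' t $ 1 *\<^sub>R (velocity a (w t $ 1) \<odot> b (w t $ 2)) + w' t $ 2 *\<^sub>R (a (w t $ 1) \<odot> velocity b (w t $ 2)))) (at t)"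
    if t: "t \<in> T" for t
  proof -
    have wt: "w t $ 1 \<in> I" "w t $ 2 \<in> J" using w[OF t] by (auto simp: rect_def)
    have "((\<lambda>t. w t $ i) has_vector_derivative w' t $ i) (at t)" for i
      using bounded_linear.has_vector_derivative[OF bounded_linear_vec_nth dw[OF t]] .
    then have 1: "((\<lambda>t. w t $ i) has_vector_derivative w' t $ i) (at t)" for i .
    have "((\<lambda>t. a (w t $ 1)) has_vector_derivative w' t $ 1 *\<^sub>R velocity a (w t $ 1)) (at t)"
      using vector_diff_chain_at[OF 1 has_velocity[OF D(5) wt(1)]] by (simp add: o_def)
    moreover have "((\<lambda>t. b (w t $ 2)) has_vector_derivative w' t $ 2 *\<^sub>R velocity b (w t $ 2)) (at t)"
      using vector_diff_chain_at[OF 1 has_velocity[OF D(6) wt(2)]] by (simp add: o_def)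
    ultimately have "((\<lambda>t. a (w t $ 1) \<odot> b (w t $ 2)) has_vector_derivative
        a (w t $ 1) \<odot> (w' t $ 2 *\<^sub>R velocity b (w t $ 2)) + (w' t $ 1 *\<^sub>R velocity a (w t $ 1)) \<odot> b (w t $ 2)) (at t)"
      by (rule qm.has_vector_derivative)
    then have "((f \<circ> c) has_vector_derivative
        a (w t $ 1) \<odot> (w' t $ 2 *\<^sub>R velocity b (w t $ 2)) + (w' t $ 1 *\<^sub>R velocity a (w t $ 1)) \<odot> b (w t $ 2)) (at t)"
    proof (rule has_vector_derivative_transform_within_open[OF _ cp(1) t])
      fix r assume "r \<in> T"
      then show "a (w r $ 1) \<odot> b (w r $ 2) = (f \<circ> c) r" using w D(10)[of "w r"] by simp
    qed
    then show ?thesis by (simp add: qm.scaleR_left qm.scaleR_right add.commute)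
  qed
  have sq: "(w' t $ 1)\<^sup>2 + (w' t $ 2)\<^sup>2 = 1" if t: "t \<in> T" for t
  proof -
    have wt: "w t $ 1 \<in> I" "w t $ 2 \<in> J" using w[OF t] by (auto simp: rect_def)
    have n: "norm (velocity a (w t $ 1) \<odot> b (w t $ 2)) = 1" "norm (a (w t $ 1) \<odot> velocity b (w t $ 2)) = 1"
      using ad wt D(7,8) unfolding adapted_def norm_qmult by auto
    have "t \<in> E" using t by (simp add: T_def)
    then have "norm (velocity (f \<circ> c) t) = 1" using us by (simp add: unit_speed_curve_def)
    then have "norm (w' t $ 1 *\<^sub>R (velocity a (w t $ 1) \<odot> b (w t $ 2)) + w' t $ 2 *\<^sub>R (a (w t $ 1) \<odot> velocity b (w t $ 2))) = 1"
      unfolding velocity_def[of "f \<circ> c"] vector_derivative_at[OF vel[OF t]] .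
    moreover have "w' t $ 1 = 0 \<or> w' t $ 2 = 0" using prod0[OF t] by simp
    ultimately have "\<bar>w' t $ 1\<bar> = 1 \<and> w' t $ 2 = 0 \<or> w' t $ 1 = 0 \<and> \<bar>w' t $ 2\<bar> = 1" using n by auto
    then show ?thesis by (auto simp: power2_eq_1_iff abs_if split: if_splits)
  qed
  \<comment> \<open>Curvature needs a second derivative, so the information at 0 has to be spread to
    a neighbourhood: by continuity the nonzero component keeps its sign, which forces the other one
    to vanish.\<close>
  have loc: "\<exists>\<delta>>0. (\<forall>t\<in>ball 0 \<delta>. t \<in> T \<and> w' t $ i = \<epsilon> \<and> w' t $ j = 0)"
    if ij: "(i = 1 \<and> j = 2) \<or> (i = 2 \<and> j = 1)" and \<epsilon>: "\<epsilon> = 1 \<or> \<epsilon> = -1" and w'0: "w' 0 $ i = \<epsilon>" for i j :: 2 and \<epsilon>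
  proof -
    have "continuous_on T (\<lambda>t. w' t $ i * \<epsilon>)" by (intro continuous_intros smooth_on_continuous[OF smw'])
    then have "open (T \<inter> (\<lambda>t. w' t $ i * \<epsilon>) -` {0<..})" by (rule continuous_open_preimage[OF _ cp(1) open_greaterThan])
    moreover have "0 \<in> T \<inter> (\<lambda>t. w' t $ i * \<epsilon>) -` {0<..}" using T0 \<epsilon> w'0 by auto
    ultimately obtain \<delta> where \<delta>: "\<delta> > 0" "ball 0 \<delta> \<subseteq> T \<inter> (\<lambda>t. w' t $ i * \<epsilon>) -` {0<..}" using openE by blast
    show ?thesis
    proof (intro exI[of _ \<delta>] conjI ballI \<delta>(1))
      fix t :: real assume "t \<in> ball 0 \<delta>"
      then have t: "t \<in> T" "w' t $ i * \<epsilon> > 0" using \<delta>(2) by auto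
      show "t \<in> T" by fact
      show z: "w' t $ j = 0" using prod0[OF t(1)] t(2) ij by auto
      have "(w' t $ i)\<^sup>2 = 1" using sq[OF t(1)] z ij by auto
      then show "w' t $ i = \<epsilon>" using \<epsilon> t(2) by (auto simp: power2_eq_1_iff)
    qed
  qed
  have line: "w t $ i = w 0 $ i + \<epsilon> * t \<and> w t $ j = w 0 $ j" if \<delta>: "\<delta> > 0" "\<forall>t\<in>ball 0 \<delta>. t \<in> T \<and> w' t $ i = \<epsilon> \<and> w' t $ j = 0" "t \<in> ball 0 \<delta>"
    for i j :: 2 and \<epsilon> \<delta> t
  proof -
    have d: "((\<lambda>t. w t $ k) has_vector_derivative w' t $ k) (at t)" if "t \<in> ball 0 \<delta>" for k t
      using bounded_linear.has_vector_derivative[OF bounded_linear_vec_nth dw] \<delta>(2) that by blast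
    have 0: "(0::real) \<in> ball 0 \<delta>" using \<delta>(1) by simp
    have "((\<lambda>t. w t $ i - \<epsilon> * t) has_derivative (\<lambda>x. 0)) (at t)" if "t \<in> ball 0 \<delta>" for t
    proof -
      have "((\<lambda>t. w t $ i - \<epsilon> * t) has_real_derivative w' t $ i - \<epsilon> * 1) (at t)"
        using d[OF that, of i, folded has_real_derivative_iff_has_vector_derivative]
        by (intro DERIV_diff DERIV_cmult DERIV_ident)
      moreover have "w' t $ i - \<epsilon> * 1 = 0" using \<delta>(2) that by simp
      ultimately have "((\<lambda>t. w t $ i - \<epsilon> * t) has_real_derivative 0) (at t)" by simp
      then show ?thesis unfolding has_field_derivative_def by (rule has_derivative_eq_rhs) (simp add: fun_eq_iff)
    qed
    from has_derivative_zero_unique_connected[OF open_ball connected_ball this \<delta>(3) 0]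
    have 1: "w t $ i = w 0 $ i + \<epsilon> * t" by simp
    have "((\<lambda>t. w t $ j) has_derivative (\<lambda>x. 0)) (at t)" if "t \<in> ball 0 \<delta>" for t
      using d[OF that, of j] \<delta>(2) that by (simp add: has_vector_derivative_def)
    from has_derivative_zero_unique_connected[OF open_ball connected_ball this \<delta>(3) 0] 1 show ?thesis by simp
  qed
  have n0: "norm (a s0) = 1" "norm (b t0) = 1" using D(7,8) st by auto
  have c0f: "(f \<circ> c) 0 = a s0 \<odot> b t0" using c0 D(10)[of "vector [s0, t0]"] st by simp
  have vel0: "velocity (f \<circ> c) 0 = w' 0 $ 1 *\<^sub>R (velocity a s0 \<odot> b t0) + w' 0 $ 2 *\<^sub>R (a s0 \<odot> velocity b t0)"
    unfolding velocity_def[of "f \<circ> c"] using vector_derivative_at[OF vel[OF T0]] by (simp add: w0)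
  have "w' 0 $ 1 = 0 \<or> w' 0 $ 2 = 0" using prod0[OF T0] by simp
  then consider (1) "w' 0 $ 1 = 1 \<or> w' 0 $ 1 = -1" "w' 0 $ 2 = 0" | (2) "w' 0 $ 2 = 1 \<or> w' 0 $ 2 = -1" "w' 0 $ 1 = 0"
    using sq[OF T0] by (auto simp: power2_eq_1_iff)
  then show ?thesis
  proof cases
    case 1
    define \<epsilon> where "\<epsilon> = w' 0 $ 1"
    have \<epsilon>: "\<epsilon> = 1 \<or> \<epsilon> = -1" using 1 by (simp add: \<epsilon>_def)
    have "\<exists>\<delta>>0. \<forall>t\<in>ball 0 \<delta>. t \<in> T \<and> w' t $ 1 = \<epsilon> \<and> w' t $ 2 = 0"
      by (rule loc[OF _ \<epsilon>]) (simp_all add: \<epsilon>_def)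
    then obtain \<delta> where \<delta>: "\<delta> > 0" "\<forall>t\<in>ball 0 \<delta>. t \<in> T \<and> w' t $ 1 = \<epsilon> \<and> w' t $ 2 = 0" by blast
    have v: "velocity (f \<circ> c) t = \<epsilon> *\<^sub>R (velocity a (s0 + \<epsilon> * t) \<odot> b t0)" if t: "t \<in> ball 0 \<delta>" for t
    proof -
      have tT: "t \<in> T" using \<delta>(2) t by blast
      show ?thesis
        unfolding velocity_def[of "f \<circ> c"] vector_derivative_at[OF vel[OF tT]] using \<delta>(2) t line[OF \<delta> t] by (simp add: w0)
    qed
    have s0': "((\<lambda>t. s0 + \<epsilon> * t) has_vector_derivative \<epsilon>) (at 0)"
      by (auto intro!: derivative_eq_intros)
    have "((\<lambda>t. velocity a (s0 + \<epsilon> * t)) has_vector_derivative \<epsilon> *\<^sub>R vector_derivative (velocity a) (at s0)) (at 0)"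
      using vector_diff_chain_at[OF s0', of "velocity a"] smooth_on_has_vector_derivative[OF smooth_on_velocity[OF D(3,5)] st(1)]
      by (simp add: o_def)
    \<comment> \<open>The sign \<open>\<epsilon>\<close> enters once through the velocity and once
      through the chain rule, so it drops out of the acceleration.\<close>
    from bounded_linear.has_vector_derivative[OF bounded_linear_scaleR_right
        bounded_linear.has_vector_derivative[OF qm.bounded_linear_left this, of "b t0"], of \<epsilon>]
    have "((\<lambda>t. \<epsilon> *\<^sub>R (velocity a (s0 + \<epsilon> * t) \<odot> b t0)) has_vector_derivative vector_derivative (velocity a) (at s0) \<odot> b t0) (at 0)"
      using \<epsilon> by (auto simp: qm.scaleR_left)
    then have "(velocity (f \<circ> c) has_vector_derivative vector_derivative (velocity a) (at s0) \<odot> b t0) (at 0)"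
      by (rule has_vector_derivative_transform_within_open[OF _ open_ball[of 0 \<delta>]]) (use \<delta>(1) v in auto)
    then have acc: "vector_derivative (velocity (f \<circ> c)) (at 0) = vector_derivative (velocity a) (at s0) \<odot> b t0"
      by (rule vector_derivative_at)
    have "cov_deriv (f \<circ> c) (velocity (f \<circ> c)) 0 = cov_deriv a (velocity a) s0 \<odot> b t0"
      unfolding cov_deriv_def acc c0f inner_qmult using n0 by (simp add: norm_eq_1 qm.diff_left qm.scaleR_left)
    then have "curvature (f \<circ> c) 0 = curvature a s0" by (simp add: curvature_def norm_qmult n0)
    moreover have "velocity (f \<circ> c) 0 = \<epsilon> *\<^sub>R (velocity a s0 \<odot> b t0)" unfolding vel0 \<epsilon>_def using 1 by simp
    ultimately show ?thesis using left \<epsilon> by blast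
  next
    case 2
    define \<epsilon> where "\<epsilon> = w' 0 $ 2"
    have \<epsilon>: "\<epsilon> = 1 \<or> \<epsilon> = -1" using 2 by (simp add: \<epsilon>_def)
    have "\<exists>\<delta>>0. \<forall>t\<in>ball 0 \<delta>. t \<in> T \<and> w' t $ 2 = \<epsilon> \<and> w' t $ 1 = 0"
      by (rule loc[OF _ \<epsilon>]) (simp_all add: \<epsilon>_def)
    then obtain \<delta> where \<delta>: "\<delta> > 0" "\<forall>t\<in>ball 0 \<delta>. t \<in> T \<and> w' t $ 2 = \<epsilon> \<and> w' t $ 1 = 0" by blast
    have v: "velocity (f \<circ> c) t = \<epsilon> *\<^sub>R (a s0 \<odot> velocity b (t0 + \<epsilon> * t))" if t: "t \<in> ball 0 \<delta>" for t
    proof -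
      have tT: "t \<in> T" using \<delta>(2) t by blast
      show ?thesis
        unfolding velocity_def[of "f \<circ> c"] vector_derivative_at[OF vel[OF tT]] using \<delta>(2) t line[OF \<delta> t] by (simp add: w0)
    qed
    have s0': "((\<lambda>t. t0 + \<epsilon> * t) has_vector_derivative \<epsilon>) (at 0)"
      by (auto intro!: derivative_eq_intros)
    have "((\<lambda>t. velocity b (t0 + \<epsilon> * t)) has_vector_derivative \<epsilon> *\<^sub>R vector_derivative (velocity b) (at t0)) (at 0)"
      using vector_diff_chain_at[OF s0', of "velocity b"] smooth_on_has_vector_derivative[OF smooth_on_velocity[OF D(4,6)] st(2)]
      by (simp add: o_def)
    from bounded_linear.has_vector_derivative[OF bounded_linear_scaleR_right
        bounded_linear.has_vector_derivative[OF qm.bounded_linear_right this, of "a s0"], of \<epsilon>]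
    have "((\<lambda>t. \<epsilon> *\<^sub>R (a s0 \<odot> velocity b (t0 + \<epsilon> * t))) has_vector_derivative a s0 \<odot> vector_derivative (velocity b) (at t0)) (at 0)"
      using \<epsilon> by (auto simp: qm.scaleR_right)
    then have "(velocity (f \<circ> c) has_vector_derivative a s0 \<odot> vector_derivative (velocity b) (at t0)) (at 0)"
      by (rule has_vector_derivative_transform_within_open[OF _ open_ball[of 0 \<delta>]]) (use \<delta>(1) v in auto)
    then have acc: "vector_derivative (velocity (f \<circ> c)) (at 0) = a s0 \<odot> vector_derivative (velocity b) (at t0)"
      by (rule vector_derivative_at)
    have "cov_deriv (f \<circ> c) (velocity (f \<circ> c)) 0 = a s0 \<odot> cov_deriv b (velocity b) t0"
      unfolding cov_deriv_def acc c0f inner_qmult using n0 by (simp add: norm_eq_1 qm.diff_right qm.scaleR_right)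
    then have "curvature (f \<circ> c) 0 = curvature b t0" by (simp add: curvature_def norm_qmult n0)
    moreover have "velocity (f \<circ> c) 0 = \<epsilon> *\<^sub>R (a s0 \<odot> velocity b t0)" unfolding vel0 \<epsilon>_def using 2 by simp
    ultimately show ?thesis using right \<epsilon> by blast
  qed
qed

section \<open>Generic points\<close>

lemma nonzero_curvature_interval:
  assumes "open I" "smooth_on I a" "a ` I \<subseteq> S3" "s \<in> I" "curvature a s \<noteq> 0"
  obtains I' where "open_interval I'" "s \<in> I'" "I' \<subseteq> I" "\<forall>r\<in>I'. curvature a r \<noteq> 0"
proof -
  have "continuous_on I (\<lambda>s. norm (vector_derivative (left_vel a) (at s)))"
    by (intro continuous_intros smooth_on_continuous smooth_on_vector_derivative smooth_on_left_vel assms)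
  then have "open (I \<inter> (\<lambda>s. norm (vector_derivative (left_vel a) (at s))) -` (- {0}))"
    by (rule continuous_open_preimage[OF _ assms(1) open_Compl[OF closed_singleton]])
  moreover have "s \<in> I \<inter> (\<lambda>s. norm (vector_derivative (left_vel a) (at s))) -` (- {0})"
    using assms(4,5) curvature_eq(1)[OF assms(1-4)] by simp
  ultimately obtain e where e: "e > 0" "ball s e \<subseteq> I \<inter> (\<lambda>s. norm (vector_derivative (left_vel a) (at s))) -` (- {0})"
    using openE by blast
  show ?thesis
  proof (rule that[of "ball s e"])
    show "\<forall>r\<in>ball s e. curvature a r \<noteq> 0"
    proof
      fix r assume "r \<in> ball s e"
      then have "r \<in> I" "norm (vector_derivative (left_vel a) (at r)) \<noteq> 0" using e(2) by auto
      then show "curvature a r \<noteq> 0" using curvature_eq(1)[OF assms(1-3)] by simp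
    qed
  qed (use e open_interval_ball in auto)
qed

text \<open>Two curves in the same coordinate family would have velocities equal up to sign,
  contrary to transversality. So one of the given asymptotic curves follows \<open>a\<close> and the
  other \<open>b\<close>, both curvatures are nonzero at the point, and they stay nonzero on smaller
  intervals.\<close>

theorem generic_point_asymptotic_product:
  assumes ts: "translation_surface M A f" and cg: "constant_gauss_curvature A f" and gp: "generic_point M A f p"
  shows "\<exists>U I J \<alpha> \<beta>. openin M U \<and> p \<in> U \<and> asymptotic_product M A f U I J \<alpha> \<beta> \<and>
    (\<forall>s\<in>I. curvature \<alpha> s \<noteq> 0) \<and> has_torsion I \<alpha> (\<lambda>s. 1) \<and> (\<forall>t\<in>J. curvature \<beta> t \<noteq> 0) \<and> has_torsion J \<beta> (\<lambda>t. -1)"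
proof -
  obtain e c1 c2 where e: "e > 0" and c: "asymptotic_curve M A f {-e<..<e} c1" "asymptotic_curve M A f {-e<..<e} c2"
    and c0: "c1 0 = p" "c2 0 = p" and v: "velocity (f \<circ> c1) 0 \<noteq> velocity (f \<circ> c2) 0" "velocity (f \<circ> c1) 0 \<noteq> - velocity (f \<circ> c2) 0"
    and k: "curvature (f \<circ> c1) 0 \<noteq> 0" "curvature (f \<circ> c2) 0 \<noteq> 0"
    using gp unfolding generic_point_def by blast
  have "p \<in> topspace M" using gp by (simp add: generic_point_def)
  then obtain I J a b x s t where ad: "adapted I J a b x" and st: "s \<in> I" "t \<in> J" "p = x (vector [s, t])"
    by (rule adapted_exists[OF ts cg])
  note D = product_paramD[OF adaptedD(1)[OF ad]]
  have k2: "curvature a s \<noteq> 0 \<and> curvature b t \<noteq> 0"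
  proof (cases rule: asymptotic_curve_in_adapted[OF ad e c(1) c0(1)[unfolded st(3)] st(1,2)])
    case (1 \<epsilon>)
    then show ?thesis
      by (cases rule: asymptotic_curve_in_adapted[OF ad e c(2) c0(2)[unfolded st(3)] st(1,2)]) (use v k in auto)
  next
    case (2 \<epsilon>)
    then show ?thesis
      by (cases rule: asymptotic_curve_in_adapted[OF ad e c(2) c0(2)[unfolded st(3)] st(1,2)]) (use v k in auto)
  qed
  obtain I' where I': "open_interval I'" "s \<in> I'" "I' \<subseteq> I" "\<forall>r\<in>I'. curvature a r \<noteq> 0"
    using nonzero_curvature_interval[OF D(3,5,7) st(1)] k2 by blast
  obtain J' where J': "open_interval J'" "t \<in> J'" "J' \<subseteq> J" "\<forall>r\<in>J'. curvature b r \<noteq> 0"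
    using nonzero_curvature_interval[OF D(4,6,8) st(2)] k2 by blast
  have ad': "adapted I' J' a b x" by (rule adapted_restrict[OF ad I'(1) J'(1) I'(3) J'(3)])
  note D' = product_paramD[OF adaptedD(1)[OF ad']]
  have "openin M (x ` rect I' J')" using local_paramD(4)[OF D'(9) local_paramD(1)[OF D'(9)]] by simp
  moreover have "p \<in> x ` rect I' J'" using st(3) I'(2) J'(2) by auto
  ultimately show ?thesis
    using adapted_asymptotic_product[OF ad'] adapted_torsion[OF ad'] I'(4) J'(4) by blast
qed

end

section \<open>Asymptotic developing maps\<close>

text \<open>The four reflections in the coordinate axes, encoded by vectors: the ambiguity of unit
  speed coordinates on unoriented asymptotic lines.\<close>

definition signs :: "real^2 \<Rightarrow> bool" where
  "signs e \<longleftrightarrow> (e $ 1 = 1 \<or> e $ 1 = -1) \<and> (e $ 2 = 1 \<or> e $ 2 = -1)"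

definition reflect :: "real^2 \<Rightarrow> real^2 \<Rightarrow> real^2" where
  "reflect e v = vector [e $ 1 * v $ 1, e $ 2 * v $ 2]"

lemma refl_nth [simp]: "reflect e v $ 1 = e $ 1 * v $ 1" "reflect e v $ 2 = e $ 2 * v $ 2"
  by (simp_all add: reflect_def)

lemma vec2_eqI: "(u::real^2) $ 1 = v $ 1 \<Longrightarrow> u $ 2 = v $ 2 \<Longrightarrow> u = v"
  by (simp add: vec_eq_iff forall_2)

lemma refl_refl [simp]: "signs e \<Longrightarrow> reflect e (reflect e v) = v"
  by (rule vec2_eqI) (auto simp: signs_def)

lemma refl_diff: "reflect e (u - v) = reflect e u - reflect e v"
  by (rule vec2_eqI) (simp_all add: algebra_simps)

lemma norm_vec2: "(norm (v::real^2))\<^sup>2 = (v $ 1)\<^sup>2 + (v $ 2)\<^sup>2"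
  by (simp only: power2_norm_eq_inner) (simp add: inner_vec_def sum_2 power2_eq_square)

lemma norm_refl: "signs e \<Longrightarrow> norm (reflect e v) = norm v"
  by (rule power2_eq_imp_eq) (auto simp: norm_vec2 signs_def)

lemma refl_0 [simp]: "reflect e 0 = 0" by (rule vec2_eqI) simp_all

lemma bounded_linear_refl: "bounded_linear (reflect e)"
  unfolding linear_conv_bounded_linear[symmetric]
  by (rule linearI; rule vec2_eqI) (simp_all add: algebra_simps)

text \<open>A sign -1 would confine one coordinate of all points of the ball to the value it has at
  \<open>z\<close>.\<close>

lemma refl_fixed_open:
  assumes "signs e" "r > 0" "\<And>v. v \<in> ball s r \<Longrightarrow> v = z + reflect e (v - z)"
  shows "reflect e v = v"
proof -
  have "e $ i = 1" if i: "i = 1 \<or> i = 2" for i :: 2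
  proof (rule ccontr)
    assume "e $ i \<noteq> 1"
    then have ei: "e $ i = -1" using assms(1) i by (auto simp: signs_def)
    have *: "v $ i = z $ i" if "v \<in> ball s r" for v
      using arg_cong[OF assms(3)[OF that], of "\<lambda>v. v $ i"] ei i by auto
    \<comment> \<open>A second point of the ball whose coordinate \<open>i\<close> differs from that
      of the centre.\<close>
    have "s + (r/2) *\<^sub>R axis i 1 \<in> ball s r" using assms(2) by (simp add: dist_norm)
    from *[OF this] *[of s] assms(2) show False by simp
  qed
  then show ?thesis by (intro vec2_eqI) simp_all
qed

section \<open>Rigidity of adapted parametrizations and the identity principle\<close>

context immersed
begin

lemma adapted_pd:
  assumes ad: "adapted I J a b x" and z: "z \<in> rect I J"
  shows "pd 1 (\<lambda>z. f (x z)) z = velocity a (z $ 1) \<odot> b (z $ 2)" "pd 2 (\<lambda>z. f (x z)) z = a (z $ 1) \<odot> velocity b (z $ 2)"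
    "norm (pd 1 (\<lambda>z. f (x z)) z) = 1" "norm (pd 2 (\<lambda>z. f (x z)) z) = 1"
proof -
  note D = product_paramD[OF adaptedD(1)[OF ad]]
  have z': "z $ 1 \<in> I" "z $ 2 \<in> J" using z by (auto simp: rect_def)
  have "pd i (\<lambda>z. f (x z)) z = pd i (\<lambda>z. a (z $ 1) \<odot> b (z $ 2)) z" for i
    by (rule pd_cong[OF open_rect[OF D(3,4)] z]) (rule D(10))
  then show 1: "pd 1 (\<lambda>z. f (x z)) z = velocity a (z $ 1) \<odot> b (z $ 2)" "pd 2 (\<lambda>z. f (x z)) z = a (z $ 1) \<odot> velocity b (z $ 2)"
    using pd_product[OF has_velocity[OF D(5) z'(1)] has_velocity[OF D(6) z'(2)]] by simp_all
  have "norm (a (z $ 1)) = 1" "norm (b (z $ 2)) = 1" using D(7,8) z' by auto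
  then show "norm (pd 1 (\<lambda>z. f (x z)) z) = 1" "norm (pd 2 (\<lambda>z. f (x z)) z) = 1"
    unfolding 1 norm_qmult using ad z' by (auto simp: adapted_def)
qed

text \<open>Asymptotic directions go to asymptotic directions, so the columns \<open>P\<close>,
  \<open>Q\<close> of the Jacobian lie on the axes, and unit speed makes their entries 1 or -1. An
  exchange of the axes is excluded by orientation: the mixed coefficients are positive in both
  charts, but the sign of the Jacobian would then make one of them negative.\<close>

lemma adapted_transition_derivative:
  assumes x: "adapted I J a b x" and y: "adapted I' J' a' b' y" and z: "z \<in> rect I J" "x z \<in> y ` rect I' J'"
  defines "\<phi> \<equiv> \<lambda>z. inv_into (rect I' J') y (x z)"
  shows "\<exists>e. signs e \<and> pd 1 \<phi> z = e $ 1 *\<^sub>R axis 1 1 \<and> pd 2 \<phi> z = e $ 2 *\<^sub>R axis 2 1"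
proof -
  have lx: "local_param M A (rect I J) x" and ly: "local_param M A (rect I' J') y"
    using product_paramD(9) adaptedD(1) x y by blast+
  define U where "U = {z \<in> rect I J. x z \<in> y ` rect I' J'}"
  have \<phi>_eq: "\<phi> = (\<lambda>z. inv_into (rect I' J') y (x z))" by (simp add: \<phi>_def)
  note ch = change_of_param[OF lx ly \<phi>_eq U_def]
  have zU: "z \<in> U" using z by (simp add: U_def)
  have \<phi>z: "\<phi> z \<in> rect I' J'" using ch(3) zU by blast
  define P Q where "P = pd 1 \<phi> z" and "Q = pd 2 \<phi> z"
  define j where "j = sgn (P $ 1 * Q $ 2 - P $ 2 * Q $ 1)"
  have J0: "P $ 1 * Q $ 2 - P $ 2 * Q $ 1 \<noteq> 0" using transition_jacobian[OF lx ly z] by (simp add: P_def Q_def \<phi>_def)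
  have d\<phi>: "\<phi> differentiable at z" using smooth_on_differentiable[OF ch(2) zU] .
  have fd: "frechet_derivative \<phi> (at z) (axis 1 1) = P" "frechet_derivative \<phi> (at z) (axis 2 1) = Q"
    by (simp_all add: P_def Q_def pd_def)
  define C C' where "C = norm (cross3 (left_vel a (z $ 1)) (right_vel b (z $ 2)))"
    and "C' = norm (cross3 (left_vel a' (\<phi> z $ 1)) (right_vel b' (\<phi> z $ 2)))"
  have C: "C > 0" "C' > 0" using adapted_second_ff(2)[OF x z(1)] adapted_second_ff(2)[OF y \<phi>z] by (auto simp: C_def C'_def)
  have II: "second_ff (\<lambda>z. f (x z)) z v w = j * second_ff (\<lambda>z. f (y z)) (\<phi> z) (frechet_derivative \<phi> (at z) v) (frechet_derivative \<phi> (at z) w)"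
    for v w using second_ff_change[OF lx ly z, of v w] by (simp add: \<phi>_def j_def P_def Q_def)
  note sx = adapted_second_ff(1)[OF x z(1), folded C_def] and sy = adapted_second_ff(1)[OF y \<phi>z, folded C'_def]
  have j0: "j \<noteq> 0" using J0 by (simp add: j_def sgn_eq_0_iff)
  have "0 = j * ((P $ 1 * P $ 2 + P $ 2 * P $ 1) * C')" using II[of "axis 1 1" "axis 1 1"] unfolding sx sy fd by simp
  then have P0: "P $ 1 = 0 \<or> P $ 2 = 0" using j0 C by auto
  have "0 = j * ((Q $ 1 * Q $ 2 + Q $ 2 * Q $ 1) * C')" using II[of "axis 2 1" "axis 2 1"] unfolding sx sy fd by simp
  then have Q0: "Q $ 1 = 0 \<or> Q $ 2 = 0" using j0 C by auto
  have PQ: "C = j * ((P $ 1 * Q $ 2 + P $ 2 * Q $ 1) * C')" using II[of "axis 1 1" "axis 2 1"] unfolding sx sy fd by simp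
  have dY: "(\<lambda>z. f (y z)) differentiable at (\<phi> z)" using smooth_on_differentiable[OF smooth_immersion(1)[OF ly] \<phi>z] .
  have "pd i (\<lambda>z. f (x z)) z = pd i (\<lambda>z. f (y (\<phi> z))) z" for i by (rule pd_cong[OF ch(1) zU]) (rule ch(5))
  then have pdx: "pd i (\<lambda>z. f (x z)) z = pd i \<phi> z $ 1 *\<^sub>R pd 1 (\<lambda>z. f (y z)) (\<phi> z) + pd i \<phi> z $ 2 *\<^sub>R pd 2 (\<lambda>z. f (y z)) (\<phi> z)" for i
    unfolding pd_compose[OF d\<phi> dY] .
  note nx = adapted_pd(3,4)[OF x z(1)] and ny = adapted_pd(3,4)[OF y \<phi>z]
  have P1: "\<bar>P $ 1\<bar> + \<bar>P $ 2\<bar> = 1" using nx(1) unfolding pdx P_def[symmetric] using P0 ny by auto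
  have Q1: "\<bar>Q $ 1\<bar> + \<bar>Q $ 2\<bar> = 1" using nx(2) unfolding pdx Q_def[symmetric] using Q0 ny by auto
  have "P $ 2 = 0"
  proof (rule ccontr)
    assume p2: "P $ 2 \<noteq> 0"
    then have p1: "P $ 1 = 0" using P0 by simp
    then have "Q $ 1 \<noteq> 0" using J0 by auto
    then have "C = j * (P $ 2 * Q $ 1 * C')" using PQ p1 by simp
    moreover have "j = - sgn (P $ 2 * Q $ 1)" unfolding j_def p1 by (simp add: sgn_minus)
    ultimately have "C = - (\<bar>P $ 2 * Q $ 1\<bar> * C')" by (simp add: abs_sgn algebra_simps)
    then show False using C by (metis abs_ge_zero less_le_not_le mult_nonneg_nonneg neg_0_less_iff_less le_less_trans not_le)
  qed
  moreover have "Q $ 1 = 0" using J0 Q0 calculation by auto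
  ultimately show ?thesis
    using P1 Q1 by (intro exI[of _ "vector [P $ 1, Q $ 2]"])
      (auto simp: signs_def abs_if split: if_splits simp flip: P_def Q_def intro!: vec2_eqI)
qed

text \<open>The signs in the derivative of the transition depend continuously on the point and take
  finitely many values, so they are constant on a ball and the transition is affine there.\<close>

lemma adapted_germ:
  assumes x: "adapted I J a b x" and y: "adapted I' J' a' b' y" and z: "z \<in> rect I J" "z' \<in> rect I' J'" "x z = y z'"
  shows "\<exists>e \<delta>. signs e \<and> \<delta> > 0 \<and> ball z \<delta> \<subseteq> rect I J \<and> ball z' \<delta> \<subseteq> rect I' J' \<and> (\<forall>v\<in>ball z \<delta>. x v = y (z' + reflect e (v - z)))"
proof -
  have lx: "local_param M A (rect I J) x" and ly: "local_param M A (rect I' J') y"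
    using product_paramD(9) adaptedD(1) x y by blast+
  define U where "U = {z \<in> rect I J. x z \<in> y ` rect I' J'}"
  define \<phi> where "\<phi> = (\<lambda>z. inv_into (rect I' J') y (x z))"
  note ch = change_of_param[OF lx ly \<phi>_def U_def]
  have zU: "z \<in> U" using z by (auto simp: U_def)
  have \<phi>z: "\<phi> z = z'" unfolding \<phi>_def z(3) using local_paramD(2)[OF ly] z(2) by simp
  obtain d1 where d1: "d1 > 0" "ball z d1 \<subseteq> U" using ch(1) zU openE by blast
  obtain d2 where d2: "d2 > 0" "ball z' d2 \<subseteq> rect I' J'" using local_paramD(1)[OF ly] z(2) openE by blast
  define \<delta> where "\<delta> = min d1 d2"
  have \<delta>: "\<delta> > 0" "ball z \<delta> \<subseteq> U" "ball z' \<delta> \<subseteq> rect I' J'" using d1 d2 by (auto simp: \<delta>_def)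
  have der: "\<exists>e. signs e \<and> pd 1 \<phi> w = e $ 1 *\<^sub>R axis 1 1 \<and> pd 2 \<phi> w = e $ 2 *\<^sub>R axis 2 1" if "w \<in> ball z \<delta>" for w
    using adapted_transition_derivative[OF x y, of w] \<delta>(2) that unfolding \<phi>_def U_def by blast
  have const: "pd i \<phi> w $ i = pd i \<phi> z $ i" if w: "w \<in> ball z \<delta>" and i: "i = 1 \<or> i = 2" for w and i :: 2
  proof -
    have "(\<lambda>w. pd i \<phi> w $ i) constant_on ball z \<delta>"
    proof (rule continuous_finite_range_constant)
      show "continuous_on (ball z \<delta>) (\<lambda>w. pd i \<phi> w $ i)"
        by (intro continuous_intros continuous_on_subset[OF smooth_on_continuous[OF smooth_on_pd[OF ch(2)]] \<delta>(2)])
      have "(\<lambda>w. pd i \<phi> w $ i) ` ball z \<delta> \<subseteq> {1, -1}" using der i by (fastforce simp: signs_def)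
      then show "finite ((\<lambda>w. pd i \<phi> w $ i) ` ball z \<delta>)" by (rule finite_subset) simp
    qed simp
    then show ?thesis using w \<delta>(1) unfolding constant_on_def by (metis centre_in_ball)
  qed
  obtain e where e: "signs e" "pd 1 \<phi> z = e $ 1 *\<^sub>R axis 1 1" "pd 2 \<phi> z = e $ 2 *\<^sub>R axis 2 1"
    using der[of z] \<delta>(1) by auto
  have pd\<phi>: "pd 1 \<phi> w = e $ 1 *\<^sub>R axis 1 1" "pd 2 \<phi> w = e $ 2 *\<^sub>R axis 2 1" if w: "w \<in> ball z \<delta>" for w
    using der[OF w] const[OF w, of 1] const[OF w, of 2] e by auto
  have lin: "\<phi> w = z' + reflect e (w - z)" if w: "w \<in> ball z \<delta>" for w
  proof -
    have "((\<lambda>w. \<phi> w - reflect e w) has_derivative (\<lambda>v. 0)) (at v)" if v: "v \<in> ball z \<delta>" for v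
    proof -
      have "v \<in> U" using v \<delta>(2) by blast
      from has_derivative_diff[OF has_derivative_pd[OF smooth_on_differentiable[OF ch(2) this]]
          bounded_linear_imp_has_derivative[OF bounded_linear_refl]]
      show ?thesis unfolding pd\<phi>[OF v]
        by (rule has_derivative_eq_rhs) (auto simp: fun_eq_iff intro!: vec2_eqI)
    qed
    from has_derivative_zero_unique_connected[OF open_ball connected_ball this w, of z] \<delta>(1)
    have "\<phi> w - reflect e w = \<phi> z - reflect e z" by simp
    then show ?thesis unfolding \<phi>z refl_diff by (simp add: algebra_simps)
  qed
  have "x v = y (z' + reflect e (v - z))" if "v \<in> ball z \<delta>" for v
    using ch(4)[of v] lin[OF that] that \<delta>(2) by auto
  moreover have "ball z \<delta> \<subseteq> rect I J" using \<delta>(2) by (auto simp: U_def)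
  ultimately show ?thesis using e(1) \<delta> by blast
qed

lemma local_param_cong:
  assumes x: "local_param M A D x" and eq: "\<And>z. z \<in> D \<Longrightarrow> x z = y z"
  shows "local_param M A D y"
proof -
  have inv: "inv_into D y p = inv_into D x p" for p
    unfolding inv_into_def using eq by (metis (no_types, lifting))
  have img: "y ` S = x ` S" if "S \<subseteq> D" for S using eq that by force
  have pre: "{z \<in> D. y z \<in> W} = {z \<in> D. x z \<in> W}" for W using eq by auto
  have "topological_param M (D, y)"
    unfolding topological_param_iff pre
  proof (intro conjI allI impI)
    show "open D" by (rule local_paramD(1)[OF x])
    show "inj_on y D" using local_paramD(2)[OF x] inj_on_cong[of D x y] eq by simp
    show "y ` D \<subseteq> topspace M" unfolding img[OF subset_refl] by (rule local_paramD(3)[OF x])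
    show "openin M (y ` S)" if "open S \<and> S \<subseteq> D" for S
      unfolding img[OF conjunct2[OF that]] using local_paramD(4)[OF x] that by simp
    show "open {z \<in> D. x z \<in> W}" if "openin M W" for W by (rule local_paramD(5)[OF x that])
  qed
  moreover have "smooth_transition (D, y) c \<and> smooth_transition c (D, y)" if c: "c \<in> A" for c
  proof -
    obtain E w where cE: "c = (E, w)" by fastforce
    note lw = atlas_local_param[OF c[unfolded cE]]
    have "smooth_on {z \<in> D. y z \<in> w ` E} (inv_into E w \<circ> y)"
      unfolding pre by (rule smooth_on_cong[OF open_overlap[OF x lw] smooth_transition_local_param[OF x lw]]) (simp add: eq)
    moreover have "smooth_on {z \<in> E. w z \<in> y ` D} (inv_into D y \<circ> w)"
      using smooth_transition_local_param[OF lw x] unfolding img[OF subset_refl] by (simp add: o_def inv)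
    ultimately show ?thesis by (simp add: smooth_transition_def cE)
  qed
  ultimately show ?thesis by (simp add: local_param_def)
qed

lemma adapted_cong:
  assumes "adapted I J a b x" "\<And>z. z \<in> rect I J \<Longrightarrow> x z = y z"
  shows "adapted I J a b y"
proof -
  note D = product_paramD[OF adaptedD(1)[OF assms(1)]]
  have "product_param M A f I J a b y"
    by (rule product_paramI[OF D(1,2,5-8) local_param_cong[OF D(9) assms(2)]]) (use D(10) assms(2) in auto)
  then show ?thesis using assms(1) by (simp add: adapted_def)
qed

lemma adapted_reflect:
  assumes ad: "adapted I J a b x" and e: "signs e" and z: "w + reflect e (v0 - z) \<in> rect I J"
  obtains I' J' a' b' where "adapted I' J' a' b' (\<lambda>v. x (w + reflect e (v - z)))"
    "rect I' J' = {v. w + reflect e (v - z) \<in> rect I J}"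
proof -
  note D = product_paramD[OF adaptedD(1)[OF ad]]
  define g h where "g = (\<lambda>v::real^2. w + reflect e (v - z))" and "h = (\<lambda>v::real^2. z + reflect e (v - w))"
  have gh: "g (h v) = v" "h (g v) = v" for v using e by (simp_all add: g_def h_def)
  have smg: "smooth_on UNIV g" "smooth_on UNIV h"
    unfolding g_def h_def
    by (intro smooth_on_add smooth_on_const bounded_linear.smooth_on[OF bounded_linear_refl] smooth_on_diff smooth_on_id open_UNIV)+
  define \<sigma> \<tau> where "\<sigma> s = w $ 1 + e $ 1 * (s - z $ 1)" and "\<tau> s = w $ 2 + e $ 2 * (s - z $ 2)" for s :: real
  define I' J' where "I' = \<sigma> -` I" and "J' = \<tau> -` J"
  have e12: "e $ 1 = 1 \<or> e $ 1 = -1" "e $ 2 = 1 \<or> e $ 2 = -1" using e by (auto simp: signs_def)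
  have pre: "open_interval ((\<lambda>s. p + \<epsilon> * (s - q)) -` K)" if K: "open_interval K" and \<epsilon>: "\<epsilon> = 1 \<or> \<epsilon> = -1" for K and p \<epsilon> q :: real
  proof -
    have "open ((\<lambda>s. p + \<epsilon> * (s - q)) -` K)"
      using K by (intro open_vimage continuous_intros) (simp add: open_interval_def)
    moreover have "is_interval ((\<lambda>s. p + \<epsilon> * (s - q)) -` K)"
    proof -
      have iv: "is_interval K" using K by (simp add: open_interval_def)
      have K': "c \<in> K" if "x \<in> K" "y \<in> K" "x \<le> c \<and> c \<le> y \<or> y \<le> c \<and> c \<le> x" for x y c
        using iv[unfolded is_interval_1] that by blast
      show ?thesis unfolding is_interval_1
      proof (intro ballI allI impI)
        fix x y c assume xy: "x \<in> (\<lambda>s. p + \<epsilon> * (s - q)) -` K" "y \<in> (\<lambda>s. p + \<epsilon> * (s - q)) -` K" "x \<le> c \<and> c \<le> y"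
        show "c \<in> (\<lambda>s. p + \<epsilon> * (s - q)) -` K"
          unfolding vimage_eq
        proof (rule K'[OF xy(1,2)[unfolded vimage_eq]])
          show "p + \<epsilon> * (x - q) \<le> p + \<epsilon> * (c - q) \<and> p + \<epsilon> * (c - q) \<le> p + \<epsilon> * (y - q) \<or>
            p + \<epsilon> * (y - q) \<le> p + \<epsilon> * (c - q) \<and> p + \<epsilon> * (c - q) \<le> p + \<epsilon> * (x - q)"
            using \<epsilon>
          proof
            assume "\<epsilon> = 1" then show ?thesis using xy(3) by simp
          next
            assume "\<epsilon> = -1" then show ?thesis using xy(3) by simp
          qed
        qed
      qed
    qed
    moreover obtain k where "k \<in> K" using K by (auto simp: open_interval_def)
    then have "q + \<epsilon> * (k - p) \<in> (\<lambda>s. p + \<epsilon> * (s - q)) -` K" using \<epsilon> by auto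
    ultimately show ?thesis unfolding open_interval_def by blast
  qed
  have oI: "open_interval I'" "open_interval J'"
    unfolding I'_def J'_def \<sigma>_def \<tau>_def by (rule pre[OF D(1) e12(1)], rule pre[OF D(2) e12(2)])
  then have o: "open I'" "open J'" by (auto simp: open_interval_def)
  have R: "rect I' J' = {v. g v \<in> rect I J}"
    by (auto simp: rect_def I'_def J'_def \<sigma>_def \<tau>_def g_def)
  have lp: "local_param M A (rect I' J') (\<lambda>v. x (g v))"
    by (rule local_param_compose[OF D(9) open_rect[OF o] smooth_on_subset[OF smg(1) subset_UNIV] _
          open_rect[OF D(3,4)] subset_refl smooth_on_subset[OF smg(2) subset_UNIV]])
      (auto simp: gh R)
  define a' b' where "a' = (\<lambda>s. a (\<sigma> s))" and "b' = (\<lambda>s. b (\<tau> s))"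
  have d\<sigma>: "(\<sigma> has_real_derivative e $ 1) (at s)" "(\<tau> has_real_derivative e $ 2) (at s)" for s
    unfolding \<sigma>_def[abs_def] \<tau>_def[abs_def] by (auto intro!: derivative_eq_intros)
  have sm\<sigma>: "smooth_on S \<sigma>" "smooth_on S \<tau>" if "open S" for S
    unfolding \<sigma>_def[abs_def] \<tau>_def[abs_def] by (intro smooth_on_add smooth_on_const smooth_on_mult smooth_on_diff smooth_on_id that)+
  have sma: "smooth_on I' a'" unfolding a'_def
    by (rule smooth_on_compose[OF o(1) D(3,5) sm\<sigma>(1)[OF o(1)]]) (auto simp: I'_def)
  have smb: "smooth_on J' b'" unfolding b'_def
    by (rule smooth_on_compose[OF o(2) D(4,6) sm\<sigma>(2)[OF o(2)]]) (auto simp: J'_def)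
  have pp: "product_param M A f I' J' a' b' (\<lambda>v. x (g v))"
  proof (rule product_paramI[OF oI sma smb _ _ lp])
    show "a' ` I' \<subseteq> S3" "b' ` J' \<subseteq> S3" using D(7,8) unfolding a'_def b'_def I'_def J'_def by blast+
    fix v assume "v \<in> rect I' J'"
    then show "f (x (g v)) = a' (v $ 1) \<odot> b' (v $ 2)" using D(10)[of "g v"] R by (simp add: a'_def b'_def \<sigma>_def \<tau>_def g_def)
  qed
  have lv: "velocity a' s = e $ 1 *\<^sub>R velocity a (\<sigma> s)" "left_vel a' s = e $ 1 *\<^sub>R left_vel a (\<sigma> s)" if "s \<in> I'" for s
    using left_vel_reparam(1,2)[OF D(3,5,7) d\<sigma>(1)] that unfolding a'_def I'_def by auto
  have rv: "velocity b' s = e $ 2 *\<^sub>R velocity b (\<tau> s)" "right_vel b' s = e $ 2 *\<^sub>R right_vel b (\<tau> s)" if "s \<in> J'" for s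
    using left_vel_reparam(1,3)[OF D(4,6,8) d\<sigma>(2)] that unfolding b'_def J'_def by auto
  have "straight I' J' a' b'"
    unfolding straight_def
  proof (intro ballI conjI)
    fix s t assume st: "s \<in> I'" "t \<in> J'"
    have st': "\<sigma> s \<in> I" "\<tau> t \<in> J" using st by (auto simp: I'_def J'_def)
    note s1 = adaptedD(2)[OF ad, unfolded straight_def, rule_format, OF st']
    define c where "c = cross3 (left_vel a' s) (right_vel b' t)"
    have c: "c = (e $ 1 * e $ 2) *\<^sub>R cross3 (left_vel a (\<sigma> s)) (right_vel b (\<tau> t))"
      unfolding c_def lv(2)[OF st(1)] rv(2)[OF st(2)] by (simp add: cross_mult_left cross_mult_right)
    show "vector_derivative (left_vel a') (at s) \<bullet> c = 0"
      by (rule scaled_derivative_orthogonal[OF o(1) st(1) lv(2) DERIV_const d\<sigma>(1)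
            smooth_on_has_vector_derivative[OF smooth_on_left_vel[OF D(3,5)] st'(1)]])
        (use s1 in \<open>simp_all add: c dot_cross_self\<close>)
    show "vector_derivative (right_vel b') (at t) \<bullet> c = 0"
      by (rule scaled_derivative_orthogonal[OF o(2) st(2) rv(2) DERIV_const d\<sigma>(2)
            smooth_on_has_vector_derivative[OF smooth_on_right_vel[OF D(4,6)] st'(2)]])
        (use s1 in \<open>simp_all add: c dot_cross_self\<close>)
  qed
  moreover have "norm (velocity a' s) = 1" if "s \<in> I'" for s
    using lv(1)[OF that] ad that e12 by (auto simp: adapted_def I'_def)
  moreover have "norm (velocity b' s) = 1" if "s \<in> J'" for s
    using rv(1)[OF that] ad that e12 by (auto simp: adapted_def J'_def)
  ultimately have "adapted I' J' a' b' (\<lambda>v. x (g v))" using pp by (simp add: adapted_def)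
  then show ?thesis using that R unfolding g_def by blast
qed

text \<open>Locally adapted maps. The factors may change from rectangle to rectangle and the map
  need not be injective on \<open>C\<close>, as befits a developing map.\<close>

definition ladm :: "(real^2) set \<Rightarrow> (real^2 \<Rightarrow> 'm) \<Rightarrow> bool" where
  "ladm C \<Phi> \<longleftrightarrow> (\<forall>z\<in>C. \<exists>I J a b. z \<in> rect I J \<and> rect I J \<subseteq> C \<and> adapted I J a b \<Phi>)"

lemma ladmE:
  assumes "ladm C \<Phi>" "z \<in> C"
  obtains I J a b where "z \<in> rect I J" "rect I J \<subseteq> C" "adapted I J a b \<Phi>" "local_param M A (rect I J) \<Phi>" "open (rect I J)"
  using assms unfolding ladm_def by (metis adaptedD(1) product_paramD(9) local_paramD(1))

lemma adapted_ladm: "adapted I J a b x \<Longrightarrow> ladm (rect I J) x"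
  unfolding ladm_def by blast

lemma ladm_open:
  assumes "ladm C \<Phi>" shows "open C"
  unfolding open_subopen[of C] using ladmE[OF assms] by metis

lemma ladm_local:
  assumes "\<And>z. z \<in> C \<Longrightarrow> \<exists>T \<Psi>. z \<in> T \<and> open T \<and> T \<subseteq> C \<and> T \<subseteq> T' \<Psi> \<and> ladm (T' \<Psi>) \<Psi> \<and> (\<forall>v\<in>T. \<Phi> v = \<Psi> v)"
  shows "ladm C \<Phi>"
  unfolding ladm_def
proof
  fix z assume "z \<in> C"
  then obtain T \<Psi> where T: "z \<in> T" "open T" "T \<subseteq> C" "T \<subseteq> T' \<Psi>" "ladm (T' \<Psi>) \<Psi>" "\<forall>v\<in>T. \<Phi> v = \<Psi> v"
    using assms by metis
  have zT: "z \<in> T' \<Psi>" using T by blast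
  obtain I J a b where I: "z \<in> rect I J" "adapted I J a b \<Psi>" "open (rect I J)" by (rule ladmE[OF T(5) zT])
  have "open (T \<inter> rect I J)" "z \<in> T \<inter> rect I J" using T I by auto
  then obtain e where e: "e > 0" "rect (ball (z $ 1) e) (ball (z $ 2) e) \<subseteq> T \<inter> rect I J"
    using rect_neighbourhood by blast
  define I' J' where "I' = ball (z $ 1) e" and "J' = ball (z $ 2) e"
  have z1: "z $ 1 \<in> I'" "z $ 2 \<in> J'" using e(1) by (auto simp: I'_def J'_def)
  have sub: "rect I' J' \<subseteq> T \<inter> rect I J" using e(2) by (simp add: I'_def J'_def)
  have "I' \<subseteq> I" "J' \<subseteq> J"
  proof -
    show "I' \<subseteq> I"
    proof
      fix s assume "s \<in> I'"
      then have "vector [s, z $ 2] \<in> rect I' J'" using z1 by simp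
      then have "vector [s, z $ 2] \<in> rect I J" using sub by blast
      then show "s \<in> I" by simp
    qed
    show "J' \<subseteq> J"
    proof
      fix t assume "t \<in> J'"
      then have "vector [z $ 1, t] \<in> rect I' J'" using z1 by simp
      then have "vector [z $ 1, t] \<in> rect I J" using sub by blast
      then show "t \<in> J" by simp
    qed
  qed
  then have "adapted I' J' a b \<Psi>"
    using adapted_restrict[OF I(2)] open_interval_ball[OF e(1)] unfolding I'_def J'_def by blast
  then have "adapted I' J' a b \<Phi>" by (rule adapted_cong) (use T(6) sub in auto)
  moreover have "z \<in> rect I' J'" using z1 by (simp add: rect_def)
  ultimately show "\<exists>I J a b. z \<in> rect I J \<and> rect I J \<subseteq> C \<and> adapted I J a b \<Phi>" using sub T(3) by blast
qed

lemma ladm_subset: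
  assumes "ladm C \<Phi>" "open C'" "C' \<subseteq> C" shows "ladm C' \<Phi>"
  by (rule ladm_local[where T' = "\<lambda>_. C"]) (use assms in blast)

lemma ladm_cong:
  assumes "ladm C \<Phi>" "\<And>v. v \<in> C \<Longrightarrow> \<Phi> v = \<Psi> v" shows "ladm C \<Psi>"
  by (rule ladm_local[where T' = "\<lambda>_. C"]) (use assms ladm_open[OF assms(1)] in \<open>metis order_refl\<close>)

lemma ladm_reflect:
  assumes "ladm C \<Phi>" "signs e"
  shows "ladm {v. w + reflect e (v - z) \<in> C} (\<lambda>v. \<Phi> (w + reflect e (v - z)))"
  unfolding ladm_def
proof
  fix v assume v: "v \<in> {v. w + reflect e (v - z) \<in> C}"
  then have "w + reflect e (v - z) \<in> C" by simp
  then obtain I J a b where I: "w + reflect e (v - z) \<in> rect I J" "rect I J \<subseteq> C" "adapted I J a b \<Phi>"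
    using ladmE[OF assms(1)] by metis
  obtain I' J' a' b' where "adapted I' J' a' b' (\<lambda>v. \<Phi> (w + reflect e (v - z)))"
    "rect I' J' = {v. w + reflect e (v - z) \<in> rect I J}"
    by (rule adapted_reflect[OF I(3) assms(2) I(1)])
  then show "\<exists>I J a b. v \<in> rect I J \<and> rect I J \<subseteq> {v. w + reflect e (v - z) \<in> C} \<and> adapted I J a b (\<lambda>v. \<Phi> (w + reflect e (v - z)))"
    using I(1,2) by (intro exI[of _ I'] exI[of _ J'] exI[of _ a'] exI[of _ b']) auto
qed

lemma ladm_germ:
  assumes "ladm C \<Phi>" "ladm C' \<Psi>" "z \<in> C" "z' \<in> C'" "\<Phi> z = \<Psi> z'"
  obtains e \<delta> where "signs e" "\<delta> > 0" "ball z \<delta> \<subseteq> C" "ball z' \<delta> \<subseteq> C'" "\<forall>v\<in>ball z \<delta>. \<Phi> v = \<Psi> (z' + reflect e (v - z))"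
proof -
  obtain I J a b where I: "z \<in> rect I J" "rect I J \<subseteq> C" "adapted I J a b \<Phi>" by (rule ladmE[OF assms(1,3)])
  obtain I' J' a' b' where I': "z' \<in> rect I' J'" "rect I' J' \<subseteq> C'" "adapted I' J' a' b' \<Psi>" by (rule ladmE[OF assms(2,4)])
  from adapted_germ[OF I(3) I'(3) I(1) I'(1) assms(5)] obtain e \<delta> where
    "signs e" "\<delta> > 0" "ball z \<delta> \<subseteq> rect I J" "ball z' \<delta> \<subseteq> rect I' J'" "\<forall>v\<in>ball z \<delta>. \<Phi> v = \<Psi> (z' + reflect e (v - z))" by blast
  then show ?thesis using I(2) I'(2) by (intro that[of e \<delta>]) auto
qed

lemma ladm_topology:
  assumes "ladm C \<Phi>"
  shows "\<Phi> ` C \<subseteq> topspace M" "\<And>S. open S \<Longrightarrow> S \<subseteq> C \<Longrightarrow> openin M (\<Phi> ` S)" "\<And>W. openin M W \<Longrightarrow> open {z \<in> C. \<Phi> z \<in> W}"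
proof -
  show "\<Phi> ` C \<subseteq> topspace M"
  proof
    fix p assume "p \<in> \<Phi> ` C"
    then obtain z where z: "z \<in> C" "p = \<Phi> z" by blast
    obtain I J a b where "z \<in> rect I J" "local_param M A (rect I J) \<Phi>" by (rule ladmE[OF assms z(1)])
    then show "p \<in> topspace M" using local_paramD(3) z(2) by blast
  qed
  show "openin M (\<Phi> ` S)" if S: "open S" "S \<subseteq> C" for S
  proof (subst openin_subopen, intro ballI)
    fix p assume "p \<in> \<Phi> ` S"
    then obtain z where z: "z \<in> S" "p = \<Phi> z" by blast
    then have zC: "z \<in> C" using S by blast
    obtain I J a b where I: "z \<in> rect I J" "local_param M A (rect I J) \<Phi>" "open (rect I J)" by (rule ladmE[OF assms zC])
    have "openin M (\<Phi> ` (S \<inter> rect I J))" using local_paramD(4)[OF I(2)] S(1) I(3) by auto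
    then show "\<exists>T. openin M T \<and> p \<in> T \<and> T \<subseteq> \<Phi> ` S" using z I(1) by blast
  qed
  show "open {z \<in> C. \<Phi> z \<in> W}" if W: "openin M W" for W
  proof (subst open_subopen, intro ballI)
    fix z assume z: "z \<in> {z \<in> C. \<Phi> z \<in> W}"
    then have zC: "z \<in> C" by blast
    obtain I J a b where I: "z \<in> rect I J" "rect I J \<subseteq> C" "local_param M A (rect I J) \<Phi>" by (rule ladmE[OF assms zC])
    show "\<exists>T. open T \<and> z \<in> T \<and> T \<subseteq> {z \<in> C. \<Phi> z \<in> W}"
      using local_paramD(5)[OF I(3) W] I z by (intro exI[of _ "{z \<in> rect I J. \<Phi> z \<in> W}"]) auto
  qed
qed

lemma ladm_locally_injective:
  assumes "ladm C \<Phi>" "z \<in> C" obtains \<delta> where "\<delta> > 0" "ball z \<delta> \<subseteq> C" "inj_on \<Phi> (ball z \<delta>)"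
proof -
  obtain I J a b where I: "z \<in> rect I J" "rect I J \<subseteq> C" "local_param M A (rect I J) \<Phi>" "open (rect I J)"
    by (rule ladmE[OF assms])
  obtain \<delta> where d: "\<delta> > 0" "ball z \<delta> \<subseteq> rect I J" using openE[OF I(4,1)] by blast
  show ?thesis by (rule that[OF d(1) subset_trans[OF d(2) I(2)] inj_on_subset[OF local_paramD(2)[OF I(3)] d(2)]])
qed

text \<open>Identity principle. \<open>S\<close> collects the points near which both maps agree. Its
  complement in \<open>C\<close> is open as well: where the values differ, the Hausdorff property
  separates them; where they agree, the germs differ by a reflection, and agreement on any small
  ball nearby forces that reflection to be trivial.\<close>

lemma ladm_unique:
  assumes \<Phi>: "ladm C \<Phi>" and \<Psi>: "ladm C \<Psi>" and C: "connected C" and z0: "z0 \<in> C" "r > 0" "\<And>v. v \<in> ball z0 r \<Longrightarrow> v \<in> C \<Longrightarrow> \<Phi> v = \<Psi> v"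
    and v: "v \<in> C"
  shows "\<Phi> v = \<Psi> v"
proof -
  note oC = ladm_open[OF \<Phi>]
  define S where "S = {z \<in> C. \<exists>\<delta>>0. ball z \<delta> \<subseteq> C \<and> (\<forall>w\<in>ball z \<delta>. \<Phi> w = \<Psi> w)}"
  have "open S"
    unfolding open_contains_ball
  proof
    fix z assume "z \<in> S"
    then obtain \<delta> where \<delta>: "\<delta> > 0" "ball z \<delta> \<subseteq> C" "\<forall>w\<in>ball z \<delta>. \<Phi> w = \<Psi> w" by (auto simp: S_def)
    have "u \<in> S" if u: "u \<in> ball z \<delta>" for u
    proof -
      obtain d where d: "d > 0" "ball u d \<subseteq> ball z \<delta>" using openE[OF open_ball u] by blast
      then show ?thesis using \<delta> u unfolding S_def by blast
    qed
    then show "\<exists>e>0. ball z e \<subseteq> S" using \<delta>(1) by blast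
  qed
  moreover have "open (C - S)"
  proof (subst open_subopen, intro ballI)
    fix z assume z: "z \<in> C - S"
    show "\<exists>T. open T \<and> z \<in> T \<and> T \<subseteq> C - S"
    proof (cases "\<Phi> z = \<Psi> z")
      case False
      have "\<Phi> z \<in> topspace M" "\<Psi> z \<in> topspace M" using ladm_topology(1) \<Phi> \<Psi> z by blast+
      then obtain U V where UV: "openin M U" "openin M V" "\<Phi> z \<in> U" "\<Psi> z \<in> V" "disjnt U V"
        using hausdorff False unfolding Hausdorff_space_def by blast
      define T where "T = {z \<in> C. \<Phi> z \<in> U} \<inter> {z \<in> C. \<Psi> z \<in> V}"
      have "open T" unfolding T_def by (intro open_Int ladm_topology(3)[OF \<Phi> UV(1)] ladm_topology(3)[OF \<Psi> UV(2)])
      moreover have "z \<in> T" using z UV by (auto simp: T_def)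
      moreover have "T \<subseteq> C - S" using UV(5) unfolding T_def S_def disjnt_def
        by auto
      ultimately show ?thesis by blast
    next
      case True
      have zC: "z \<in> C" using z by blast
      obtain e d where ed: "signs e" "d > 0" "ball z d \<subseteq> C" and "ball z d \<subseteq> C" and ed4: "\<forall>v\<in>ball z d. \<Phi> v = \<Psi> (z + reflect e (v - z))"
        by (rule ladm_germ[OF \<Phi> \<Psi> zC zC True])
      obtain d' where d': "d' > 0" "inj_on \<Psi> (ball z d')" by (rule ladm_locally_injective[OF \<Psi> zC])
      define \<eta> where "\<eta> = min d d'"
      have "ball z \<eta> \<subseteq> C - S"
      proof
        fix s assume s: "s \<in> ball z \<eta>"
        have sC: "s \<in> C" using s ed(3) by (auto simp: \<eta>_def)
        moreover have "s \<notin> S"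
        proof
          assume "s \<in> S"
          then obtain \<delta> where \<delta>: "\<delta> > 0" "\<forall>w\<in>ball s \<delta>. \<Phi> w = \<Psi> w" by (auto simp: S_def)
          obtain \<rho> where \<rho>: "\<rho> > 0" "ball s \<rho> \<subseteq> ball s \<delta> \<inter> ball z \<eta>"
            using openE[of "ball s \<delta> \<inter> ball z \<eta>" s] s \<delta>(1) by auto
          \<comment> \<open>Both points lie in a ball on which \<open>\<Psi>\<close> is injective,
            since the reflection preserves the distance to \<open>z\<close>, and
            \<open>\<Psi>\<close> takes the same value at them.\<close>
          have "v = z + reflect e (v - z)" if v: "v \<in> ball s \<rho>" for v
          proof -
            have v\<eta>: "v \<in> ball z \<eta>" "v \<in> ball s \<delta>" using v \<rho>(2) by auto
            then have vd: "v \<in> ball z d" "v \<in> ball z d'" by (auto simp: \<eta>_def)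
            have "\<Psi> v = \<Psi> (z + reflect e (v - z))" using ed4[rule_format, OF vd(1)] \<delta>(2) v\<eta>(2) by simp
            moreover have "z + reflect e (v - z) \<in> ball z d'" using vd(2) norm_refl[OF ed(1)] by (simp add: dist_norm norm_minus_commute)
            ultimately show ?thesis using inj_onD[OF d'(2)] vd(2) by blast
          qed
          then have "reflect e u = u" for u using refl_fixed_open[OF ed(1) \<rho>(1)] by blast
          then have "\<forall>w\<in>ball z d. \<Phi> w = \<Psi> w" using ed4 by simp
          then have "z \<in> S" using zC ed(2,3) by (auto simp: S_def)
          then show False using z by blast
        qed
        ultimately show "s \<in> C - S" by blast
      qed
      moreover have "z \<in> ball z \<eta>" using ed(2) d'(1) by (simp add: \<eta>_def)
      ultimately show ?thesis using open_ball by blast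
    qed
  qed
  moreover have "z0 \<in> S"
  proof -
    obtain d where d: "d > 0" "ball z0 d \<subseteq> C" using openE[OF oC z0(1)] by blast
    then show ?thesis using z0 unfolding S_def by (intro CollectI conjI exI[of _ "min d r"]) auto
  qed
  ultimately have "C - S = {}"
    using connectedD[OF C, of S "C - S"] z0(1) by (auto simp: S_def)
  then have "v \<in> S" using v by blast
  then show ?thesis by (auto simp: S_def)
qed

end

section \<open>Completeness and global developing maps\<close>

text \<open>For unit partial derivatives the metric is governed by their angle alone: the mixed term
  is at most \<open>k\<close> times the sum of squares.\<close>

lemma norm_combination_lower:
  fixes P Q :: "'a::real_inner"
  assumes "norm P = 1" "norm Q = 1" "\<bar>P \<bullet> Q\<bar> \<le> k" "k \<le> 1"
  shows "sqrt (1 - k) * norm (v::real^2) \<le> norm (v $ 1 *\<^sub>R P + v $ 2 *\<^sub>R Q)"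
proof (rule power2_le_imp_le)
  have PQ: "P \<bullet> P = 1" "Q \<bullet> Q = 1" using assms(1,2) by (simp_all add: dot_square_norm)
  have "(norm (v $ 1 *\<^sub>R P + v $ 2 *\<^sub>R Q))\<^sup>2 = (v $ 1)\<^sup>2 + (v $ 2)\<^sup>2 + (2 * v $ 1 * v $ 2) * (P \<bullet> Q)"
    unfolding power2_norm_eq_inner
    by (simp add: inner_add_left inner_add_right PQ inner_commute[of Q P] power2_eq_square algebra_simps)
  moreover have "\<bar>(2 * v $ 1 * v $ 2) * (P \<bullet> Q)\<bar> \<le> ((v $ 1)\<^sup>2 + (v $ 2)\<^sup>2) * k"
    unfolding abs_mult
  proof (rule mult_mono[of "\<bar>2\<bar> * \<bar>v $ 1\<bar> * \<bar>v $ 2\<bar>"])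
    show "\<bar>2\<bar> * \<bar>v $ 1\<bar> * \<bar>v $ 2\<bar> \<le> (v $ 1)\<^sup>2 + (v $ 2)\<^sup>2"
      using zero_le_power2[of "\<bar>v $ 1\<bar> - \<bar>v $ 2\<bar>"] by (simp add: power2_diff)
  qed (use assms(3) in auto)
  ultimately have "(1 - k) * (norm v)\<^sup>2 \<le> (norm (v $ 1 *\<^sub>R P + v $ 2 *\<^sub>R Q))\<^sup>2"
    unfolding norm_vec2 by (simp add: algebra_simps abs_le_iff)
  then show "(sqrt (1 - k) * norm v)\<^sup>2 \<le> (norm (v $ 1 *\<^sub>R P + v $ 2 *\<^sub>R Q))\<^sup>2"
    using assms(4) by (simp add: power_mult_distrib)
qed simp

section \<open>Comparison of the induced distance with the parameter plane\<close>

context immersed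
begin

lemma ladm_Union:
  assumes "\<And>C. C \<in> \<C> \<Longrightarrow> ladm C \<Phi>" shows "ladm (\<Union>\<C>) \<Phi>"
  unfolding ladm_def
proof
  fix z assume "z \<in> \<Union>\<C>"
  then obtain C where C: "C \<in> \<C>" "z \<in> C" by blast
  obtain I J a b where I: "z \<in> rect I J" "rect I J \<subseteq> C" "adapted I J a b \<Phi>" by (rule ladmE[OF assms[OF C(1)] C(2)])
  have "rect I J \<subseteq> \<Union>\<C>" using I(2) C(1) by (rule order_trans[OF _ Union_upper])
  then show "\<exists>I J a b. z \<in> rect I J \<and> rect I J \<subseteq> \<Union>\<C> \<and> adapted I J a b \<Phi>" using I(1,3) by (intro exI conjI)
qed

text \<open>The image of the straight segment is a competitor. Its speed is at most the sum of the
  moduli of the two components, which explains the factor 2.\<close>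

lemma induced_dist_ladm_le:
  assumes \<Phi>: "ladm C \<Phi>" and C: "convex C" and z: "z \<in> C" "z' \<in> C"
  shows "induced_dist M A f (\<Phi> z) (\<Phi> z') \<le> ereal (2 * norm (z' - z))"
proof -
  note oC = ladm_open[OF \<Phi>]
  define u where "u = z' - z"
  define l where "l t = z + t *\<^sub>R u" for t :: real
  define c where "c = (\<lambda>t. \<Phi> (l t))"
  have contl: "continuous_on UNIV l" unfolding l_def by (intro continuous_intros)
  have seg: "l t \<in> C" if "t \<in> {0..1}" for t
  proof -
    have "l t = (1 - t) *\<^sub>R z + t *\<^sub>R z'" by (simp add: l_def u_def algebra_simps)
    then show ?thesis using convexD_alt[OF C z, of t] that by simp
  qed
  \<comment> \<open>Competitors must be smooth on an open interval around the unit interval; the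
    segment is prolonged a little beyond both ends inside the open set \<open>C\<close>.\<close>
  have "open (l -` C)" using open_vimage[OF oC contl] .
  moreover have "0 \<in> l -` C" "1 \<in> l -` C" using seg by auto
  ultimately obtain e0 e1 where e: "e0 > 0" "ball 0 e0 \<subseteq> l -` C" "e1 > 0" "ball 1 e1 \<subseteq> l -` C"
    using openE by metis
  define \<epsilon> where "\<epsilon> = min e0 e1"
  have \<epsilon>: "\<epsilon> > 0" using e by (simp add: \<epsilon>_def)
  define K where "K = {-\<epsilon><..<1+\<epsilon>}"
  have K: "open K" by (simp add: K_def)
  have lC: "l t \<in> C" if "t \<in> K" for t
  proof -
    have "t \<in> ball 0 e0 \<or> t \<in> ball 1 e1 \<or> t \<in> {0..1}"
      using that by (auto simp: K_def \<epsilon>_def dist_real_def)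
    then show ?thesis using e seg by blast
  qed
  have sml: "smooth_on S l" if "open S" for S
    unfolding l_def by (intro smooth_on_add smooth_on_const smooth_on_scaleR smooth_on_id that)
  have sc: "smooth_curve M A K c"
  proof (rule smooth_curveI[OF K])
    fix t assume t: "t \<in> K"
    obtain I J a b where I: "l t \<in> rect I J" "local_param M A (rect I J) \<Phi>" "open (rect I J)"
      by (rule ladmE[OF \<Phi> lC[OF t]])
    have o: "open (K \<inter> l -` rect I J)" using K open_vimage[OF I(3) contl] by blast
    show "\<exists>T D x w. open T \<and> t \<in> T \<and> T \<subseteq> K \<and> local_param M A D x \<and> smooth_on T w \<and> w ` T \<subseteq> D \<and> (\<forall>r\<in>T. c r = x (w r))"
      by (rule exI[of _ "K \<inter> l -` rect I J"], rule exI[of _ "rect I J"], rule exI[of _ \<Phi>], rule exI[of _ l])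
        (use o t I sml[OF o] in \<open>auto simp: c_def\<close>)
  qed
  have vel: "norm (velocity (f \<circ> c) t) \<le> 2 * norm u" if t: "t \<in> {0..1}" for t
  proof -
    obtain I J a b where I: "l t \<in> rect I J" "adapted I J a b \<Phi>" "local_param M A (rect I J) \<Phi>"
      by (rule ladmE[OF \<Phi> seg[OF t]])
    have "(l has_derivative (\<lambda>h. h *\<^sub>R u)) (at t)"
      unfolding l_def by (auto intro!: derivative_eq_intros)
    from has_derivative_compose[OF this has_derivative_pd[OF smooth_on_differentiable[OF smooth_immersion(1)[OF I(3)] I(1)]]]
    have "((\<lambda>t. f (\<Phi> (l t))) has_vector_derivative
        u $ 1 *\<^sub>R pd 1 (\<lambda>z. f (\<Phi> z)) (l t) + u $ 2 *\<^sub>R pd 2 (\<lambda>z. f (\<Phi> z)) (l t)) (at t)"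
      unfolding has_vector_derivative_def by (simp add: scaleR_add_right)
    then have "velocity (f \<circ> c) t = u $ 1 *\<^sub>R pd 1 (\<lambda>z. f (\<Phi> z)) (l t) + u $ 2 *\<^sub>R pd 2 (\<lambda>z. f (\<Phi> z)) (l t)"
      unfolding velocity_def c_def o_def by (rule vector_derivative_at)
    then have "norm (velocity (f \<circ> c) t) \<le> \<bar>u $ 1\<bar> + \<bar>u $ 2\<bar>"
      using norm_triangle_ineq[of "u $ 1 *\<^sub>R pd 1 (\<lambda>z. f (\<Phi> z)) (l t)" "u $ 2 *\<^sub>R pd 2 (\<lambda>z. f (\<Phi> z)) (l t)"]
        adapted_pd(3,4)[OF I(2,1)] by simp
    then show ?thesis using component_le_norm_cart[of u 1] component_le_norm_cart[of u 2] by linarith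
  qed
  have int: "integral {0..1} (\<lambda>t. norm (velocity (f \<circ> c) t)) \<le> 2 * norm u"
  \<comment> \<open>The integral of a function that is not integrable is 0 by convention, so the
    bound holds in either case.\<close>
  proof (cases "(\<lambda>t. norm (velocity (f \<circ> c) t)) integrable_on {0..1}")
    case True
    have "integral {0..1} (\<lambda>t. norm (velocity (f \<circ> c) t)) \<le> integral {0..1::real} (\<lambda>_. 2 * norm u)"
      by (rule integral_le[OF True integrable_const_ivl vel])
    then show ?thesis by simp
  next
    case False
    then show ?thesis by (simp add: not_integrable_integral)
  qed
  have "c 0 = \<Phi> z \<and> c 1 = \<Phi> z' \<and> (\<exists>\<epsilon>>0. smooth_curve M A {-\<epsilon><..<1+\<epsilon>} c)"
    using sc \<epsilon> unfolding K_def by (auto simp: c_def l_def u_def)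
  then have "induced_dist M A f (\<Phi> z) (\<Phi> z') \<le> ereal (integral {0..1} (\<lambda>t. norm (velocity (f \<circ> c) t)))"
    unfolding induced_dist_def by (intro INF_lower) blast
  also have "\<dots> \<le> ereal (2 * norm u)" using int by simp
  finally show ?thesis by (simp add: u_def)
qed

lemma smooth_curve_immersion:
  assumes I: "open I" and c: "smooth_curve M A I c" shows "smooth_on I (\<lambda>t. f (c t))"
proof (rule smooth_on_local)
  fix t assume t: "t \<in> I"
  have "c t \<in> topspace M" using c t unfolding smooth_curve_def continuous_map_def by auto
  then obtain D x z where D: "(D, x) \<in> A" "z \<in> D" "c t = x z" by (rule atlas_cover)
  note lx = atlas_local_param[OF D(1)]
  note s = smooth_curve_param[OF I c lx]
  have "smooth_on {t \<in> I. c t \<in> x ` D} (\<lambda>t. f (x (inv_into D x (c t))))"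
    by (rule smooth_on_compose[OF s(1) local_paramD(1)[OF lx] smooth_immersion(1)[OF lx] s(2)]) (auto intro: inv_into_into)
  then have "smooth_on {t \<in> I. c t \<in> x ` D} (\<lambda>t. f (c t))"
    by (rule smooth_on_cong[OF s(1)]) (simp add: f_inv_into_f)
  then show "\<exists>T. open T \<and> t \<in> T \<and> smooth_on T (\<lambda>t. f (c t))" using s(1) t D by blast
qed

text \<open>On a compact set the cosine of the angle between the unit partial derivatives attains
  its maximal modulus \<open>k\<close>, and \<open>k < 1\<close> because the map is an
  immersion.\<close>

lemma adapted_metric_lower:
  assumes ad: "adapted I J a b x" and K: "compact K" "K \<subseteq> rect I J" "K \<noteq> {}"
  obtains m where "m > 0" "\<forall>z\<in>K. \<forall>v::real^2. m * norm v \<le> norm (v $ 1 *\<^sub>R pd 1 (\<lambda>z. f (x z)) z + v $ 2 *\<^sub>R pd 2 (\<lambda>z. f (x z)) z)"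
proof -
  note lx = product_paramD(9)[OF adaptedD(1)[OF ad]]
  define P Q where "P = pd 1 (\<lambda>z. f (x z))" and "Q = pd 2 (\<lambda>z. f (x z))"
  note n = adapted_pd(3,4)[OF ad, folded P_def Q_def]
  have sm: "smooth_on (rect I J) P" "smooth_on (rect I J) Q"
    unfolding P_def Q_def by (rule smooth_on_pd[OF smooth_immersion(1)[OF lx]])+
  have cont: "continuous_on K (\<lambda>z. \<bar>P z \<bullet> Q z\<bar>)"
    by (intro continuous_intros continuous_on_subset[OF smooth_on_continuous[OF sm(1)] K(2)]
        continuous_on_subset[OF smooth_on_continuous[OF sm(2)] K(2)])
  obtain z1 where z1: "z1 \<in> K" "\<forall>z\<in>K. \<bar>P z \<bullet> Q z\<bar> \<le> \<bar>P z1 \<bullet> Q z1\<bar>"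
    using continuous_attains_sup[OF K(1,3) cont] by blast
  define k where "k = \<bar>P z1 \<bullet> Q z1\<bar>"
  have z1r: "z1 \<in> rect I J" using z1 K by blast
  have k1: "k \<le> 1" using Cauchy_Schwarz_ineq2[of "P z1" "Q z1"] n[OF z1r] by (simp add: k_def)
  have "det (first_ff (\<lambda>z. f (x z)) z1) \<noteq> 0" by (rule smooth_immersion(2)[OF lx z1r])
  then have "(P z1 \<bullet> P z1) * (Q z1 \<bullet> Q z1) - (P z1 \<bullet> Q z1) * (P z1 \<bullet> Q z1) \<noteq> 0"
    by (simp add: det_2 first_ff_def P_def Q_def inner_commute)
  then have "k * k \<noteq> 1" using n[OF z1r] by (simp add: dot_square_norm k_def)
  then have "k < 1" using k1 by (cases "k = 1") auto
  then have "sqrt (1 - k) > 0" by simp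
  moreover have "\<forall>z\<in>K. \<forall>v::real^2. sqrt (1 - k) * norm v \<le> norm (v $ 1 *\<^sub>R P z + v $ 2 *\<^sub>R Q z)"
  proof (intro ballI allI)
    fix z and v :: "real^2" assume z: "z \<in> K"
    then have "z \<in> rect I J" using K by blast
    from norm_combination_lower[OF n[OF this] _ k1] z1(2)[rule_format, OF z]
    show "sqrt (1 - k) * norm v \<le> norm (v $ 1 *\<^sub>R P z + v $ 2 *\<^sub>R Q z)" by (simp add: k_def)
  qed
  ultimately show ?thesis unfolding P_def Q_def by (rule that)
qed

text \<open>After the last time outside the open coordinate ball the curve runs from its boundary to
  the centre within the chart, so its coordinates travel at least \<open>\<delta>\<close>, at a
  speed at most 1/m times that on the surface.\<close>

lemma curve_exit:
  assumes ad: "adapted I J a b x" and z0: "cball z0 \<delta> \<subseteq> rect I J" "\<delta> > 0"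
    and m: "m > 0" "\<forall>z\<in>cball z0 \<delta>. \<forall>v::real^2. m * norm v \<le> norm (v $ 1 *\<^sub>R pd 1 (\<lambda>z. f (x z)) z + v $ 2 *\<^sub>R pd 2 (\<lambda>z. f (x z)) z)"
    and c: "smooth_curve M A {-\<epsilon><..<1+\<epsilon>} c" "\<epsilon> > 0" "c 1 = x z0" and out: "c 0 \<notin> x ` ball z0 \<delta>"
  shows "m * \<delta> \<le> integral {0..1} (\<lambda>t. norm (velocity (f \<circ> c) t))"
proof -
  note lx = product_paramD(9)[OF adaptedD(1)[OF ad]]
  note L = local_paramD[OF lx]
  define G where "G = {-\<epsilon><..<1+\<epsilon>}"
  have G: "open G" "{0..1} \<subseteq> G" using c(2) by (auto simp: G_def)
  have cG: "smooth_curve M A G c" using c(1) by (simp add: G_def)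
  have cc: "continuous_map (top_of_set G) M c" using cG by (simp add: smooth_curve_def)
  have opre: "open {t \<in> G. c t \<in> W}" if "openin M W" for W
    using openin_continuous_map_preimage[OF cc that] openin_open_eq[OF G(1)] by simp
  have sub: "ball z0 \<delta> \<subseteq> rect I J" using z0 ball_subset_cball by blast
  have oB: "openin M (x ` ball z0 \<delta>)" by (rule L(4)[OF open_ball sub])
  have "compactin M (x ` cball z0 \<delta>)"
  proof (rule image_compactin)
    show "compactin (top_of_set (rect I J)) (cball z0 \<delta>)"
      using z0(1) by (simp add: compactin_subtopology)
    show "continuous_map (top_of_set (rect I J)) M x"
      unfolding continuous_map topspace_euclidean_subtopology openin_open_eq[OF L(1)] using L(3,5) by simp
  qed
  \<comment> \<open>Here the Hausdorff property matters: a curve cannot enter the chart from outside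
    without meeting the image of the bounding circle.\<close>
  then have clC: "closedin M (x ` cball z0 \<delta>)" by (rule compactin_imp_closedin[OF hausdorff])
  have oC: "openin M (topspace M - x ` cball z0 \<delta>)" using clC by blast
  have cM: "c t \<in> topspace M" if "t \<in> G" for t using cc that by (auto simp: continuous_map_def Pi_iff)
  define S where "S = {0..1} - {t \<in> G. c t \<in> x ` ball z0 \<delta>}"
  have "0 \<in> S" unfolding S_def using out by simp
  then have S: "compact S" "S \<noteq> {}"
    using compact_diff[OF compact_Icc opre[OF oB]] unfolding S_def by blast+
  \<comment> \<open>The last time at which the curve is outside the open coordinate ball.\<close>
  obtain \<tau> where \<tau>: "\<tau> \<in> S" "\<And>t. t \<in> S \<Longrightarrow> t \<le> \<tau>" using compact_attains_sup[OF S] by blast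
  have \<tau>01: "\<tau> \<in> {0..1}" "\<tau> \<in> G" using \<tau>(1) G(2) by (auto simp: S_def)
  have \<tau>n: "c \<tau> \<notin> x ` ball z0 \<delta>" using \<tau>(1) \<tau>01 by (auto simp: S_def)
  have "\<tau> \<noteq> 1" using \<tau>n c(3) z0(2) by auto
  then have \<tau>1: "\<tau> < 1" using \<tau>01 by auto
  have after: "c t \<in> x ` ball z0 \<delta>" if t: "\<tau> < t" "t \<le> 1" for t
  proof (rule ccontr)
    assume "c t \<notin> x ` ball z0 \<delta>"
    then have "t \<in> S" using t \<tau>01(1) by (auto simp: S_def)
    then show False using \<tau>(2)[of t] t by simp
  qed
  have \<tau>c: "c \<tau> \<in> x ` cball z0 \<delta>"
  proof (rule ccontr)
    assume "c \<tau> \<notin> x ` cball z0 \<delta>"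
    then have "\<tau> \<in> {t \<in> G. c t \<in> topspace M - x ` cball z0 \<delta>}" using \<tau>01 cM by blast
    then obtain d where d: "d > 0" "ball \<tau> d \<subseteq> {t \<in> G. c t \<in> topspace M - x ` cball z0 \<delta>}"
      using openE[OF opre[OF oC]] by blast
    define t where "t = \<tau> + min (d/2) (1 - \<tau>)"
    have "t \<in> ball \<tau> d" "\<tau> < t" "t \<le> 1" using d(1) \<tau>1 by (auto simp: t_def dist_real_def)
    then have "c t \<in> x ` ball z0 \<delta>" "c t \<notin> x ` cball z0 \<delta>" using after d(2) by blast+
    then show False using ball_subset_cball by blast
  qed
  define w where "w = (\<lambda>t. inv_into (rect I J) x (c t))"
  define T where "T = {t \<in> G. c t \<in> x ` rect I J}"
  have T: "open T" "smooth_on T w" unfolding T_def w_def by (rule smooth_curve_param[OF G(1) cG lx])+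
  have wc: "w t \<in> cball z0 \<delta>" "t \<in> T" if t: "t \<in> {\<tau>..1}" for t
  proof -
    have "c t \<in> x ` cball z0 \<delta>" using \<tau>c after[of t] t ball_subset_cball by (cases "t = \<tau>") auto
    then obtain u where u: "u \<in> cball z0 \<delta>" "c t = x u" by blast
    then have ur: "u \<in> rect I J" using z0 by blast
    have "w t = u" unfolding w_def u(2) by (rule inv_into_f_f[OF L(2) ur])
    then show "w t \<in> cball z0 \<delta>" using u by simp
    show "t \<in> T" unfolding T_def using u ur t \<tau>01 G(2) by auto
  qed
  have w1: "w 1 = z0" unfolding w_def c(3) by (rule inv_into_f_f[OF L(2)]) (use z0 in auto)
  have xw: "x (w t) = c t" "w t \<in> rect I J" if "t \<in> T" for t
    using that unfolding w_def T_def by (auto simp: f_inv_into_f intro: inv_into_into)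
  have \<tau>T: "\<tau> \<in> {\<tau>..1}" using \<tau>1 by simp
  have "w \<tau> \<notin> ball z0 \<delta>" using \<tau>n xw(1)[OF wc(2)[OF \<tau>T]] by (metis imageI)
  then have d\<tau>: "\<delta> \<le> norm (w 1 - w \<tau>)" by (simp add: w1 dist_norm)
  define w' where "w' t = vector_derivative w (at t)" for t
  have der: "(w has_vector_derivative w' t) (at t)" if "t \<in> T" for t
    unfolding w'_def by (rule smooth_on_has_vector_derivative[OF T(2) that])
  have FTC: "(w' has_integral w 1 - w \<tau>) {\<tau>..1}"
    by (rule fundamental_theorem_of_calculus)
      (use \<tau>1 der[OF wc(2)] in \<open>auto intro: has_vector_derivative_at_within\<close>)
  have smc: "smooth_on G (f \<circ> c)" using smooth_curve_immersion[OF G(1) cG] by (simp add: o_def)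
  have contv: "continuous_on G (\<lambda>t. norm (velocity (f \<circ> c) t))"
    unfolding velocity_def by (intro continuous_on_norm smooth_on_continuous smooth_on_vector_derivative[OF G(1) smc])
  have intv: "(\<lambda>t. norm (velocity (f \<circ> c) t)) integrable_on {p..q}" if "{p..q} \<subseteq> {0..1}" for p q
    by (intro integrable_continuous_real continuous_on_subset[OF contv] order_trans[OF that G(2)])
  have bound: "norm (w' t) \<le> norm (velocity (f \<circ> c) t) / m" if t: "t \<in> {\<tau>..1}" for t
  proof -
    note tT = wc(2)[OF t]
    have dX: "(\<lambda>z. f (x z)) differentiable at (w t)"
      by (rule smooth_on_differentiable[OF smooth_immersion(1)[OF lx] xw(2)[OF tT]])
    from has_derivative_compose[OF der[OF tT, unfolded has_vector_derivative_def] has_derivative_pd[OF dX]]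
    have "((\<lambda>t. f (x (w t))) has_vector_derivative
        w' t $ 1 *\<^sub>R pd 1 (\<lambda>z. f (x z)) (w t) + w' t $ 2 *\<^sub>R pd 2 (\<lambda>z. f (x z)) (w t)) (at t)"
      unfolding has_vector_derivative_def by (simp add: scaleR_add_right)
    then have "((f \<circ> c) has_vector_derivative
        w' t $ 1 *\<^sub>R pd 1 (\<lambda>z. f (x z)) (w t) + w' t $ 2 *\<^sub>R pd 2 (\<lambda>z. f (x z)) (w t)) (at t)"
      by (rule has_vector_derivative_transform_within_open[OF _ T(1) tT]) (simp add: xw)
    then have "velocity (f \<circ> c) t = w' t $ 1 *\<^sub>R pd 1 (\<lambda>z. f (x z)) (w t) + w' t $ 2 *\<^sub>R pd 2 (\<lambda>z. f (x z)) (w t)"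
      unfolding velocity_def by (rule vector_derivative_at)
    then have "m * norm (w' t) \<le> norm (velocity (f \<circ> c) t)" using m(2) wc(1)[OF t] by simp
    then show ?thesis using m(1) by (simp add: field_simps)
  qed
  have ss: "{\<tau>..1} \<subseteq> {0..1}" using \<tau>01 by auto
  have "\<delta> \<le> norm (integral {\<tau>..1} w')" using d\<tau> FTC by (simp add: integral_unique)
  also have "\<dots> \<le> integral {\<tau>..1} (\<lambda>t. norm (velocity (f \<circ> c) t) / m)"
    by (rule integral_norm_bound_integral[OF has_integral_integrable[OF FTC] integrable_on_divide[OF intv[OF ss]] bound])
  also have "\<dots> = integral {\<tau>..1} (\<lambda>t. norm (velocity (f \<circ> c) t)) / m" by simp
  also have "\<dots> \<le> integral {0..1} (\<lambda>t. norm (velocity (f \<circ> c) t)) / m"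
    by (rule divide_right_mono[OF integral_subset_le[OF ss intv[OF ss] intv[OF subset_refl]]]) (use m in auto)
  finally show ?thesis using m(1) by (simp add: field_simps)
qed

text \<open>Points close to \<open>x z0\<close> in the induced distance are covered by the chart.
  They are placed in the ball of half the radius so that around each of them a disc of radius
  \<open>\<delta> / 2\<close> still fits into the chart; this uniformity drives the
  continuation.\<close>

lemma induced_dist_small:
  assumes ad: "adapted I J a b x" and z0: "z0 \<in> rect I J"
  obtains \<delta> m where "\<delta> > 0" "m > 0" "cball z0 \<delta> \<subseteq> rect I J"
    "\<forall>p. induced_dist M A f p (x z0) < ereal m \<longrightarrow> p \<in> x ` ball z0 (\<delta> / 2)"
proof -
  have oR: "open (rect I J)" using local_paramD(1) product_paramD(9)[OF adaptedD(1)[OF ad]] by blast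
  obtain \<delta> where \<delta>: "\<delta> > 0" "cball z0 \<delta> \<subseteq> rect I J" using oR z0 open_contains_cball by metis
  have half: "cball z0 (\<delta>/2) \<subseteq> rect I J" "cball z0 (\<delta>/2) \<noteq> {}" "\<delta>/2 > 0" using \<delta> by auto
  obtain m where m: "m > 0" "\<forall>z\<in>cball z0 (\<delta>/2). \<forall>v::real^2. m * norm v \<le> norm (v $ 1 *\<^sub>R pd 1 (\<lambda>z. f (x z)) z + v $ 2 *\<^sub>R pd 2 (\<lambda>z. f (x z)) z)"
    by (rule adapted_metric_lower[OF ad compact_cball half(1,2)])
  have "p \<in> x ` ball z0 (\<delta>/2)" if p: "induced_dist M A f p (x z0) < ereal (m * (\<delta>/2))" for p
  proof (rule ccontr)
    assume out: "p \<notin> x ` ball z0 (\<delta>/2)"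
    have "ereal (m * (\<delta>/2)) \<le> induced_dist M A f p (x z0)"
      unfolding induced_dist_def
    proof (rule INF_greatest)
      fix c assume "c \<in> {c. c 0 = p \<and> c 1 = x z0 \<and> (\<exists>\<epsilon>>0. smooth_curve M A {-\<epsilon><..<1+\<epsilon>} c)}"
      then obtain \<epsilon> where c: "c 0 = p" "c 1 = x z0" "\<epsilon> > 0" "smooth_curve M A {-\<epsilon><..<1+\<epsilon>} c" by blast
      from curve_exit[OF ad half(1,3) m c(4,3,2)] out c(1)
      show "ereal (m * (\<delta>/2)) \<le> ereal (integral {0..1} (\<lambda>t. norm (velocity (f \<circ> c) t)))" by simp
    qed
    then show False using p by simp
  qed
  moreover have "m * (\<delta>/2) > 0" using m \<delta> by simp
  ultimately show ?thesis using that \<delta> by blast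
qed

end

section \<open>Continuation of developing maps to the whole plane\<close>

locale complete_adapted = immersed +
  assumes complete: "complete_surface M A f"
    and charts: "p \<in> topspace M \<Longrightarrow> \<exists>I J a b x z. adapted I J a b x \<and> z \<in> rect I J \<and> p = x z"
begin

text \<open>Along a radius towards \<open>\<zeta>\<close> the images form a Cauchy sequence for the
  induced distance, so by completeness they converge to some \<open>p\<close>. An adapted chart at
  \<open>p\<close>, suitably reflected and translated, continues the germ at a late point
  \<open>y n\<close> to a disc whose radius does not depend on \<open>n\<close>; this disc
  eventually contains \<open>\<zeta>\<close>.\<close>

lemma ladm_continue_at:
  assumes \<Phi>: "ladm (ball z0 r) \<Phi>" and r: "r > 0" and \<zeta>: "\<zeta> \<in> sphere z0 r"
  shows "\<exists>\<epsilon> \<Psi>. \<epsilon> > 0 \<and> ladm (ball \<zeta> \<epsilon>) \<Psi> \<and> (\<forall>v\<in>ball \<zeta> \<epsilon> \<inter> ball z0 r. \<Phi> v = \<Psi> v)"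
proof -
  define y where "y n = \<zeta> + (1 / (real n + 2)) *\<^sub>R (z0 - \<zeta>)" for n :: nat
  have n\<zeta>: "norm (\<zeta> - z0) = r" "norm (z0 - \<zeta>) = r" using \<zeta> by (simp_all add: dist_norm norm_minus_commute)
  have yb: "y n \<in> ball z0 r" for n
  proof -
    have "z0 - y n = (1 - 1 / (real n + 2)) *\<^sub>R (z0 - \<zeta>)" by (simp add: y_def algebra_simps)
    then have "dist z0 (y n) = (1 - 1 / (real n + 2)) * r" by (simp add: dist_norm n\<zeta> abs_of_nonneg)
    also have "\<dots> < 1 * r" using r by (intro mult_strict_right_mono) auto
    finally show ?thesis by simp
  qed
  have "(\<lambda>n. 1 / (real n + 2)) \<longlonglongrightarrow> 0"
    using LIMSEQ_ignore_initial_segment[OF lim_1_over_n[where 'a = real], of 2] by (simp add: add.commute)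
  then have "(\<lambda>n. \<zeta> + (1 / (real n + 2)) *\<^sub>R (z0 - \<zeta>)) \<longlonglongrightarrow> \<zeta> + 0 *\<^sub>R (z0 - \<zeta>)" by (intro tendsto_intros)
  then have y\<zeta>: "y \<longlonglongrightarrow> \<zeta>" by (simp add: y_def[abs_def])
  have cauchy: "\<exists>n\<^sub>0. \<forall>m\<ge>n\<^sub>0. \<forall>n\<ge>n\<^sub>0. induced_dist M A f (\<Phi> (y m)) (\<Phi> (y n)) < ereal \<epsilon>" if "\<epsilon> > 0" for \<epsilon>
  proof -
    have "\<epsilon> / 2 > 0" using that by simp
    then obtain n0 where n0: "\<And>m n. m \<ge> n0 \<Longrightarrow> n \<ge> n0 \<Longrightarrow> dist (y m) (y n) < \<epsilon>/2"
      using LIMSEQ_imp_Cauchy[OF y\<zeta>] unfolding Cauchy_def by metis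
    show ?thesis
    proof (intro exI allI impI)
      fix m n assume "n0 \<le> m" "n0 \<le> n"
      from n0[OF this] have "2 * norm (y n - y m) < \<epsilon>" by (simp add: dist_norm norm_minus_commute)
      then show "induced_dist M A f (\<Phi> (y m)) (\<Phi> (y n)) < ereal \<epsilon>"
        using induced_dist_ladm_le[OF \<Phi> convex_ball yb yb, of m n] by (metis le_less_trans less_ereal.simps(1))
    qed
  qed
  have rng: "range (\<lambda>n. \<Phi> (y n)) \<subseteq> topspace M" using ladm_topology(1)[OF \<Phi>] yb by blast
  have "\<exists>p\<in>topspace M. (\<lambda>n. induced_dist M A f (\<Phi> (y n)) p) \<longlonglongrightarrow> 0"
    by (rule complete[unfolded complete_surface_def, rule_format, of "\<lambda>n. \<Phi> (y n)", OF conjI])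
      (use rng cauchy in auto)
  then obtain p where p: "p \<in> topspace M" "(\<lambda>n. induced_dist M A f (\<Phi> (y n)) p) \<longlonglongrightarrow> 0" by blast
  obtain I J a b x u0 where x: "adapted I J a b x" "u0 \<in> rect I J" "p = x u0" using charts[OF p(1)] by blast
  obtain \<delta> m where \<delta>: "\<delta> > 0" "m > 0" "cball u0 \<delta> \<subseteq> rect I J"
    "\<forall>p. induced_dist M A f p (x u0) < ereal m \<longrightarrow> p \<in> x ` ball u0 (\<delta> / 2)"
    by (rule induced_dist_small[OF x(1,2)])
  have "\<forall>\<^sub>F n in sequentially. induced_dist M A f (\<Phi> (y n)) p < ereal m"
    by (rule order_tendstoD(2)[OF p(2)]) (use \<delta>(2) in simp)
  moreover have "\<forall>\<^sub>F n in sequentially. dist (y n) \<zeta> < \<delta>/4" by (rule tendstoD[OF y\<zeta>]) (use \<delta> in simp)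
  ultimately have "\<forall>\<^sub>F n in sequentially. induced_dist M A f (\<Phi> (y n)) p < ereal m \<and> dist (y n) \<zeta> < \<delta>/4"
    by (rule eventually_conj)
  then obtain n where n: "induced_dist M A f (\<Phi> (y n)) p < ereal m" "dist (y n) \<zeta> < \<delta>/4"
    unfolding eventually_sequentially by (elim exE allE impE conjE) (rule order_refl)
  have "\<Phi> (y n) \<in> x ` ball u0 (\<delta>/2)"
    by (rule \<delta>(4)[rule_format]) (rule n(1)[unfolded x(3)])
  then obtain u where u: "u \<in> ball u0 (\<delta>/2)" "\<Phi> (y n) = x u" by (rule imageE)
  have "ball u0 (\<delta>/2) \<subseteq> cball u0 \<delta>" using \<delta>(1) by auto
  then have ur: "u \<in> rect I J" using u(1) \<delta>(3) by blast
  obtain e d where ed: "signs e" "d > 0" and "ball (y n) d \<subseteq> ball z0 r" and "ball u d \<subseteq> rect I J"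
    and germ: "\<forall>v\<in>ball (y n) d. \<Phi> v = x (u + reflect e (v - y n))"
    by (rule ladm_germ[OF \<Phi> adapted_ladm[OF x(1)] yb ur u(2)])
  define \<Psi> where "\<Psi> v = x (u + reflect e (v - y n))" for v
  have in_rect: "u + reflect e (v - y n) \<in> rect I J" if v: "v \<in> ball (y n) (\<delta>/2)" for v
  proof -
    have "dist u0 (u + reflect e (v - y n)) \<le> dist u0 u + norm (reflect e (v - y n))"
      using norm_triangle_ineq4[of "u0 - u" "reflect e (v - y n)"] by (simp add: dist_norm algebra_simps)
    also have "\<dots> \<le> \<delta>/2 + \<delta>/2"
      using u(1) v norm_refl[OF ed(1), of "v - y n"] by (simp add: dist_norm norm_minus_commute)
    finally show ?thesis using \<delta>(3) by auto
  qed
  have \<Psi>2: "ladm (ball (y n) (\<delta>/2)) \<Psi>"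
    unfolding \<Psi>_def
    by (rule ladm_subset[OF ladm_reflect[OF adapted_ladm[OF x(1)] ed(1)] open_ball]) (use in_rect in blast)
  \<comment> \<open>The index \<open>n\<close> was chosen with \<open>y n\<close> closer than
    \<open>\<delta>/4\<close> to \<open>\<zeta>\<close> for this inclusion.\<close>
  have sub: "ball \<zeta> (\<delta>/4) \<subseteq> ball (y n) (\<delta>/2)"
  proof
    fix v assume "v \<in> ball \<zeta> (\<delta>/4)"
    then show "v \<in> ball (y n) (\<delta>/2)" using n(2) dist_triangle[of "y n" v \<zeta>] by (simp add: dist_commute)
  qed
  have "\<Phi> v = \<Psi> v" if v: "v \<in> ball \<zeta> (\<delta>/4) \<inter> ball z0 r" for v
  proof (rule ladm_unique[of "ball (y n) (\<delta>/2) \<inter> ball z0 r"])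
    show "ladm (ball (y n) (\<delta>/2) \<inter> ball z0 r) \<Phi>" by (rule ladm_subset[OF \<Phi>]) auto
    show "ladm (ball (y n) (\<delta>/2) \<inter> ball z0 r) \<Psi>" by (rule ladm_subset[OF \<Psi>2]) auto
    show "connected (ball (y n) (\<delta>/2) \<inter> ball z0 r)" by (intro convex_connected convex_Int convex_ball)
    show "y n \<in> ball (y n) (\<delta>/2) \<inter> ball z0 r" using \<delta>(1) yb by simp
    show "d > 0" by (rule ed(2))
    show "\<Phi> w = \<Psi> w" if "w \<in> ball (y n) d" for w using germ that by (simp add: \<Psi>_def)
    show "v \<in> ball (y n) (\<delta>/2) \<inter> ball z0 r" using v sub by blast
  qed
  moreover have "ladm (ball \<zeta> (\<delta>/4)) \<Psi>" by (rule ladm_subset[OF \<Psi>2 open_ball sub])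
  moreover have "\<delta>/4 > 0" using \<delta> by simp
  ultimately show ?thesis by blast
qed

text \<open>Continuations at the boundary points are glued. Two overlapping patches agree because
  their convex overlap contains a point of the open segment between the centres; by strict convexity
  it lies inside the disc, where both equal \<open>\<Phi>\<close>. Compactness of the closed disc
  provides a uniform gain in radius.\<close>

lemma ladm_extend_ball:
  assumes \<Phi>: "ladm (ball z0 r) \<Phi>" and r: "r > 0"
  shows "\<exists>r' \<Phi>'. r' > r \<and> ladm (ball z0 r') \<Phi>' \<and> (\<forall>v\<in>ball z0 r. \<Phi>' v = \<Phi> v)"
proof -
  have "\<forall>\<zeta>\<in>sphere z0 r. \<exists>\<epsilon> \<Psi>. \<epsilon> > 0 \<and> ladm (ball \<zeta> \<epsilon>) \<Psi> \<and> (\<forall>v\<in>ball \<zeta> \<epsilon> \<inter> ball z0 r. \<Phi> v = \<Psi> v)"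
    using ladm_continue_at[OF \<Phi> r] by blast
  then obtain \<epsilon> \<Psi> where H: "\<And>\<zeta>. \<zeta> \<in> sphere z0 r \<Longrightarrow> \<epsilon> \<zeta> > 0 \<and> ladm (ball \<zeta> (\<epsilon> \<zeta>)) (\<Psi> \<zeta>)
      \<and> (\<forall>v\<in>ball \<zeta> (\<epsilon> \<zeta>) \<inter> ball z0 r. \<Phi> v = \<Psi> \<zeta> v)"
    by metis
  have overlap: "\<Psi> \<zeta>1 v = \<Psi> \<zeta>2 v" if \<zeta>: "\<zeta>1 \<in> sphere z0 r" "\<zeta>2 \<in> sphere z0 r" and v: "v \<in> ball \<zeta>1 (\<epsilon> \<zeta>1)" "v \<in> ball \<zeta>2 (\<epsilon> \<zeta>2)" for \<zeta>1 \<zeta>2 v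
  proof (cases "\<zeta>1 = \<zeta>2")
    case False
    note H1 = H[OF \<zeta>(1)] and H2 = H[OF \<zeta>(2)]
    \<comment> \<open>Divides the segment between the centres in the ratio of the radii, so that the
      division point lies in both balls.\<close>
    define q where "q = \<epsilon> \<zeta>1 / (\<epsilon> \<zeta>1 + \<epsilon> \<zeta>2)"
    have q: "0 < q" "q < 1" using H1 H2 by (auto simp: q_def)
    have dl: "dist \<zeta>1 \<zeta>2 < \<epsilon> \<zeta>1 + \<epsilon> \<zeta>2" using v dist_triangle2[of \<zeta>1 \<zeta>2 v] by (simp add: dist_commute)
    define s where "s = (1 - q) *\<^sub>R \<zeta>1 + q *\<^sub>R \<zeta>2"
    have "s \<in> open_segment \<zeta>1 \<zeta>2" using False q by (auto simp: in_segment s_def)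
    then have sr: "s \<in> ball z0 r" using dist_decreases_open_segment[of s \<zeta>1 \<zeta>2 z0] \<zeta> by auto
    have pos: "\<epsilon> \<zeta>1 > 0" "\<epsilon> \<zeta>2 > 0" using H1 H2 by auto
    have "\<zeta>1 - s = q *\<^sub>R (\<zeta>1 - \<zeta>2)" by (simp add: s_def algebra_simps)
    then have "dist \<zeta>1 s = q * dist \<zeta>1 \<zeta>2" using q by (simp add: dist_norm)
    also have "\<dots> < q * (\<epsilon> \<zeta>1 + \<epsilon> \<zeta>2)" using q dl by (intro mult_strict_left_mono)
    finally have s1: "s \<in> ball \<zeta>1 (\<epsilon> \<zeta>1)" using pos by (simp add: q_def)
    have "\<zeta>2 - s = (1 - q) *\<^sub>R (\<zeta>2 - \<zeta>1)" by (simp add: s_def algebra_simps)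
    then have "dist \<zeta>2 s = (1 - q) * dist \<zeta>1 \<zeta>2" using q by (simp add: dist_norm norm_minus_commute)
    also have "\<dots> < (1 - q) * (\<epsilon> \<zeta>1 + \<epsilon> \<zeta>2)" using q dl by (intro mult_strict_left_mono) auto
    also have "\<dots> = \<epsilon> \<zeta>2" using pos by (simp add: q_def field_simps)
    finally have s2: "s \<in> ball \<zeta>2 (\<epsilon> \<zeta>2)" by simp
    obtain d where d: "d > 0" "ball s d \<subseteq> ball z0 r" using openE[OF open_ball sr] by blast
    show ?thesis
    proof (rule ladm_unique[of "ball \<zeta>1 (\<epsilon> \<zeta>1) \<inter> ball \<zeta>2 (\<epsilon> \<zeta>2)" _ _ s d])
      show "ladm (ball \<zeta>1 (\<epsilon> \<zeta>1) \<inter> ball \<zeta>2 (\<epsilon> \<zeta>2)) (\<Psi> \<zeta>1)" by (rule ladm_subset[of "ball \<zeta>1 (\<epsilon> \<zeta>1)"]) (use H1 in auto)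
      show "ladm (ball \<zeta>1 (\<epsilon> \<zeta>1) \<inter> ball \<zeta>2 (\<epsilon> \<zeta>2)) (\<Psi> \<zeta>2)" by (rule ladm_subset[of "ball \<zeta>2 (\<epsilon> \<zeta>2)"]) (use H2 in auto)
      show "connected (ball \<zeta>1 (\<epsilon> \<zeta>1) \<inter> ball \<zeta>2 (\<epsilon> \<zeta>2))" by (intro convex_connected convex_Int convex_ball)
      show "s \<in> ball \<zeta>1 (\<epsilon> \<zeta>1) \<inter> ball \<zeta>2 (\<epsilon> \<zeta>2)" using s1 s2 by blast
      show "\<Psi> \<zeta>1 w = \<Psi> \<zeta>2 w" if "w \<in> ball s d" "w \<in> ball \<zeta>1 (\<epsilon> \<zeta>1) \<inter> ball \<zeta>2 (\<epsilon> \<zeta>2)" for w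
      proof -
        have "w \<in> ball z0 r" using d that by blast
        then have "\<Phi> w = \<Psi> \<zeta>1 w" "\<Phi> w = \<Psi> \<zeta>2 w" using H1 H2 that(2) by blast+
        then show ?thesis by simp
      qed
    qed (use d v in auto)
  qed simp
  define \<Phi>' where "\<Phi>' v = (if v \<in> ball z0 r then \<Phi> v else \<Psi> (SOME \<zeta>. \<zeta> \<in> sphere z0 r \<and> v \<in> ball \<zeta> (\<epsilon> \<zeta>)) v)" for v
  have \<Phi>'\<Psi>: "\<Phi>' v = \<Psi> \<zeta> v" if \<zeta>: "\<zeta> \<in> sphere z0 r" "v \<in> ball \<zeta> (\<epsilon> \<zeta>)" for \<zeta> v
  proof (cases "v \<in> ball z0 r")
    case True
    then have "\<Phi> v = \<Psi> \<zeta> v" using H[OF \<zeta>(1)] \<zeta>(2) by blast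
    then show ?thesis using True by (simp add: \<Phi>'_def)
  next
    case False
    define \<xi> where "\<xi> = (SOME \<zeta>. \<zeta> \<in> sphere z0 r \<and> v \<in> ball \<zeta> (\<epsilon> \<zeta>))"
    have \<xi>: "\<xi> \<in> sphere z0 r \<and> v \<in> ball \<xi> (\<epsilon> \<xi>)" unfolding \<xi>_def by (rule someI[of _ \<zeta>]) (use \<zeta> in blast)
    have "\<Phi>' v = \<Psi> \<xi> v" unfolding \<Phi>'_def \<xi>_def using False by simp
    then show ?thesis using overlap[OF _ \<zeta>(1) _ \<zeta>(2)] \<xi> by simp
  qed
  define U where "U = ball z0 r \<union> (\<Union>\<zeta>\<in>sphere z0 r. ball \<zeta> (\<epsilon> \<zeta>))"
  have "open U" unfolding U_def by (intro open_Un open_UN ballI open_ball)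
  moreover have "cball z0 r \<subseteq> U"
  proof
    fix v assume "v \<in> cball z0 r"
    then have "v \<in> ball z0 r \<or> v \<in> sphere z0 r" by auto
    then show "v \<in> U"
    proof
      assume v: "v \<in> sphere z0 r"
      have "v \<in> ball v (\<epsilon> v)" using H[OF v] by simp
      then show ?thesis unfolding U_def using v by blast
    qed (simp add: U_def)
  qed
  ultimately obtain e where e: "e > 0" "(\<Union>x\<in>cball z0 r. ball x e) \<subseteq> U"
    using compact_subset_open_imp_ball_epsilon_subset[OF compact_cball] by metis
  have sub: "ball z0 (r + e) \<subseteq> U"
  proof
    fix v assume v: "v \<in> ball z0 (r + e)"
    show "v \<in> U"
    proof (cases "v \<in> ball z0 r")
      case False
      define N where "N = norm (v - z0)"
      have N: "N \<ge> r" "N < r + e" using False v by (auto simp: N_def dist_norm norm_minus_commute)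
      \<comment> \<open>Radial projection of \<open>v\<close> onto the sphere of radius
        \<open>r\<close>; it moves \<open>v\<close> by less than \<open>e\<close>.\<close>
      define w where "w = z0 + (r / N) *\<^sub>R (v - z0)"
      have "norm (w - z0) = r / N * N" using r N by (simp add: w_def N_def[symmetric])
      then have "norm (w - z0) = r" using r N by simp
      then have "w \<in> cball z0 r" by (simp add: dist_norm norm_minus_commute)
      moreover have "v - w = (1 - r / N) *\<^sub>R (v - z0)" by (simp add: w_def algebra_simps)
      then have "norm (v - w) = (1 - r / N) * N" using N r by (simp add: N_def[symmetric])
      then have "norm (v - w) = N - r" using N r by (simp add: left_diff_distrib)
      then have "v \<in> ball w e" using N by (simp add: dist_norm norm_minus_commute)
      ultimately show ?thesis using e(2) by blast
    qed (simp add: U_def)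
  qed
  have "ladm (ball z0 (r + e)) \<Phi>'"
  proof (rule ladm_subset[OF _ open_ball sub])
    have U: "U = \<Union>(insert (ball z0 r) ((\<lambda>\<zeta>. ball \<zeta> (\<epsilon> \<zeta>)) ` sphere z0 r))" by (simp add: U_def)
    show "ladm U \<Phi>'"
      unfolding U
    proof (rule ladm_Union, elim insertE imageE)
      fix C assume C: "C = ball z0 r"
      show "ladm C \<Phi>'" unfolding C by (rule ladm_cong[OF \<Phi>]) (simp add: \<Phi>'_def)
    next
      fix C \<zeta> assume C: "C = ball \<zeta> (\<epsilon> \<zeta>)" "\<zeta> \<in> sphere z0 r"
      show "ladm C \<Phi>'" unfolding C(1) by (rule ladm_cong[of _ "\<Psi> \<zeta>"]) (use H[OF C(2)] \<Phi>'\<Psi>[OF C(2)] in simp_all)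
    qed
  qed
  then show ?thesis using e(1) by (intro exI[of _ "r + e"] exI[of _ \<Phi>']) (simp add: \<Phi>'_def)
qed

text \<open>All continuations to discs about \<open>z0\<close> agree by the identity principle and
  combine to one map. Were the radii bounded, this map would live on the disc of radius
  \<open>Sup R\<close> and \<open>ladm_extend_ball\<close> would enlarge it.\<close>

theorem global_ladm:
  assumes p: "p \<in> topspace M"
  obtains \<Phi> where "ladm UNIV \<Phi>" "p \<in> range \<Phi>"
proof -
  obtain I J a b x z0 where x: "adapted I J a b x" "z0 \<in> rect I J" "p = x z0" using charts[OF p] by blast
  have lx: "ladm (rect I J) x" by (rule adapted_ladm[OF x(1)])
  obtain r0 where r0: "r0 > 0" "ball z0 r0 \<subseteq> rect I J" using openE[OF ladm_open[OF lx] x(2)] by blast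
  \<comment> \<open>Prescribing the germ at the centre removes the freedom of reflections, so that
    different discs carry compatible maps.\<close>
  define E where "E r \<Phi> \<longleftrightarrow> ladm (ball z0 r) \<Phi> \<and> (\<forall>v\<in>ball z0 (min r r0). \<Phi> v = x v)" for r \<Phi>
  define R where "R = {r. r > 0 \<and> (\<exists>\<Phi>. E r \<Phi>)}"
  have "E r0 x" unfolding E_def using ladm_subset[OF lx open_ball r0(2)] by simp
  then have r0R: "r0 \<in> R" using r0(1) by (auto simp: R_def)
  have agree: "\<Phi> v = \<Psi> v" if E: "E r \<Phi>" "E s \<Psi>" and v: "v \<in> ball z0 r" "v \<in> ball z0 s" and rs: "r \<in> R" "s \<in> R" for r s \<Phi> \<Psi> v
  proof (rule ladm_unique[of "ball z0 (min r s)" _ _ z0 r0])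
    show "ladm (ball z0 (min r s)) \<Phi>" by (rule ladm_subset[of "ball z0 r"]) (use E in \<open>auto simp: E_def\<close>)
    show "ladm (ball z0 (min r s)) \<Psi>" by (rule ladm_subset[of "ball z0 s"]) (use E in \<open>auto simp: E_def\<close>)
    show "\<Phi> w = \<Psi> w" if "w \<in> ball z0 r0" "w \<in> ball z0 (min r s)" for w
      using E that by (auto simp: E_def)
  qed (use v rs r0 in \<open>auto simp: R_def\<close>)
  define F where "F r = (SOME \<Phi>. E r \<Phi>)" for r
  have F: "E r (F r)" if "r \<in> R" for r using that someI_ex[of "E r"] by (simp add: R_def F_def)
  define \<Theta> where "\<Theta> v = F (SOME r. r \<in> R \<and> v \<in> ball z0 r) v" for v
  have \<Theta>: "\<Theta> v = F r v" if r: "r \<in> R" "v \<in> ball z0 r" for r v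
  proof -
    define s where "s = (SOME r. r \<in> R \<and> v \<in> ball z0 r)"
    have s: "s \<in> R \<and> v \<in> ball z0 s" unfolding s_def by (rule someI[of _ r]) (use r in blast)
    have "F s v = F r v" by (rule agree[OF F F]) (use r s in auto)
    then show ?thesis by (simp add: \<Theta>_def s_def)
  qed
  have \<Theta>ladm: "ladm (\<Union>r\<in>R. ball z0 r) \<Theta>"
  proof (rule ladm_Union, elim imageE)
    fix C r assume C: "C = ball z0 r" "r \<in> R"
    have "ladm (ball z0 r) (F r)" using F[OF C(2)] by (simp add: E_def)
    then show "ladm C \<Theta>" unfolding C(1) by (rule ladm_cong) (simp add: \<Theta>[OF C(2)])
  qed
  have z0p: "\<Theta> z0 = p"
  proof -
    have "\<Theta> z0 = F r0 z0" by (rule \<Theta>[OF r0R]) (use r0 in simp)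
    also have "\<dots> = x z0" using F[OF r0R] r0(1) by (simp add: E_def)
    finally show ?thesis using x(3) by simp
  qed
  have "\<not> bdd_above R"
  proof
    assume bd: "bdd_above R"
    define s where "s = Sup R"
    have le: "r \<le> s" if "r \<in> R" for r unfolding s_def by (rule cSup_upper[OF that bd])
    have U: "(\<Union>r\<in>R. ball z0 r) = ball z0 s"
    proof
      show "(\<Union>r\<in>R. ball z0 r) \<subseteq> ball z0 s" using le by fastforce
      show "ball z0 s \<subseteq> (\<Union>r\<in>R. ball z0 r)"
      proof
        fix v assume "v \<in> ball z0 s"
        then have "dist z0 v < Sup R" by (simp add: s_def)
        then obtain r where "r \<in> R" "dist z0 v < r" using less_cSup_iff[of R] r0R bd by blast
        then show "v \<in> (\<Union>r\<in>R. ball z0 r)" by auto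
      qed
    qed
    have s: "s > 0" using le[OF r0R] r0(1) by simp
    obtain s' \<Phi>' where s': "s' > s" "ladm (ball z0 s') \<Phi>'" "\<forall>v\<in>ball z0 s. \<Phi>' v = \<Theta> v"
      using ladm_extend_ball[OF \<Theta>ladm[unfolded U] s] by blast
    have "\<Phi>' v = x v" if v: "v \<in> ball z0 (min s' r0)" for v
    proof -
      have v0: "v \<in> ball z0 r0" using v by simp
      then have "v \<in> ball z0 s" using le[OF r0R] by simp
      then have "\<Phi>' v = \<Theta> v" using s' by blast
      also have "\<dots> = F r0 v" by (rule \<Theta>[OF r0R v0])
      also have "\<dots> = x v" using F[OF r0R] v0 by (simp add: E_def)
      finally show ?thesis .
    qed
    then have "s' \<in> R" using s s' unfolding R_def E_def by auto
    then show False using le s'(1) by fastforce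
  qed
  have U: "UNIV = (\<Union>r\<in>R. ball z0 r)"
  proof (rule UNIV_eq_I)
    fix v
    obtain r where "r \<in> R" "\<not> r \<le> dist z0 v" using \<open>\<not> bdd_above R\<close> unfolding bdd_above_def by blast
    then show "v \<in> (\<Union>r\<in>R. ball z0 r)" by (intro UN_I) auto
  qed
  show ?thesis by (rule that[of \<Theta>]) (use \<Theta>ladm[folded U] z0p in auto)
qed

end

section \<open>Deck motions, lifting and injectivity\<close>

context immersed
begin

text \<open>The reflection relating the two germs at a common value extends to the whole plane by
  the identity principle. With \<open>\<Psi>\<close> = \<open>\<Phi>\<close> these plane isometries
  are the deck transformations.\<close>

lemma ladm_deck:
  assumes \<Phi>: "ladm UNIV \<Phi>" and \<Psi>: "ladm UNIV \<Psi>" and eq: "\<Phi> \<zeta> = \<Psi> \<zeta>'"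
  obtains e where "signs e" "\<forall>v. \<Phi> v = \<Psi> (\<zeta>' + reflect e (v - \<zeta>))"
proof -
  obtain e d where ed: "signs e" "d > 0" and "ball \<zeta> d \<subseteq> UNIV" "ball \<zeta>' d \<subseteq> UNIV"
    and g: "\<forall>v\<in>ball \<zeta> d. \<Phi> v = \<Psi> (\<zeta>' + reflect e (v - \<zeta>))"
    by (rule ladm_germ[OF \<Phi> \<Psi> UNIV_I UNIV_I eq])
  have "ladm UNIV (\<lambda>v. \<Psi> (\<zeta>' + reflect e (v - \<zeta>)))" using ladm_reflect[OF \<Psi> ed(1), of \<zeta>' \<zeta>] by simp
  from ladm_unique[OF \<Phi> this connected_UNIV UNIV_I ed(2) _ UNIV_I] g
  have "\<Phi> v = \<Psi> (\<zeta>' + reflect e (v - \<zeta>))" for v by blast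
  then show ?thesis using that ed(1) by blast
qed

lemma lift_unique:
  assumes \<Phi>: "ladm UNIV \<Phi>" and T: "connected T" and g: "continuous_on T g1" "continuous_on T g2"
    and eq: "\<And>y. y \<in> T \<Longrightarrow> \<Phi> (g1 y) = \<Phi> (g2 y)" and a: "a \<in> T" "g1 a = g2 a" and b: "b \<in> T"
  shows "g1 b = g2 b"
proof -
  define S where "S = {y \<in> T. g1 y = g2 y}"
  have "closedin (top_of_set T) S"
    unfolding S_def using continuous_closedin_preimage_constant[of T "\<lambda>y. g1 y - g2 y" 0]
      continuous_on_diff[OF g] by simp
  moreover have "openin (top_of_set T) S"
  proof (subst openin_subopen, intro ballI)
    fix y assume y: "y \<in> S"
    obtain \<delta> where d: "\<delta> > 0" and "ball (g1 y) \<delta> \<subseteq> UNIV" and inj: "inj_on \<Phi> (ball (g1 y) \<delta>)"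
      by (rule ladm_locally_injective[OF \<Phi> UNIV_I])
    define W where "W = (T \<inter> g1 -` ball (g1 y) \<delta>) \<inter> (T \<inter> g2 -` ball (g1 y) \<delta>)"
    have "openin (top_of_set T) W"
      unfolding W_def by (intro openin_Int continuous_openin_preimage_gen g open_ball)
    moreover have "y \<in> W" using y d by (auto simp: W_def S_def)
    moreover have "W \<subseteq> S"
    proof
      fix w assume "w \<in> W"
      then have w: "w \<in> T" "g1 w \<in> ball (g1 y) \<delta>" "g2 w \<in> ball (g1 y) \<delta>" by (auto simp: W_def)
      have "g1 w = g2 w" by (rule inj_onD[OF inj eq[OF w(1)] w(2,3)])
      then show "w \<in> S" using w(1) by (simp add: S_def)
    qed
    ultimately show "\<exists>W. openin (top_of_set T) W \<and> y \<in> W \<and> W \<subseteq> S" by (intro exI conjI)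
  qed
  ultimately have "S = {} \<or> S = T" using T unfolding connected_clopen by simp
  then have "S = T" using a by (auto simp: S_def)
  then show ?thesis using b by (auto simp: S_def)
qed

text \<open>A deck motion carries one point of the fibre to the other and preserves distances. Hence
  one radius of injectivity serves the entire fibre, which is what an even covering
  requires.\<close>

lemma ladm_injective_fibre:
  assumes \<Phi>: "ladm UNIV \<Phi>" and \<zeta>: "\<Phi> \<zeta>0 = \<Phi> \<zeta>" and inj: "inj_on \<Phi> (ball \<zeta>0 \<rho>)"
  shows "inj_on \<Phi> (ball \<zeta> \<rho>)" "\<Phi> ` ball \<zeta> r = \<Phi> ` ball \<zeta>0 r"
proof -
  obtain e where e: "signs e" "\<forall>v. \<Phi> v = \<Phi> (\<zeta> + reflect e (v - \<zeta>0))" by (rule ladm_deck[OF \<Phi> \<Phi> \<zeta>])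
  define g where "g v = \<zeta> + reflect e (v - \<zeta>0)" for v
  define h where "h v = \<zeta>0 + reflect e (v - \<zeta>)" for v
  have \<Phi>g: "\<Phi> (g v) = \<Phi> v" for v using e(2) by (simp add: g_def)
  have gh: "g (h v) = v" "h (g v) = v" for v using e(1) by (simp_all add: g_def h_def)
  have gb: "g v \<in> ball \<zeta> s" if "v \<in> ball \<zeta>0 s" for v s
    using that norm_refl[OF e(1), of "v - \<zeta>0"] by (simp add: g_def dist_norm norm_minus_commute)
  have hb: "h v \<in> ball \<zeta>0 s" if "v \<in> ball \<zeta> s" for v s
    using that norm_refl[OF e(1), of "v - \<zeta>"] by (simp add: h_def dist_norm norm_minus_commute)
  have \<Phi>h: "\<Phi> (h v) = \<Phi> v" for v using \<Phi>g[of "h v"] by (simp add: gh)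
  show "inj_on \<Phi> (ball \<zeta> \<rho>)"
  proof (rule inj_onI)
    fix u v assume uv: "u \<in> ball \<zeta> \<rho>" "v \<in> ball \<zeta> \<rho>" "\<Phi> u = \<Phi> v"
    have "h u = h v" by (rule inj_onD[OF inj _ hb[OF uv(1)] hb[OF uv(2)]]) (simp add: \<Phi>h uv(3))
    then show "u = v" by (metis gh(1))
  qed
  show "\<Phi> ` ball \<zeta> r = \<Phi> ` ball \<zeta>0 r"
  proof (intro equalityI image_subsetI)
    show "\<Phi> v \<in> \<Phi> ` ball \<zeta>0 r" if "v \<in> ball \<zeta> r" for v using imageI[OF hb[OF that], of \<Phi>] by (simp add: \<Phi>h)
    show "\<Phi> v \<in> \<Phi> ` ball \<zeta> r" if "v \<in> ball \<zeta>0 r" for v using imageI[OF gb[OF that], of \<Phi>] by (simp add: \<Phi>g)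
  qed
qed

text \<open>The pullback of \<open>\<Phi>\<close> along \<open>h\<close> is a covering between subsets of normed spaces, so the lifting
  theorem of the library applies although the target of \<open>h\<close> is an abstract topology.\<close>

lemma pullback_covering:
  fixes h :: "'b::real_normed_vector \<Rightarrow> 'm"
  assumes \<Phi>: "ladm UNIV \<Phi>" and h: "continuous_map (top_of_set Q) M h" and surj: "h ` Q \<subseteq> range \<Phi>"
  shows "covering_space {(y, z). y \<in> Q \<and> \<Phi> z = h y} fst Q"
proof -
  define E where "E = {(y, z). y \<in> Q \<and> \<Phi> z = h y}"
  have pre: "openin (top_of_set Q) {y \<in> Q. h y \<in> W}" if "openin M W" for W
    using openin_continuous_map_preimage[OF h that] by simp
  have "\<exists>T. y0 \<in> T \<and> openin (top_of_set Q) T \<and> (\<exists>v. \<Union>v = E \<inter> fst -` T \<and> (\<forall>u\<in>v. openin (top_of_set E) u) \<and>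
      pairwise disjnt v \<and> (\<forall>u\<in>v. \<exists>q. homeomorphism u T fst q))" if y0: "y0 \<in> Q" for y0
  proof -
    obtain \<zeta>0 where \<zeta>0: "h y0 = \<Phi> \<zeta>0" using surj y0 by blast
    obtain \<rho> where \<rho>: "\<rho> > 0" and "ball \<zeta>0 \<rho> \<subseteq> UNIV" and inj0: "inj_on \<Phi> (ball \<zeta>0 \<rho>)"
      by (rule ladm_locally_injective[OF \<Phi> UNIV_I])
    \<comment> \<open>Halved so that sheets around different points of the fibre are disjoint: a
      common point would put both centres into one ball of radius \<open>\<rho>\<close>, where
      \<open>\<Phi>\<close> is injective.\<close>
    define r where "r = \<rho> / 2"
    have r: "r > 0" "r \<le> \<rho>" using \<rho> by (auto simp: r_def)
    define F where "F = {\<zeta>. \<Phi> \<zeta>0 = \<Phi> \<zeta>}"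
    have inj: "inj_on \<Phi> (ball \<zeta> \<rho>)" and img: "\<Phi> ` ball \<zeta> r = \<Phi> ` ball \<zeta>0 r" if "\<zeta> \<in> F" for \<zeta>
      by (rule ladm_injective_fibre[OF \<Phi> that[unfolded F_def mem_Collect_eq] inj0])+
    define W where "W = \<Phi> ` ball \<zeta>0 r"
    define T where "T = {y \<in> Q. h y \<in> W}"
    have oT: "openin (top_of_set Q) T" unfolding T_def W_def
      by (rule pre[OF ladm_topology(2)[OF \<Phi> open_ball subset_UNIV]])
    define V where "V \<zeta> = E \<inter> (fst -` T \<inter> snd -` ball \<zeta> r)" for \<zeta>
    have yT: "y0 \<in> T" using y0 r(1) by (auto simp: T_def W_def \<zeta>0)
    have U: "\<Union>(V ` F) = E \<inter> fst -` T"
    proof (intro equalityI subsetI)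
      fix p assume "p \<in> \<Union>(V ` F)" then show "p \<in> E \<inter> fst -` T" by (auto simp: V_def)
    next
      fix p assume p: "p \<in> E \<inter> fst -` T"
      obtain y z where yz: "p = (y, z)" by (cases p)
      have "\<Phi> z \<in> W" using p yz by (auto simp: E_def T_def)
      then obtain w where w: "w \<in> ball \<zeta>0 r" "\<Phi> w = \<Phi> z" unfolding W_def by (metis imageE)
      obtain e where e: "signs e" "\<forall>v. \<Phi> v = \<Phi> (z + reflect e (v - w))" by (rule ladm_deck[OF \<Phi> \<Phi> w(2)])
      \<comment> \<open>The image of the centre \<open>\<zeta>0\<close> under the deck motion taking
        \<open>w\<close> to \<open>z\<close>; it is the centre of the sheet containing
        \<open>z\<close>.\<close>
      define \<zeta> where "\<zeta> = z + reflect e (\<zeta>0 - w)"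
      have "\<zeta> \<in> F" unfolding F_def \<zeta>_def using e(2)[rule_format, of \<zeta>0] by blast
      moreover have "z \<in> ball \<zeta> r" using w(1) norm_refl[OF e(1), of "\<zeta>0 - w"] by (simp add: \<zeta>_def dist_norm)
      ultimately show "p \<in> \<Union>(V ` F)" using p yz by (auto simp: V_def)
    qed
    have oV: "openin (top_of_set E) (V \<zeta>)" for \<zeta>
    proof -
      obtain Z where Z: "open Z" "T = Q \<inter> Z" using oT unfolding openin_open by blast
      have "V \<zeta> = E \<inter> (Z \<times> ball \<zeta> r)" unfolding V_def Z(2) by (auto simp: E_def)
      then show ?thesis using openin_open_Int[OF open_Times[OF Z(1) open_ball]] by simp
    qed
    have disj: "pairwise disjnt (V ` F)"
      unfolding pairwise_def
    proof (intro ballI impI)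
      fix A B assume "A \<in> V ` F" "B \<in> V ` F" "A \<noteq> B"
      then obtain \<zeta> \<xi> where \<zeta>: "\<zeta> \<in> F" "\<xi> \<in> F" "A = V \<zeta>" "B = V \<xi>" "\<zeta> \<noteq> \<xi>" by blast
      show "disjnt A B"
      proof (rule ccontr)
        assume "\<not> disjnt A B"
        then obtain p where "p \<in> V \<zeta>" "p \<in> V \<xi>" unfolding disjnt_def \<zeta> by blast
        then have "dist \<zeta> (snd p) < r" "dist \<xi> (snd p) < r" by (auto simp: V_def)
        then have "\<xi> \<in> ball \<zeta> \<rho>" using dist_triangle2[of \<zeta> \<xi> "snd p"] by (simp add: r_def)
        moreover have "\<zeta> \<in> ball \<zeta> \<rho>" using \<rho> by simp
        moreover have "\<Phi> \<zeta> = \<Phi> \<xi>" using \<zeta>(1,2) by (simp add: F_def)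
        ultimately show False using inj_onD[OF inj[OF \<zeta>(1)]] \<zeta>(5) by blast
      qed
    qed
    have hom: "\<exists>q. homeomorphism (V \<zeta>) T fst q" if \<zeta>: "\<zeta> \<in> F" for \<zeta>
    proof -
      have injr: "inj_on \<Phi> (ball \<zeta> r)" by (rule inj_on_subset[OF inj[OF \<zeta>]]) (use r in auto)
      \<comment> \<open>The branch of the inverse of \<open>\<Phi>\<close> on this sheet, composed
        with \<open>h\<close>; its graph is the local section of the pullback.\<close>
      define k where "k y = inv_into (ball \<zeta> r) \<Phi> (h y)" for y
      have hW: "h y \<in> \<Phi> ` ball \<zeta> r" if "y \<in> T" for y using that by (simp add: T_def W_def img[OF \<zeta>])
      have k: "k y \<in> ball \<zeta> r" "\<Phi> (k y) = h y" if "y \<in> T" for y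
        unfolding k_def using inv_into_into[OF hW[OF that]] f_inv_into_f[OF hW[OF that]] by auto
      have TQ: "y \<in> Q" if "y \<in> T" for y using that by (simp add: T_def)
      have kT: "k \<in> T \<rightarrow> ball \<zeta> r" using k(1) by (rule Pi_I)
      have contk: "continuous_on T k"
      proof (rule iffD2[OF continuous_on_open_gen[OF kT]], intro allI impI)
        fix S assume "openin (top_of_set (ball \<zeta> r)) S"
        then have S: "open S" "S \<subseteq> ball \<zeta> r" by (auto simp: openin_open_eq)
        have "T \<inter> k -` S = T \<inter> {y \<in> Q. h y \<in> \<Phi> ` S}"
        proof (intro equalityI subsetI)
          fix y assume y: "y \<in> T \<inter> k -` S"
          then have "\<Phi> (k y) \<in> \<Phi> ` S" by blast
          then show "y \<in> T \<inter> {y \<in> Q. h y \<in> \<Phi> ` S}" using y k(2)[of y] TQ[of y] by simp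
        next
          fix y assume y: "y \<in> T \<inter> {y \<in> Q. h y \<in> \<Phi> ` S}"
          then obtain s where s: "s \<in> S" "h y = \<Phi> s" by blast
          have "k y = s" unfolding k_def s(2) by (rule inv_into_f_f[OF injr]) (use s S in blast)
          then show "y \<in> T \<inter> k -` S" using s y by simp
        qed
        moreover have "openin (top_of_set T) (T \<inter> {y \<in> Q. h y \<in> \<Phi> ` S})"
        proof -
          obtain Z where Z: "open Z" "{y \<in> Q. h y \<in> \<Phi> ` S} = Q \<inter> Z"
            using pre[OF ladm_topology(2)[OF \<Phi> S(1) subset_UNIV]] unfolding openin_open by blast
          have "T \<inter> {y \<in> Q. h y \<in> \<Phi> ` S} = T \<inter> Z" unfolding Z(2) using TQ by blast
          then show ?thesis using openin_open_Int[OF Z(1)] by simp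
        qed
        ultimately show "openin (top_of_set T) (T \<inter> k -` S)" by simp
      qed
      have "homeomorphism (V \<zeta>) T fst (\<lambda>y. (y, k y))"
      proof (rule homeomorphismI)
        show "continuous_on (V \<zeta>) fst" by (intro continuous_intros)
        show "continuous_on T (\<lambda>y. (y, k y))" by (intro continuous_intros contk)
        show "fst ` V \<zeta> \<subseteq> T" by (auto simp: V_def)
        show "(\<lambda>y. (y, k y)) ` T \<subseteq> V \<zeta>" using k TQ by (auto simp: V_def E_def)
        show "(fst p, k (fst p)) = p" if "p \<in> V \<zeta>" for p
        proof -
          have p: "\<Phi> (snd p) = h (fst p)" "snd p \<in> ball \<zeta> r" using that by (auto simp: V_def E_def)
          have "k (fst p) = snd p" unfolding k_def p(1)[symmetric] by (rule inv_into_f_f[OF injr p(2)])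
          then show ?thesis by simp
        qed
      qed auto
      then show ?thesis by blast
    qed
    show ?thesis
      by (rule exI[of _ T], intro conjI yT oT, rule exI[of _ "V ` F"]) (use U oV disj hom in auto)
  qed
  moreover have "fst ` E = Q"
  proof (intro equalityI subsetI)
    fix y assume y: "y \<in> Q"
    then obtain z where "h y = \<Phi> z" using surj by blast
    then have "(y, z) \<in> E" using y by (simp add: E_def)
    then show "y \<in> fst ` E" by force
  qed (auto simp: E_def)
  moreover have "continuous_on E fst" by (intro continuous_intros)
  ultimately show ?thesis unfolding covering_space_def E_def[symmetric] by blast
qed

text \<open>Lifting the identity of the convex set \<open>Q\<close> through the pullback covering
  gives a section, and its second component is a lift of \<open>h\<close>.\<close>

lemma homotopy_lift:
  fixes h :: "'b::real_normed_vector \<Rightarrow> 'm"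
  assumes \<Phi>: "ladm UNIV \<Phi>" and h: "continuous_map (top_of_set Q) M h" and surj: "h ` Q \<subseteq> range \<Phi>" and Q: "convex Q"
  obtains G where "continuous_on Q G" "\<forall>y\<in>Q. \<Phi> (G y) = h y"
proof -
  obtain g where g: "continuous_on Q g" "g \<in> Q \<rightarrow> {(y, z). y \<in> Q \<and> \<Phi> z = h y}" "\<And>y. y \<in> Q \<Longrightarrow> fst (g y) = y"
    using covering_space_lift[OF pullback_covering[OF \<Phi> h surj] convex_imp_simply_connected[OF Q]
        convex_imp_locally_path_connected[OF Q] continuous_on_id] by auto
  show ?thesis
  proof (rule that[of "\<lambda>y. snd (g y)"])
    show "continuous_on Q (\<lambda>y. snd (g y))" by (intro continuous_intros g(1))
    show "\<forall>y\<in>Q. \<Phi> (snd (g y)) = h y"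
    proof
      fix y assume y: "y \<in> Q"
      have "g y \<in> {(y, z). y \<in> Q \<and> \<Phi> z = h y}" by (rule funcset_mem[OF g(2) y])
      then show "\<Phi> (snd (g y)) = h y" using g(3)[OF y] by (auto simp: case_prod_beta)
    qed
  qed
qed

text \<open>The segment from \<open>\<zeta>0\<close> to \<open>\<zeta>1\<close> maps to a loop,
  which is homotopic through loops to a constant one. The homotopy is free, so base points move; but
  in the lift \<open>H\<close> the two edges swept by the end points of the loops project to the
  same path. They coincide where the loop is constant, hence also at the start, where their values
  are \<open>\<zeta>0\<close> and \<open>\<zeta>1\<close>.\<close>

lemma ladm_injective:
  assumes \<Phi>: "ladm UNIV \<Phi>" and sc: "simply_connected_top M" and surj: "topspace M \<subseteq> range \<Phi>"
  shows "inj \<Phi>"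
proof (rule injI)
  fix \<zeta>0 \<zeta>1 assume eq: "\<Phi> \<zeta>0 = \<Phi> \<zeta>1"
  define l where "l t = \<zeta>0 + t *\<^sub>R (\<zeta>1 - \<zeta>0)" for t :: real
  have contl: "continuous_on S l" for S unfolding l_def by (intro continuous_intros)
  have \<Phi>c: "continuous_map euclidean M \<Phi>"
    unfolding continuous_map using ladm_topology(1,3)[OF \<Phi>] by simp
  have "pathin M (\<lambda>t. \<Phi> (l t))"
    unfolding pathin_def
    using continuous_map_compose[of "top_of_set {0..1}" euclidean l M \<Phi>] contl \<Phi>c by (simp add: o_def)
  moreover have "pathin M (\<lambda>t. \<Phi> \<zeta>0)" unfolding pathin_def using ladm_topology(1)[OF \<Phi>] by (auto simp: continuous_map_const)
  moreover have "l 0 = \<zeta>0" "l 1 = \<zeta>1" by (simp_all add: l_def)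
  ultimately have "homotopic_with (\<lambda>r. r 1 = r 0) (top_of_set {0..1::real}) M (\<lambda>t. \<Phi> (l t)) (\<lambda>t. \<Phi> \<zeta>0)"
    using sc eq unfolding simply_connected_top_def by simp
  then obtain h where h: "continuous_map (prod_topology (top_of_set {0..1::real}) (top_of_set {0..1::real})) M h"
    "\<And>t. h (0, t) = \<Phi> (l t)" "\<And>t. h (1, t) = \<Phi> \<zeta>0" "\<And>s. s \<in> {0..1} \<Longrightarrow> h (s, 1) = h (s, 0)"
    unfolding homotopic_with_def by auto
  define Q where "Q = {0..1::real} \<times> {0..1::real}"
  have top: "prod_topology (top_of_set {0..1::real}) (top_of_set {0..1::real}) = top_of_set Q"
    by (simp add: Q_def)
  note hQ = h(1)[unfolded top]
  have "h ` Q \<subseteq> range \<Phi>" using continuous_map_image_subset_topspace[OF hQ] surj by auto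
  moreover have "convex Q" unfolding Q_def by (intro convex_Times) auto
  ultimately obtain G where G: "continuous_on Q G" "\<forall>y\<in>Q. \<Phi> (G y) = h y" by (rule homotopy_lift[OF \<Phi> hQ])
  have corner: "(0, 0) \<in> Q" by (simp add: Q_def)
  have "\<Phi> (G (0, 0)) = \<Phi> \<zeta>0" using G(2) corner by (simp add: h(2) l_def)
  then obtain e where e: "signs e" "\<forall>v. \<Phi> v = \<Phi> (\<zeta>0 + reflect e (v - G (0, 0)))" by (rule ladm_deck[OF \<Phi> \<Phi>])
  \<comment> \<open>The lift supplied by the covering starts at an arbitrary point of the fibre; a
    deck motion moves its start to \<open>\<zeta>0\<close>.\<close>
  define H where "H y = \<zeta>0 + reflect e (G y - G (0, 0))" for y
  have contH: "continuous_on Q H" unfolding H_def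
    by (intro continuous_intros linear_continuous_on_compose[OF continuous_on_diff[OF G(1) continuous_on_const]]
        bounded_linear.linear[OF bounded_linear_refl])
  have \<Phi>H: "\<Phi> (H y) = h y" if "y \<in> Q" for y using e(2)[rule_format, of "G y"] G(2) that by (simp add: H_def)
  have inQ: "(s, t) \<in> Q" if "s \<in> {0..1}" "t \<in> {0..1}" for s t using that by (simp add: Q_def)
  have contHt: "continuous_on {0..1} (\<lambda>s. H (s, t))" if t: "t \<in> {0..1}" for t
    by (rule continuous_on_compose2[OF contH]) (auto intro!: continuous_intros inQ t)
  have contHs: "continuous_on {0..1} (\<lambda>t. H (s, t))" if s: "s \<in> {0..1}" for s
    by (rule continuous_on_compose2[OF contH]) (auto intro!: continuous_intros inQ s)
  have I: "connected {0..1::real}" "(0::real) \<in> {0..1}" "(1::real) \<in> {0..1}" by auto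
  have H00: "H (0, 0) = \<zeta>0" by (simp add: H_def)
  have "H (0, 1) = l 1"
    by (rule lift_unique[OF \<Phi> I(1) contHs[OF I(2)] contl _ I(2) _ I(3)])
      (simp_all add: \<Phi>H inQ h(2) H00 l_def)
  then have H01: "H (0, 1) = \<zeta>1" by (simp add: l_def)
  have H1: "H (1, 1) = H (1, 0)"
    by (rule lift_unique[OF \<Phi> I(1) contHs[OF I(3)] continuous_on_const _ I(2) _ I(3)])
      (simp_all add: \<Phi>H inQ h(3))
  \<comment> \<open>Uniqueness of lifts along the homotopy parameter, run from 1 back to 0.\<close>
  have "H (0, 1) = H (0, 0)"
    by (rule lift_unique[OF \<Phi> I(1) contHt[OF I(3)] contHt[OF I(2)] _ I(3) H1 I(2)])
      (simp add: \<Phi>H inQ h(4))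
  then show "\<zeta>0 = \<zeta>1" by (simp add: H00 H01)
qed

text \<open>A homotopy between the constant loops at two points traces a path between them.\<close>

lemma simply_connected_top_imp_connected_space:
  assumes "simply_connected_top M" shows "connected_space M"
proof (rule path_connected_imp_connected_space, unfold path_connected_space_def, intro ballI)
  fix p q assume pq: "p \<in> topspace M" "q \<in> topspace M"
  then have "pathin M (\<lambda>_. p)" "pathin M (\<lambda>_. q)" by (simp_all add: pathin_def continuous_map_const)
  then have "homotopic_with (\<lambda>r. r 1 = r 0) (top_of_set {0..1::real}) M (\<lambda>_. p) (\<lambda>_. q)"
    using assms unfolding simply_connected_top_def by simp
  then obtain h where h: "continuous_map (prod_topology (top_of_set {0..1::real}) (top_of_set {0..1::real})) M h"
    "\<And>t. h (0, t) = p" "\<And>t. h (1, t) = q"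
    unfolding homotopic_with_def by auto
  have "continuous_map (top_of_set {0..1::real}) (prod_topology (top_of_set {0..1::real}) (top_of_set {0..1::real})) (\<lambda>s. (s, 0))"
    by (intro continuous_map_pairedI) (auto simp: continuous_map_const)
  from continuous_map_compose[OF this h(1)] have "pathin M (\<lambda>s. h (s, 0))" by (simp add: pathin_def o_def)
  then show "\<exists>g. pathin M g \<and> g 0 = p \<and> g 1 = q" using h(2,3) by blast
qed

section \<open>The global parametrization as a product\<close>

lemma ladm_global_param:
  assumes \<Phi>: "ladm UNIV \<Phi>" and inj: "inj \<Phi>"
  shows "local_param M A UNIV \<Phi>"
proof -
  have "topological_param M (UNIV, \<Phi>)"
    unfolding topological_param_iff using inj ladm_topology[OF \<Phi>] by simp
  moreover have "smooth_transition (UNIV, \<Phi>) c \<and> smooth_transition c (UNIV, \<Phi>)" if c: "c \<in> A" for c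
  proof -
    obtain E w where cE: "c = (E, w)" by fastforce
    note lw = atlas_local_param[OF c[unfolded cE]]
    have "smooth_on {z \<in> UNIV. \<Phi> z \<in> w ` E} (\<lambda>z. inv_into E w (\<Phi> z))"
    proof (rule smooth_on_local)
      fix z assume z: "z \<in> {z \<in> UNIV. \<Phi> z \<in> w ` E}"
      obtain I J a b where I: "z \<in> rect I J" "local_param M A (rect I J) \<Phi>" by (rule ladmE[OF \<Phi> UNIV_I])
      show "\<exists>T. open T \<and> z \<in> T \<and> smooth_on T (\<lambda>z. inv_into E w (\<Phi> z))"
        by (rule exI[of _ "{z \<in> rect I J. \<Phi> z \<in> w ` E}"])
          (use open_overlap[OF I(2) lw] smooth_transition_local_param[OF I(2) lw] I(1) z in simp)
    qed
    moreover have "smooth_on {z \<in> E. w z \<in> range \<Phi>} (\<lambda>z. inv_into UNIV \<Phi> (w z))"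
    proof (rule smooth_on_local)
      fix z assume "z \<in> {z \<in> E. w z \<in> range \<Phi>}"
      then obtain \<zeta> where z: "z \<in> E" "w z = \<Phi> \<zeta>" by blast
      obtain I J a b where I: "\<zeta> \<in> rect I J" "local_param M A (rect I J) \<Phi>" by (rule ladmE[OF \<Phi> UNIV_I])
      note o = open_overlap[OF lw I(2)]
      have inv: "inv_into (rect I J) \<Phi> p = inv_into UNIV \<Phi> p" if p: "p \<in> \<Phi> ` rect I J" for p
        using p local_paramD(2)[OF I(2)] inj by (auto simp: inv_into_f_f)
      have "smooth_on {z \<in> E. w z \<in> \<Phi> ` rect I J} (\<lambda>z. inv_into UNIV \<Phi> (w z))"
        by (rule smooth_on_cong[OF o smooth_transition_local_param[OF lw I(2)]]) (simp add: inv)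
      then show "\<exists>T. open T \<and> z \<in> T \<and> smooth_on T (\<lambda>z. inv_into UNIV \<Phi> (w z))" using o z I(1) by blast
    qed
    ultimately show ?thesis by (simp add: smooth_transition_def cE o_def)
  qed
  ultimately show ?thesis by (simp add: local_param_def)
qed

text \<open>Locally the immersion is a product a(s) b(t), and its right logarithmic derivative in s
  is a' a^(-1), which does not contain t. The factors depend on the chosen rectangle, but local
  constancy in t along a connected line gives constancy.\<close>

lemma ladm_right_velocity:
  assumes \<Phi>: "ladm UNIV \<Phi>"
  shows "\<exists>R. \<forall>s t. pd 1 (\<lambda>z. f (\<Phi> z)) (vector [s, t]) = (0, R s) \<odot> f (\<Phi> (vector [s, t]))"
proof -
  define X where "X = (\<lambda>z. f (\<Phi> z))"
  define V where "V z = pd 1 X z \<odot> qconj (X z)" for z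
  have loc: "\<exists>d>0. \<exists>r. \<forall>t'\<in>ball t d. V (vector [s, t']) = (0, r)" for s t
  proof -
    obtain I J a b where I: "vector [s, t] \<in> rect I J" "adapted I J a b \<Phi>" "local_param M A (rect I J) \<Phi>"
      by (rule ladmE[OF \<Phi> UNIV_I])
    note D = product_paramD[OF adaptedD(1)[OF I(2)]]
    have st: "s \<in> I" "t \<in> J" using I(1) by auto
    obtain d where d: "d > 0" "ball t d \<subseteq> J" using openE[OF D(4) st(2)] by blast
    have "V (vector [s, t']) = (0, right_vel a s)" if t': "t' \<in> ball t d" for t'
    proof -
      have tJ: "t' \<in> J" using t' d by blast
      then have z: "vector [s, t'] \<in> rect I J" using st by simp
      have a: "a s \<in> S3" "b t' \<in> S3" using D(7,8) st(1) tJ by blast+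
      have "V (vector [s, t']) = velocity a s \<odot> b t' \<odot> qconj (a s \<odot> b t')"
        unfolding V_def X_def using adapted_pd(1)[OF I(2) z] D(10)[OF z] by simp
      also have "\<dots> = velocity a s \<odot> qconj (a s)"
        unfolding qconj_qmult qmult_assoc qconj_cancel(1)[OF a(2)] ..
      also have "\<dots> = (0, right_vel a s)"
        unfolding velocity_left_right(2)[OF D(3,5,7) st(1)] qconj_cancel(4)[OF a(1)] ..
      finally show ?thesis .
    qed
    then show ?thesis using d(1) by blast
  qed
  have V0: "V (vector [s, t]) = V (vector [s, 0])" for s t
  proof -
    have "(\<lambda>t. V (vector [s, t])) constant_on UNIV"
    proof (rule locally_constant_imp_constant[OF connected_UNIV])
      fix t :: real
      obtain d r where d: "d > 0" "\<forall>t'\<in>ball t d. V (vector [s, t']) = (0, r)" using loc[of t s] by blast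
      show "\<exists>T. openin (top_of_set UNIV) T \<and> t \<in> T \<and> (\<forall>t'\<in>T. V (vector [s, t']) = V (vector [s, t]))"
        by (rule exI[of _ "ball t d"]) (use d in simp)
    qed
    then show ?thesis unfolding constant_on_def by fastforce
  qed
  show ?thesis
  proof (intro exI allI)
    fix s t
    obtain d r where "d > 0" "\<forall>t'\<in>ball 0 d. V (vector [s, t']) = (0, r)" using loc[of 0 s] by blast
    then have "V (vector [s, 0]) = (0, snd (V (vector [s, 0])))" by simp
    then have V: "V (vector [s, t]) = (0, snd (V (vector [s, 0])))" unfolding V0[of s t] .
    have "f (\<Phi> (vector [s, t])) \<in> S3" by (rule f_S3) (use ladm_topology(1)[OF \<Phi>] in blast)
    then have "pd 1 X (vector [s, t]) = V (vector [s, t]) \<odot> X (vector [s, t])"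
      unfolding V_def X_def by (simp only: qconj_cancel(3))
    then show "pd 1 (\<lambda>z. f (\<Phi> z)) (vector [s, t]) = (0, snd (V (vector [s, 0]))) \<odot> f (\<Phi> (vector [s, t]))"
      unfolding V unfolding X_def .
  qed
qed

text \<open>For every t the curve s to X(s, t) solves the same linear equation X_s = R(s) X. The
  quotient X(s, 0)^(-1) X(s, t) of two solutions is therefore constant in s, which splits off the
  second factor. Straightness and unit speed are inherited from the local adapted
  rectangles.\<close>

theorem ladm_global_product:
  assumes \<Phi>: "ladm UNIV \<Phi>" and inj: "inj \<Phi>"
  obtains \<alpha> \<beta> where "adapted UNIV UNIV \<alpha> \<beta> \<Phi>"
proof -
  define X where "X = (\<lambda>z. f (\<Phi> z))"
  note lp = ladm_global_param[OF \<Phi> inj]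
  have smX: "smooth_on UNIV X" unfolding X_def by (rule smooth_immersion(1)[OF lp])
  have dX: "X differentiable at z" for z by (rule smooth_on_differentiable[OF smX UNIV_I])
  have S: "X z \<in> S3" for z unfolding X_def by (rule f_S3) (use ladm_topology(1)[OF \<Phi>] in blast)
  obtain R where R: "\<And>s t. pd 1 X (vector [s, t]) = (0, R s) \<odot> X (vector [s, t])"
    using ladm_right_velocity[OF \<Phi>] unfolding X_def by blast
  define \<alpha> where "\<alpha> s = X (vector [s, 0])" for s
  define \<beta> where "\<beta> t = qconj (X (vector [0, 0])) \<odot> X (vector [0, t])" for t
  have quotient: "qconj (\<alpha> s) \<odot> X (vector [s, t]) = \<beta> t" for s t
  proof -
    have "((\<lambda>s. qconj (X (vector [s, 0])) \<odot> X (vector [s, t])) has_vector_derivative 0) (at s)" for s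
    proof -
      have d1: "((\<lambda>s. qconj (X (vector [s, 0]))) has_vector_derivative qconj (pd 1 X (vector [s, 0]))) (at s)"
        by (rule bounded_linear.has_vector_derivative[OF bounded_linear_qconj pd_line_derivative(1)[OF dX]])
      have d2: "((\<lambda>s. X (vector [s, t])) has_vector_derivative pd 1 X (vector [s, t])) (at s)"
        by (rule pd_line_derivative(1)[OF dX])
      have q: "qconj (0, R s) = - (0, R s)" by (simp add: qconj_def)
      have "qconj (X (vector [s, 0])) \<odot> pd 1 X (vector [s, t]) + qconj (pd 1 X (vector [s, 0])) \<odot> X (vector [s, t]) = 0"
        unfolding R qconj_qmult q qm.minus_left qm.minus_right qmult_assoc by simp
      with qm.has_vector_derivative[OF d1 d2] show ?thesis by simp
    qed
    then have der: "((\<lambda>s. qconj (X (vector [s, 0])) \<odot> X (vector [s, t])) has_vector_derivative 0) (at s within UNIV)" for s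
      by simp
    have "\<exists>c. \<forall>s. qconj (X (vector [s, 0])) \<odot> X (vector [s, t]) = c"
      by (rule has_vector_derivative_zero_constant[OF convex_UNIV der]) blast
    then obtain c where c: "\<And>s. qconj (X (vector [s, 0])) \<odot> X (vector [s, t]) = c" by blast
    show ?thesis unfolding \<alpha>_def \<beta>_def c ..
  qed
  have prod: "X (vector [s, t]) = \<alpha> s \<odot> \<beta> t" for s t
    unfolding quotient[of s t, symmetric] unfolding \<alpha>_def qconj_cancel(1)[OF S] ..
  have prodz: "f (\<Phi> z) = \<alpha> (z $ 1) \<odot> \<beta> (z $ 2)" for z
    using prod[of "z $ 1" "z $ 2"] by (simp add: X_def vector2_collapse)
  have smv: "smooth_on UNIV (\<lambda>s. vector [s, t] :: real^2)" "smooth_on UNIV (\<lambda>s. vector [t, s] :: real^2)" for t :: real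
    by (intro smooth_on_vector2 smooth_on_id smooth_on_const open_UNIV)+
  have sm: "smooth_on UNIV (\<lambda>s. X (vector [s, t]))" "smooth_on UNIV (\<lambda>s. X (vector [t, s]))" for t
    by (rule smooth_on_compose[OF open_UNIV open_UNIV smX smv(1) subset_UNIV],
        rule smooth_on_compose[OF open_UNIV open_UNIV smX smv(2) subset_UNIV])
  have sma: "smooth_on UNIV \<alpha>" unfolding \<alpha>_def by (rule sm)
  have smb: "smooth_on UNIV \<beta>" unfolding \<beta>_def by (intro qm.smooth_on smooth_on_const open_UNIV sm)
  have S\<beta>: "\<beta> t \<in> S3" for t unfolding \<beta>_def by (rule S3_qmult[OF S3_qconj[OF S] S])
  have S\<alpha>: "\<alpha> s \<in> S3" for s unfolding \<alpha>_def by (rule S)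
  have oi: "open_interval UNIV" by (simp add: open_interval_def)
  have rU: "rect UNIV UNIV = UNIV" by (simp add: rect_def)
  have pp: "product_param M A f UNIV UNIV \<alpha> \<beta> \<Phi>"
    by (rule product_paramI[OF oi oi sma smb]) (use S\<alpha> S\<beta> lp prodz in \<open>simp_all only: rU image_subsetI\<close>)
  have speed: "norm (pd i X z) = 1" if "i = 1 \<or> i = 2" for i z
  proof -
    obtain I J a b where I: "z \<in> rect I J" "adapted I J a b \<Phi>" by (rule ladmE[OF \<Phi> UNIV_I])
    show ?thesis using adapted_pd(3,4)[OF I(2,1)] that by (auto simp: X_def)
  qed
  have "velocity \<alpha> s = pd 1 X (vector [s, 0])" for s
    unfolding velocity_def \<alpha>_def by (rule vector_derivative_at[OF pd_line_derivative(1)[OF dX]])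
  then have va: "norm (velocity \<alpha> s) = 1" for s by (simp add: speed)
  have "velocity \<beta> t = qconj (X (vector [0, 0])) \<odot> pd 2 X (vector [0, t])" for t
    unfolding velocity_def \<beta>_def
    by (rule vector_derivative_at[OF bounded_linear.has_vector_derivative[OF qm.bounded_linear_right pd_line_derivative(2)[OF dX]]])
  moreover have "norm (qconj (X z)) = 1" for z using S3_qconj[OF S, of z] by simp
  moreover have "norm (pd 2 X z) = 1" for z using speed[of 2] by simp
  ultimately have vb: "norm (velocity \<beta> t) = 1" for t by (simp only: norm_qmult mult_1)
  have "straight UNIV UNIV \<alpha> \<beta>"
    unfolding straight_def
  proof (intro ballI)
    fix s t :: real
    define z :: "real^2" where "z = vector [s, t]"
    obtain I J a b where I: "z \<in> rect I J" "adapted I J a b \<Phi>" by (rule ladmE[OF \<Phi> UNIV_I])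
    have II: "second_ff (\<lambda>z. f (\<Phi> z)) z v v = 0" if "v $ 1 * v $ 2 = 0" for v
      unfolding adapted_second_ff(1)[OF I(2,1)] using that by (auto simp: mult.commute)
    have zU: "z \<in> rect UNIV UNIV" by (simp add: rU)
    show "vector_derivative (left_vel \<alpha>) (at s) \<bullet> cross3 (left_vel \<alpha> s) (right_vel \<beta> t) = 0 \<and>
      vector_derivative (right_vel \<beta>) (at t) \<bullet> cross3 (left_vel \<alpha> s) (right_vel \<beta> t) = 0"
      using product_second_ff[OF pp zU, of "axis 1 1" "axis 1 1"] product_second_ff[OF pp zU, of "axis 2 1" "axis 2 1"]
        II[of "axis 1 1"] II[of "axis 2 1"] by (simp add: z_def)
  qed
  then have "adapted UNIV UNIV \<alpha> \<beta> \<Phi>" using pp va vb by (simp add: adapted_def)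
  then show ?thesis by (rule that)
qed

end

section \<open>Surjectivity and the global statement\<close>

context complete_adapted
begin

text \<open>A point outside the range lies in the range of its own global map. By
  \<open>ladm_deck\<close> two global maps sharing one value have equal ranges, so that second range
  is an open set disjoint from the first, and connectedness excludes it.\<close>

lemma ladm_surjective:
  assumes \<Phi>: "ladm UNIV \<Phi>" and M: "connected_space M"
  shows "range \<Phi> = topspace M"
proof (rule ccontr)
  assume "range \<Phi> \<noteq> topspace M"
  have o: "openin M (range \<Phi>)" by (rule ladm_topology(2)[OF \<Phi> open_UNIV subset_UNIV])
  have "openin M (topspace M - range \<Phi>)"
  proof (subst openin_subopen, intro ballI)
    fix q assume q: "q \<in> topspace M - range \<Phi>"
    then have qM: "q \<in> topspace M" by blast
    obtain \<Psi> where \<Psi>: "ladm UNIV \<Psi>" "q \<in> range \<Psi>" by (rule global_ladm[OF qM])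
    have "\<Psi> w \<notin> range \<Phi>" for w
    proof
      assume "\<Psi> w \<in> range \<Phi>"
      then obtain z where z: "\<Psi> w = \<Phi> z" by blast
      obtain e where "\<forall>v. \<Psi> v = \<Phi> (z + reflect e (v - w))" by (rule ladm_deck[OF \<Psi>(1) \<Phi> z])
      then show False using \<Psi>(2) q by auto
    qed
    have \<Psi>M: "\<Psi> w \<in> topspace M" for w using ladm_topology(1)[OF \<Psi>(1)] by (rule subsetD) (rule rangeI)
    have "range \<Psi> \<subseteq> topspace M - range \<Phi>" by (rule image_subsetI) (rule DiffI[OF \<Psi>M \<open>\<And>w. \<Psi> w \<notin> range \<Phi>\<close>])
    then show "\<exists>T. openin M T \<and> q \<in> T \<and> T \<subseteq> topspace M - range \<Phi>"
      by (intro exI[of _ "range \<Psi>"] conjI ladm_topology(2)[OF \<Psi>(1) open_UNIV subset_UNIV] \<Psi>(2))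
  qed
  moreover have sub: "range \<Phi> \<subseteq> topspace M" by (rule ladm_topology(1)[OF \<Phi>])
  moreover have "topspace M - range \<Phi> \<noteq> {}" using \<open>range \<Phi> \<noteq> topspace M\<close> sub by blast
  moreover have "topspace M \<subseteq> range \<Phi> \<union> (topspace M - range \<Phi>)" "range \<Phi> \<inter> (topspace M - range \<Phi>) = {}" "range \<Phi> \<noteq> {}"
    by auto
  ultimately have "\<not> connected_space M" unfolding connected_space_def using o by (simp only: not_not) (intro exI conjI)
  then show False using M by simp
qed

theorem global_asymptotic_product:
  assumes sc: "simply_connected_top M"
  shows "\<exists>I J \<alpha> \<beta>. asymptotic_product M A f (topspace M) I J \<alpha> \<beta> \<and>
    has_torsion I \<alpha> (\<lambda>s. 1) \<and> has_torsion J \<beta> (\<lambda>t. -1)"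
proof -
  obtain p where p: "p \<in> topspace M" using sc unfolding simply_connected_top_def by blast
  obtain \<Phi> where \<Phi>: "ladm UNIV \<Phi>" and "p \<in> range \<Phi>" by (rule global_ladm[OF p])
  have rng: "range \<Phi> = topspace M"
    by (rule ladm_surjective[OF \<Phi> simply_connected_top_imp_connected_space[OF sc]])
  have "inj \<Phi>" by (rule ladm_injective[OF \<Phi> sc]) (simp add: rng)
  then obtain \<alpha> \<beta> where ad: "adapted UNIV UNIV \<alpha> \<beta> \<Phi>" by (rule ladm_global_product[OF \<Phi>])
  have "rect UNIV UNIV = UNIV" by (simp add: rect_def)
  then have "asymptotic_product M A f (topspace M) UNIV UNIV \<alpha> \<beta>"
    using adapted_asymptotic_product[OF ad] rng by simp
  then show ?thesis using adapted_torsion[OF ad] by blast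
qed

end

theorem corollary1p1:
  fixes M :: "'m topology" and A :: "'m parametrization set" and f :: "'m \<Rightarrow> quat"
  assumes "translation_surface M A f"
    and "constant_gauss_curvature A f"
  shows "(\<forall>p. generic_point M A f p \<longrightarrow>
           (\<exists>U I J \<alpha> \<beta>. openin M U \<and> p \<in> U \<and>
              asymptotic_product M A f U I J \<alpha> \<beta> \<and>
              (\<forall>s\<in>I. curvature \<alpha> s \<noteq> 0) \<and> has_torsion I \<alpha> (\<lambda>s. 1) \<and>
              (\<forall>t\<in>J. curvature \<beta> t \<noteq> 0) \<and> has_torsion J \<beta> (\<lambda>t. -1)))
       \<and> (simply_connected_top M \<and> complete_surface M A f \<longrightarrow>
           (\<exists>I J \<alpha> \<beta>. asymptotic_product M A f (topspace M) I J \<alpha> \<beta> \<and>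
              has_torsion I \<alpha> (\<lambda>s. 1) \<and> has_torsion J \<beta> (\<lambda>t. -1)))"
proof -
  interpret immersed M A f
    by unfold_locales (use assms(1) in \<open>simp add: translation_surface_def\<close>)
  show ?thesis
  proof (intro conjI allI impI)
    fix p assume "generic_point M A f p"
    then show "\<exists>U I J \<alpha> \<beta>. openin M U \<and> p \<in> U \<and> asymptotic_product M A f U I J \<alpha> \<beta> \<and>
              (\<forall>s\<in>I. curvature \<alpha> s \<noteq> 0) \<and> has_torsion I \<alpha> (\<lambda>s. 1) \<and>
              (\<forall>t\<in>J. curvature \<beta> t \<noteq> 0) \<and> has_torsion J \<beta> (\<lambda>t. -1)"
      by (rule generic_point_asymptotic_product[OF assms])
  next
    assume M: "simply_connected_top M \<and> complete_surface M A f"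
    interpret complete_adapted M A f
    proof
      show "complete_surface M A f" using M by blast
      fix p assume p: "p \<in> topspace M"
      obtain I J a b x s t where "adapted I J a b x" "s \<in> I" "t \<in> J" "p = x (vector [s, t])"
        by (rule adapted_exists[OF assms p])
      moreover from this have "vector [s, t] \<in> rect I J" by simp
      ultimately show "\<exists>I J a b x z. adapted I J a b x \<and> z \<in> rect I J \<and> p = x z" by blast
    qed
    show "\<exists>I J \<alpha> \<beta>. asymptotic_product M A f (topspace M) I J \<alpha> \<beta> \<and>
              has_torsion I \<alpha> (\<lambda>s. 1) \<and> has_torsion J \<beta> (\<lambda>t. -1)"
      by (rule global_asymptotic_product) (use M in blast)
  qed
qed

end
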